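(* Let $F^3$ be the full flag variety of $\mathbb{C}^3$, realized as the hypersurface $\{\sum_{i=0}^2 x_i y_i = 0\}\subset \mathbb{CP}^2_x\times\mathbb{CP}^2_y$ and endowed with the symplectic form obtained by restricting the product of the Fubini–Study forms. Then $F^3$ is pseudotoric, i.e. it admits a pseudotoric structure.
   Context: $\mathbb{CP}^2_x$ and $\mathbb{CP}^2_y$ are two complex projective planes with homogeneous coordinates $[x_0:x_1:x_2]$ and $[y_0:y_1:y_2]$, each with its standard Fubini–Study Kähler form (same normalization). A pseudotoric structure on a symplectic manifold $(M,\omega_M)$ of real dimension $2n$ is a set of data $(f_1,\dots,f_k,B,\psi,(Y,\omega_Y))$, where: $f_1,\dots,f_k$ are smooth Morse functions on $M$ in involution (pairwise Poisson commuting); $(Y,\omega_Y)$ is a symplectic toric manifold of real dimension $2(n-k)$; $B\subset M$ is a subset (the base set); and $\psi: M\setminus B\to Y$ is a map with generically smooth symplectic fibers, defining a family $\overline{\psi^{-1}(p)}=\psi^{-1}(p)\cup B$, $p\in Y$, of (for generic $p$, smooth) symplectic toric submanifolds of $M$ of real dimension $2k$ whose moment maps are the restrictions of $f_1,\dots,f_k$. The following compatibility conditions are required: (1) for each $p\in Y$, the set $\overline{\psi^{-1}(p)}=\psi^{-1}(p)\cup B$ is preserved by the Hamiltonian action of each $f_i$; (2) for each smooth function $h\in C^\infty(Y,\mathbb{R})$ one has $\nabla_\psi X_h=\tau X_{\psi^*h}$ on $M\setminus(B\cup \mathrm{Sing})$, where $\mathrm{Sing}$ is the set of singular points of the singular fibers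 of $\psi$; $\nabla_\psi$ is the symplectic connection defined by $\psi$ (the horizontal space at a point is the $\omega_M$-orthogonal complement of the tangent space to the fiber of $\psi$, and $\nabla_\psi X_h$ is the horizontal lift of $X_h$); $X_h$ and $X_{\psi^*h}$ are the Hamiltonian vector fields of $h$ and $\psi^*h$ with respect to $\omega_Y$ and $\omega_M$ respectively; and $\tau$ is a positive function. *)

theory Defs
  imports "HOL-Analysis.Analysis"
begin

text \<open>
  A chart is given by its inverse: a pair of a set \<open>D\<close> of coordinates and a
  parametrization \<open>\<sigma>\<close> of an open piece of the manifold by \<open>D\<close>. A manifold of dimension
  \<open>d\<close> has \<open>D\<close> open in some \<open>d\<close>-dimensional linear subspace of the coordinate type \<open>'e\<close>
  (that subspace is then \<open>span D\<close>, see \<open>manifold\<close> below). Manifolds of different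
  dimensions can so share one coordinate type, which is needed because \<open>k\<close> is quantified
  in the definition of a pseudotoric structure.
\<close>

record ('a, 'e) mfd =
  pts :: "'a set"
  charts :: "('e set \<times> ('e \<Rightarrow> 'a)) set"

text \<open>
  For \<open>D\<close> relatively open in \<open>span D\<close>, as in every use below, \<open>Ck_on k D f\<close> is the usual
  notion: the values of the witness \<open>f'\<close> are determined on \<open>span D\<close> only, and may be
  extended to all of \<open>'e\<close> by a projection.
\<close>

primrec Ck_on ::
    "nat \<Rightarrow> 'e::euclidean_space set \<Rightarrow> ('e \<Rightarrow> 'b::real_normed_vector) \<Rightarrow> bool" where
  "Ck_on 0 D f \<longleftrightarrow> continuous_on D f"
| "Ck_on (Suc k) D f \<longleftrightarrow>
     (\<exists>f'. (\<forall>u\<in>D. (f has_derivative f' u) (at u within D)) \<and> (\<forall>v. Ck_on k D (\<lambda>u. f' u v)))"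

definition smooth_on :: "'e::euclidean_space set \<Rightarrow> ('e \<Rightarrow> 'b::real_normed_vector) \<Rightarrow> bool" where
  "smooth_on D f \<longleftrightarrow> (\<forall>k. Ck_on k D f)"

definition mtop :: "('a, 'e::euclidean_space, 'z) mfd_scheme \<Rightarrow> 'a topology" where
  "mtop M = topology (\<lambda>U. U \<subseteq> pts M \<and>
     (\<forall>(D, \<sigma>)\<in>charts M. openin (top_of_set D) (D \<inter> \<sigma> -` U)))"

lemma openin_mtop:
  "openin (mtop M) U \<longleftrightarrow> U \<subseteq> pts M \<and>
     (\<forall>(D, \<sigma>)\<in>charts M. openin (top_of_set D) (D \<inter> \<sigma> -` U))"
proof -
  have "istopology (\<lambda>U. U \<subseteq> pts M \<and>
     (\<forall>(D, \<sigma>)\<in>charts M. openin (top_of_set D) (D \<inter> \<sigma> -` U)))"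
    unfolding istopology_def
  proof (intro conjI allI impI)
    fix S T assume *: "S \<subseteq> pts M \<and> (\<forall>(D, \<sigma>)\<in>charts M. openin (top_of_set D) (D \<inter> \<sigma> -` S))"
      "T \<subseteq> pts M \<and> (\<forall>(D, \<sigma>)\<in>charts M. openin (top_of_set D) (D \<inter> \<sigma> -` T))"
    then show "S \<inter> T \<subseteq> pts M" by blast
    have eq: "D \<inter> \<sigma> -` (S \<inter> T) = (D \<inter> \<sigma> -` S) \<inter> (D \<inter> \<sigma> -` T)"
      for D :: "'b set" and \<sigma> :: "'b \<Rightarrow> 'a" by blast
    show "\<forall>(D, \<sigma>)\<in>charts M. openin (top_of_set D) (D \<inter> \<sigma> -` (S \<inter> T))"
      unfolding eq using * by (blast intro: openin_Int)
  next
    fix K assume *: "\<forall>U\<in>K. U \<subseteq> pts M \<and>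
      (\<forall>(D, \<sigma>)\<in>charts M. openin (top_of_set D) (D \<inter> \<sigma> -` U))"
    then show "\<Union>K \<subseteq> pts M" by blast
    have eq: "D \<inter> \<sigma> -` \<Union>K = \<Union>((\<lambda>U. D \<inter> \<sigma> -` U) ` K)"
      for D :: "'b set" and \<sigma> :: "'b \<Rightarrow> 'a" by blast
    show "\<forall>(D, \<sigma>)\<in>charts M. openin (top_of_set D) (D \<inter> \<sigma> -` \<Union>K)"
      unfolding eq using * by (blast intro: openin_Union)
  qed
  then show ?thesis
    unfolding mtop_def by (simp add: topology_inverse')
qed

definition manifold :: "('a, 'e::euclidean_space, 'z) mfd_scheme \<Rightarrow> nat \<Rightarrow> bool" where
  "manifold M d \<longleftrightarrow>
     pts M = (\<Union>(D, \<sigma>)\<in>charts M. \<sigma> ` D) \<and>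
     (\<forall>(D, \<sigma>)\<in>charts M. openin (top_of_set (span D)) D \<and> dim D = d \<and> inj_on \<sigma> D) \<and>
     (\<forall>(D, \<sigma>)\<in>charts M. \<forall>(E, \<tau>)\<in>charts M.
        openin (top_of_set D) (D \<inter> \<sigma> -` (\<tau> ` E)) \<and>
        smooth_on (D \<inter> \<sigma> -` (\<tau> ` E)) (\<lambda>u. inv_into E \<tau> (\<sigma> u))) \<and>
     Hausdorff_space (mtop M) \<and> second_countable (mtop M)"

definition smooth_fun_on ::
    "('a, 'e::euclidean_space, 'z) mfd_scheme \<Rightarrow> 'a set \<Rightarrow> ('a \<Rightarrow> 'b::real_normed_vector) \<Rightarrow> bool" where
  "smooth_fun_on M U g \<longleftrightarrow> (\<forall>(D, \<sigma>)\<in>charts M. smooth_on (D \<inter> \<sigma> -` U) (\<lambda>u. g (\<sigma> u)))"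

text \<open>Only the germ of \<open>g\<close> at \<open>x\<close> matters here; away from \<open>x\<close> the function \<open>g\<close> is arbitrary.\<close>

definition smooth_near ::
    "('a, 'e::euclidean_space, 'z) mfd_scheme \<Rightarrow> 'a \<Rightarrow> ('a \<Rightarrow> real) \<Rightarrow> bool" where
  "smooth_near M x g \<longleftrightarrow> (\<exists>U. openin (mtop M) U \<and> x \<in> U \<and> smooth_fun_on M U g)"

text \<open>
  Because \<open>g\<close> is arbitrary away from \<open>\<psi> x\<close>, this pull-back condition also forces continuity
  of \<open>\<psi>\<close> (test it on functions that are locally constant near \<open>\<psi> x\<close> and jump elsewhere).
\<close>

definition smooth_map_on ::
    "('a, 'e::euclidean_space, 'z) mfd_scheme \<Rightarrow> ('b, 'c::euclidean_space, 'y) mfd_scheme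
      \<Rightarrow> 'a set \<Rightarrow> ('a \<Rightarrow> 'b) \<Rightarrow> bool" where
  "smooth_map_on M N U \<psi> \<longleftrightarrow>
     (\<forall>x\<in>U. \<psi> x \<in> pts N \<and> (\<forall>g. smooth_near N (\<psi> x) g \<longrightarrow> smooth_near M x (\<lambda>y. g (\<psi> y))))"

text \<open>
  A tangent vector at \<open>x\<close> is the directional derivative it induces on germs of smooth
  functions at \<open>x\<close>, set to \<open>0\<close> on all other functions.
\<close>

type_synonym 'a tvec = "('a \<Rightarrow> real) \<Rightarrow> real"

definition velocity :: "('a, 'e::euclidean_space, 'z) mfd_scheme \<Rightarrow> (real \<Rightarrow> 'a) \<Rightarrow> 'a tvec" where
  "velocity M \<gamma> = (\<lambda>g. if smooth_near M (\<gamma> 0) g then deriv (\<lambda>t. g (\<gamma> t)) 0 else 0)"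

definition chart_vec ::
    "('a, 'e::euclidean_space, 'z) mfd_scheme \<Rightarrow> ('e \<Rightarrow> 'a) \<Rightarrow> 'e \<Rightarrow> 'e \<Rightarrow> 'a tvec" where
  "chart_vec M \<sigma> u v = velocity M (\<lambda>t. \<sigma> (u + t *\<^sub>R v))"

definition tangent_space :: "('a, 'e::euclidean_space, 'z) mfd_scheme \<Rightarrow> 'a \<Rightarrow> 'a tvec set" where
  "tangent_space M x =
     {chart_vec M \<sigma> u v |D \<sigma> u v. (D, \<sigma>) \<in> charts M \<and> u \<in> D \<and> \<sigma> u = x \<and> v \<in> span D}"

definition push ::
    "('b, 'c::euclidean_space, 'y) mfd_scheme \<Rightarrow> ('a \<Rightarrow> 'b) \<Rightarrow> 'a \<Rightarrow> 'a tvec \<Rightarrow> 'b tvec" where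
  "push N \<psi> x \<xi> = (\<lambda>g. if smooth_near N (\<psi> x) g then \<xi> (\<lambda>y. g (\<psi> y)) else 0)"

record ('a, 'e) smfd = "('a, 'e) mfd" +
  form :: "'a \<Rightarrow> 'a tvec \<Rightarrow> 'a tvec \<Rightarrow> real"

definition form_in ::
    "('a, 'e::euclidean_space) smfd \<Rightarrow> ('e \<Rightarrow> 'a) \<Rightarrow> 'e \<Rightarrow> 'e \<Rightarrow> 'e \<Rightarrow> real" where
  "form_in M \<sigma> u v w = form M (\<sigma> u) (chart_vec M \<sigma> u v) (chart_vec M \<sigma> u w)"

text \<open>
  The last conjunct is \<open>d\<omega> = 0\<close>, evaluated on constant coordinate vector fields.
\<close>

definition symplectic_manifold :: "('a, 'e::euclidean_space) smfd \<Rightarrow> nat \<Rightarrow> bool" where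
  "symplectic_manifold M n \<longleftrightarrow>
     manifold M (2 * n) \<and>
     (\<forall>x\<in>pts M. \<forall>\<xi>\<in>tangent_space M x. \<forall>\<eta>\<in>tangent_space M x.
        form M x \<xi> \<eta> = - form M x \<eta> \<xi> \<and>
        (\<forall>\<zeta>\<in>tangent_space M x. \<forall>a b.
           form M x (\<lambda>g. a * \<xi> g + b * \<eta> g) \<zeta> = a * form M x \<xi> \<zeta> + b * form M x \<eta> \<zeta>)) \<and>
     (\<forall>x\<in>pts M. \<forall>\<xi>\<in>tangent_space M x.
        (\<forall>\<eta>\<in>tangent_space M x. form M x \<xi> \<eta> = 0) \<longrightarrow> \<xi> = (\<lambda>g. 0)) \<and>
     (\<forall>(D, \<sigma>)\<in>charts M. \<forall>v\<in>span D. \<forall>w\<in>span D. smooth_on D (\<lambda>u. form_in M \<sigma> u v w)) \<and>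
     (\<forall>(D, \<sigma>)\<in>charts M. \<forall>u\<in>D. \<forall>v1\<in>span D. \<forall>v2\<in>span D. \<forall>v3\<in>span D.
        deriv (\<lambda>t. form_in M \<sigma> (u + t *\<^sub>R v1) v2 v3) 0 +
        deriv (\<lambda>t. form_in M \<sigma> (u + t *\<^sub>R v2) v3 v1) 0 +
        deriv (\<lambda>t. form_in M \<sigma> (u + t *\<^sub>R v3) v1 v2) 0 = 0)"

text \<open>Sign convention: \<open>\<omega>(X\<^sub>f, \<cdot>) = df\<close>.\<close>

definition ham_vec :: "('a, 'e::euclidean_space) smfd \<Rightarrow> ('a \<Rightarrow> real) \<Rightarrow> 'a \<Rightarrow> 'a tvec" where
  "ham_vec M f x =
     (THE \<xi>. \<xi> \<in> tangent_space M x \<and> (\<forall>\<eta>\<in>tangent_space M x. form M x \<xi> \<eta> = \<eta> f))"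

definition poisson :: "('a, 'e::euclidean_space) smfd \<Rightarrow> ('a \<Rightarrow> real) \<Rightarrow> ('a \<Rightarrow> real) \<Rightarrow> 'a \<Rightarrow> real" where
  "poisson M f g x = form M x (ham_vec M f x) (ham_vec M g x)"

definition integral_curve ::
    "('a, 'e::euclidean_space, 'z) mfd_scheme \<Rightarrow> ('a \<Rightarrow> 'a tvec) \<Rightarrow> real set \<Rightarrow> (real \<Rightarrow> 'a) \<Rightarrow> bool" where
  "integral_curve M X I \<gamma> \<longleftrightarrow>
     (\<forall>t\<in>I. \<gamma> t \<in> pts M \<and>
        (\<forall>g. smooth_near M (\<gamma> t) g \<longrightarrow>
           ((\<lambda>s. g (\<gamma> s)) has_real_derivative X (\<gamma> t) g) (at t)))"

definition ham_preserved :: "('a, 'e::euclidean_space) smfd \<Rightarrow> ('a \<Rightarrow> real) \<Rightarrow> 'a set \<Rightarrow> bool" where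
  "ham_preserved M f S \<longleftrightarrow>
     (\<forall>I \<gamma>. open I \<and> is_interval I \<and> 0 \<in> I \<and> integral_curve M (ham_vec M f) I \<gamma> \<and> \<gamma> 0 \<in> S
        \<longrightarrow> \<gamma> ` I \<subseteq> S)"

text \<open>A critical point is nondegenerate if its Hessian, computed in a chart, has no kernel.\<close>

definition morse_function ::
    "('a, 'e::euclidean_space, 'z) mfd_scheme \<Rightarrow> ('a \<Rightarrow> real) \<Rightarrow> bool" where
  "morse_function M f \<longleftrightarrow>
     smooth_fun_on M (pts M) f \<and>
     (\<forall>(D, \<sigma>)\<in>charts M. \<forall>u\<in>D.
        (\<forall>\<xi>\<in>tangent_space M (\<sigma> u). \<xi> f = 0) \<longrightarrow>
        (\<forall>v\<in>span D.
           (\<forall>w\<in>span D. deriv (\<lambda>s. deriv (\<lambda>t. f (\<sigma> (u + s *\<^sub>R v + t *\<^sub>R w))) 0) 0 = 0)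
           \<longrightarrow> v = 0))"

text \<open>
  The charts of an embedded \<open>d\<close>-dimensional submanifold \<open>S\<close> of \<open>M\<close> are all diffeomorphisms
  \<open>\<sigma>\<close> from relatively open subsets \<open>E\<close> of \<open>d\<close>-dimensional linear subspaces of \<open>'e\<close> onto open
  subsets \<open>S \<inter> U\<close> of \<open>S\<close> whose inverse extends to a smooth map \<open>r\<close> on the open set \<open>U\<close> of \<open>M\<close>.
  The set \<open>S\<close> is a \<open>d\<close>-dimensional submanifold iff these charts cover it, i.e. iff
  \<open>sub_smfd M d S\<close> is a manifold.
\<close>

definition sub_charts ::
    "('a, 'e::euclidean_space, 'z) mfd_scheme \<Rightarrow> nat \<Rightarrow> 'a set \<Rightarrow> ('e set \<times> ('e \<Rightarrow> 'a)) set" where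
  "sub_charts M d S = {(E, \<sigma>).
     openin (top_of_set (span E)) E \<and> dim E = d \<and>
     (\<forall>u\<in>E. \<forall>g. smooth_near M (\<sigma> u) g \<longrightarrow>
        (\<exists>W. openin (top_of_set E) W \<and> u \<in> W \<and> smooth_on W (\<lambda>w. g (\<sigma> w)))) \<and>
     (\<exists>U r. openin (mtop M) U \<and> \<sigma> ` E = S \<inter> U \<and>
        smooth_fun_on M U (r :: 'a \<Rightarrow> 'e) \<and> (\<forall>u\<in>E. r (\<sigma> u) = u))}"

definition sub_smfd ::
    "('a, 'e::euclidean_space) smfd \<Rightarrow> nat \<Rightarrow> 'a set \<Rightarrow> ('a, 'e) smfd" where
  "sub_smfd M d S =
     \<lparr>pts = S, charts = sub_charts M d S,
      form = (\<lambda>x \<xi> \<eta>. form M x (push M (\<lambda>y. y) x \<xi>) (push M (\<lambda>y. y) x \<eta>))\<rparr>"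

text \<open>
  The torus \<open>(\<real> / 2\<pi>\<int>)\<^sup>m\<close> is presented through its universal cover, with \<open>\<real>\<^sup>m\<close> the sequences
  vanishing from index \<open>m\<close> on. The one-parameter subgroups act by the flows of the smooth
  vector fields \<open>ham_vec M (\<mu> i)\<close>, so joint smoothness of the action is automatic.
\<close>

definition Rm :: "nat \<Rightarrow> (nat \<Rightarrow> real) set" where
  "Rm m = {\<theta>. \<forall>i\<ge>m. \<theta> i = 0}"

definition torus_lattice :: "nat \<Rightarrow> (nat \<Rightarrow> real) set" where
  "torus_lattice m = {\<theta>\<in>Rm m. \<forall>i. \<exists>z::int. \<theta> i = 2 * pi * of_int z}"

definition effective_hamiltonian_torus_action ::
    "('a, 'e::euclidean_space) smfd \<Rightarrow> nat \<Rightarrow> ((nat \<Rightarrow> real) \<Rightarrow> 'a \<Rightarrow> 'a) \<Rightarrow> (nat \<Rightarrow> 'a \<Rightarrow> real) \<Rightarrow> bool" where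
  "effective_hamiltonian_torus_action M m \<Phi> \<mu> \<longleftrightarrow>
     (\<forall>\<theta>\<in>Rm m. smooth_map_on M M (pts M) (\<Phi> \<theta>)) \<and>
     (\<forall>x\<in>pts M. \<Phi> (\<lambda>i. 0) x = x) \<and>
     (\<forall>\<theta>\<in>Rm m. \<forall>\<theta>'\<in>Rm m. \<forall>x\<in>pts M. \<Phi> (\<lambda>i. \<theta> i + \<theta>' i) x = \<Phi> \<theta> (\<Phi> \<theta>' x)) \<and>
     (\<forall>\<theta>\<in>Rm m. (\<forall>x\<in>pts M. \<Phi> \<theta> x = x) \<longleftrightarrow> \<theta> \<in> torus_lattice m) \<and>
     (\<forall>i<m. smooth_fun_on M (pts M) (\<mu> i)) \<and>
     (\<forall>i<m. \<forall>\<theta>\<in>Rm m. \<forall>x\<in>pts M. \<mu> i (\<Phi> \<theta> x) = \<mu> i x) \<and>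
     (\<forall>i<m. \<forall>x\<in>pts M.
        integral_curve M (ham_vec M (\<mu> i)) UNIV (\<lambda>t. \<Phi> (\<lambda>j. if j = i then t else 0) x))"

definition symplectic_toric :: "('a, 'e::euclidean_space) smfd \<Rightarrow> nat \<Rightarrow> (nat \<Rightarrow> 'a \<Rightarrow> real) \<Rightarrow> bool" where
  "symplectic_toric M m \<mu> \<longleftrightarrow>
     symplectic_manifold M m \<and> pts M \<noteq> {} \<and>
     compact_space (mtop M) \<and> connected_space (mtop M) \<and>
     (\<exists>\<Phi>. effective_hamiltonian_torus_action M m \<Phi> \<mu>)"

definition fiber :: "('a, 'e, 'z) mfd_scheme \<Rightarrow> 'a set \<Rightarrow> ('a \<Rightarrow> 'b) \<Rightarrow> 'b \<Rightarrow> 'a set" where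
  "fiber M B \<psi> p = {x \<in> pts M - B. \<psi> x = p}"

text \<open>A point of \<open>M - B\<close> is a singular point of its fiber if \<open>\<psi>\<close> is not a submersion there.\<close>

definition Sing ::
    "('a, 'e::euclidean_space, 'z) mfd_scheme \<Rightarrow> 'a set \<Rightarrow> ('a \<Rightarrow> 'b)
      \<Rightarrow> ('b, 'c::euclidean_space, 'y) mfd_scheme \<Rightarrow> 'a set" where
  "Sing M B \<psi> Y =
     {x \<in> pts M - B. push Y \<psi> x ` tangent_space M x \<noteq> tangent_space Y (\<psi> x)}"

definition horizontal ::
    "('a, 'e::euclidean_space) smfd \<Rightarrow> ('a \<Rightarrow> 'b) \<Rightarrow> ('b, 'c::euclidean_space) smfd
      \<Rightarrow> 'a \<Rightarrow> 'a tvec set" where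
  "horizontal M \<psi> Y x =
     {\<xi>\<in>tangent_space M x.
        \<forall>\<eta>\<in>tangent_space M x. push Y \<psi> x \<eta> = (\<lambda>g. 0) \<longrightarrow> form M x \<xi> \<eta> = 0}"

definition horizontal_lift ::
    "('a, 'e::euclidean_space) smfd \<Rightarrow> ('a \<Rightarrow> 'b) \<Rightarrow> ('b, 'c::euclidean_space) smfd
      \<Rightarrow> 'a \<Rightarrow> 'b tvec \<Rightarrow> 'a tvec" where
  "horizontal_lift M \<psi> Y x \<zeta> = (THE \<xi>. \<xi> \<in> horizontal M \<psi> Y x \<and> push Y \<psi> x \<xi> = \<zeta>)"

text \<open>
  ``Generic'' means: on an open dense subset \<open>G\<close> of \<open>Y\<close>. The functions \<open>f\<^sub>1, \<dots>, f\<^sub>k\<close> are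
  \<open>f 0, \<dots>, f (k - 1)\<close>, and \<open>\<mu>\<close> is a moment map of the toric manifold \<open>Y\<close>. Nonemptiness of
  the generic fibers is part of their being submanifolds of dimension \<open>2k\<close>; without it a
  constant map \<open>\<psi>\<close> would be allowed.
\<close>

definition pseudotoric_structure ::
    "('a, 'e::euclidean_space) smfd \<Rightarrow> nat \<Rightarrow> nat \<Rightarrow> (nat \<Rightarrow> 'a \<Rightarrow> real) \<Rightarrow> 'a set
      \<Rightarrow> ('a \<Rightarrow> 'b) \<Rightarrow> ('b, 'c::euclidean_space) smfd \<Rightarrow> bool" where
  "pseudotoric_structure M n k f B \<psi> Y \<longleftrightarrow>
     symplectic_manifold M n \<and> 1 \<le> k \<and> k \<le> n \<and>
     (\<forall>i<k. morse_function M (f i)) \<and>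
     (\<forall>i<k. \<forall>j<k. \<forall>x\<in>pts M. poisson M (f i) (f j) x = 0) \<and>
     (\<exists>\<mu>. symplectic_toric Y (n - k) \<mu>) \<and>
     closedin (mtop M) B \<and>
     smooth_map_on M Y (pts M - B) \<psi> \<and>
     (\<exists>G. openin (mtop Y) G \<and> mtop Y closure_of G = pts Y \<and>
        (\<forall>p\<in>G.
           fiber M B \<psi> p \<noteq> {} \<and> fiber M B \<psi> p \<inter> Sing M B \<psi> Y = {} \<and>
           symplectic_manifold (sub_smfd M (2 * k) (fiber M B \<psi> p)) k \<and>
           symplectic_toric (sub_smfd M (2 * k) (fiber M B \<psi> p \<union> B)) k f)) \<and>
     (\<forall>p\<in>pts Y. \<forall>i<k. ham_preserved M (f i) (fiber M B \<psi> p \<union> B)) \<and>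
     (\<exists>\<tau>. \<forall>x\<in>pts M - (B \<union> Sing M B \<psi> Y).
        \<tau> x > 0 \<and>
        (\<forall>\<zeta>\<in>tangent_space Y (\<psi> x). \<exists>!\<xi>. \<xi> \<in> horizontal M \<psi> Y x \<and> push Y \<psi> x \<xi> = \<zeta>) \<and>
        (\<forall>h. smooth_fun_on Y (pts Y) h \<longrightarrow>
           horizontal_lift M \<psi> Y x (ham_vec Y h (\<psi> x)) =
             (\<lambda>g. \<tau> x * ham_vec M (\<lambda>y. h (\<psi> y)) x g)))"

text \<open>
  Taking the points and coordinates of \<open>Y\<close> in the types used for \<open>M\<close> is no restriction: \<open>M\<close>
  is nonempty of positive dimension \<open>2n\<close>, so that its point type has at least the cardinality
  of the continuum, while \<open>Y\<close> has at most that many points; and \<open>2(n - k) \<le> DIM('e)\<close>. The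
  topology of \<open>Y\<close> comes from its charts, not from its point type.
\<close>

definition pseudotoric :: "('a, 'e::euclidean_space) smfd \<Rightarrow> bool" where
  "pseudotoric M \<longleftrightarrow>
     (\<exists>n k f B \<psi> (Y :: ('a, 'e) smfd). pseudotoric_structure M n k f B \<psi> Y)"

text \<open>\<open>cline z\<close> is the point \<open>[z\<^sub>0 : z\<^sub>1 : \<dots>]\<close> with homogeneous coordinates \<open>z\<close>.\<close>

definition cline :: "complex ^ 'n \<Rightarrow> (complex ^ 'n) set" where
  "cline z = {c *s z |c. True}"

text \<open>
  The domain \<open>{z. z $ a = 0}\<close> of the affine chart at \<open>a\<close> is the space of the remaining
  coordinates, the \<open>a\<close>-th one being set to 1.
\<close>

definition proj_mfd :: "((complex ^ 'n) set, complex ^ 'n) mfd" where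
  "proj_mfd =
     \<lparr>pts = {cline z |z. z \<noteq> 0},
      charts = {({z. z $ a = 0}, \<lambda>z. cline (z + axis a 1)) |a. True}\<rparr>"

definition herm :: "complex ^ 'n \<Rightarrow> complex ^ 'n \<Rightarrow> complex" where
  "herm v w = (\<Sum>i\<in>UNIV. v $ i * cnj (w $ i))"

text \<open>
  This is \<open>(i/2) \<partial>\<partial>\<^sup>- log |z|\<^sup>2\<close> at \<open>z\<close>, evaluated on \<open>v\<close> and \<open>w\<close>. The Fubini-Study form takes
  this value on the images of \<open>v\<close> and \<open>w\<close> under the differential of \<open>z \<mapsto> [z]\<close>.
\<close>

definition fs_lifted :: "complex ^ 'n \<Rightarrow> complex ^ 'n \<Rightarrow> complex ^ 'n \<Rightarrow> real" where
  "fs_lifted z v w =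
     - Im ((herm v w * herm z z - herm v z * herm z w) / (herm z z)\<^sup>2)"

definition proj_vec :: "complex ^ 'n \<Rightarrow> complex ^ 'n \<Rightarrow> (complex ^ 'n) set tvec" where
  "proj_vec z v = velocity proj_mfd (\<lambda>t. cline (z + t *\<^sub>R v))"

definition fubini_study ::
    "(complex ^ 'n) set \<Rightarrow> (complex ^ 'n) set tvec \<Rightarrow> (complex ^ 'n) set tvec \<Rightarrow> real" where
  "fubini_study x \<xi> \<eta> =
     (THE r. \<exists>z v w. z \<noteq> 0 \<and> x = cline z \<and> \<xi> = proj_vec z v \<and> \<eta> = proj_vec z w \<and>
        r = fs_lifted z v w)"

definition CP :: "((complex ^ 'n) set, complex ^ 'n) smfd" where
  "CP = \<lparr>pts = pts proj_mfd, charts = charts proj_mfd, form = fubini_study\<rparr>"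

definition prod_smfd ::
    "('a, 'e::euclidean_space) smfd \<Rightarrow> ('b, 'c::euclidean_space) smfd \<Rightarrow> ('a \<times> 'b, 'e \<times> 'c) smfd" where
  "prod_smfd M N =
     \<lparr>pts = pts M \<times> pts N,
      charts = {(D \<times> E, map_prod \<sigma> \<tau>) |D \<sigma> E \<tau>. (D, \<sigma>) \<in> charts M \<and> (E, \<tau>) \<in> charts N},
      form = (\<lambda>x \<xi> \<eta>. form M (fst x) (push M fst x \<xi>) (push M fst x \<eta>) +
                       form N (snd x) (push N snd x \<xi>) (push N snd x \<eta>))\<rparr>"

definition flag_points :: "((complex ^ 3) set \<times> (complex ^ 3) set) set" where
  "flag_points =
     {(cline x, cline y) |x y. x \<noteq> 0 \<and> y \<noteq> 0 \<and> (\<Sum>i\<in>UNIV. x $ i * y $ i) = 0}"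

definition flag_variety ::
    "((complex ^ 3) set \<times> (complex ^ 3) set, (complex ^ 3) \<times> (complex ^ 3)) smfd" where
  "flag_variety = sub_smfd (prod_smfd CP CP) 6 flag_points"

end

theory Submission imports Defs begin

text \<open>
  Everything is computed on the cone of pairs of nonzero vectors \<open>(x, y)\<close> over \<open>CP \<times> CP\<close>: points, tangent
  vectors, functions and forms on a complex submanifold are lifted there, where the form is a
  homogeneous expression in Hermitian products.

  Take \<open>\<psi> [x, y] = [x\<^sub>1 y\<^sub>1 : x\<^sub>2 y\<^sub>2]\<close>, with base set \<open>x\<^sub>i y\<^sub>i = 0\<close> for all \<open>i\<close>, and for \<open>f\<^sub>1, f\<^sub>2\<close> the
  components of the moment map of the torus acting by \<open>(t\<^sub>i x\<^sub>i, t\<^sub>i\<^sup>-\<^sup>1 y\<^sub>i)\<close> with weights \<open>(0, 1, 2)\<close> and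
  \<open>(0, 1, 3)\<close>.  The torus fixes every \<open>x\<^sub>i y\<^sub>i\<close>, hence preserves the closed fibres of \<open>\<psi>\<close>; over a point
  \<open>p\<close> with \<open>p\<^sub>1\<close>, \<open>p\<^sub>2\<close>, \<open>p\<^sub>3 = - p\<^sub>1 - p\<^sub>2\<close> nonzero the closed fibre \<open>x\<^sub>i y\<^sub>i p\<^sub>k = x\<^sub>k y\<^sub>k p\<^sub>i\<close> is a smooth toric
  surface (the del Pezzo surface of degree six).  The weights within each \<open>f\<^sub>i\<close> are distinct, so that
  its critical points are nondegenerate.  Finally \<open>\<psi>\<close> is holomorphic with values in a curve:
  where it is submersive, the horizontal space is a complex line that it maps conformally onto the
  tangent space, and \<open>\<tau>\<close> is the conformal factor.
\<close>

section \<open>Calculus of smooth maps on arbitrary sets\<close>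

text \<open>The obstacle is that the notions quantify over all charts of a submanifold and let
  tangent vectors act on functions known only near one point, while the closed fibres are
  submanifolds of a submanifold. For such iterated submanifolds it is enough to record that charts
  lift locally to the cone and that smooth functions extend locally; tangent vectors then become
  vectors of the cone modulo vertical ones. Complex tangent spaces give nondegeneracy:
  \<open>omega z v (mult_i v)\<close> is positive unless v is vertical. The conformal factor comes
  from an adjoint: the Hamiltonian vector of a pulled-back function is the adjoint of the
  differential applied to the Hamiltonian vector below, and on a complex line the differential
  composed with its adjoint is a positive multiple of the identity. The pair of weights also has to
  make the action effective: relative to the first coordinate it is the matrix with rows (1, 2) and
  (1, 3), of determinant 1. Closed fibres must be preserved along every integral curve. A
  torus-invariant function that vanishes exactly on the fibre gives this without a uniqueness
  theorem for differential equations.\<close>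

lemma Ck_on_subset:
  assumes "Ck_on k D f" "D' \<subseteq> D" shows "Ck_on k D' f"
  using assms
proof (induction k arbitrary: f)
  case 0 then show ?case by (auto intro: continuous_on_subset)
next
  case (Suc k)
  then obtain f' where "\<forall>u\<in>D. (f has_derivative f' u) (at u within D)"
    "\<forall>v. Ck_on k D (\<lambda>u. f' u v)" by auto
  with Suc show ?case by (auto intro!: exI[of _ f'] intro: has_derivative_subset)
qed

lemma Ck_on_cong:
  assumes "Ck_on k D f" "\<And>x. x \<in> D \<Longrightarrow> f x = g x" shows "Ck_on k D g"
proof (cases k)
  case 0 with assms show ?thesis by (simp cong: continuous_on_cong)
next
  case (Suc m)
  then obtain f' where "\<forall>u\<in>D. (f has_derivative f' u) (at u within D)"
    "\<forall>v. Ck_on m D (\<lambda>u. f' u v)" using assms by auto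
  with Suc assms(2) show ?thesis
    by (fastforce intro!: exI[of _ f'] intro: has_derivative_transform[of _ D g f])
qed

lemma Ck_on_SucD: "Ck_on (Suc k) D f \<Longrightarrow> Ck_on k D f"
proof (induction k arbitrary: f)
  case 0 then show ?case
    by (auto simp: continuous_on_eq_continuous_within intro: has_derivative_continuous)
next
  case (Suc k)
  from Suc.prems obtain f' where "\<forall>u\<in>D. (f has_derivative f' u) (at u within D)"
    "\<forall>v. Ck_on (Suc k) D (\<lambda>u. f' u v)" unfolding Ck_on.simps(2)[of "Suc k"] by auto
  with Suc.IH show ?case unfolding Ck_on.simps(2)[of k] by blast
qed

lemma Ck_on_const: "Ck_on k D (\<lambda>_. c)"
  by (induction k arbitrary: c) (auto intro!: exI[of _ "\<lambda>_ _. 0"])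

lemma Ck_on_bounded_linear:
  assumes "bounded_linear g" "Ck_on k D f" shows "Ck_on k D (\<lambda>u. g (f u))"
  using assms(2)
proof (induction k arbitrary: f)
  case 0 then show ?case
    using assms(1) by (auto intro: bounded_linear.continuous_on)
next
  case (Suc k)
  then obtain f' where "\<forall>u\<in>D. (f has_derivative f' u) (at u within D)"
    "\<forall>v. Ck_on k D (\<lambda>u. f' u v)" by auto
  with Suc.IH show ?case
    by (auto intro!: exI[of _ "\<lambda>u v. g (f' u v)"] bounded_linear.has_derivative[OF assms(1)])
qed

lemma Ck_on_ident: "Ck_on k D (\<lambda>u. u)"
  by (cases k) (auto intro!: exI[of _ "\<lambda>u v. v"] Ck_on_const)

lemma Ck_on_add:
  assumes "Ck_on k D f" "Ck_on k D g" shows "Ck_on k D (\<lambda>u. f u + g u)"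
  using assms
proof (induction k arbitrary: f g)
  case 0 then show ?case by (auto intro: continuous_on_add)
next
  case (Suc k)
  then obtain f' g' where "\<forall>u\<in>D. (f has_derivative f' u) (at u within D)"
    "\<forall>v. Ck_on k D (\<lambda>u. f' u v)" "\<forall>u\<in>D. (g has_derivative g' u) (at u within D)"
    "\<forall>v. Ck_on k D (\<lambda>u. g' u v)" by auto
  with Suc.IH show ?case
    by (auto intro!: exI[of _ "\<lambda>u v. f' u v + g' u v"] has_derivative_add)
qed

lemma Ck_on_sum:
  assumes "\<And>i. i \<in> I \<Longrightarrow> Ck_on k D (f i)" shows "Ck_on k D (\<lambda>u. \<Sum>i\<in>I. f i u)"
  using assms
  by (induction I rule: infinite_finite_induct) (auto intro: Ck_on_const Ck_on_add)

lemma Ck_on_bilinear: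
  assumes b: "bounded_bilinear b" and "Ck_on k D f" "Ck_on k D g"
  shows "Ck_on k D (\<lambda>u. b (f u) (g u))"
  using assms(2,3)
proof (induction k arbitrary: f g)
  case 0 then show ?case by (auto intro: bounded_bilinear.continuous_on[OF b])
next
  case (Suc k)
  then obtain f' g' where *: "\<forall>u\<in>D. (f has_derivative f' u) (at u within D)"
    "\<forall>v. Ck_on k D (\<lambda>u. f' u v)" "\<forall>u\<in>D. (g has_derivative g' u) (at u within D)"
    "\<forall>v. Ck_on k D (\<lambda>u. g' u v)" by auto
  have "Ck_on k D f" "Ck_on k D g" using Suc.prems Ck_on_SucD by blast+
  with * Suc.IH show ?case
    by (auto intro!: exI[of _ "\<lambda>u v. b (f u) (g' u v) + b (f' u v) (g u)"] Ck_on_add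
        bounded_bilinear.FDERIV[OF b])
qed

lemma Ck_on_inverse:
  fixes f :: "'e::euclidean_space \<Rightarrow> 'b::real_normed_div_algebra"
  assumes "Ck_on k D f" "\<And>u. u \<in> D \<Longrightarrow> f u \<noteq> 0" shows "Ck_on k D (\<lambda>u. inverse (f u))"
  using assms(1)
proof (induction k)
  case 0 then show ?case using assms(2) by (auto intro: continuous_on_inverse)
next
  case (Suc k)
  then obtain f' where *: "\<forall>u\<in>D. (f has_derivative f' u) (at u within D)"
    "\<forall>v. Ck_on k D (\<lambda>u. f' u v)" by auto
  \<comment> \<open>The derivative of the inverse contains the inverse itself, but only to order k,
    where the induction hypothesis applies.\<close>
  have "Ck_on k D (\<lambda>u. inverse (f u))" using Suc Ck_on_SucD by blast
  then have "Ck_on k D (\<lambda>u. - (inverse (f u) * f' u v * inverse (f u)))" for v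
    using *(2)
    by (intro Ck_on_bounded_linear[OF bounded_linear_minus[OF bounded_linear_ident]]
        Ck_on_bilinear[OF bounded_bilinear_mult]) auto
  with * assms(2) show ?case
    by (auto intro!: exI[of _ "\<lambda>u v. - (inverse (f u) * f' u v * inverse (f u))"] has_derivative_inverse)
qed

lemma Ck_on_compose:
  fixes f :: "'e::euclidean_space \<Rightarrow> 'c::euclidean_space"
  assumes "Ck_on k D f" "Ck_on k D' g" "f ` D \<subseteq> D'"
  shows "Ck_on k D (\<lambda>u. g (f u))"
  using assms
proof (induction k arbitrary: g)
  case 0 then show ?case by (auto intro: continuous_on_compose2)
next
  case (Suc k)
  then obtain f' g' where *: "\<forall>u\<in>D. (f has_derivative f' u) (at u within D)"
    "\<forall>v. Ck_on k D (\<lambda>u. f' u v)" "\<forall>u\<in>D'. (g has_derivative g' u) (at u within D')"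
    "\<forall>v. Ck_on k D' (\<lambda>u. g' u v)" by auto
  have "((\<lambda>u. g (f u)) has_derivative (\<lambda>v. g' (f u) (f' u v))) (at u within D)" if "u \<in> D" for u
    using * that Suc.prems(3) by (intro has_derivative_in_compose2[of D' g g' f D]) auto
  moreover have "Ck_on k D (\<lambda>u. g' (f u) (f' u v))" for v
  proof -
    \<comment> \<open>The induction hypothesis covers g' in a fixed direction, whereas the chain
      rule needs the direction \<open>f' u v\<close>, which moves with u. Expanding it in the
      standard basis separates the two dependences.\<close>
    have "Ck_on k D (\<lambda>u. g' (f u) b)" for b
      using * Suc.IH[of "\<lambda>u. g' u b"] Ck_on_SucD[OF Suc.prems(1)] Suc.prems(3) by blast
    then have "Ck_on k D (\<lambda>u. \<Sum>b\<in>Basis. (f' u v \<bullet> b) *\<^sub>R g' (f u) b)"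
      using *
      by (intro Ck_on_sum Ck_on_bilinear[OF bounded_bilinear_scaleR]
          Ck_on_bounded_linear[OF bounded_linear_inner_left]) auto
    then show ?thesis
    proof (rule Ck_on_cong)
      fix u assume "u \<in> D"
      then have l: "linear (g' (f u))" using * Suc.prems(3) has_derivative_linear by blast
      show "(\<Sum>b\<in>Basis. (f' u v \<bullet> b) *\<^sub>R g' (f u) b) = g' (f u) (f' u v)"
        by (subst (2) euclidean_representation[symmetric, of "f' u v"])
           (simp add: linear_sum[OF l] linear_scale[OF l])
    qed
  qed
  ultimately show ?case by (auto intro!: exI[of _ "\<lambda>u v. g' (f u) (f' u v)"])
qed

lemma smooth_on_subset: "smooth_on D f \<Longrightarrow> D' \<subseteq> D \<Longrightarrow> smooth_on D' f"
  by (auto simp: smooth_on_def intro: Ck_on_subset)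

lemma smooth_on_cong: "smooth_on D f \<Longrightarrow> (\<And>x. x \<in> D \<Longrightarrow> f x = g x) \<Longrightarrow> smooth_on D g"
  by (auto simp: smooth_on_def intro: Ck_on_cong)

lemma smooth_on_const: "smooth_on D (\<lambda>_. c)"
  by (auto simp: smooth_on_def intro: Ck_on_const)

lemma smooth_on_ident: "smooth_on D (\<lambda>u. u)"
  by (auto simp: smooth_on_def intro: Ck_on_ident)

lemma smooth_on_bounded_linear: "bounded_linear g \<Longrightarrow> smooth_on D f \<Longrightarrow> smooth_on D (\<lambda>u. g (f u))"
  by (auto simp: smooth_on_def intro: Ck_on_bounded_linear)

lemma smooth_on_add: "smooth_on D f \<Longrightarrow> smooth_on D g \<Longrightarrow> smooth_on D (\<lambda>u. f u + g u)"
  by (auto simp: smooth_on_def intro: Ck_on_add)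

lemma smooth_on_sum: "(\<And>i. i \<in> I \<Longrightarrow> smooth_on D (f i)) \<Longrightarrow> smooth_on D (\<lambda>u. \<Sum>i\<in>I. f i u)"
  by (auto simp: smooth_on_def intro: Ck_on_sum)

lemma smooth_on_bilinear:
  "bounded_bilinear b \<Longrightarrow> smooth_on D f \<Longrightarrow> smooth_on D g \<Longrightarrow> smooth_on D (\<lambda>u. b (f u) (g u))"
  by (auto simp: smooth_on_def intro: Ck_on_bilinear)

lemma smooth_on_inverse:
  fixes f :: "'e::euclidean_space \<Rightarrow> 'b::real_normed_div_algebra"
  shows "smooth_on D f \<Longrightarrow> (\<And>u. u \<in> D \<Longrightarrow> f u \<noteq> 0) \<Longrightarrow> smooth_on D (\<lambda>u. inverse (f u))"
  by (auto simp: smooth_on_def intro: Ck_on_inverse)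

lemma smooth_on_compose:
  fixes f :: "'e::euclidean_space \<Rightarrow> 'c::euclidean_space"
  shows "smooth_on D f \<Longrightarrow> smooth_on D' g \<Longrightarrow> f ` D \<subseteq> D' \<Longrightarrow> smooth_on D (\<lambda>u. g (f u))"
  unfolding smooth_on_def using Ck_on_compose by blast

lemma smooth_on_continuous: "smooth_on D f \<Longrightarrow> continuous_on D f"
  unfolding smooth_on_def using Ck_on.simps(1) by blast

lemma smooth_on_mult:
  fixes f g :: "'e::euclidean_space \<Rightarrow> 'b::real_normed_algebra"
  shows "smooth_on D f \<Longrightarrow> smooth_on D g \<Longrightarrow> smooth_on D (\<lambda>u. f u * g u)"
  by (rule smooth_on_bilinear[OF bounded_bilinear_mult])

lemma smooth_on_divide:
  fixes f g :: "'e::euclidean_space \<Rightarrow> 'b::real_normed_field"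
  shows "smooth_on D f \<Longrightarrow> smooth_on D g \<Longrightarrow> (\<And>u. u \<in> D \<Longrightarrow> g u \<noteq> 0) \<Longrightarrow>
    smooth_on D (\<lambda>u. f u / g u)"
  unfolding divide_inverse by (intro smooth_on_mult smooth_on_inverse)

lemma smooth_on_minus: "smooth_on D f \<Longrightarrow> smooth_on D (\<lambda>u. - f u)"
  by (rule smooth_on_bounded_linear[OF bounded_linear_minus[OF bounded_linear_ident]])

lemma smooth_on_diff: "smooth_on D f \<Longrightarrow> smooth_on D g \<Longrightarrow> smooth_on D (\<lambda>u. f u - g u)"
  using smooth_on_add[of D f "\<lambda>u. - g u"] smooth_on_minus[of D g] by simp

lemma smooth_on_Pair:
  assumes "smooth_on D f" "smooth_on D g" shows "smooth_on D (\<lambda>u. (f u, g u))"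
proof -
  have "smooth_on D (\<lambda>u. (f u, 0) + (0, g u))"
    using assms by (intro smooth_on_add smooth_on_bounded_linear[of "\<lambda>x. (x, 0)"]
        smooth_on_bounded_linear[of "\<lambda>x. (0, x)"]) (auto intro!: bounded_linear_intros)
  then show ?thesis by simp
qed

lemma smooth_on_fst: "smooth_on D f \<Longrightarrow> smooth_on D (\<lambda>u. fst (f u))"
  by (rule smooth_on_bounded_linear[OF bounded_linear_fst])

lemma smooth_on_snd: "smooth_on D f \<Longrightarrow> smooth_on D (\<lambda>u. snd (f u))"
  by (rule smooth_on_bounded_linear[OF bounded_linear_snd])

lemma smooth_on_nth: "smooth_on D f \<Longrightarrow> smooth_on D (\<lambda>u. f u $ i)"
  by (rule smooth_on_bounded_linear[OF bounded_linear_vec_nth])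

lemma bounded_linear_axis: "bounded_linear (\<lambda>x::'b::euclidean_space. axis i x)"
  by (intro linear_conv_bounded_linear[THEN iffD1] linearI)
     (auto simp: vec_eq_iff axis_def)

lemma smooth_on_vec:
  fixes f :: "'e::euclidean_space \<Rightarrow> 'b::euclidean_space ^ 'n"
  assumes "\<And>i. smooth_on D (\<lambda>u. f u $ i)" shows "smooth_on D f"
proof -
  have "smooth_on D (\<lambda>u. \<Sum>i\<in>UNIV. axis i (f u $ i))"
    using assms by (intro smooth_on_sum smooth_on_bounded_linear[OF bounded_linear_axis])
  moreover have "(\<Sum>i\<in>UNIV. axis i (f u $ i)) = f u" for u
    by (simp add: vec_eq_iff axis_def)
  ultimately show ?thesis by simp
qed

section \<open>Directional derivatives on relatively open sets\<close>

definition dd :: "('e::real_normed_vector \<Rightarrow> 'b::real_normed_vector) \<Rightarrow> 'e \<Rightarrow> 'e \<Rightarrow> 'b" where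
  "dd f u v = vector_derivative (\<lambda>t. f (u + t *\<^sub>R v)) (at 0)"

lemma at_within_openin:
  assumes "openin (top_of_set D) W" "u \<in> W" shows "at u within W = at u within D"
proof -
  obtain T where "open T" "W = D \<inter> T" using assms(1) by (auto simp: openin_open)
  with assms(2) show ?thesis by (intro at_within_nhd[of u T]) auto
qed

lemma line_eventually:
  fixes u v :: "'e::real_normed_vector"
  assumes "openin (top_of_set V) D" "subspace V" "u \<in> D" "v \<in> V"
  shows "eventually (\<lambda>t. u + t *\<^sub>R v \<in> D) (nhds (0::real))"
proof -
  obtain T where T: "open T" "D = V \<inter> T" using assms(1) by (auto simp: openin_open)
  have "open ((\<lambda>t::real. u + t *\<^sub>R v) -` T)"
    using T(1) by (intro open_vimage continuous_intros)
  moreover have "0 \<in> (\<lambda>t::real. u + t *\<^sub>R v) -` T" using T assms(3) by auto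
  ultimately have "eventually (\<lambda>t. t \<in> (\<lambda>t::real. u + t *\<^sub>R v) -` T) (nhds 0)"
    by (rule eventually_nhds_in_open)
  then show ?thesis
    by eventually_elim (use T assms in \<open>auto intro: subspace_add subspace_scale\<close>)
qed

text \<open>Since D is open in V, a line in a direction of V stays in D for small t. On that
  interval the derivative within D becomes an ordinary one-variable derivative, so \<open>dd\<close>
  is determined by f even when V is a proper subspace.\<close>

lemma line_derivative:
  assumes "openin (top_of_set V) D" "subspace V" "u \<in> D" "v \<in> V"
    and f: "(f has_derivative f') (at u within D)"
  shows "((\<lambda>t. f (u + t *\<^sub>R v)) has_vector_derivative f' v) (at 0)"
proof -
  let ?S = "{t. u + t *\<^sub>R v \<in> D}"
  have ev: "eventually (\<lambda>t. t \<in> ?S) (nhds 0)" using line_eventually[OF assms(1-4)] by simp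
  then obtain U where U: "open U" "0 \<in> U" "U \<subseteq> ?S" unfolding eventually_nhds by auto
  have "((\<lambda>t. u + t *\<^sub>R v) has_derivative (\<lambda>t. t *\<^sub>R v)) (at 0 within U)"
    by (auto intro!: derivative_eq_intros)
  moreover have "(f has_derivative f') (at (u + 0 *\<^sub>R v) within D)" using f by simp
  moreover have "(\<lambda>t. u + t *\<^sub>R v) ` U \<subseteq> D" using U by auto
  ultimately have "((\<lambda>t. f (u + t *\<^sub>R v)) has_derivative (\<lambda>t. f' (t *\<^sub>R v))) (at 0 within U)"
    by (intro has_derivative_in_compose[of "\<lambda>t. u + t *\<^sub>R v" _ 0 U f]) (auto intro: has_derivative_subset)
  then show ?thesis
    using U has_derivative_linear[OF f]
    by (simp add: has_vector_derivative_def at_within_open[OF U(2,1)] linear_scale)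
qed

lemma dd_eq:
  assumes "openin (top_of_set V) D" "subspace V" "u \<in> D" "v \<in> V"
    "(f has_derivative f') (at u within D)"
  shows "dd f u v = f' v"
  unfolding dd_def using line_derivative[OF assms] by (rule vector_derivative_at)

lemma exists_projection:
  fixes V :: "'e::euclidean_space set"
  assumes "subspace V" obtains P where "bounded_linear P" "range P \<subseteq> V" "\<And>v. v \<in> V \<Longrightarrow> P v = v"
  using linear_exists_left_inverse_on[of "\<lambda>x. x" V] assms
  by (auto simp: linear_conv_bounded_linear bounded_linear_ident)

text \<open>A derivative within D is determined only along V, so derivatives chosen point by point
  may behave wildly in the other directions. Composing them with a linear projection onto V gives a
  witness whose values are \<open>dd f u (P v)\<close>.\<close>

lemma Ck_on_SucI:
  fixes D :: "'e::euclidean_space set"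
  assumes V: "openin (top_of_set V) D" "subspace V"
    and "\<And>u. u \<in> D \<Longrightarrow> f differentiable (at u within D)"
    and C: "\<And>v. v \<in> V \<Longrightarrow> Ck_on k D (\<lambda>u. dd f u v)"
  shows "Ck_on (Suc k) D f"
proof -
  obtain P where P: "bounded_linear P" "range P \<subseteq> V" "\<And>v. v \<in> V \<Longrightarrow> P v = v"
    using exists_projection[OF V(2)] by metis
  from assms(3) obtain F where F: "\<And>u. u \<in> D \<Longrightarrow> (f has_derivative F u) (at u within D)"
    unfolding differentiable_def by metis
  have "(f has_derivative (\<lambda>v. F u (P v))) (at u within D)" if "u \<in> D" for u
  proof -
    have DV: "D \<subseteq> V" using V(1) openin_imp_subset by blast
    have "((\<lambda>y. (1 / norm (y - u)) *\<^sub>R (f y - (f u + F u (y - u)))) \<longlongrightarrow> 0) (at u within D)"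
      using F[OF that] by (simp add: has_derivative_within)
    \<comment> \<open>For y and u in D the difference y - u lies in V, where P is the identity, so
      the difference quotient is unchanged.\<close>
    then have "((\<lambda>y. (1 / norm (y - u)) *\<^sub>R (f y - (f u + F u (P (y - u))))) \<longlongrightarrow> 0) (at u within D)"
      by (rule Lim_transform_within_set_eq[THEN iffD1, rotated, OF tendsto_cong[THEN iffD1, rotated]])
         (use DV that in \<open>auto simp: eventually_at_filter P(3)[OF subspace_diff[OF V(2)]] subsetD intro!: always_eventually\<close>)
    then show ?thesis
      using F[OF that] P(1) by (auto simp: has_derivative_within intro: bounded_linear_compose)
  qed
  moreover have "Ck_on k D (\<lambda>u. F u (P v))" for v
    by (rule Ck_on_cong[OF C[of "P v"]]) (use P F V in \<open>auto intro!: dd_eq\<close>)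
  ultimately show ?thesis by (auto intro!: exI[of _ "\<lambda>u v. F u (P v)"])
qed

lemma Ck_on_SucE:
  assumes "Ck_on (Suc k) D f" "openin (top_of_set V) D" "subspace V"
  shows "u \<in> D \<Longrightarrow> f differentiable (at u within D)"
    and "v \<in> V \<Longrightarrow> Ck_on k D (\<lambda>u. dd f u v)"
proof -
  obtain f' where *: "\<forall>u\<in>D. (f has_derivative f' u) (at u within D)"
    "\<forall>v. Ck_on k D (\<lambda>u. f' u v)" using assms(1) by auto
  then show "u \<in> D \<Longrightarrow> f differentiable (at u within D)" by (auto simp: differentiable_def)
  show "Ck_on k D (\<lambda>u. dd f u v)" if "v \<in> V"
    using *(2)[rule_format, of v] by (rule Ck_on_cong) (use * assms that dd_eq in metis)
qed

text \<open>\<open>Ck_on\<close> asks for one derivative witness on all of D, and witnesses on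
  overlapping pieces need not agree. The canonical \<open>dd\<close> is the same for all pieces,
  which makes the induction local.\<close>

lemma Ck_on_local:
  fixes D :: "'e::euclidean_space set"
  assumes "openin (top_of_set V) D" "subspace V"
    and "\<And>u. u \<in> D \<Longrightarrow> \<exists>W. openin (top_of_set D) W \<and> u \<in> W \<and> Ck_on k W f"
  shows "Ck_on k D f"
  using assms(3)
proof (induction k arbitrary: f)
  case 0
  show ?case unfolding Ck_on.simps continuous_on_eq_continuous_within
  proof
    fix u assume "u \<in> D"
    then obtain W where "openin (top_of_set D) W" "u \<in> W" "continuous_on W f"
      using 0 by auto
    then show "continuous (at u within D) f"
      using at_within_openin[of D W u] by (auto simp: continuous_on_eq_continuous_within)
  qed
next
  case (Suc k)
  show ?case
  proof (rule Ck_on_SucI[OF assms(1,2)])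
    fix u assume "u \<in> D"
    then obtain W where W: "openin (top_of_set D) W" "u \<in> W" "Ck_on (Suc k) W f"
      using Suc.prems by blast
    have "openin (top_of_set V) W" using W(1) assms(1) openin_trans by blast
    then have "f differentiable (at u within W)" using Ck_on_SucE(1)[OF W(3)] assms W by blast
    then show "f differentiable (at u within D)" using at_within_openin[OF W(1,2)] by simp
  next
    fix v assume v: "v \<in> V"
    show "Ck_on k D (\<lambda>u. dd f u v)"
    proof (rule Suc.IH)
      fix u assume "u \<in> D"
      then obtain W where W: "openin (top_of_set D) W" "u \<in> W" "Ck_on (Suc k) W f"
        using Suc.prems by blast
      have "openin (top_of_set V) W" using W(1) assms(1) openin_trans by blast
      then have "Ck_on k W (\<lambda>u. dd f u v)" using Ck_on_SucE(2)[OF W(3)] assms v by blast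
      with W show "\<exists>W. openin (top_of_set D) W \<and> u \<in> W \<and> Ck_on k W (\<lambda>u. dd f u v)" by blast
    qed
  qed
qed

lemma smooth_on_local:
  fixes D :: "'e::euclidean_space set"
  assumes "openin (top_of_set V) D" "subspace V"
    and "\<And>u. u \<in> D \<Longrightarrow> \<exists>W. openin (top_of_set D) W \<and> u \<in> W \<and> smooth_on W f"
  shows "smooth_on D f"
  unfolding smooth_on_def using assms(3)
  by (intro allI Ck_on_local[OF assms(1,2)]) (auto simp: smooth_on_def)

lemma smooth_on_has_derivative:
  assumes "smooth_on D f" "u \<in> D" obtains f' where "(f has_derivative f') (at u within D)"
proof -
  have "Ck_on (Suc 0) D f" using assms by (auto simp only: smooth_on_def)
  then obtain f' where "\<forall>u\<in>D. (f has_derivative f' u) (at u within D)" by auto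
  with assms(2) that show ?thesis by blast
qed

lemma smooth_on_dd:
  assumes "smooth_on D f" "openin (top_of_set V) D" "subspace V" "v \<in> V"
  shows "smooth_on D (\<lambda>u. dd f u v)"
  unfolding smooth_on_def
proof
  fix k have "Ck_on (Suc k) D f" using assms by (auto simp: smooth_on_def)
  then show "Ck_on k D (\<lambda>u. dd f u v)" using assms(2-4) by (rule Ck_on_SucE(2))
qed

lemma smooth_on_dd_derivative:
  assumes "smooth_on D f" "openin (top_of_set V) D" "subspace V" "u \<in> D" "v \<in> V"
  shows "((\<lambda>t. f (u + t *\<^sub>R v)) has_vector_derivative dd f u v) (at 0)"
  by (metis smooth_on_has_derivative assms line_derivative dd_eq)

lemma dd_real:
  fixes f :: "'e::euclidean_space \<Rightarrow> real"
  assumes "smooth_on D f" "openin (top_of_set V) D" "subspace V" "u \<in> D" "v \<in> V"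
  shows "deriv (\<lambda>t. f (u + t *\<^sub>R v)) 0 = dd f u v"
  using smooth_on_dd_derivative[OF assms]
  by (simp add: has_real_derivative_iff_has_vector_derivative[symmetric] DERIV_imp_deriv)

lemma line_derivative2:
  fixes F :: "'e::euclidean_space \<Rightarrow> real"
  assumes "smooth_on D F" "openin (top_of_set V) D" "subspace V" "x + s *\<^sub>R v \<in> D" "v \<in> V"
  shows "((\<lambda>s. F (x + s *\<^sub>R v)) has_real_derivative dd F (x + s *\<^sub>R v) v) (at s)"
proof -
  have "((\<lambda>t. F (x + s *\<^sub>R v + t *\<^sub>R v)) has_real_derivative dd F (x + s *\<^sub>R v) v) (at 0)"
    using smooth_on_dd_derivative[OF assms]
    by (simp add: has_real_derivative_iff_has_vector_derivative)
  then show ?thesis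
    using DERIV_shift[of "\<lambda>s. F (x + s *\<^sub>R v)" "dd F (x + s *\<^sub>R v) v" 0 s]
    by (simp add: algebra_simps)
qed

text \<open>Two applications of the mean value theorem, first along v to the difference in the
  direction w, then along w. The left-hand side is symmetric in v and w, which is what forces the
  mixed derivatives to agree.\<close>

lemma second_difference:
  fixes F :: "'e::euclidean_space \<Rightarrow> real"
  assumes F: "smooth_on D F" "openin (top_of_set V) D" "subspace V" and V: "v \<in> V" "w \<in> V"
    and h: "h > 0" and sq: "\<And>s t. s \<in> {0..h} \<Longrightarrow> t \<in> {0..h} \<Longrightarrow> u + s *\<^sub>R v + t *\<^sub>R w \<in> D"
  obtains s t where "s \<in> {0..h}" "t \<in> {0..h}"
    "F (u + h *\<^sub>R v + h *\<^sub>R w) - F (u + h *\<^sub>R v) - F (u + h *\<^sub>R w) + F u =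
      h * h * dd (\<lambda>x. dd F x v) (u + s *\<^sub>R v + t *\<^sub>R w) w"
proof -
  let ?\<phi> = "\<lambda>s. F (u + h *\<^sub>R w + s *\<^sub>R v) - F (u + s *\<^sub>R v)"
  have 1: "(?\<phi> has_real_derivative dd F (u + h *\<^sub>R w + s *\<^sub>R v) v - dd F (u + s *\<^sub>R v) v) (at s)"
    if "0 \<le> s" "s \<le> h" for s
    using sq[of s h] sq[of s 0] that h
    by (intro DERIV_diff line_derivative2[OF F]) (auto simp: V algebra_simps)
  obtain s where s: "0 < s" "s < h" "?\<phi> h - ?\<phi> 0 =
      (h - 0) * (dd F (u + h *\<^sub>R w + s *\<^sub>R v) v - dd F (u + s *\<^sub>R v) v)"
    using MVT2[OF h 1] by blast
  have F': "smooth_on D (\<lambda>x. dd F x v)" by (rule smooth_on_dd[OF F V(1)])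
  let ?\<psi> = "\<lambda>t. dd F (u + s *\<^sub>R v + t *\<^sub>R w) v"
  have 2: "(?\<psi> has_real_derivative dd (\<lambda>x. dd F x v) (u + s *\<^sub>R v + t *\<^sub>R w) w) (at t)"
    if "0 \<le> t" "t \<le> h" for t
    using sq[of s t] that s by (intro line_derivative2[OF F' F(2,3)]) (auto simp: V)
  obtain t where t: "0 < t" "t < h" "?\<psi> h - ?\<psi> 0 =
      (h - 0) * dd (\<lambda>x. dd F x v) (u + s *\<^sub>R v + t *\<^sub>R w) w"
    using MVT2[OF h 2] by blast
  have "F (u + h *\<^sub>R v + h *\<^sub>R w) - F (u + h *\<^sub>R v) - F (u + h *\<^sub>R w) + F u = ?\<phi> h - ?\<phi> 0"
    by (simp add: algebra_simps)
  also have "\<dots> = h * (?\<psi> h - ?\<psi> 0)" using s(3) by (simp add: algebra_simps)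
  also have "\<dots> = h * h * dd (\<lambda>x. dd F x v) (u + s *\<^sub>R v + t *\<^sub>R w) w" using t(3) by simp
  finally show ?thesis using s t that[of s t] by simp
qed

text \<open>If the mixed derivatives differed at u, continuity would keep each of them within half
  of their distance on a small parallelogram. The symmetric second difference equals both of them at
  points of that parallelogram, a contradiction.\<close>

lemma dd_commute_real:
  fixes F :: "'e::euclidean_space \<Rightarrow> real"
  assumes F: "smooth_on D F" "openin (top_of_set V) D" "subspace V" and V: "v \<in> V" "w \<in> V"
    and u: "u \<in> D"
  shows "dd (\<lambda>x. dd F x v) u w = dd (\<lambda>x. dd F x w) u v"
proof (rule ccontr)
  let ?A = "\<lambda>x. dd (\<lambda>x. dd F x v) x w" and ?B = "\<lambda>x. dd (\<lambda>x. dd F x w) x v"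
  assume "?A u \<noteq> ?B u"
  then have e: "dist (?A u) (?B u) / 2 > 0" (is "?e > 0") by simp
  have cont: "continuous_on D ?A" "continuous_on D ?B"
    using F V by (auto intro!: smooth_on_continuous smooth_on_dd)
  have "openin (top_of_set D) (D \<inter> ?A -` ball (?A u) ?e)" "openin (top_of_set D) (D \<inter> ?B -` ball (?B u) ?e)"
    by (intro continuous_openin_preimage_gen cont; simp)+
  then have "openin (top_of_set D) ((D \<inter> ?A -` ball (?A u) ?e) \<inter> (D \<inter> ?B -` ball (?B u) ?e))" (is "openin _ ?D")
    by (rule openin_Int)
  then have "openin (top_of_set V) ?D" using F(2) openin_trans by blast
  then obtain T where T: "open T" "?D = V \<inter> T" by (auto simp: openin_open)
  have "u \<in> T" using T u e by auto
  then obtain d where d: "d > 0" "ball u d \<subseteq> T" using T(1) open_contains_ball by blast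
  \<comment> \<open>The summand 1 keeps m positive when v and w both vanish; with h = d / (2 m) the
    whole parallelogram of side parameter h lies in the ball of radius d.\<close>
  define m where "m = norm v + norm w + 1"
  have m: "m > 0" by (simp add: m_def add_nonneg_pos)
  define h where "h = d / (2 * m)"
  have h: "h > 0" using d m by (simp add: h_def)
  have "h * m < d" using d m by (simp add: h_def)
  have in_D: "u + s *\<^sub>R v + t *\<^sub>R w \<in> ?D" if "s \<in> {0..h}" "t \<in> {0..h}" for s t
  proof -
    have "norm (s *\<^sub>R v + t *\<^sub>R w) \<le> \<bar>s\<bar> * norm v + \<bar>t\<bar> * norm w"
      by (rule norm_triangle_le) simp
    also have "\<dots> \<le> h * norm v + h * norm w"
      using that by (intro add_mono mult_right_mono) auto
    also have "\<dots> \<le> h * m" using h by (simp add: m_def algebra_simps)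
    also have "\<dots> < d" by fact
    finally have "u + (s *\<^sub>R v + t *\<^sub>R w) \<in> ball u d" by (simp add: dist_norm norm_minus_commute add.commute)
    then have "u + s *\<^sub>R v + t *\<^sub>R w \<in> T" using d(2) by (auto simp: add.assoc)
    moreover have "u \<in> V" using openin_imp_subset[OF F(2)] u by auto
    then have "u + s *\<^sub>R v + t *\<^sub>R w \<in> V" using V F(3) by (intro subspace_add subspace_scale)
    ultimately show ?thesis unfolding T(2) by blast
  qed
  obtain s t where st: "s \<in> {0..h}" "t \<in> {0..h}"
    "F (u + h *\<^sub>R v + h *\<^sub>R w) - F (u + h *\<^sub>R v) - F (u + h *\<^sub>R w) + F u =
      h * h * ?A (u + s *\<^sub>R v + t *\<^sub>R w)"
    using second_difference[OF F V h, of u] in_D by blast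
  have in_D': "u + s *\<^sub>R w + t *\<^sub>R v \<in> ?D" if "s \<in> {0..h}" "t \<in> {0..h}" for s t
    using in_D[OF that(2,1)] by (simp add: algebra_simps)
  obtain s' t' where st': "s' \<in> {0..h}" "t' \<in> {0..h}"
    "F (u + h *\<^sub>R w + h *\<^sub>R v) - F (u + h *\<^sub>R w) - F (u + h *\<^sub>R v) + F u =
      h * h * ?B (u + s' *\<^sub>R w + t' *\<^sub>R v)"
    using second_difference[OF F V(2,1) h, of u] in_D' by blast
  have "h * h * ?A (u + s *\<^sub>R v + t *\<^sub>R w) = h * h * ?B (u + s' *\<^sub>R w + t' *\<^sub>R v)"
    using st(3) st'(3) by (simp add: algebra_simps)
  then have "?A (u + s *\<^sub>R v + t *\<^sub>R w) = ?B (u + s' *\<^sub>R w + t' *\<^sub>R v)" using h by simp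
  moreover have "dist (?A u) (?A (u + s *\<^sub>R v + t *\<^sub>R w)) < ?e" using in_D[OF st(1,2)] by simp
  moreover have "dist (?B u) (?B (u + s' *\<^sub>R w + t' *\<^sub>R v)) < ?e" using in_D'[OF st'(1,2)] by simp
  ultimately show False
    using dist_triangle_half_r by (metis dist_commute less_irrefl)
qed

lemma dd_bounded_linear:
  assumes f: "smooth_on D f" "openin (top_of_set V) D" "subspace V" "u \<in> D" "v \<in> V"
    and "bounded_linear g"
  shows "dd (\<lambda>x. g (f x)) u v = g (dd f u v)"
proof -
  have "((\<lambda>t. g (f (u + t *\<^sub>R v))) has_vector_derivative g (dd f u v)) (at 0)"
    using smooth_on_dd_derivative[OF f] assms(6) bounded_linear.has_vector_derivative by blast
  then show ?thesis unfolding dd_def by (simp add: vector_derivative_at)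
qed

lemma dd_cong:
  assumes "\<And>x. x \<in> D \<Longrightarrow> f x = g x" "openin (top_of_set V) D" "subspace V" "u \<in> D" "v \<in> V"
  shows "dd f u v = dd g u v"
  unfolding dd_def
  by (intro vector_derivative_cong_eq eventually_mono[OF line_eventually[OF assms(2-5)]])
     (use assms(1) in auto)

lemma dd_commute:
  fixes F :: "'e::euclidean_space \<Rightarrow> 'b::euclidean_space"
  assumes F: "smooth_on D F" "openin (top_of_set V) D" "subspace V" and V: "v \<in> V" "w \<in> V"
    and u: "u \<in> D"
  shows "dd (\<lambda>x. dd F x v) u w = dd (\<lambda>x. dd F x w) u v"
proof (rule euclidean_eqI)
  fix b :: 'b assume "b \<in> Basis"
  have *: "dd (\<lambda>x. dd F x v) u w \<bullet> b = dd (\<lambda>x. dd (\<lambda>y. F y \<bullet> b) x v) u w" if "v \<in> V" "w \<in> V" for v w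
  proof -
    have "dd (\<lambda>x. dd F x v) u w \<bullet> b = dd (\<lambda>x. dd F x v \<bullet> b) u w"
      using dd_bounded_linear[OF smooth_on_dd[OF F that(1)] F(2,3) u that(2) bounded_linear_inner_left] by simp
    also have "\<dots> = dd (\<lambda>x. dd (\<lambda>y. F y \<bullet> b) x v) u w"
      by (rule dd_cong[OF _ F(2,3) u that(2)])
         (simp add: dd_bounded_linear[OF F _ that(1) bounded_linear_inner_left])
    finally show ?thesis .
  qed
  have "smooth_on D (\<lambda>y. F y \<bullet> b)"
    by (rule smooth_on_bounded_linear[OF bounded_linear_inner_left F(1)])
  then show "dd (\<lambda>x. dd F x v) u w \<bullet> b = dd (\<lambda>x. dd F x w) u v \<bullet> b"
    unfolding *[OF V] *[OF V(2,1)] using dd_commute_real F(2,3) V u by blast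
qed

section \<open>Projective spaces as quotients of cones\<close>

text \<open>Openness and smoothness are defined in charts. The lifts j carry them from Z to the
  charts, and the local maps s, which satisfy \<open>\<sigma> (s y) = \<pi> y\<close>, carry them
  back. From here on homogeneous coordinates replace the affine charts.\<close>

lemma quotient_mfd:
  fixes M :: "('a, 'e::euclidean_space, 'z) mfd_scheme"
  assumes Z: "open Z" and pts: "pts M = \<pi> ` Z"
    and charts: "\<And>D \<sigma>. (D, \<sigma>) \<in> charts M \<Longrightarrow> openin (top_of_set (span D)) D"
    and lift: "\<And>D \<sigma>. (D, \<sigma>) \<in> charts M \<Longrightarrow> \<exists>j. smooth_on D j \<and> j ` D \<subseteq> Z \<and> (\<forall>u\<in>D. \<sigma> u = \<pi> (j u))"
    and sec: "\<And>z. z \<in> Z \<Longrightarrow> \<exists>D \<sigma> Q s. (D, \<sigma>) \<in> charts M \<and> open Q \<and> z \<in> Q \<and> Q \<subseteq> Z \<and>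
      smooth_on Q s \<and> s ` Q \<subseteq> D \<and> (\<forall>y\<in>Q. \<sigma> (s y) = \<pi> y)"
  shows openin_quotient_mfd: "openin (mtop M) U \<longleftrightarrow> U \<subseteq> \<pi> ` Z \<and> open (Z \<inter> \<pi> -` U)"
    and smooth_quotient_mfd: "open (Z \<inter> \<pi> -` U) \<Longrightarrow>
      smooth_fun_on M U (g :: 'a \<Rightarrow> 'b::real_normed_vector) \<longleftrightarrow> smooth_on (Z \<inter> \<pi> -` U) (\<lambda>z. g (\<pi> z))"
proof -
  have open_pre: "openin (top_of_set D) (D \<inter> \<sigma> -` U)" if U: "open (Z \<inter> \<pi> -` U)" and c: "(D, \<sigma>) \<in> charts M" for U D \<sigma>
  proof -
    obtain j where j: "smooth_on D j" "j ` D \<subseteq> Z" "\<forall>u\<in>D. \<sigma> u = \<pi> (j u)" using lift[OF c] by blast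
    have "D \<inter> \<sigma> -` U = D \<inter> j -` (Z \<inter> \<pi> -` U)" using j by auto
    then show ?thesis using continuous_openin_preimage_gen[OF smooth_on_continuous[OF j(1)] U] by simp
  qed
  show "openin (mtop M) U \<longleftrightarrow> U \<subseteq> \<pi> ` Z \<and> open (Z \<inter> \<pi> -` U)"
  proof
    assume U: "openin (mtop M) U"
    have "open (Z \<inter> \<pi> -` U)"
    proof (subst open_subopen, intro ballI)
      fix z assume z: "z \<in> Z \<inter> \<pi> -` U"
      then obtain D \<sigma> Q s where *: "(D, \<sigma>) \<in> charts M" "open Q" "z \<in> Q" "Q \<subseteq> Z"
        "smooth_on Q s" "s ` Q \<subseteq> D" "\<forall>y\<in>Q. \<sigma> (s y) = \<pi> y" using sec by (meson IntD1)
      have "openin (top_of_set D) (D \<inter> \<sigma> -` U)" using U * by (auto simp: openin_mtop)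
      then have "openin (top_of_set Q) (Q \<inter> s -` (D \<inter> \<sigma> -` U))"
        using continuous_openin_preimage[OF smooth_on_continuous[OF *(5)]] *(6) by blast
      then have "open (Q \<inter> s -` (D \<inter> \<sigma> -` U))" using *(2) openin_open_eq by blast
      moreover have "z \<in> Q \<inter> s -` (D \<inter> \<sigma> -` U)" "Q \<inter> s -` (D \<inter> \<sigma> -` U) \<subseteq> Z \<inter> \<pi> -` U"
        using * z by auto
      ultimately show "\<exists>T. open T \<and> z \<in> T \<and> T \<subseteq> Z \<inter> \<pi> -` U" by blast
    qed
    then show "U \<subseteq> \<pi> ` Z \<and> open (Z \<inter> \<pi> -` U)" using U pts by (auto simp: openin_mtop)
  next
    assume "U \<subseteq> \<pi> ` Z \<and> open (Z \<inter> \<pi> -` U)"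
    then show "openin (mtop M) U" using open_pre pts by (auto simp: openin_mtop)
  qed
  assume U: "open (Z \<inter> \<pi> -` U)"
  show "smooth_fun_on M U g \<longleftrightarrow> smooth_on (Z \<inter> \<pi> -` U) (\<lambda>z. g (\<pi> z))"
  proof
    assume g: "smooth_fun_on M U g"
    show "smooth_on (Z \<inter> \<pi> -` U) (\<lambda>z. g (\<pi> z))"
    proof (rule smooth_on_local[of UNIV])
      show "openin (top_of_set UNIV) (Z \<inter> \<pi> -` U)" using U by simp
      fix z assume z: "z \<in> Z \<inter> \<pi> -` U"
      then obtain D \<sigma> Q s where *: "(D, \<sigma>) \<in> charts M" "open Q" "z \<in> Q" "Q \<subseteq> Z"
        "smooth_on Q s" "s ` Q \<subseteq> D" "\<forall>y\<in>Q. \<sigma> (s y) = \<pi> y" using sec by (meson IntD1)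
      let ?W = "Q \<inter> (Z \<inter> \<pi> -` U)"
      have "smooth_on ?W (\<lambda>y. g (\<sigma> (s y)))"
        using g * by (intro smooth_on_compose[of ?W s "D \<inter> \<sigma> -` U" "\<lambda>u. g (\<sigma> u)"])
          (auto simp: smooth_fun_on_def intro: smooth_on_subset)
      then have "smooth_on ?W (\<lambda>y. g (\<pi> y))" by (rule smooth_on_cong) (use * in auto)
      moreover have "openin (top_of_set (Z \<inter> \<pi> -` U)) ?W" using *(2) by (auto simp: openin_open)
      ultimately show "\<exists>W. openin (top_of_set (Z \<inter> \<pi> -` U)) W \<and> z \<in> W \<and> smooth_on W (\<lambda>z. g (\<pi> z))"
        using z * by blast
    qed simp
  next
    assume g: "smooth_on (Z \<inter> \<pi> -` U) (\<lambda>z. g (\<pi> z))"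
    show "smooth_fun_on M U g" unfolding smooth_fun_on_def
    proof (clarify)
      fix D \<sigma> assume c: "(D, \<sigma>) \<in> charts M"
      obtain j where j: "smooth_on D j" "j ` D \<subseteq> Z" "\<forall>u\<in>D. \<sigma> u = \<pi> (j u)" using lift[OF c] by blast
      have "smooth_on (D \<inter> \<sigma> -` U) (\<lambda>u. g (\<pi> (j u)))"
        using j by (intro smooth_on_compose[OF _ g, of _ j]) (auto intro: smooth_on_subset)
      then show "smooth_on (D \<inter> \<sigma> -` U) (\<lambda>u. g (\<sigma> u))" by (rule smooth_on_cong) (use j in auto)
    qed
  qed
qed

section \<open>Hermitian products and the Fubini-Study form in homogeneous coordinates\<close>

lemma herm_add_left: "herm (u + v) w = herm u w + herm v w"
  by (simp add: herm_def algebra_simps sum.distrib)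

lemma herm_add_right: "herm w (u + v) = herm w u + herm w v"
  by (simp add: herm_def algebra_simps sum.distrib)

lemma herm_scale_left: "herm (c *s v) w = c * herm v w"
  by (simp add: herm_def algebra_simps sum_distrib_left)

lemma herm_scale_right: "herm v (c *s w) = cnj c * herm v w"
  by (simp add: herm_def algebra_simps sum_distrib_left)

lemma scaleR_scale: "r *\<^sub>R v = complex_of_real r *s v"
  by (simp add: vec_eq_iff scaleR_conv_of_real[where 'a = complex])

lemma herm_scaleR_left: "herm (r *\<^sub>R v) w = of_real r * herm v w"
  by (simp add: scaleR_scale herm_scale_left)

lemma herm_scaleR_right: "herm v (r *\<^sub>R w) = of_real r * herm v w"
  by (simp add: scaleR_scale herm_scale_right)

lemma cnj_herm: "cnj (herm v w) = herm w v"
  by (simp add: herm_def mult.commute)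

lemma herm_self: "herm z z = of_real ((norm z)\<^sup>2)"
proof -
  have "(norm z)\<^sup>2 = (\<Sum>i\<in>UNIV. (cmod (z $ i))\<^sup>2)"
    by (simp add: norm_vec_def L2_set_def sum_nonneg)
  then show ?thesis
    by (simp add: herm_def complex_norm_square[symmetric])
qed

lemma herm_self_eq_0 [simp]: "herm z z = 0 \<longleftrightarrow> z = 0"
  by (simp add: herm_self)

lemma fs_lifted_add_left: "fs_lifted z (u + v) w = fs_lifted z u w + fs_lifted z v w"
  by (simp only: fs_lifted_def herm_add_left ring_distribs add_divide_distrib diff_divide_distrib minus_complex.sel plus_complex.sel minus_add_distrib)

lemma fs_lifted_add_right: "fs_lifted z w (u + v) = fs_lifted z w u + fs_lifted z w v"
  by (simp only: fs_lifted_def herm_add_right ring_distribs add_divide_distrib diff_divide_distrib minus_complex.sel plus_complex.sel minus_add_distrib)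

lemma fs_lifted_eq:
  "fs_lifted z v w = Im (herm v z * herm z w) / ((norm z)\<^sup>2)\<^sup>2 - Im (herm v w) / (norm z)\<^sup>2"
proof -
  define N where "N = (norm z)\<^sup>2"
  define p q where "p = herm v w" and "q = herm v z * herm z w"
  have "fs_lifted z v w = - Im ((p * of_real N - q) / of_real (N\<^sup>2))"
    unfolding fs_lifted_def herm_self N_def p_def q_def by simp
  also have "\<dots> = - ((Im p * N - Im q) / N\<^sup>2)"
    by (simp only: Im_divide_of_real) simp
  also have "\<dots> = Im q / N\<^sup>2 - Im p / N"
    by (cases "N = 0") (simp_all add: field_simps power2_eq_square)
  finally show ?thesis by (simp only: N_def p_def q_def)
qed

lemma fs_lifted_swap: "fs_lifted z v w = - fs_lifted z w v"
proof -
  have "cnj (herm v z * herm z w) = herm w z * herm z v" by (simp add: cnj_herm)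
  from arg_cong[OF this, of Im]
  have "Im (herm v z * herm z w) = - Im (herm w z * herm z v)" by simp
  moreover have "Im (herm v w) = - Im (herm w v)" using arg_cong[OF cnj_herm[of w v], of Im] by simp
  ultimately show ?thesis by (simp add: fs_lifted_eq del: times_complex.sel)
qed

lemma fs_lifted_scaleR_left: "fs_lifted z (r *\<^sub>R v) w = r * fs_lifted z v w"
proof -
  have "Im (of_real r * a) = r * Im a" for a by simp
  then show ?thesis
    by (simp only: fs_lifted_eq herm_scaleR_left mult.assoc right_diff_distrib times_divide_eq_right)
qed

lemma fs_lifted_vertical: "fs_lifted z (s *s z) w = 0"
  by (simp add: fs_lifted_def herm_scale_left)

lemma fs_lifted_scale:
  assumes "c \<noteq> 0" shows "fs_lifted (c *s z) (c *s v) (c *s w) = fs_lifted z v w"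
proof -
  have "(herm (c *s v) (c *s w) * herm (c *s z) (c *s z) - herm (c *s v) (c *s z) * herm (c *s z) (c *s w))
     / (herm (c *s z) (c *s z))\<^sup>2 = (c * cnj c)\<^sup>2 * (herm v w * herm z z - herm v z * herm z w)
     / ((c * cnj c)\<^sup>2 * (herm z z)\<^sup>2)"
    by (simp add: herm_scale_left herm_scale_right power2_eq_square algebra_simps)
  also have "\<dots> = (herm v w * herm z z - herm v z * herm z w) / (herm z z)\<^sup>2" using assms by simp
  finally show ?thesis by (simp add: fs_lifted_def)
qed

lemma fs_lifted_i: "fs_lifted z v (\<i> *s v) = ((norm v)\<^sup>2 * (norm z)\<^sup>2 - (cmod (herm v z))\<^sup>2) / ((norm z)\<^sup>2)\<^sup>2"
proof -
  have 1: "herm v z * herm z (\<i> *s v) = - \<i> * of_real ((cmod (herm v z))\<^sup>2)"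
    using complex_norm_square[of "herm v z"] by (simp add: herm_scale_right cnj_herm)
  have 2: "herm v (\<i> *s v) = - \<i> * of_real ((norm v)\<^sup>2)"
    by (simp add: herm_scale_right herm_self)
  show ?thesis unfolding fs_lifted_eq 1 2
    by (cases "z = 0") (simp_all add: field_simps power2_eq_square)
qed

text \<open>Pythagoras for the orthogonal projection of v onto the complex line of z. It is the
  Cauchy-Schwarz inequality together with its equality case, hence both the positivity of the
  Fubini-Study metric and the fact that its kernel on the cone is the line of z.\<close>

lemma herm_proj: 
  assumes "z \<noteq> 0"
  shows "(norm v)\<^sup>2 * (norm z)\<^sup>2 - (cmod (herm v z))\<^sup>2 = (norm z)\<^sup>2 * (norm (v - (herm v z / herm z z) *s z))\<^sup>2"
proof -
  define c where "c = herm v z / herm z z"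
  have c: "herm v z = c * herm z z" using assms by (simp add: c_def)
  have d: "v - c *s z = v + (- c) *s z" by (simp add: vec_eq_iff)
  have e: "herm z v = cnj c * herm z z" using c cnj_herm[of v z] cnj_herm[of z z] by simp
  have "herm (v - c *s z) (v - c *s z) = herm v v - c * cnj c * herm z z"
    unfolding d herm_add_left herm_add_right herm_scale_left herm_scale_right c e
    by (simp add: algebra_simps)
  then have "of_real ((norm (v - c *s z))\<^sup>2) = (of_real ((norm v)\<^sup>2 - (cmod c)\<^sup>2 * (norm z)\<^sup>2) :: complex)"
    by (simp only: herm_self complex_norm_square of_real_diff of_real_mult)
  then have "(norm (v - c *s z))\<^sup>2 = (norm v)\<^sup>2 - (cmod c)\<^sup>2 * (norm z)\<^sup>2" by (simp only: of_real_eq_iff)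
  note n = this
  have h: "(cmod (herm v z))\<^sup>2 = (cmod c)\<^sup>2 * ((norm z)\<^sup>2)\<^sup>2"
    unfolding c herm_self norm_mult norm_of_real power_mult_distrib by simp
  show ?thesis unfolding c_def[symmetric] n h by (simp add: algebra_simps power2_eq_square)
qed

lemma fs_lifted_i_nonneg: "fs_lifted z v (\<i> *s v) \<ge> 0"
  by (cases "z = 0") (simp_all add: fs_lifted_i herm_proj)

lemma fs_lifted_i_eq_0:
  assumes "z \<noteq> 0" "fs_lifted z v (\<i> *s v) = 0" obtains s where "v = s *s z"
proof -
  have "v - (herm v z / herm z z) *s z = 0" using assms by (simp add: fs_lifted_i herm_proj)
  then show ?thesis using that[of "herm v z / herm z z"] by simp
qed

lemma cline_scale: "c \<noteq> 0 \<Longrightarrow> cline (c *s z) = cline z"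
proof (intro set_eqI iffI)
  assume c: "c \<noteq> 0"
  show "x \<in> cline z" if "x \<in> cline (c *s z)" for x
    using that by (auto simp: cline_def vector_smult_assoc)
  show "x \<in> cline (c *s z)" if "x \<in> cline z" for x
  proof -
    obtain k where "x = k *s z" using \<open>x \<in> cline z\<close> unfolding cline_def by blast
    then have "x = (k / c) *s (c *s z)" using c by (simp add: vector_smult_assoc)
    then show ?thesis unfolding cline_def by blast
  qed
qed

lemma cline_eqD:
  assumes "cline z = cline z'" "z' \<noteq> 0" obtains c where "c \<noteq> 0" "z' = c *s z"
proof -
  have "z' \<in> cline z'" by (auto simp: cline_def intro: exI[of _ 1])
  then obtain c where c: "z' = c *s z" using assms by (auto simp: cline_def)
  with assms(2) have "c \<noteq> 0" by auto
  with c that show ?thesis by blast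
qed

text \<open>An arbitrary representative. It is only inserted into expressions for which a rescaling
  of the representative does not matter.\<close>

definition rep :: "(complex ^ 'n) set \<Rightarrow> complex ^ 'n" where
  "rep x = (SOME z. z \<noteq> 0 \<and> cline z = x)"

lemma rep_cline: assumes "z \<noteq> 0" obtains c where "c \<noteq> 0" "rep (cline z) = c *s z"
proof -
  have "rep (cline z) \<noteq> 0 \<and> cline (rep (cline z)) = cline z"
    unfolding rep_def by (rule someI[of _ z]) (use assms in auto)
  then obtain c where "c \<noteq> 0" "rep (cline z) = c *s z" using cline_eqD[of z "rep (cline z)"] by metis
  then show ?thesis by (rule that)
qed

text \<open>The a-th coordinate is normalised to 1 and then removed, because the chart domain has
  a-th coordinate 0 and the parametrization adds \<open>axis a 1\<close> again.\<close>

definition aff :: "'n \<Rightarrow> complex ^ 'n \<Rightarrow> complex ^ 'n" where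
  "aff a y = (1 / y $ a) *s y - axis a 1"

lemma aff_in: "y $ a \<noteq> 0 \<Longrightarrow> aff a y $ a = 0"
  by (simp add: aff_def axis_def)

lemma cline_aff: "y $ a \<noteq> 0 \<Longrightarrow> cline (aff a y + axis a 1) = cline y"
  by (simp add: aff_def cline_scale)

lemma smooth_on_aff: "D \<subseteq> {y. y $ a \<noteq> 0} \<Longrightarrow> smooth_on D (aff a)"
proof (rule smooth_on_vec)
  fix i assume "D \<subseteq> {y. y $ a \<noteq> 0}"
  then have "smooth_on D (\<lambda>y. y $ i / y $ a - axis a 1 $ i)"
    by (intro smooth_on_diff smooth_on_divide smooth_on_nth smooth_on_ident smooth_on_const) auto
  then show "smooth_on D (\<lambda>y. aff a y $ i)" by (rule smooth_on_cong) (simp add: aff_def)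
qed

lemma openin_span_subspace: "subspace D \<Longrightarrow> openin (top_of_set (span D)) D"
  by (metis openin_subtopology_self span_eq_iff)

lemma subspace_nth: "subspace {z :: complex ^ 'n. z $ a = 0}"
  by (auto simp: subspace_def)

lemma open_nth: "open {z :: complex ^ 'n. z $ a \<noteq> 0}"
  by (intro open_Collect_neq continuous_intros)

lemma axis_nonzero: "z $ a = 0 \<Longrightarrow> z + axis a 1 \<noteq> (0 :: complex ^ 'n)"
  by (auto simp: vec_eq_iff axis_def)

lemma CP_quotient:
  fixes U :: "(complex ^ 'n) set set"
  shows openin_CP: "openin (mtop CP) U \<longleftrightarrow> U \<subseteq> cline ` (- {0}) \<and> open (- {0} \<inter> cline -` U)"
    and smooth_CP: "open (- {0} \<inter> cline -` U) \<Longrightarrow>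
      smooth_fun_on CP U (g :: _ \<Rightarrow> 'b::real_normed_vector) \<longleftrightarrow> smooth_on (- {0} \<inter> cline -` U) (\<lambda>z. g (cline z))"
proof -
  have 1: "open (- {0 :: complex ^ 'n})" by auto
  have 2: "pts (CP :: (_, complex ^ 'n) smfd) = cline ` (- {0})" by (auto simp: CP_def proj_mfd_def)
  have 3: "openin (top_of_set (span D)) D" if "(D, \<sigma>) \<in> charts (CP :: (_, complex ^ 'n) smfd)" for D \<sigma>
    using that by (auto simp: CP_def proj_mfd_def intro!: openin_span_subspace subspace_nth)
  have 4: "\<exists>j. smooth_on D j \<and> j ` D \<subseteq> - {0} \<and> (\<forall>u\<in>D. \<sigma> u = cline (j u))"
    if c: "(D, \<sigma>) \<in> charts (CP :: (_, complex ^ 'n) smfd)" for D \<sigma>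
  proof -
    obtain a where a: "D = {z. z $ a = 0}" "\<sigma> = (\<lambda>z. cline (z + axis a 1))"
      using c by (auto simp: CP_def proj_mfd_def)
    show ?thesis
      by (rule exI[of _ "\<lambda>z. z + axis a 1"])
         (auto simp: a axis_nonzero intro!: smooth_on_add smooth_on_ident smooth_on_const)
  qed
  have 5: "\<exists>D \<sigma> Q s. (D, \<sigma>) \<in> charts (CP :: (_, complex ^ 'n) smfd) \<and> open Q \<and> z \<in> Q \<and> Q \<subseteq> - {0} \<and>
      smooth_on Q s \<and> s ` Q \<subseteq> D \<and> (\<forall>y\<in>Q. \<sigma> (s y) = cline y)" if z: "z \<in> - {0}" for z
  proof -
    obtain a where "z $ a \<noteq> 0" using z by (auto simp: vec_eq_iff)
    then show ?thesis
      by (intro exI[of _ "{z. z $ a = 0}"] exI[of _ "\<lambda>z. cline (z + axis a 1)"] exI[of _ "{y. y $ a \<noteq> 0}"]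
          exI[of _ "aff a"])
        (auto simp: CP_def proj_mfd_def open_nth smooth_on_aff aff_in cline_aff)
  qed
  show "openin (mtop CP) U \<longleftrightarrow> U \<subseteq> cline ` (- {0}) \<and> open (- {0} \<inter> cline -` U)"
    by (rule openin_quotient_mfd[OF 1 2 3 4 5])
  show "open (- {0} \<inter> cline -` U) \<Longrightarrow>
      smooth_fun_on CP U g \<longleftrightarrow> smooth_on (- {0} \<inter> cline -` U) (\<lambda>z. g (cline z))"
    by (rule smooth_quotient_mfd[OF 1 2 3 4 5])
qed

lemma smooth_near_CP_proj: "smooth_near CP = smooth_near proj_mfd"
  unfolding smooth_near_def smooth_fun_on_def mtop_def by (simp add: CP_def)

lemma proj_vec_scale:
  assumes "c \<noteq> 0" shows "proj_vec (c *s z) (c *s v) = proj_vec z v"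
proof -
  have *: "c *s z + t *\<^sub>R (c *s v) = c *s (z + t *\<^sub>R v)" for t
    by (simp add: vec_eq_iff algebra_simps)
  show ?thesis unfolding proj_vec_def * by (simp only: cline_scale[OF assms])
qed

text \<open>These are the test functions that tell tangent vectors of projective space apart. The
  factor k selects real and imaginary parts of an affine coordinate, since only real-valued
  functions can be tested.\<close>

lemma affine_coordinate_derivative:
  fixes z v :: "complex ^ 'n"
  assumes a: "z $ a \<noteq> 0"
  shows "proj_vec z v (\<lambda>x. Re (k * (rep x $ i / rep x $ a))) =
    Re (k * ((v $ i * z $ a - z $ i * v $ a) / (z $ a)\<^sup>2))"
proof -
  let ?g = "\<lambda>x. Re (k * (rep x $ i / rep x $ a))"
  have g: "?g (cline y) = Re (k * (y $ i / y $ a))" if y: "y \<noteq> 0" for y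
  proof -
    obtain c where c: "c \<noteq> 0" "rep (cline y) = c *s y" using rep_cline[OF y] .
    then show ?thesis by simp
  qed
  have z: "z \<noteq> 0" using a by auto
  let ?U = "cline ` {y. y $ a \<noteq> 0}"
  have pre: "- {0} \<inter> cline -` ?U = {y. y $ a \<noteq> 0}"
  proof (intro set_eqI iffI)
    fix y assume "y \<in> - {0} \<inter> cline -` ?U"
    then obtain y' where "cline y' = cline y" "y' $ a \<noteq> 0" "y \<noteq> 0" by force
    moreover obtain c where "c \<noteq> 0" "y = c *s y'" using cline_eqD[of y' y] calculation by blast
    ultimately show "y \<in> {y. y $ a \<noteq> 0}" by simp
  qed auto
  have "smooth_on {y. y $ a \<noteq> 0} (\<lambda>y. ?g (cline y))"
  proof (rule smooth_on_cong)
    show "smooth_on {y. y $ a \<noteq> 0} (\<lambda>y. Re (k * (y $ i / y $ a)))"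
      by (intro smooth_on_bounded_linear[OF bounded_linear_Re] smooth_on_mult smooth_on_divide
          smooth_on_nth smooth_on_ident smooth_on_const) auto
    show "Re (k * (y $ i / y $ a)) = ?g (cline y)" if "y \<in> {y. y $ a \<noteq> 0}" for y
      using that by (intro g[symmetric]) auto
  qed
  then have "smooth_fun_on CP ?U ?g" using smooth_CP[of ?U ?g] pre open_nth[of a] by simp
  moreover have "openin (mtop CP) ?U" using openin_CP[of ?U] pre open_nth[of a] by auto
  ultimately have "smooth_near CP (cline z) ?g" using a unfolding smooth_near_def by blast
  then have "proj_vec z v ?g = deriv (\<lambda>t. ?g (cline (z + t *\<^sub>R v))) 0"
    by (simp add: proj_vec_def velocity_def smooth_near_CP_proj)
  also have "\<dots> = deriv (\<lambda>t. Re (k * ((z + t *\<^sub>R v) $ i / (z + t *\<^sub>R v) $ a))) 0"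
  proof (intro deriv_cong_ev refl eventually_mono[OF line_eventually[of UNIV "- {0}" z v]])
    show "openin (top_of_set UNIV) (- {0 :: complex ^ 'n})" by auto
  qed (use z g in auto)
  also have "\<dots> = Re (k * ((v $ i * z $ a - z $ i * v $ a) / (z $ a)\<^sup>2))"
  proof (intro DERIV_imp_deriv)
    have "((\<lambda>t. (z $ i + t * v $ i) / (z $ a + t * v $ a)) has_field_derivative
       (v $ i * z $ a - z $ i * v $ a) / (z $ a)\<^sup>2) (at (of_real 0))"
      using a by (auto intro!: derivative_eq_intros simp: power2_eq_square)
    from has_vector_derivative_real_field[OF this]
    have "((\<lambda>t::real. (z + t *\<^sub>R v) $ i / (z + t *\<^sub>R v) $ a) has_vector_derivative
       (v $ i * z $ a - z $ i * v $ a) / (z $ a)\<^sup>2) (at 0)"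
      by (simp add: scaleR_conv_of_real[where 'a = complex])
    then have "((\<lambda>t::real. Re (k * ((z + t *\<^sub>R v) $ i / (z + t *\<^sub>R v) $ a))) has_vector_derivative
       Re (k * ((v $ i * z $ a - z $ i * v $ a) / (z $ a)\<^sup>2))) (at 0)"
      by (intro bounded_linear.has_vector_derivative[OF bounded_linear_Re]
          bounded_linear.has_vector_derivative[OF bounded_linear_mult_right])
    then show "((\<lambda>t::real. Re (k * ((z + t *\<^sub>R v) $ i / (z + t *\<^sub>R v) $ a))) has_real_derivative
       Re (k * ((v $ i * z $ a - z $ i * v $ a) / (z $ a)\<^sup>2))) (at 0)"
      by (simp add: has_real_derivative_iff_has_vector_derivative)
  qed
  finally show ?thesis .
qed

text \<open>The derivatives of the affine coordinates at a nonvanishing coordinate a determine v up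
  to its a-th entry, and this freedom is a multiple of z: the kernel of the differential of z to [z]
  is the line of z.\<close>

lemma proj_vec_eqD:
  fixes z :: "complex ^ 'n"
  assumes z: "z \<noteq> 0" and eq: "proj_vec z v = proj_vec z w" obtains s where "w = v + s *s z"
proof -
  obtain a where a: "z $ a \<noteq> 0" using z by (auto simp: vec_eq_iff)
  have "v $ i * z $ a - z $ i * v $ a = w $ i * z $ a - z $ i * w $ a" for i
  proof -
    have "Re (k * ((v $ i * z $ a - z $ i * v $ a) / (z $ a)\<^sup>2)) =
        Re (k * ((w $ i * z $ a - z $ i * w $ a) / (z $ a)\<^sup>2))" for k
      using affine_coordinate_derivative[OF a, where v = v and k = k and i = i]
      unfolding eq affine_coordinate_derivative[OF a] by (rule sym)
    moreover have "A = B" if "\<And>k. Re (k * A) = Re (k * B)" for A B :: complex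
      using that[of 1] that[of "\<i>"] by (simp add: complex_eq_iff)
    ultimately have
      "(v $ i * z $ a - z $ i * v $ a) / (z $ a)\<^sup>2 = (w $ i * z $ a - z $ i * w $ a) / (z $ a)\<^sup>2"
      by blast
    then show ?thesis using a by simp
  qed
  then have "w = v + ((w $ a - v $ a) / z $ a) *s z"
    using a by (simp add: vec_eq_iff field_simps)
  then show ?thesis using that by blast
qed

lemma fs_lifted_cong:
  assumes z: "z \<noteq> 0" and "proj_vec z v = proj_vec z v'" "proj_vec z w = proj_vec z w'"
  shows "fs_lifted z v w = fs_lifted z v' w'"
proof -
  obtain s where "v' = v + s *s z" using proj_vec_eqD[OF z assms(2)] .
  moreover obtain t where "w' = w + t *s z" using proj_vec_eqD[OF z assms(3)] .
  ultimately
  show ?thesis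
    using fs_lifted_swap[of z _ "t *s z"]
    by (simp add: fs_lifted_add_left fs_lifted_add_right fs_lifted_vertical)
qed

text \<open>The description in \<open>fubini_study\<close> picks out one number because
  \<open>fs_lifted\<close> is invariant under a common rescaling of base point and vectors, and does
  not see multiples of z added to the vectors.\<close>

lemma fubini_study_eq:
  assumes z: "z \<noteq> 0"
  shows "fubini_study (cline z) (proj_vec z v) (proj_vec z w) = fs_lifted z v w"
  unfolding fubini_study_def
proof (rule the_equality)
  fix r assume "\<exists>z' v' w'. z' \<noteq> 0 \<and> cline z = cline z' \<and> proj_vec z v = proj_vec z' v' \<and>
      proj_vec z w = proj_vec z' w' \<and> r = fs_lifted z' v' w'"
  then obtain z' v' w' where *: "z' \<noteq> 0" "cline z = cline z'" "proj_vec z v = proj_vec z' v'"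
      "proj_vec z w = proj_vec z' w'" "r = fs_lifted z' v' w'" by blast
  obtain c where c: "c \<noteq> 0" "z' = c *s z" using cline_eqD[OF *(2,1)] .
  have sc: "c *s ((1 / c) *s x) = x" for x :: "complex ^ 'a" using c(1) by (simp add: vector_smult_assoc)
  have pv: "proj_vec z' x = proj_vec z ((1 / c) *s x)" for x
    using proj_vec_scale[OF c(1), of z "(1 / c) *s x"] by (simp only: sc c(2))
  have "fs_lifted z v w = fs_lifted z ((1 / c) *s v') ((1 / c) *s w')"
    by (rule fs_lifted_cong[OF z]) (simp_all only: *(3,4) pv)
  also have "\<dots> = r"
    using fs_lifted_scale[OF c(1), of z "(1 / c) *s v'" "(1 / c) *s w'"] by (simp only: sc c(2) *(5))
  finally show "r = fs_lifted z v w" by simp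
qed (intro exI[of _ z] exI[of _ v] exI[of _ w] conjI z refl)

section \<open>The cone over the product of two projective planes\<close>

type_synonym hvec = "(complex ^ 3) \<times> (complex ^ 3)"
type_synonym ppoint = "(complex ^ 3) set \<times> (complex ^ 3) set"

definition hcone :: "hvec set" where
  "hcone = {z. fst z \<noteq> 0 \<and> snd z \<noteq> 0}"

definition pr :: "hvec \<Rightarrow> ppoint" where
  "pr z = (cline (fst z), cline (snd z))"

definition scal :: "complex \<Rightarrow> complex \<Rightarrow> hvec \<Rightarrow> hvec" where
  "scal c d z = (c *s fst z, d *s snd z)"

abbreviation PP :: "(ppoint, hvec) smfd" where
  "PP \<equiv> prod_smfd CP CP"

lemma scal_simps [simp]: "fst (scal c d z) = c *s fst z" "snd (scal c d z) = d *s snd z"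
  by (simp_all add: scal_def)

lemma scal_scal: "scal a b (scal c d z) = scal (a * c) (b * d) z"
  by (simp add: scal_def vector_smult_assoc)

lemma scal_1 [simp]: "scal 1 1 z = z"
  by (simp add: scal_def)

lemma scal_add: "scal c d (v + w) = scal c d v + scal c d w"
  by (simp add: scal_def prod_eq_iff vector_add_ldistrib)

lemma scal_scaleR: "scal c d (r *\<^sub>R v) = r *\<^sub>R scal c d v"
  by (simp add: scal_def prod_eq_iff vec_eq_iff)

lemma scal_scalar_add: "scal a b z + scal c d z = scal (a + c) (b + d) z"
  by (simp add: scal_def prod_eq_iff vec_eq_iff algebra_simps)

lemma linear_scal: "linear (scal c d)"
  by (intro linearI scal_add scal_scaleR)

lemma scaleR_scal: "r *\<^sub>R z = scal (of_real r) (of_real r) z"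
  by (simp add: prod_eq_iff scaleR_scale)

lemma scal_hcone: "z \<in> hcone \<Longrightarrow> c \<noteq> 0 \<Longrightarrow> d \<noteq> 0 \<Longrightarrow> scal c d z \<in> hcone"
  by (simp add: hcone_def vector_mul_eq_0)

lemma scal_hcone_iff: "c \<noteq> 0 \<Longrightarrow> d \<noteq> 0 \<Longrightarrow> scal c d z \<in> hcone \<longleftrightarrow> z \<in> hcone"
  by (simp add: hcone_def vector_mul_eq_0)

lemma pr_scal: "c \<noteq> 0 \<Longrightarrow> d \<noteq> 0 \<Longrightarrow> pr (scal c d z) = pr z"
  by (simp add: pr_def cline_scale)

lemma pr_eqD:
  assumes "pr z = pr z'" "z' \<in> hcone" obtains c d where "c \<noteq> 0" "d \<noteq> 0" "z' = scal c d z"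
proof -
  obtain c where c: "c \<noteq> 0" "fst z' = c *s fst z"
    using cline_eqD[of "fst z" "fst z'"] assms by (auto simp: pr_def hcone_def)
  obtain d where "d \<noteq> 0" "snd z' = d *s snd z"
    using cline_eqD[of "snd z" "snd z'"] assms by (auto simp: pr_def hcone_def)
  with c that show ?thesis by (simp add: scal_def prod_eq_iff)
qed

lemma open_hcone: "open hcone"
proof -
  have "hcone = (- {0}) \<times> (- {0})" by (auto simp: hcone_def)
  moreover have "open ((- {0 :: complex ^ 3}) \<times> (- {0 :: complex ^ 3}))" by (intro open_Times) auto
  ultimately show ?thesis by (simp only:)
qed

lemma PP_quotient:
  shows openin_PP: "openin (mtop PP) U \<longleftrightarrow> U \<subseteq> pr ` hcone \<and> open (hcone \<inter> pr -` U)"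
    and smooth_PP: "open (hcone \<inter> pr -` U) \<Longrightarrow>
      smooth_fun_on PP U (g :: _ \<Rightarrow> 'b::real_normed_vector) \<longleftrightarrow> smooth_on (hcone \<inter> pr -` U) (\<lambda>z. g (pr z))"
proof -
  have charts: "charts PP = {({z. z $ a = 0} \<times> {z. z $ b = 0},
      map_prod (\<lambda>z. cline (z + axis a 1)) (\<lambda>z. cline (z + axis b 1))) | a b. True}"
    by (auto simp: prod_smfd_def CP_def proj_mfd_def) blast
  have 2: "pts PP = pr ` hcone"
  proof (intro set_eqI iffI)
    fix x assume "x \<in> pts PP"
    then obtain y z where "x = pr (y, z)" "y \<noteq> 0" "z \<noteq> 0"
      by (auto simp: prod_smfd_def CP_def proj_mfd_def pr_def)
    then show "x \<in> pr ` hcone" by (auto simp: hcone_def)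
  qed (auto simp: prod_smfd_def CP_def proj_mfd_def pr_def hcone_def)
  have 3: "openin (top_of_set (span D)) D" if "(D, \<sigma>) \<in> charts PP" for D \<sigma>
  proof -
    obtain a b where "D = {z. z $ a = 0} \<times> {z. z $ b = 0}" using \<open>(D, \<sigma>) \<in> charts PP\<close> charts by auto
    then show ?thesis by (simp add: openin_span_subspace subspace_nth subspace_Times)
  qed
  have 4: "\<exists>j. smooth_on D j \<and> j ` D \<subseteq> hcone \<and> (\<forall>u\<in>D. \<sigma> u = pr (j u))"
    if c: "(D, \<sigma>) \<in> charts PP" for D \<sigma>
  proof -
    obtain a b where a: "D = {z. z $ a = 0} \<times> {z. z $ b = 0}"
      "\<sigma> = map_prod (\<lambda>z. cline (z + axis a 1)) (\<lambda>z. cline (z + axis b 1))" using c charts by auto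
    show ?thesis
      by (rule exI[of _ "\<lambda>z. z + (axis a 1, axis b 1)"])
         (auto simp: a hcone_def pr_def axis_nonzero intro!: smooth_on_add smooth_on_ident smooth_on_const)
  qed
  have 5: "\<exists>D \<sigma> Q s. (D, \<sigma>) \<in> charts PP \<and> open Q \<and> z \<in> Q \<and> Q \<subseteq> hcone \<and>
      smooth_on Q s \<and> s ` Q \<subseteq> D \<and> (\<forall>y\<in>Q. \<sigma> (s y) = pr y)" if z: "z \<in> hcone" for z
  proof -
    obtain a b where ab: "fst z $ a \<noteq> 0" "snd z $ b \<noteq> 0" using z by (auto simp: hcone_def vec_eq_iff)
    let ?Q = "{y. y $ a \<noteq> 0} \<times> {y. y $ b \<noteq> 0} :: hvec set"
    have "smooth_on ?Q (\<lambda>z. aff a (fst z))" "smooth_on ?Q (\<lambda>z. aff b (snd z))"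
      using smooth_on_aff[OF order_refl, of a] smooth_on_aff[OF order_refl, of b]
      by (auto intro!: smooth_on_compose[of _ fst _ "aff a"] smooth_on_compose[of _ snd _ "aff b"]
          smooth_on_fst smooth_on_snd smooth_on_ident)
    then have "smooth_on ?Q (\<lambda>z. (aff a (fst z), aff b (snd z)))" by (rule smooth_on_Pair)
    then show ?thesis
      using ab
      by (intro exI[of _ "{z. z $ a = 0} \<times> {z. z $ b = 0}"]
          exI[of _ "map_prod (\<lambda>z. cline (z + axis a 1)) (\<lambda>z. cline (z + axis b 1))"]
          exI[of _ ?Q] exI[of _ "\<lambda>z. (aff a (fst z), aff b (snd z))"])
        (auto simp: charts open_nth open_Times aff_in cline_aff pr_def hcone_def mem_Times_iff)
  qed
  show "openin (mtop PP) U \<longleftrightarrow> U \<subseteq> pr ` hcone \<and> open (hcone \<inter> pr -` U)"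
    by (rule openin_quotient_mfd[OF open_hcone 2 3 4 5])
  show "open (hcone \<inter> pr -` U) \<Longrightarrow>
      smooth_fun_on PP U g \<longleftrightarrow> smooth_on (hcone \<inter> pr -` U) (\<lambda>z. g (pr z))"
    by (rule smooth_quotient_mfd[OF open_hcone 2 3 4 5])
qed

lemma pts_PP: "pts PP = pr ` hcone"
proof -
  have "cline y \<in> pts CP" if "y \<noteq> 0" for y :: "complex ^ 3" using that by (auto simp: CP_def proj_mfd_def)
  then show ?thesis
    by (force simp: prod_smfd_def CP_def proj_mfd_def pr_def hcone_def image_iff)
qed

text \<open>On the cone, the fibres of \<open>pr\<close> are exactly the orbits of the scalings, so
  a set stable under them is the full preimage of its image.\<close>

lemma saturated_preimage:
  assumes "Q \<subseteq> hcone" "\<And>z c d. z \<in> Q \<Longrightarrow> c \<noteq> 0 \<Longrightarrow> d \<noteq> 0 \<Longrightarrow> scal c d z \<in> Q"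
  shows "hcone \<inter> pr -` (pr ` Q) = Q"
proof (intro set_eqI iffI)
  fix y assume "y \<in> hcone \<inter> pr -` (pr ` Q)"
  then obtain z where z: "z \<in> Q" "pr z = pr y" "y \<in> hcone" by auto
  then obtain c d where "c \<noteq> 0" "d \<noteq> 0" "y = scal c d z" using pr_eqD by metis
  then show "y \<in> Q" using assms(2)[OF z(1)] by simp
qed (use assms in auto)

lemma openin_PP_saturated:
  assumes "open Q" "Q \<subseteq> hcone" "\<And>z c d. z \<in> Q \<Longrightarrow> c \<noteq> 0 \<Longrightarrow> d \<noteq> 0 \<Longrightarrow> scal c d z \<in> Q"
  shows "openin (mtop PP) (pr ` Q)"
  using assms saturated_preimage[OF assms(2,3)] by (auto simp: openin_PP)

lemma topspace_PP: "topspace (mtop PP) = pr ` hcone"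
proof -
  have "openin (mtop PP) (pr ` hcone)" by (rule openin_PP_saturated[OF open_hcone]) (auto intro: scal_hcone)
  moreover have "topspace (mtop PP) \<subseteq> pr ` hcone" using openin_PP openin_topspace by blast
  ultimately show ?thesis using openin_subset by blast
qed

lemma continuous_map_pr: "continuous_map (top_of_set hcone) (mtop PP) pr"
  unfolding continuous_map_def topspace_PP
  by (auto simp: openin_PP openin_open_eq[OF open_hcone] Int_def vimage_def)

lemma second_countable_PP: "second_countable (mtop PP)"
proof (rule second_countable_open_map_image[of "top_of_set hcone" _ pr])
  show "open_map (top_of_set hcone) (mtop PP) pr" unfolding open_map_def
  proof (intro allI impI)
    fix Q assume "openin (top_of_set hcone) Q"
    then have Q: "open Q" "Q \<subseteq> hcone" using openin_open_eq[OF open_hcone] by auto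
    \<comment> \<open>The saturation of Q under the scalings is a union of preimages of Q under
      linear maps, hence open, and has the same image as Q. So \<open>pr\<close> is an open map, and
      second countability passes from the cone to its image.\<close>
    let ?Q' = "\<Union>c\<in>-{0}. \<Union>d\<in>-{0}. scal c d -` Q"
    have "open (scal c d -` Q)" for c d
      by (intro open_vimage Q(1) linear_continuous_on linear_conv_bounded_linear[THEN iffD1] linear_scal)
    then have "open ?Q'" by blast
    moreover have "?Q' \<subseteq> hcone" using Q(2) scal_hcone_iff by fastforce
    moreover have "scal c d z \<in> ?Q'" if "z \<in> ?Q'" "c \<noteq> 0" "d \<noteq> 0" for z c d
    proof -
      obtain a b where "a \<noteq> 0" "b \<noteq> 0" "scal a b z \<in> Q" using \<open>z \<in> ?Q'\<close> by auto
      then have "scal (a / c) (b / d) (scal c d z) \<in> Q" "a / c \<noteq> 0" "b / d \<noteq> 0"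
        using \<open>c \<noteq> 0\<close> \<open>d \<noteq> 0\<close> by (simp_all add: scal_scal)
      then show ?thesis by blast
    qed
    ultimately have "openin (mtop PP) (pr ` ?Q')" by (rule openin_PP_saturated)
    moreover have "pr ` ?Q' = pr ` Q"
    proof (intro set_eqI iffI)
      fix x assume "x \<in> pr ` ?Q'"
      then obtain z c d where "c \<noteq> 0" "d \<noteq> 0" "scal c d z \<in> Q" "x = pr z" by blast
      then show "x \<in> pr ` Q" using pr_scal by (metis imageI)
    next
      fix x assume "x \<in> pr ` Q"
      then obtain z where z: "z \<in> Q" "x = pr z" by auto
      then have "scal 1 1 z \<in> Q" by simp
      then show "x \<in> pr ` ?Q'" using z by (intro image_eqI[of _ _ z]) (auto intro!: bexI[of _ 1])
    qed
    ultimately show "openin (mtop PP) (pr ` Q)" by simp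
  qed
  show "second_countable (top_of_set hcone)"
  proof (intro second_countable_subtopology)
    obtain \<B> :: "hvec set set" where B: "countable \<B>" "\<And>C. C \<in> \<B> \<Longrightarrow> open C"
      "\<And>S. open S \<Longrightarrow> \<exists>U. U \<subseteq> \<B> \<and> S = \<Union>U"
      using univ_second_countable by blast
    show "second_countable (euclidean :: hvec topology)"
      unfolding second_countable_def
    proof (intro exI[of _ \<B>] conjI allI impI ballI)
      fix U :: "hvec set" and x assume *: "openin euclidean U \<and> x \<in> U"
      then obtain \<U> where "\<U> \<subseteq> \<B>" "U = \<Union>\<U>" using B(3)[of U] by auto
      then show "\<exists>V\<in>\<B>. x \<in> V \<and> V \<subseteq> U" using * by blast
    qed (use B in auto)
  qed
qed (simp_all add: continuous_map_pr topspace_PP)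

lemma Hausdorff_PP: "Hausdorff_space (mtop PP)"
  unfolding Hausdorff_space_def topspace_PP
proof (intro allI impI)
  fix x y assume xy: "x \<in> pr ` hcone \<and> y \<in> pr ` hcone \<and> x \<noteq> y"
  have sep: "\<exists>U V. openin (mtop PP) U \<and> openin (mtop PP) V \<and> pr z \<in> U \<and> pr z' \<in> V \<and> disjnt U V"
    if z: "z \<in> hcone" "z' \<in> hcone" and ne: "cline (p z) \<noteq> cline (p z')" and p: "p = fst \<or> p = snd" for p z z'
  proof -
    have nz: "p y \<noteq> 0" if "y \<in> hcone" for y using that p by (auto simp: hcone_def)
    \<comment> \<open>The squared cosine of the angle between the lines of p y and p z, where p is
      one of the two factors. It depends only on the point below and equals 1 only on the line of p
      z, so its level sets separate the two points.\<close>
    define q where "q y = (cmod (herm (p y) (p z)))\<^sup>2 / ((norm (p y))\<^sup>2 * (norm (p z))\<^sup>2)" for y :: hvec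
    have qz: "q z = 1" using nz[OF z(1)] unfolding q_def herm_self norm_of_real by (simp add: power2_eq_square)
    have "(cmod (herm (p z') (p z)))\<^sup>2 \<noteq> (norm (p z'))\<^sup>2 * (norm (p z))\<^sup>2"
    proof
      assume "(cmod (herm (p z') (p z)))\<^sup>2 = (norm (p z'))\<^sup>2 * (norm (p z))\<^sup>2"
      then have "p z' - (herm (p z') (p z) / herm (p z) (p z)) *s p z = 0"
        using herm_proj[OF nz[OF z(1)], of "p z'"] nz[OF z(1)] by simp
      then obtain c where c: "p z' = c *s p z" by auto
      with nz[OF z(2)] have "c \<noteq> 0" by auto
      then show False using c ne by (simp add: cline_scale)
    qed
    moreover have "(cmod (herm (p z') (p z)))\<^sup>2 \<le> (norm (p z'))\<^sup>2 * (norm (p z))\<^sup>2"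
      using herm_proj[OF nz[OF z(1)], of "p z'"] by (smt (verit) mult_nonneg_nonneg zero_le_power2)
    ultimately have "q z' < 1" using nz z by (simp add: q_def divide_less_eq)
    then obtain m where m: "q z' < m" "m < 1" using dense by blast
    have pc: "\<exists>e\<noteq>0. p (scal c d y) = e *s p y" if "c \<noteq> 0" "d \<noteq> 0" for c d y
      using p that by auto
    have q_scal: "q (scal c d y) = q y" if cd: "c \<noteq> 0" "d \<noteq> 0" for c d y
    proof -
      obtain e where e: "e \<noteq> 0" "p (scal c d y) = e *s p y" using pc[OF cd] by blast
      have "(norm (e *s p y))\<^sup>2 = (cmod e)\<^sup>2 * (norm (p y))\<^sup>2"
      proof -
        have "of_real ((norm (e *s p y))\<^sup>2) = (of_real ((cmod e)\<^sup>2 * (norm (p y))\<^sup>2) :: complex)"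
          by (simp only: herm_self[symmetric] of_real_mult complex_norm_square herm_scale_left herm_scale_right)
             (simp add: algebra_simps)
        then show ?thesis by (simp only: of_real_eq_iff)
      qed
      then show ?thesis using e
        by (simp add: q_def herm_scale_left norm_mult power_mult_distrib)
    qed
    have "continuous_on hcone (\<lambda>y. herm (p y) (p z))"
      using p unfolding herm_def by (auto intro!: continuous_intros)
    moreover have "continuous_on hcone p" using p by (auto intro!: continuous_intros)
    ultimately have cont: "continuous_on hcone q"
      unfolding q_def using nz[OF z(1)] nz by (intro continuous_intros) auto
    have "openin (top_of_set hcone) (hcone \<inter> q -` {m<..})" "openin (top_of_set hcone) (hcone \<inter> q -` {..<m})"
      using cont by (auto intro!: continuous_openin_preimage_gen)
    then have "open (hcone \<inter> q -` {m<..})" "open (hcone \<inter> q -` {..<m})"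
      using openin_open_eq[OF open_hcone] by auto
    then have o: "openin (mtop PP) (pr ` (hcone \<inter> q -` {m<..}))" "openin (mtop PP) (pr ` (hcone \<inter> q -` {..<m}))"
      by (intro openin_PP_saturated; auto simp: q_scal scal_hcone)+
    have "disjnt (pr ` (hcone \<inter> q -` {m<..})) (pr ` (hcone \<inter> q -` {..<m}))"
    proof -
      have "False" if "pr a = pr b" "a \<in> hcone" "b \<in> hcone" "m < q a" "q b < m" for a b
      proof -
        obtain c d where "c \<noteq> 0" "d \<noteq> 0" "b = scal c d a" using pr_eqD[OF \<open>pr a = pr b\<close> \<open>b \<in> hcone\<close>] .
        then show False using that q_scal by simp
      qed
      then show ?thesis unfolding disjnt_iff by force
    qed
    with o show ?thesis using z m qz by blast
  qed
  obtain z z' where zz: "z \<in> hcone" "z' \<in> hcone" "x = pr z" "y = pr z'" using xy by auto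
  then have "cline (fst z) \<noteq> cline (fst z') \<or> cline (snd z) \<noteq> cline (snd z')" using xy by (auto simp: pr_def)
  then show "\<exists>U V. openin (mtop PP) U \<and> openin (mtop PP) V \<and> x \<in> U \<and> y \<in> V \<and> disjnt U V"
    using sep[of z z' fst] sep[of z z' snd] zz by auto
qed

section \<open>Complex structure, form and tangent vectors on the cone\<close>

definition mult_i :: "hvec \<Rightarrow> hvec" where "mult_i = scal \<i> \<i>"

definition omega :: "hvec \<Rightarrow> hvec \<Rightarrow> hvec \<Rightarrow> real" where
  "omega z v w = fs_lifted (fst z) (fst v) (fst w) + fs_lifted (snd z) (snd v) (snd w)"

definition Pvec :: "hvec \<Rightarrow> hvec \<Rightarrow> ppoint tvec" where
  "Pvec z w = velocity PP (\<lambda>t. pr (z + t *\<^sub>R w))"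

lemma omega_swap: "omega z v w = - omega z w v"
  using fs_lifted_swap[of "fst z" "fst v" "fst w"] fs_lifted_swap[of "snd z" "snd v" "snd w"]
  by (simp add: omega_def)

lemma omega_add_left: "omega z (u + v) w = omega z u w + omega z v w"
  by (simp add: omega_def fs_lifted_add_left)

lemma omega_scaleR_left: "omega z (r *\<^sub>R v) w = r * omega z v w"
  by (simp add: omega_def fs_lifted_scaleR_left algebra_simps)

lemma omega_add_right: "omega z w (u + v) = omega z w u + omega z w v"
  using omega_add_left[of z u v w] by (simp add: omega_swap[of z w])

lemma omega_scaleR_right: "omega z v (r *\<^sub>R w) = r * omega z v w"
  using omega_scaleR_left[of z r w v] by (simp add: omega_swap[of z v])

lemma omega_vertical_left: "omega z (scal a b z) w = 0"
  by (simp add: omega_def fs_lifted_vertical)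

lemma omega_vertical_right: "omega z w (scal a b z) = 0"
  using omega_vertical_left[of z a b w] by (simp add: omega_swap[of z w])

lemma omega_self: "omega z v v = 0"
  using omega_swap[of z v v] by simp

lemma fs_lifted_i_left: "fs_lifted z (\<i> *s v) w = - fs_lifted z v (\<i> *s w)"
proof -
  have "(herm (\<i> *s v) w * herm z z - herm (\<i> *s v) z * herm z w) / (herm z z)\<^sup>2 =
    - ((herm v (\<i> *s w) * herm z z - herm v z * herm z (\<i> *s w)) / (herm z z)\<^sup>2)"
    unfolding herm_scale_left herm_scale_right minus_divide_left by (simp add: algebra_simps)
  then show ?thesis unfolding fs_lifted_def by simp
qed

lemma omega_J_left: "omega z (mult_i v) w = - omega z v (mult_i w)"
  by (simp add: omega_def mult_i_def fs_lifted_i_left)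

lemma omega_J_nonneg: "omega z v (mult_i v) \<ge> 0"
  by (simp add: omega_def mult_i_def fs_lifted_i_nonneg)

lemma omega_J_eq_0:
  assumes "z \<in> hcone" "omega z v (mult_i v) = 0" obtains a b where "v = scal a b z"
proof -
  have "fs_lifted (fst z) (fst v) (\<i> *s fst v) \<ge> 0" "fs_lifted (snd z) (snd v) (\<i> *s snd v) \<ge> 0"
    by (rule fs_lifted_i_nonneg)+
  then have "fs_lifted (fst z) (fst v) (\<i> *s fst v) = 0" "fs_lifted (snd z) (snd v) (\<i> *s snd v) = 0"
    using assms(2) by (simp_all add: omega_def mult_i_def)
  then obtain a b where "fst v = a *s fst z" "snd v = b *s snd z"
    using assms(1) fs_lifted_i_eq_0 unfolding hcone_def by (metis (mono_tags, lifting) mem_Collect_eq)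
  then have "v = scal a b z" by (simp add: prod_eq_iff)
  then show ?thesis by (rule that)
qed

lemma mult_i_mult_i: "mult_i (mult_i v) = - v"
  by (simp add: mult_i_def scal_scal) (simp add: scal_def prod_eq_iff vec_eq_iff)

lemma PP_nearE:
  assumes "smooth_near PP x g"
  obtains V where "openin (mtop PP) V" "x \<in> V" "open (hcone \<inter> pr -` V)" "smooth_fun_on PP V g"
    "smooth_on (hcone \<inter> pr -` V) (\<lambda>y. g (pr y))"
  using assms smooth_PP openin_PP unfolding smooth_near_def by metis

lemma PP_deriv:
  assumes z: "z \<in> hcone" and g: "smooth_near PP (pr z) g"
  obtains F where "((\<lambda>y. g (pr y)) has_derivative F) (at z)" "\<And>w. Pvec z w g = F w"
proof -
  obtain V where V: "pr z \<in> V" "open (hcone \<inter> pr -` V)" "smooth_on (hcone \<inter> pr -` V) (\<lambda>y. g (pr y))"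
    using PP_nearE[OF g] .
  then obtain F where F: "((\<lambda>y. g (pr y)) has_derivative F) (at z within hcone \<inter> pr -` V)"
    using smooth_on_has_derivative[OF V(3), of z] z by blast
  have "deriv (\<lambda>t. g (pr (z + t *\<^sub>R w))) 0 = F w" for w
    using dd_real[OF V(3), of UNIV z w] dd_eq[of UNIV "hcone \<inter> pr -` V" z w _ F] V z F by simp
  then have "Pvec z w g = F w" for w using g by (simp add: Pvec_def velocity_def)
  moreover have "((\<lambda>y. g (pr y)) has_derivative F) (at z)"
    using F at_within_open[of z "hcone \<inter> pr -` V"] V z by simp
  ultimately show ?thesis using that by blast
qed

lemma Pvec_not_near: "\<not> smooth_near PP (pr z) g \<Longrightarrow> Pvec z w g = 0"
  by (simp add: Pvec_def velocity_def)

lemma Pvec_linear: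
  assumes z: "z \<in> hcone"
  shows "Pvec z (a *\<^sub>R v + b *\<^sub>R w) g = a * Pvec z v g + b * Pvec z w g"
proof (cases "smooth_near PP (pr z) g")
  case True
  obtain F where F: "((\<lambda>y. g (pr y)) has_derivative F) (at z)" "\<And>w. Pvec z w g = F w"
    using PP_deriv[OF z True] by blast
  then interpret linear F using has_derivative_linear by blast
  show ?thesis unfolding F(2) by (simp add: add scale)
qed (simp add: Pvec_not_near)

lemma Pvec_curve:
  assumes c: "(c has_vector_derivative w) (at t)" "c t \<in> hcone" and g: "smooth_near PP (pr (c t)) g"
  shows "((\<lambda>t. g (pr (c t))) has_real_derivative Pvec (c t) w g) (at t)"
proof -
  obtain F where F: "((\<lambda>y. g (pr y)) has_derivative F) (at (c t))" "\<And>w. Pvec (c t) w g = F w"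
    using PP_deriv[OF c(2) g] by blast
  have "((\<lambda>t. g (pr (c t))) has_derivative (\<lambda>s. F (s *\<^sub>R w))) (at t)"
    using has_derivative_compose[OF c(1)[unfolded has_vector_derivative_def] F(1)] .
  then show ?thesis
    using F linear_scale[OF has_derivative_linear[OF F(1)]]
    by (simp add: has_real_derivative_iff_has_vector_derivative has_vector_derivative_def)
qed

lemma Pvec_scal: "c \<noteq> 0 \<Longrightarrow> d \<noteq> 0 \<Longrightarrow> Pvec (scal c d z) (scal c d w) = Pvec z w"
  unfolding Pvec_def by (simp add: scal_scaleR[symmetric] scal_add[symmetric] pr_scal)

lemma scal_has_vector_derivative:
  assumes "(a has_vector_derivative a') (at t)" "(b has_vector_derivative b') (at t)"
    "(c has_vector_derivative c') (at t)"
  shows "((\<lambda>t. scal (a t) (b t) (c t)) has_vector_derivative scal a' b' (c t) + scal (a t) (b t) c') (at t)"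
proof -
  have b: "bounded_bilinear (\<lambda>a v. a *s (v :: complex ^ 3))"
  proof
    show "\<exists>K. \<forall>a b. norm (a *s (b :: complex ^ 3)) \<le> norm a * norm b * K"
    proof (intro exI allI)
      fix a and b :: "complex ^ 3"
      have "of_real ((norm (a *s b))\<^sup>2) = (of_real ((cmod a * norm b)\<^sup>2) :: complex)"
        unfolding herm_self[symmetric] herm_scale_left herm_scale_right power_mult_distrib of_real_mult
          complex_norm_square by (simp add: algebra_simps)
      then have "(norm (a *s b))\<^sup>2 = (cmod a * norm b)\<^sup>2" by (simp only: of_real_eq_iff)
      then show "norm (a *s b) \<le> norm a * norm b * 1"
        using power2_eq_imp_eq[OF _ norm_ge_zero mult_nonneg_nonneg[OF norm_ge_zero norm_ge_zero]] by simp
    qed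
  qed (auto simp: vec_eq_iff algebra_simps)
  have f: "((\<lambda>t. fst (c t)) has_vector_derivative fst c') (at t)"
    "((\<lambda>t. snd (c t)) has_vector_derivative snd c') (at t)"
    using bounded_linear.has_vector_derivative[OF bounded_linear_fst assms(3)]
      bounded_linear.has_vector_derivative[OF bounded_linear_snd assms(3)] by auto
  have "((\<lambda>t. (a t *s fst (c t), b t *s snd (c t))) has_vector_derivative
     (a t *s fst c' + a' *s fst (c t), b t *s snd c' + b' *s snd (c t))) (at t)"
    by (intro has_vector_derivative_Pair bounded_bilinear.has_vector_derivative[OF b] assms f)
  then show ?thesis
    by (simp add: scal_def[abs_def] add.commute)
qed

lemma exp_curve: "((\<lambda>t. exp (of_real t * a)) has_vector_derivative a) (at 0)" for a :: complex
proof -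
  have "((\<lambda>t. exp (t * a)) has_field_derivative a) (at (of_real 0))"
    by (auto intro!: derivative_eq_intros)
  from has_vector_derivative_real_field[OF this] show ?thesis by simp
qed

text \<open>Multiplying z by exponentials gives a curve with velocity \<open>scal a b z\<close> that
  stays over one point, so no function pulled back along \<open>pr\<close> changes on it.\<close>

lemma Pvec_vertical:
  assumes z: "z \<in> hcone" shows "Pvec z (scal a b z) g = 0"
proof (cases "smooth_near PP (pr z) g")
  case True
  let ?c = "\<lambda>t. scal (exp (of_real t * a)) (exp (of_real t * b)) z"
  have "(?c has_vector_derivative scal a b z) (at 0)"
    using scal_has_vector_derivative[OF exp_curve[of a] exp_curve[of b] has_vector_derivative_const, of z]
    by (simp add: scal_def)
  then have "((\<lambda>t. g (pr (?c t))) has_real_derivative Pvec z (scal a b z) g) (at 0)"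
    using Pvec_curve[of ?c "scal a b z" 0 g] z True by simp
  moreover have "((\<lambda>t. g (pr (?c t))) has_real_derivative 0) (at 0)"
    by (simp add: pr_scal)
  ultimately show ?thesis using DERIV_unique by blast
qed (simp add: Pvec_not_near)

text \<open>A velocity has the default value 0 on functions that are not smooth near the point.
  Pull-backs from a factor are smooth on the product, so pushing a velocity forward to the factor
  never meets this default.\<close>

lemma smooth_near_PP_fst:
  assumes "smooth_near CP x g" "y \<in> pts CP" shows "smooth_near PP (x, y) (\<lambda>p. g (fst p))"
proof -
  obtain U where U: "openin (mtop CP) U" "x \<in> U" "smooth_fun_on CP U g"
    using assms(1) unfolding smooth_near_def by blast
  then have oU: "open (- {0} \<inter> cline -` U)" "U \<subseteq> cline ` (- {0})" using openin_CP by auto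
  let ?V = "U \<times> pts CP :: ppoint set"
  have pts: "pts CP = cline ` (- {0 :: complex ^ 3})" by (auto simp: CP_def proj_mfd_def)
  have pre: "hcone \<inter> pr -` ?V = (- {0} \<inter> cline -` U) \<times> (- {0})"
    by (auto simp: hcone_def pr_def pts)
  have op: "open (hcone \<inter> pr -` ?V)" unfolding pre by (intro open_Times oU) auto
  have "?V \<subseteq> pr ` hcone" using oU(2) by (force simp: pts hcone_def pr_def image_iff)
  then have "openin (mtop PP) ?V" using openin_PP op by blast
  moreover have "smooth_on (hcone \<inter> pr -` ?V) (\<lambda>z. g (fst (pr z)))"
    using U(3) smooth_CP[OF oU(1), of g] unfolding pre
    by (auto simp: pr_def intro!: smooth_on_compose[of _ fst "- {0} \<inter> cline -` U" "\<lambda>z. g (cline z)"]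
        smooth_on_fst smooth_on_ident)
  then have "smooth_fun_on PP ?V (\<lambda>p. g (fst p))" using smooth_PP[OF op] by blast
  ultimately show ?thesis using U(2) assms(2) unfolding smooth_near_def by blast
qed

lemma smooth_near_PP_snd:
  assumes "smooth_near CP y g" "x \<in> pts CP" shows "smooth_near PP (x, y) (\<lambda>p. g (snd p))"
proof -
  obtain U where U: "openin (mtop CP) U" "y \<in> U" "smooth_fun_on CP U g"
    using assms(1) unfolding smooth_near_def by blast
  then have oU: "open (- {0} \<inter> cline -` U)" "U \<subseteq> cline ` (- {0})" using openin_CP by auto
  let ?V = "pts CP \<times> U :: ppoint set"
  have pts: "pts CP = cline ` (- {0 :: complex ^ 3})" by (auto simp: CP_def proj_mfd_def)
  have pre: "hcone \<inter> pr -` ?V = (- {0}) \<times> (- {0} \<inter> cline -` U)"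
    by (auto simp: hcone_def pr_def pts)
  have op: "open (hcone \<inter> pr -` ?V)" unfolding pre by (intro open_Times oU) auto
  have "?V \<subseteq> pr ` hcone" using oU(2) by (force simp: pts hcone_def pr_def image_iff)
  then have "openin (mtop PP) ?V" using openin_PP op by blast
  moreover have "smooth_on (hcone \<inter> pr -` ?V) (\<lambda>z. g (snd (pr z)))"
    using U(3) smooth_CP[OF oU(1), of g] unfolding pre
    by (auto simp: pr_def intro!: smooth_on_compose[of _ snd "- {0} \<inter> cline -` U" "\<lambda>z. g (cline z)"]
        smooth_on_snd smooth_on_ident)
  then have "smooth_fun_on PP ?V (\<lambda>p. g (snd p))" using smooth_PP[OF op] by blast
  ultimately show ?thesis using U(2) assms(2) unfolding smooth_near_def by blast
qed

lemma push_fst_Pvec: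
  assumes z: "z \<in> hcone" shows "push CP fst (pr z) (Pvec z w) = proj_vec (fst z) (fst w)"
proof
  fix g
  have "cline (snd z) \<in> pts CP" using z by (auto simp: CP_def proj_mfd_def hcone_def)
  then show "push CP fst (pr z) (Pvec z w) g = proj_vec (fst z) (fst w) g"
    using smooth_near_PP_fst[of "cline (fst z)" g "cline (snd z)"]
    by (auto simp: push_def Pvec_def proj_vec_def velocity_def smooth_near_CP_proj pr_def)
qed

lemma push_snd_Pvec:
  assumes z: "z \<in> hcone" shows "push CP snd (pr z) (Pvec z w) = proj_vec (snd z) (snd w)"
proof
  fix g
  have "cline (fst z) \<in> pts CP" using z by (auto simp: CP_def proj_mfd_def hcone_def)
  then show "push CP snd (pr z) (Pvec z w) g = proj_vec (snd z) (snd w) g"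
    using smooth_near_PP_snd[of "cline (snd z)" g "cline (fst z)"]
    by (auto simp: push_def Pvec_def proj_vec_def velocity_def smooth_near_CP_proj pr_def)
qed

lemma form_PP:
  assumes z: "z \<in> hcone" shows "form PP (pr z) (Pvec z v) (Pvec z w) = omega z v w"
proof -
  have "form PP (pr z) (Pvec z v) (Pvec z w) =
    fubini_study (cline (fst z)) (push CP fst (pr z) (Pvec z v)) (push CP fst (pr z) (Pvec z w)) +
    fubini_study (cline (snd z)) (push CP snd (pr z) (Pvec z v)) (push CP snd (pr z) (Pvec z w))"
    by (simp add: prod_smfd_def CP_def pr_def)
  then show ?thesis
    using z by (simp add: push_fst_Pvec push_snd_Pvec fubini_study_eq omega_def hcone_def)
qed

lemma Pvec_eqD:
  assumes z: "z \<in> hcone" and eq: "Pvec z v = Pvec z w" obtains a b where "w = v + scal a b z"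
proof -
  have "proj_vec (fst z) (fst v) = proj_vec (fst z) (fst w)" "proj_vec (snd z) (snd v) = proj_vec (snd z) (snd w)"
    using eq push_fst_Pvec[OF z] push_snd_Pvec[OF z] by metis+
  moreover have "fst z \<noteq> 0" "snd z \<noteq> 0" using z by (auto simp: hcone_def)
  ultimately obtain a b where "fst w = fst v + a *s fst z" "snd w = snd v + b *s snd z"
    using proj_vec_eqD by metis
  then have "w = v + scal a b z" by (simp add: prod_eq_iff)
  then show ?thesis by (rule that)
qed

lemma PP_open_preimage:
  fixes r :: "ppoint \<Rightarrow> 'b::real_normed_vector"
  assumes V: "openin (mtop PP) V" and r: "smooth_fun_on PP V r" and T: "open T"
  shows "openin (mtop PP) (V \<inter> r -` T)"
proof -
  have o: "open (hcone \<inter> pr -` V)" "V \<subseteq> pr ` hcone" using V openin_PP by auto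
  have "continuous_on (hcone \<inter> pr -` V) (\<lambda>y. r (pr y))"
    using r smooth_PP[OF o(1)] smooth_on_continuous by blast
  then have "open ((hcone \<inter> pr -` V) \<inter> (\<lambda>y. r (pr y)) -` T)"
    using continuous_openin_preimage_gen[OF _ T] openin_open_eq[OF o(1)] by blast
  moreover have "(hcone \<inter> pr -` V) \<inter> (\<lambda>y. r (pr y)) -` T = hcone \<inter> pr -` (V \<inter> r -` T)" by auto
  ultimately show ?thesis using o(2) by (auto simp: openin_PP)
qed

section \<open>Complex submanifolds of the product of projective planes\<close>

text \<open>Lifts are required only locally: the domain of an arbitrary chart is any relatively open
  set, and over its image the cone need not have a global section.\<close>

definition local_lifts :: "hvec set \<Rightarrow> (hvec \<Rightarrow> ppoint) \<Rightarrow> bool" where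
  "local_lifts D \<sigma> \<longleftrightarrow> (\<forall>u\<in>D. \<exists>W L. openin (top_of_set D) W \<and> u \<in> W \<and> smooth_on W L \<and>
     L ` W \<subseteq> hcone \<and> (\<forall>w\<in>W. \<sigma> w = pr (L w)))"

text \<open>The properties of N that pass on to its submanifolds, in terms of the ambient product.
  Extension is stated for \<open>hvec\<close>-valued functions because the inverses of charts take
  values there. The forms are compared after pushing along the identity, as this is how
  \<open>sub_smfd\<close> restricts a form.\<close>

definition emb :: "(ppoint, hvec) smfd \<Rightarrow> bool" where
  "emb N \<longleftrightarrow> pts N \<subseteq> pr ` hcone \<and> mtop N = subtopology (mtop PP) (pts N) \<and>
     (\<forall>(D, \<sigma>)\<in>charts N. openin (top_of_set (span D)) D \<and> \<sigma> ` D \<subseteq> pts N \<and> local_lifts D \<sigma>) \<and>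
     (\<forall>U x (r :: ppoint \<Rightarrow> hvec). openin (mtop N) U \<longrightarrow> x \<in> U \<longrightarrow> smooth_fun_on N U r \<longrightarrow>
        (\<exists>V r'. openin (mtop PP) V \<and> x \<in> V \<and> smooth_fun_on PP V r' \<and> (\<forall>y\<in>V \<inter> pts N. r' y = r y))) \<and>
     (\<forall>x\<in>pts N. \<forall>\<xi> \<eta>. form N x (push N (\<lambda>y. y) x \<xi>) (push N (\<lambda>y. y) x \<eta>) =
        form PP x (push PP (\<lambda>y. y) x \<xi>) (push PP (\<lambda>y. y) x \<eta>))"

lemma local_lifts_preimage:
  assumes l: "local_lifts D \<sigma>" and V: "openin (mtop PP) V"
  shows "openin (top_of_set D) (D \<inter> \<sigma> -` V)"
proof (subst openin_subopen, intro ballI)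
  fix u assume u: "u \<in> D \<inter> \<sigma> -` V"
  then obtain W L where W: "openin (top_of_set D) W" "u \<in> W" "smooth_on W L" "L ` W \<subseteq> hcone"
    "\<forall>w\<in>W. \<sigma> w = pr (L w)" using l unfolding local_lifts_def by blast
  have "open (hcone \<inter> pr -` V)" using V openin_PP by blast
  then have "openin (top_of_set W) (W \<inter> L -` (hcone \<inter> pr -` V))"
    using continuous_openin_preimage_gen smooth_on_continuous[OF W(3)] by blast
  then have "openin (top_of_set D) (W \<inter> L -` (hcone \<inter> pr -` V))" using W(1) openin_trans by blast
  then show "\<exists>T. openin (top_of_set D) T \<and> u \<in> T \<and> T \<subseteq> D \<inter> \<sigma> -` V"
    using W u openin_imp_subset[OF W(1)]
    by (intro exI[of _ "W \<inter> L -` (hcone \<inter> pr -` V)"]) auto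
qed

lemma local_lifts_smooth:
  fixes g :: "ppoint \<Rightarrow> 'b::real_normed_vector"
  assumes l: "local_lifts D \<sigma>" and D: "openin (top_of_set (span D)) D"
    and V: "openin (mtop PP) V" and g: "smooth_fun_on PP V g"
  shows "smooth_on (D \<inter> \<sigma> -` V) (\<lambda>u. g (\<sigma> u))"
proof (rule smooth_on_local[OF _ subspace_span])
  have o: "openin (top_of_set D) (D \<inter> \<sigma> -` V)" by (rule local_lifts_preimage[OF l V])
  then show "openin (top_of_set (span D)) (D \<inter> \<sigma> -` V)" using D openin_trans by blast
  fix u assume u: "u \<in> D \<inter> \<sigma> -` V"
  then obtain W L where W: "openin (top_of_set D) W" "u \<in> W" "smooth_on W L" "L ` W \<subseteq> hcone"
    "\<forall>w\<in>W. \<sigma> w = pr (L w)" using l unfolding local_lifts_def by blast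
  have "open (hcone \<inter> pr -` V)" using V openin_PP by blast
  then have g': "smooth_on (hcone \<inter> pr -` V) (\<lambda>y. g (pr y))" using g smooth_PP by blast
  let ?W = "W \<inter> (D \<inter> \<sigma> -` V)"
  have "smooth_on ?W (\<lambda>w. g (pr (L w)))"
    by (rule smooth_on_compose[OF smooth_on_subset[OF W(3)] g']) (use W in auto)
  then have "smooth_on ?W (\<lambda>w. g (\<sigma> w))" by (rule smooth_on_cong) (use W in auto)
  moreover have "openin (top_of_set (D \<inter> \<sigma> -` V)) ?W"
    using openin_subset_trans[OF openin_Int[OF W(1) o]] openin_imp_subset[OF o] by blast
  ultimately show "\<exists>W. openin (top_of_set (D \<inter> \<sigma> -` V)) W \<and> u \<in> W \<and> smooth_on W (\<lambda>u. g (\<sigma> u))"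
    using u W by blast
qed

lemma embD:
  assumes "emb N"
  shows "pts N \<subseteq> pr ` hcone" "mtop N = subtopology (mtop PP) (pts N)"
    and "(D, \<sigma>) \<in> charts N \<Longrightarrow> openin (top_of_set (span D)) D"
    and "(D, \<sigma>) \<in> charts N \<Longrightarrow> \<sigma> ` D \<subseteq> pts N"
    and "(D, \<sigma>) \<in> charts N \<Longrightarrow> local_lifts D \<sigma>"
proof -
  have c: "\<forall>(D, \<sigma>)\<in>charts N. openin (top_of_set (span D)) D \<and> \<sigma> ` D \<subseteq> pts N \<and> local_lifts D \<sigma>"
    using assms unfolding emb_def by (elim conjE)
  show "pts N \<subseteq> pr ` hcone" using assms unfolding emb_def by (elim conjE)
  show "mtop N = subtopology (mtop PP) (pts N)" using assms unfolding emb_def by (elim conjE)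
  show "(D, \<sigma>) \<in> charts N \<Longrightarrow> openin (top_of_set (span D)) D"
    "(D, \<sigma>) \<in> charts N \<Longrightarrow> \<sigma> ` D \<subseteq> pts N" "(D, \<sigma>) \<in> charts N \<Longrightarrow> local_lifts D \<sigma>"
    using bspec[OF c] by auto
qed

lemma emb_extension:
  fixes r :: "ppoint \<Rightarrow> hvec"
  assumes "emb N" "openin (mtop N) U" "x \<in> U" "smooth_fun_on N U r"
  shows "\<exists>V r'. openin (mtop PP) V \<and> x \<in> V \<and> smooth_fun_on PP V r' \<and> (\<forall>y\<in>V \<inter> pts N. r' y = r y)"
  using assms(1) unfolding emb_def by (elim conjE allE impE) (rule assms)+

lemma emb_form:
  assumes "emb N" "x \<in> pts N"
  shows "form N x (push N (\<lambda>y. y) x \<xi>) (push N (\<lambda>y. y) x \<eta>) =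
    form PP x (push PP (\<lambda>y. y) x \<xi>) (push PP (\<lambda>y. y) x \<eta>)"
  using assms(1) unfolding emb_def by (elim conjE ballE allE) (use assms(2) in auto)

lemma emb_restrict:
  fixes g :: "ppoint \<Rightarrow> 'b::real_normed_vector"
  assumes N: "emb N" and V: "openin (mtop PP) V" and g: "smooth_fun_on PP V g"
  shows "smooth_fun_on N V g"
  unfolding smooth_fun_on_def using local_lifts_smooth[OF _ _ V g] embD[OF N] by blast

lemma emb_near:
  assumes N: "emb N" and x: "x \<in> pts N" and g: "smooth_near PP x g"
  shows "smooth_near N x g"
proof -
  obtain V where V: "openin (mtop PP) V" "x \<in> V" "smooth_fun_on PP V g"
    using g unfolding smooth_near_def by blast
  have "smooth_fun_on N V g" by (rule emb_restrict[OF N V(1,3)])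
  then have "smooth_fun_on N (pts N \<inter> V) g"
    unfolding smooth_fun_on_def by (auto elim!: smooth_on_subset dest!: bspec)
  moreover have "openin (mtop N) (pts N \<inter> V)"
    unfolding embD(2)[OF N] using V(1) by (simp add: openin_subtopology_Int2)
  ultimately show ?thesis using x V(2) unfolding smooth_near_def by blast
qed

lemma smooth_fun_on_bounded_linear:
  "bounded_linear h \<Longrightarrow> smooth_fun_on M U g \<Longrightarrow> smooth_fun_on M U (\<lambda>x. h (g x))"
  unfolding smooth_fun_on_def by (auto intro: smooth_on_bounded_linear)

lemma emb_extend:
  assumes N: "emb N" and g: "smooth_near N x g"
  obtains V g' where "openin (mtop PP) V" "x \<in> V" "smooth_fun_on PP V g'"
    "\<forall>y\<in>V \<inter> pts N. g' y = g y"
proof -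
  obtain U where U: "openin (mtop N) U" "x \<in> U" "smooth_fun_on N U g"
    using g unfolding smooth_near_def by blast
  \<comment> \<open>A real function is turned into an \<open>hvec\<close>-valued one along a unit
    vector e and recovered by the inner product with e.\<close>
  obtain e :: hvec where e: "e \<in> Basis" using nonempty_Basis by blast
  have "smooth_fun_on N U (\<lambda>y. g y *\<^sub>R e)"
    by (rule smooth_fun_on_bounded_linear[OF bounded_linear_scaleR_left U(3)])
  then obtain V r' where V: "openin (mtop PP) V" "x \<in> V" "smooth_fun_on PP V r'"
    "\<forall>y\<in>V \<inter> pts N. r' y = g y *\<^sub>R e" using emb_extension[OF N U(1,2)] by blast
  have "smooth_fun_on PP V (\<lambda>y. r' y \<bullet> e)"
    by (rule smooth_fun_on_bounded_linear[OF bounded_linear_inner_left V(3)])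
  moreover have "\<forall>y\<in>V \<inter> pts N. r' y \<bullet> e = g y" using V(4) e by (simp add: inner_Basis)
  ultimately show ?thesis using that V(1,2) by blast
qed

lemma smooth_near_cong:
  assumes "smooth_near N x g'" "openin (mtop N) V" "x \<in> V" "\<forall>y\<in>V. g' y = g y"
  shows "smooth_near N x g"
proof -
  obtain U where U: "openin (mtop N) U" "x \<in> U" "smooth_fun_on N U g'"
    using assms(1) unfolding smooth_near_def by blast
  have "smooth_fun_on N (U \<inter> V) g" unfolding smooth_fun_on_def
  proof clarify
    fix D \<sigma> assume "(D, \<sigma>) \<in> charts N"
    then have "smooth_on (D \<inter> \<sigma> -` U) (\<lambda>u. g' (\<sigma> u))" using U(3) unfolding smooth_fun_on_def by blast
    then have "smooth_on (D \<inter> \<sigma> -` (U \<inter> V)) (\<lambda>u. g' (\<sigma> u))" by (rule smooth_on_subset) auto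
    then show "smooth_on (D \<inter> \<sigma> -` (U \<inter> V)) (\<lambda>u. g (\<sigma> u))"
      by (rule smooth_on_cong) (use assms(4) in auto)
  qed
  then show ?thesis using U assms unfolding smooth_near_def by (intro exI[of _ "U \<inter> V"]) auto
qed

lemma emb_near_cong:
  assumes N: "emb N" and x: "x \<in> pts N" and V: "openin (mtop PP) V" "x \<in> V"
    and g: "smooth_fun_on PP V g'" and eq: "\<forall>y\<in>V \<inter> pts N. g' y = g y"
  shows "smooth_near N x g"
proof (rule smooth_near_cong[of N x g' "pts N \<inter> V"])
  show "smooth_near N x g'" using emb_near[OF N x] V g unfolding smooth_near_def by blast
  show "openin (mtop N) (pts N \<inter> V)" unfolding embD(2)[OF N] using V(1) by (simp add: openin_subtopology_Int2)
qed (use x V eq in auto)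

text \<open>The right-hand side does not mention \<open>N\<close>: a tangent vector of \<open>N\<close> is determined by its
  image in the tangent space of the ambient product.\<close>

lemma emb_curve:
  assumes N: "emb N" and c: "(c has_vector_derivative w) (at 0)" "c 0 \<in> hcone"
    and ev: "eventually (\<lambda>t. pr (c t) \<in> pts N) (nhds (0::real))"
    and V: "openin (mtop PP) V" "pr (c 0) \<in> V" "smooth_fun_on PP V g'" "\<forall>y\<in>V \<inter> pts N. g' y = g y"
  shows "((\<lambda>t. g (pr (c t))) has_real_derivative Pvec (c 0) w g') (at 0)"
proof -
  have o: "open (hcone \<inter> pr -` V)" using V openin_PP by blast
  have "(c \<longlongrightarrow> c 0) (at 0)" using has_vector_derivative_continuous[OF c(1)] by (simp add: continuous_within)
  then have "eventually (\<lambda>t. c t \<in> hcone \<inter> pr -` V) (at 0)"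
    by (rule topological_tendstoD[OF _ o]) (use c(2) V(2) in auto)
  then have "eventually (\<lambda>t. c t \<in> hcone \<inter> pr -` V) (nhds 0)"
    unfolding eventually_nhds_conv_at using c(2) V(2) by auto
  then have "eventually (\<lambda>t. g' (pr (c t)) = g (pr (c t))) (nhds 0)"
    using ev by eventually_elim (use V(4) in auto)
  moreover have "((\<lambda>t. g' (pr (c t))) has_real_derivative Pvec (c 0) w g') (at 0)"
    using Pvec_curve[OF c] V unfolding smooth_near_def by blast
  ultimately show ?thesis using DERIV_cong_ev[OF refl _ refl, of "\<lambda>t. g' (pr (c t))" "\<lambda>t. g (pr (c t))" 0] by simp
qed

lemma charts_PP:
  assumes "(D, \<sigma>) \<in> charts PP"
  shows "openin (top_of_set (span D)) D" "\<sigma> ` D \<subseteq> pts PP" "local_lifts D \<sigma>"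
proof -
  obtain a b where a: "D = {z. z $ a = 0} \<times> {z. z $ b = 0}"
    "\<sigma> = map_prod (\<lambda>z. cline (z + axis a 1)) (\<lambda>z. cline (z + axis b 1))"
    using assms by (auto simp: prod_smfd_def CP_def proj_mfd_def)
  let ?j = "\<lambda>z. z + (axis a 1, axis b 1)"
  have j: "smooth_on D ?j" "?j ` D \<subseteq> hcone" "\<forall>u\<in>D. \<sigma> u = pr (?j u)"
    by (auto simp: a hcone_def pr_def axis_nonzero intro!: smooth_on_add smooth_on_ident smooth_on_const)
  show "\<sigma> ` D \<subseteq> pts PP"
  proof
    fix x assume "x \<in> \<sigma> ` D"
    then obtain u where u: "u \<in> D" "x = \<sigma> u" by blast
    then have "x = pr (?j u)" "?j u \<in> hcone" using j by blast+
    then show "x \<in> pts PP" unfolding pts_PP by (rule image_eqI)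
  qed
  show "local_lifts D \<sigma>" unfolding local_lifts_def
    by (intro ballI exI[of _ D] exI[of _ ?j] conjI openin_subtopology_self j)
  show "openin (top_of_set (span D)) D"
    unfolding a by (intro openin_span_subspace subspace_Times subspace_nth)
qed

text \<open>The inner push only resets functions that are not smooth on N near x. Those are not
  smooth on M either, so the outer push resets them anyway.\<close>

lemma push_id_push_id:
  assumes "\<And>g. smooth_near M x g \<Longrightarrow> smooth_near N x g"
  shows "push M (\<lambda>y. y) x (push N (\<lambda>y. y) x \<xi>) = push M (\<lambda>y. y) x \<xi>"
  using assms by (auto simp: push_def)

lemma emb_PP: "emb PP"
  unfolding emb_def
proof (intro conjI)
  show "mtop PP = subtopology (mtop PP) (pts PP)"
    by (metis pts_PP topspace_PP subtopology_topspace)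
  show "\<forall>(D, \<sigma>)\<in>charts PP. openin (top_of_set (span D)) D \<and> \<sigma> ` D \<subseteq> pts PP \<and> local_lifts D \<sigma>"
    using charts_PP by blast
qed (auto simp: pts_PP)

text \<open>\<open>lchart\<close> is what charts of arbitrary iterated submanifolds satisfy; \<open>nchart\<close> is a holomorphic
  parametrisation by lifts to the cone.\<close>

definition lchart :: "nat \<Rightarrow> ppoint set \<Rightarrow> hvec set \<Rightarrow> (hvec \<Rightarrow> ppoint) \<Rightarrow> bool" where
  "lchart d S E \<sigma> \<longleftrightarrow> openin (top_of_set (span E)) E \<and> dim E = d \<and> inj_on \<sigma> E \<and>
     (\<exists>V. openin (mtop PP) V \<and> \<sigma> ` E = S \<inter> V) \<and> local_lifts E \<sigma> \<and>
     (\<forall>u\<in>E. \<exists>V r. openin (mtop PP) V \<and> \<sigma> u \<in> V \<and> smooth_fun_on PP V (r :: ppoint \<Rightarrow> hvec) \<and>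
        (\<forall>u'\<in>E. \<sigma> u' \<in> V \<longrightarrow> r (\<sigma> u') = u'))"

definition nchart ::
    "nat \<Rightarrow> ppoint set \<Rightarrow> hvec set \<Rightarrow> (hvec \<Rightarrow> hvec) \<Rightarrow> (ppoint \<Rightarrow> hvec) \<Rightarrow> ppoint set \<Rightarrow> bool" where
  "nchart d S E L r V \<longleftrightarrow> openin (top_of_set (span E)) E \<and> dim E = d \<and> mult_i ` span E \<subseteq> span E \<and>
     L ` E \<subseteq> hcone \<and> smooth_on E L \<and>
     (\<forall>u\<in>E. \<exists>L'. (L has_derivative L') (at u) \<and> (\<forall>v. L' (mult_i v) = mult_i (L' v))) \<and>
     openin (mtop PP) V \<and> pr ` L ` E = S \<inter> V \<and> smooth_fun_on PP V r \<and> (\<forall>u\<in>E. r (pr (L u)) = u)"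

lemma nchart_local_lifts: "nchart d S E L r V \<Longrightarrow> local_lifts E (\<lambda>u. pr (L u))"
  unfolding local_lifts_def nchart_def by (intro ballI exI[of _ E] exI[of _ L]) auto

text \<open>Every chart has to satisfy \<open>lchart\<close>, because \<open>manifold\<close> and
  closedness of the form are demanded in every chart. Holomorphic charts are only asked to cover;
  they supply the complex structure of the tangent spaces.\<close>

locale complex_submfd =
  fixes N :: "(ppoint, hvec) smfd" and d :: nat
  assumes pts_hcone: "pts N \<subseteq> pr ` hcone"
    and charts_lchart: "\<And>E \<sigma>. (E, \<sigma>) \<in> charts N \<Longrightarrow> lchart d (pts N) E \<sigma>"
    and nice: "\<And>x. x \<in> pts N \<Longrightarrow>
      \<exists>E L r V. nchart d (pts N) E L r V \<and> x \<in> V \<and> (E, \<lambda>u. pr (L u)) \<in> charts N"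
    and form_eq: "\<And>x \<xi> \<eta>. x \<in> pts N \<Longrightarrow>
      form N x \<xi> \<eta> = form PP x (push PP (\<lambda>y. y) x \<xi>) (push PP (\<lambda>y. y) x \<eta>)"
begin

lemma chartD:
  assumes "(E, \<sigma>) \<in> charts N"
  shows "openin (top_of_set (span E)) E" "dim E = d" "inj_on \<sigma> E" "local_lifts E \<sigma>" "\<sigma> ` E \<subseteq> pts N"
  using charts_lchart[OF assms] by (auto simp: lchart_def)

lemma nice_chart:
  assumes "x \<in> pts N" obtains E L r V u where "nchart d (pts N) E L r V" "x \<in> V"
    "(E, \<lambda>u. pr (L u)) \<in> charts N" "u \<in> E" "pr (L u) = x"
proof -
  obtain E L r V where *: "nchart d (pts N) E L r V" "x \<in> V" "(E, \<lambda>u. pr (L u)) \<in> charts N"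
    using nice[OF assms] by blast
  then have "x \<in> pr ` L ` E" using assms by (auto simp: nchart_def)
  with * that show ?thesis by blast
qed

text \<open>The inverse r of a covering chart is defined on an open set of the ambient product, so
  open sets of the chart are cut out by ambient open sets. The converse inclusion needs only the
  continuity of the charts.\<close>

lemma mtop_eq: "mtop N = subtopology (mtop PP) (pts N)"
proof (rule topology_eq[THEN iffD2], intro allI iffI)
  fix U assume U: "openin (mtop N) U"
  show "openin (subtopology (mtop PP) (pts N)) U"
  proof (subst openin_subopen, intro ballI)
    fix x assume x: "x \<in> U"
    then have "x \<in> pts N" using U by (auto simp: openin_mtop)
    then obtain E L r V u where E: "nchart d (pts N) E L r V" "x \<in> V"
      "(E, \<lambda>u. pr (L u)) \<in> charts N" "u \<in> E" "pr (L u) = x" by (rule nice_chart)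
    have "openin (top_of_set E) (E \<inter> (\<lambda>u. pr (L u)) -` U)"
      using U E(3) by (auto simp: openin_mtop)
    then obtain T where T: "open T" "E \<inter> (\<lambda>u. pr (L u)) -` U = E \<inter> T" by (auto simp: openin_open)
    have V: "openin (mtop PP) (V \<inter> r -` T)"
      using E(1) T(1) by (intro PP_open_preimage) (auto simp: nchart_def)
    have r: "r (pr (L u)) = u" if "u \<in> E" for u using E(1) that by (auto simp: nchart_def)
    have im: "pr ` L ` E = pts N \<inter> V" using E(1) by (auto simp: nchart_def)
    have "pts N \<inter> (V \<inter> r -` T) \<subseteq> U"
    proof
      fix y assume y: "y \<in> pts N \<inter> (V \<inter> r -` T)"
      then obtain u where u: "u \<in> E" "y = pr (L u)" using im by blast
      then have "u \<in> E \<inter> T" using y r by auto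
      then show "y \<in> U" using T(2) u by blast
    qed
    moreover have "u \<in> E \<inter> T" unfolding T(2)[symmetric] using E x by simp
    then have "x \<in> pts N \<inter> (V \<inter> r -` T)" using E(2) r[OF E(4)] E(5) \<open>x \<in> pts N\<close> by auto
    ultimately show "\<exists>T. openin (subtopology (mtop PP) (pts N)) T \<and> x \<in> T \<and> T \<subseteq> U"
      using openin_subtopology_Int2[OF V] by blast
  qed
next
  fix U assume "openin (subtopology (mtop PP) (pts N)) U"
  then obtain V where V: "openin (mtop PP) V" "U = V \<inter> pts N" by (auto simp: openin_subtopology)
  have "openin (top_of_set E) (E \<inter> \<sigma> -` U)" if c: "(E, \<sigma>) \<in> charts N" for E \<sigma>
  proof -
    have "E \<inter> \<sigma> -` U = E \<inter> \<sigma> -` V" using V(2) chartD(5)[OF c] by auto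
    then show ?thesis using local_lifts_preimage[OF chartD(4)[OF c] V(1)] by simp
  qed
  then show "openin (mtop N) U" using V by (auto simp: openin_mtop)
qed

text \<open>Near x the inverse r0 of a chart retracts an ambient neighbourhood onto coordinates, and
  r is extended by making it constant along this retraction.\<close>

lemma extension:
  fixes r :: "ppoint \<Rightarrow> hvec"
  assumes U: "openin (mtop N) U" "x \<in> U" and r: "smooth_fun_on N U r"
  shows "\<exists>V r'. openin (mtop PP) V \<and> x \<in> V \<and> smooth_fun_on PP V r' \<and> (\<forall>y\<in>V \<inter> pts N. r' y = r y)"
proof -
  have x: "x \<in> pts N" using U by (auto simp: openin_mtop)
  obtain E L r0 V u where E: "nchart d (pts N) E L r0 V" "x \<in> V"
    "(E, \<lambda>u. pr (L u)) \<in> charts N" "u \<in> E" "pr (L u) = x" using nice_chart[OF x] .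
  have oE: "openin (top_of_set (span E)) E" by (rule chartD(1)[OF E(3)])
  let ?E' = "E \<inter> (\<lambda>u. pr (L u)) -` U"
  have "openin (top_of_set E) ?E'" using U E(3) by (auto simp: openin_mtop)
  then have "openin (top_of_set (span E)) ?E'" using oE openin_trans by blast
  then obtain T where T: "open T" "?E' = span E \<inter> T" by (auto simp: openin_open)
  \<comment> \<open>Away from N the values of r0 may leave the subspace that contains the chart
    domain. The projection brings them back, so that membership in the relatively open set
    \<open>?E'\<close> becomes the open condition T.\<close>
  obtain P where P: "bounded_linear P" "range P \<subseteq> span E" "\<And>v. v \<in> span E \<Longrightarrow> P v = v"
    using exists_projection[OF subspace_span] by metis
  have V: "openin (mtop PP) V" "smooth_fun_on PP V r0" using E(1) by (auto simp: nchart_def)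
  have Pr: "smooth_fun_on PP V (\<lambda>y. P (r0 y))" by (rule smooth_fun_on_bounded_linear[OF P(1) V(2)])
  have r0: "P (r0 (pr (L u))) = u" if "u \<in> E" for u
    using E(1) that P(3)[OF span_base] unfolding nchart_def by simp
  let ?V' = "V \<inter> (\<lambda>y. P (r0 y)) -` T"
  have V': "openin (mtop PP) ?V'" by (rule PP_open_preimage[OF V(1) Pr T(1)])
  have o: "open (hcone \<inter> pr -` V)" "open (hcone \<inter> pr -` ?V')" using V V' openin_PP by blast+
  have s1: "smooth_on (hcone \<inter> pr -` ?V') (\<lambda>z. P (r0 (pr z)))"
    using Pr smooth_PP[OF o(1), of "\<lambda>y. P (r0 y)"] by (auto elim: smooth_on_subset)
  have s2: "smooth_on ?E' (\<lambda>u. r (pr (L u)))" using r E(3) unfolding smooth_fun_on_def by auto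
  have "smooth_on (hcone \<inter> pr -` ?V') (\<lambda>z. r (pr (L (P (r0 (pr z))))))"
    by (rule smooth_on_compose[OF s1 s2]) (use P(2) in \<open>unfold T(2), blast\<close>)
  then have "smooth_fun_on PP ?V' (\<lambda>y. r (pr (L (P (r0 y)))))" using smooth_PP[OF o(2)] by blast
  moreover have "r (pr (L (P (r0 y)))) = r y" if y: "y \<in> ?V' \<inter> pts N" for y
  proof -
    have "pr ` L ` E = pts N \<inter> V" using E(1) by (auto simp: nchart_def)
    then obtain u where "u \<in> E" "y = pr (L u)" using y by blast
    then show ?thesis using r0 by simp
  qed
  moreover have "x \<in> ?V'"
  proof -
    have "P (r0 x) = u" using r0[OF E(4)] E(5) by simp
    moreover have "u \<in> ?E'" using E(4,5) U(2) by simp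
    then have "u \<in> T" unfolding T(2) by blast
    ultimately show ?thesis using E(2) by auto
  qed
  ultimately show ?thesis using V' by blast
qed

lemma emb: "emb N"
proof -
  have base: "pts N \<subseteq> pr ` hcone" by (rule pts_hcone)
  have near: "smooth_near N x g" if x: "x \<in> pts N" and g: "smooth_near PP x g" for x g
  proof -
    obtain V where V: "openin (mtop PP) V" "x \<in> V" "smooth_fun_on PP V g"
      using g unfolding smooth_near_def by blast
    have "smooth_on (D \<inter> \<sigma> -` (pts N \<inter> V)) (\<lambda>u. g (\<sigma> u))" if c: "(D, \<sigma>) \<in> charts N" for D \<sigma>
      using local_lifts_smooth[OF chartD(4)[OF c] chartD(1)[OF c] V(1,3)]
      by (rule smooth_on_subset) auto
    then have "smooth_fun_on N (pts N \<inter> V) g" unfolding smooth_fun_on_def by blast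
    moreover have "openin (mtop N) (pts N \<inter> V)"
      unfolding mtop_eq using V(1) by (simp add: openin_subtopology_Int2)
    ultimately show ?thesis using x V(2) unfolding smooth_near_def by blast
  qed
  show ?thesis unfolding emb_def
  proof (intro conjI)
    show "\<forall>(D, \<sigma>)\<in>charts N. openin (top_of_set (span D)) D \<and> \<sigma> ` D \<subseteq> pts N \<and> local_lifts D \<sigma>"
      using chartD by blast
    show "\<forall>x\<in>pts N. \<forall>\<xi> \<eta>. form N x (push N (\<lambda>y. y) x \<xi>) (push N (\<lambda>y. y) x \<eta>) =
        form PP x (push PP (\<lambda>y. y) x \<xi>) (push PP (\<lambda>y. y) x \<eta>)"
      using near by (simp add: form_eq push_id_push_id)
  qed (use base mtop_eq extension in auto)
qed

lemma manifold: "manifold N d"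
  unfolding manifold_def
proof (intro conjI)
  show "pts N = (\<Union>(D, \<sigma>)\<in>charts N. \<sigma> ` D)"
  proof
    show "pts N \<subseteq> (\<Union>(D, \<sigma>)\<in>charts N. \<sigma> ` D)"
    proof
      fix x assume "x \<in> pts N"
      then obtain E L r V u where E: "(E, \<lambda>u. pr (L u)) \<in> charts N" "u \<in> E" "pr (L u) = x"
        by (rule nice_chart)
      then have "x \<in> (\<lambda>u. pr (L u)) ` E" by blast
      then show "x \<in> (\<Union>(D, \<sigma>)\<in>charts N. \<sigma> ` D)"
        by (intro UN_I[OF E(1)]) simp
    qed
    show "(\<Union>(D, \<sigma>)\<in>charts N. \<sigma> ` D) \<subseteq> pts N"
    proof (rule UN_least)
      fix c assume "c \<in> charts N"
      then show "(case c of (D, \<sigma>) \<Rightarrow> \<sigma> ` D) \<subseteq> pts N" by (cases c) (simp add: chartD(5))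
    qed
  qed
  show "\<forall>(D, \<sigma>)\<in>charts N. openin (top_of_set (span D)) D \<and> dim D = d \<and> inj_on \<sigma> D"
    using chartD by blast
  show "\<forall>(D, \<sigma>)\<in>charts N. \<forall>(E, \<tau>)\<in>charts N.
        openin (top_of_set D) (D \<inter> \<sigma> -` (\<tau> ` E)) \<and>
        smooth_on (D \<inter> \<sigma> -` (\<tau> ` E)) (\<lambda>u. inv_into E \<tau> (\<sigma> u))"
  proof (clarify, intro conjI)
    fix D \<sigma> E \<tau> assume D: "(D, \<sigma>) \<in> charts N" and E: "(E, \<tau>) \<in> charts N"
    obtain V where V: "openin (mtop PP) V" "\<tau> ` E = pts N \<inter> V"
      using charts_lchart[OF E] by (auto simp: lchart_def)
    have eq: "D \<inter> \<sigma> -` (\<tau> ` E) = D \<inter> \<sigma> -` V" using V(2) chartD(5)[OF D] by auto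
    show o: "openin (top_of_set D) (D \<inter> \<sigma> -` (\<tau> ` E))"
      unfolding eq by (rule local_lifts_preimage[OF chartD(4)[OF D] V(1)])
    show "smooth_on (D \<inter> \<sigma> -` (\<tau> ` E)) (\<lambda>u. inv_into E \<tau> (\<sigma> u))"
    proof (rule smooth_on_local[OF _ subspace_span])
      show "openin (top_of_set (span D)) (D \<inter> \<sigma> -` (\<tau> ` E))" using o chartD(1)[OF D] openin_trans by blast
      fix u assume u: "u \<in> D \<inter> \<sigma> -` (\<tau> ` E)"
      then obtain e where e: "e \<in> E" "\<sigma> u = \<tau> e" by blast
      \<comment> \<open>The function r inverts \<tau> only near the point considered; smoothness of
        the transition map is therefore proved locally.\<close>
      obtain V' r where V': "openin (mtop PP) V'" "\<tau> e \<in> V'" "smooth_fun_on PP V' (r :: ppoint \<Rightarrow> hvec)"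
        "\<forall>u'\<in>E. \<tau> u' \<in> V' \<longrightarrow> r (\<tau> u') = u'"
        using charts_lchart[OF E] e(1) unfolding lchart_def by blast
      let ?W = "(D \<inter> \<sigma> -` (\<tau> ` E)) \<inter> (D \<inter> \<sigma> -` V')"
      have "smooth_on (D \<inter> \<sigma> -` V') (\<lambda>u. r (\<sigma> u))"
        by (rule local_lifts_smooth[OF chartD(4)[OF D] chartD(1)[OF D] V'(1,3)])
      then have "smooth_on ?W (\<lambda>u. r (\<sigma> u))" by (rule smooth_on_subset) auto
      then have "smooth_on ?W (\<lambda>u. inv_into E \<tau> (\<sigma> u))"
      proof (rule smooth_on_cong)
        fix w assume w: "w \<in> ?W"
        then have "inv_into E \<tau> (\<sigma> w) \<in> E" "\<tau> (inv_into E \<tau> (\<sigma> w)) = \<sigma> w"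
          by (auto simp: inv_into_into f_inv_into_f)
        then show "r (\<sigma> w) = inv_into E \<tau> (\<sigma> w)" using V'(4) w by fastforce
      qed
      moreover have "openin (top_of_set (D \<inter> \<sigma> -` (\<tau> ` E))) ?W"
        by (rule openin_subset_trans[OF openin_Int[OF o local_lifts_preimage[OF chartD(4)[OF D] V'(1)]]]) auto
      ultimately show "\<exists>W. openin (top_of_set (D \<inter> \<sigma> -` (\<tau> ` E))) W \<and> u \<in> W \<and>
          smooth_on W (\<lambda>u. inv_into E \<tau> (\<sigma> u))" using u e V'(2) by (intro exI[of _ ?W]) auto
    qed
  qed
  show "Hausdorff_space (mtop N)" unfolding mtop_eq by (rule Hausdorff_space_subtopology[OF Hausdorff_PP])
  show "second_countable (mtop N)" unfolding mtop_eq by (rule second_countable_subtopology[OF second_countable_PP])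
qed

end

section \<open>Affine normalisation, and charts of iterated submanifolds\<close>

definition affrep :: "3 \<Rightarrow> 3 \<Rightarrow> ppoint \<Rightarrow> hvec" where
  "affrep a b p = scal (1 / rep (fst p) $ a) (1 / rep (snd p) $ b) (rep (fst p), rep (snd p))"

definition affcone :: "3 \<Rightarrow> 3 \<Rightarrow> hvec set" where
  "affcone a b = {z. fst z $ a \<noteq> 0 \<and> snd z $ b \<noteq> 0}"

text \<open>The unknown scalars in the chosen representatives cancel, so \<open>affrep a b\<close>
  is a holomorphic section of \<open>pr\<close> over the affine piece, normalised by x_a = y_b =
  1.\<close>

lemma affrep_pr:
  assumes "z \<in> hcone" shows "affrep a b (pr z) = scal (1 / fst z $ a) (1 / snd z $ b) z"
proof -
  obtain c where c: "c \<noteq> 0" "rep (cline (fst z)) = c *s fst z"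
    using rep_cline[of "fst z"] assms by (auto simp: hcone_def)
  obtain d where d: "d \<noteq> 0" "rep (cline (snd z)) = d *s snd z"
    using rep_cline[of "snd z"] assms by (auto simp: hcone_def)
  show ?thesis
    using c d by (simp add: affrep_def pr_def scal_def vector_smult_assoc)
qed

lemma affcone_hcone: "affcone a b \<subseteq> hcone"
  by (auto simp: affcone_def hcone_def)

lemma open_affcone: "open (affcone a b)"
  unfolding affcone_def by (intro open_Collect_conj open_Collect_neq continuous_intros)

lemma preimage_affcone: "hcone \<inter> pr -` pr ` affcone a b = affcone a b"
  by (rule saturated_preimage[OF affcone_hcone]) (auto simp: affcone_def)

lemma openin_affcone: "openin (mtop PP) (pr ` affcone a b)"
  by (rule openin_PP_saturated[OF open_affcone affcone_hcone]) (auto simp: affcone_def)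

lemma smooth_on_scal:
  assumes "smooth_on D a" "smooth_on D b" "smooth_on D f"
  shows "smooth_on D (\<lambda>u. scal (a u) (b u) (f u))"
  unfolding scal_def
  by (intro smooth_on_Pair smooth_on_vec)
     (simp_all add: smooth_on_mult smooth_on_nth smooth_on_fst smooth_on_snd assms)

lemma smooth_affrep: "smooth_fun_on PP (pr ` affcone a b) (affrep a b)"
proof -
  have "smooth_on (affcone a b) (\<lambda>z. scal (1 / fst z $ a) (1 / snd z $ b) z)"
    by (intro smooth_on_scal smooth_on_divide smooth_on_nth smooth_on_fst smooth_on_snd smooth_on_ident
        smooth_on_const) (auto simp: affcone_def)
  then have "smooth_on (affcone a b) (\<lambda>z. affrep a b (pr z))"
    by (rule smooth_on_cong) (rule affrep_pr[symmetric, OF subsetD[OF affcone_hcone]])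
  then show ?thesis using smooth_PP[of "pr ` affcone a b" "affrep a b"] open_affcone by (simp add: preimage_affcone)
qed

lemma pr_affrep:
  assumes "x \<in> pr ` affcone a b" shows "affrep a b x \<in> hcone" "pr (affrep a b x) = x"
proof -
  obtain z where z: "z \<in> affcone a b" "x = pr z" using assms by blast
  have "z \<in> hcone" using z(1) affcone_hcone by blast
  moreover have "affrep a b x = scal (1 / fst z $ a) (1 / snd z $ b) z"
    unfolding z(2) by (rule affrep_pr[OF calculation])
  ultimately
  show "affrep a b x \<in> hcone" "pr (affrep a b x) = x"
    using z by (auto simp: affcone_def pr_scal scal_hcone)
qed

lemma in_affcone:
  assumes "x \<in> pr ` hcone" obtains a b where "x \<in> pr ` affcone a b"
proof -
  obtain z where z: "z \<in> hcone" "x = pr z" using assms by blast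
  then obtain a b where "fst z $ a \<noteq> 0" "snd z $ b \<noteq> 0" by (auto simp: hcone_def vec_eq_iff)
  then show ?thesis using that[of a b] z by (auto simp: affcone_def)
qed

text \<open>A chart of a submanifold is known only through the functions that it pulls back to
  smooth ones. A lift is recovered by pulling back the real coordinates of \<open>affrep a b\<close>
  one at a time and reassembling them on the intersection of the finitely many domains.\<close>

lemma pullback_lift:
  fixes E :: "hvec set"
  assumes E: "openin (top_of_set V0) E" "subspace V0" and im: "\<sigma> ` E \<subseteq> pr ` hcone"
    and pull: "\<And>u g. u \<in> E \<Longrightarrow> smooth_near PP (\<sigma> u) g \<Longrightarrow>
      \<exists>W. openin (top_of_set E) W \<and> u \<in> W \<and> smooth_on W (\<lambda>w. g (\<sigma> w))"
  shows "local_lifts E \<sigma>"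
  unfolding local_lifts_def
proof
  fix u assume u: "u \<in> E"
  then obtain a b where ab: "\<sigma> u \<in> pr ` affcone a b" using in_affcone im by blast
  let ?A = "pr ` affcone a b"
  have near: "smooth_near PP (\<sigma> u) g" if "smooth_fun_on PP ?A g" for g
    using that openin_affcone ab unfolding smooth_near_def by blast
  \<comment> \<open>The indicator of the affine piece is constant on it, hence smooth near \<sigma>
    u. Its pull-back is then continuous, which keeps nearby values of \<sigma> inside the
    piece.\<close>
  have "smooth_fun_on PP ?A (indicat_real ?A)"
    unfolding smooth_fun_on_def by (auto intro!: smooth_on_cong[OF smooth_on_const[of _ 1]])
  then obtain W0 where W0: "openin (top_of_set E) W0" "u \<in> W0" "smooth_on W0 (\<lambda>w. indicat_real ?A (\<sigma> w))"
    using pull[OF u near] by blast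
  have "\<exists>W. openin (top_of_set E) W \<and> u \<in> W \<and> smooth_on W (\<lambda>w. affrep a b (\<sigma> w) \<bullet> e)" for e
    by (rule pull[OF u near]) (rule smooth_fun_on_bounded_linear[OF bounded_linear_inner_left smooth_affrep])
  then obtain W where W: "\<And>e. openin (top_of_set E) (W e)" "\<And>e. u \<in> W e"
    "\<And>e. smooth_on (W e) (\<lambda>w. affrep a b (\<sigma> w) \<bullet> e)" by metis
  \<comment> \<open>An indicator that exceeds 1/2 is 1.\<close>
  let ?W0 = "W0 \<inter> (\<lambda>w. indicat_real ?A (\<sigma> w)) -` {1/2<..}"
  have "openin (top_of_set W0) ?W0"
    by (intro continuous_openin_preimage_gen smooth_on_continuous W0(3)) simp
  then have "openin (top_of_set E) ?W0" using W0(1) openin_trans by blast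
  moreover have "openin (top_of_set E) (\<Inter>e\<in>Basis. W e)"
    using W(1) by (intro openin_Inter) auto
  ultimately have o: "openin (top_of_set E) (?W0 \<inter> (\<Inter>e\<in>Basis. W e))" (is "openin _ ?W") by (rule openin_Int)
  have "smooth_on ?W (\<lambda>w. \<Sum>e\<in>Basis. (affrep a b (\<sigma> w) \<bullet> e) *\<^sub>R e)"
    by (intro smooth_on_sum smooth_on_bounded_linear[OF bounded_linear_scaleR_left]
        smooth_on_subset[OF W(3)]) auto
  then have s: "smooth_on ?W (\<lambda>w. affrep a b (\<sigma> w))" by (simp add: euclidean_representation)
  have A: "\<sigma> w \<in> ?A" if "w \<in> ?W" for w
    using that by (cases "\<sigma> w \<in> ?A") auto
  show "\<exists>W L. openin (top_of_set E) W \<and> u \<in> W \<and> smooth_on W L \<and> L ` W \<subseteq> hcone \<and> (\<forall>w\<in>W. \<sigma> w = pr (L w))"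
  proof (intro exI conjI ballI)
    show "u \<in> ?W" using ab W0 W(2) by (auto simp: indicator_def)
    show "(\<lambda>w. affrep a b (\<sigma> w)) ` ?W \<subseteq> hcone" by (rule image_subsetI) (rule pr_affrep(1)[OF A])
    show "\<sigma> w = pr (affrep a b (\<sigma> w))" if "w \<in> ?W" for w using pr_affrep(2)[OF A[OF that]] by simp
  qed (use o s in auto)
qed

text \<open>Local extension from N to the ambient product turns the defining conditions, which speak
  of functions on N, into ambient ones. A submanifold of a submanifold thus needs no treatment of
  its own.\<close>

lemma sub_chart_lchart:
  assumes N: "emb N" and S: "S \<subseteq> pts N" and c: "(E, \<sigma>) \<in> sub_charts N d S"
  shows "lchart d S E \<sigma>"
proof -
  note c' = c[unfolded sub_charts_def mem_Collect_eq prod.case]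
  have a1: "openin (top_of_set (span E)) E" and a2: "dim E = d" and a3: "\<forall>u\<in>E. \<forall>g. smooth_near N (\<sigma> u) g \<longrightarrow>
        (\<exists>W. openin (top_of_set E) W \<and> u \<in> W \<and> smooth_on W (\<lambda>w. g (\<sigma> w)))"
    and "\<exists>U r. openin (mtop N) U \<and> \<sigma> ` E = S \<inter> U \<and> smooth_fun_on N U (r :: ppoint \<Rightarrow> hvec) \<and>
        (\<forall>u\<in>E. r (\<sigma> u) = u)"
    by (rule conjunct1[OF c'], rule conjunct1[OF conjunct2[OF c']],
        rule conjunct1[OF conjunct2[OF conjunct2[OF c']]], rule conjunct2[OF conjunct2[OF conjunct2[OF c']]])
  then obtain U and r :: "ppoint \<Rightarrow> hvec" where a4: "openin (mtop N) U" "\<sigma> ` E = S \<inter> U"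
    "smooth_fun_on N U r" "\<forall>u\<in>E. r (\<sigma> u) = u" by blast
  have a5: "r (\<sigma> u) = u" if "u \<in> E" for u using a4(4) that by blast
  have a3': "\<exists>W. openin (top_of_set E) W \<and> u \<in> W \<and> smooth_on W (\<lambda>w. g (\<sigma> w))"
    if "u \<in> E" "smooth_near N (\<sigma> u) g" for u g using a3 that by blast
  note * = a1 a2 a3' a4(1-3) a5
  have im: "\<sigma> ` E \<subseteq> pts N" using *(5) S by blast
  show ?thesis unfolding lchart_def
  proof (intro conjI)
    show "inj_on \<sigma> E" using *(7) by (rule inj_on_inverseI)
    obtain V where "openin (mtop PP) V" "U = V \<inter> pts N"
      using *(4) unfolding embD(2)[OF N] by (auto simp: openin_subtopology)
    then show "\<exists>V. openin (mtop PP) V \<and> \<sigma> ` E = S \<inter> V" using *(5) S by blast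
    show "local_lifts E \<sigma>"
    proof (rule pullback_lift[OF *(1) subspace_span])
      show "\<sigma> ` E \<subseteq> pr ` hcone" using im embD(1)[OF N] by blast
      fix u g assume u: "u \<in> E" "smooth_near PP (\<sigma> u) g"
      then have "smooth_near N (\<sigma> u) g" using emb_near[OF N] im by blast
      then show "\<exists>W. openin (top_of_set E) W \<and> u \<in> W \<and> smooth_on W (\<lambda>w. g (\<sigma> w))" by (rule *(3)[OF u(1)])
    qed
    show "\<forall>u\<in>E. \<exists>V r. openin (mtop PP) V \<and> \<sigma> u \<in> V \<and> smooth_fun_on PP V (r :: ppoint \<Rightarrow> hvec) \<and>
        (\<forall>u'\<in>E. \<sigma> u' \<in> V \<longrightarrow> r (\<sigma> u') = u')"
    proof
      fix u assume "u \<in> E"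
      then have "\<sigma> u \<in> U" using *(5) by blast
      then obtain V r' where "openin (mtop PP) V" "\<sigma> u \<in> V" "smooth_fun_on PP V r'"
        "\<forall>y\<in>V \<inter> pts N. r' y = r y" using emb_extension[OF N *(4) _ *(6)] by blast
      then show "\<exists>V r. openin (mtop PP) V \<and> \<sigma> u \<in> V \<and> smooth_fun_on PP V (r :: ppoint \<Rightarrow> hvec) \<and>
        (\<forall>u'\<in>E. \<sigma> u' \<in> V \<longrightarrow> r (\<sigma> u') = u')"
        using im *(7) by (intro exI[of _ V] exI[of _ r']) auto
    qed
  qed (use * in auto)
qed

lemma nchart_sub_chart:
  assumes N: "emb N" and S: "S \<subseteq> pts N" and c: "nchart d S E L r V"
  shows "(E, \<lambda>u. pr (L u)) \<in> sub_charts N d S"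
proof -
  let ?\<sigma> = "\<lambda>u. pr (L u)"
  have *: "openin (top_of_set (span E)) E" "dim E = d" "openin (mtop PP) V" "?\<sigma> ` E = S \<inter> V"
    "smooth_fun_on PP V r" "\<And>u. u \<in> E \<Longrightarrow> r (pr (L u)) = u"
    using c unfolding nchart_def by (auto simp: image_image)
  have ll: "local_lifts E ?\<sigma>" by (rule nchart_local_lifts[OF c])
  have "\<exists>W. openin (top_of_set E) W \<and> u \<in> W \<and> smooth_on W (\<lambda>w. g (?\<sigma> w))"
    if u: "u \<in> E" and g: "smooth_near N (?\<sigma> u) g" for u g
  proof -
    obtain V' g' where V': "openin (mtop PP) V'" "?\<sigma> u \<in> V'" "smooth_fun_on PP V' g'"
      "\<forall>y\<in>V' \<inter> pts N. g' y = g y" using emb_extend[OF N g] .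
    have "smooth_on (E \<inter> ?\<sigma> -` V') (\<lambda>w. g' (?\<sigma> w))"
      by (rule local_lifts_smooth[OF ll *(1) V'(1,3)])
    then have "smooth_on (E \<inter> ?\<sigma> -` V') (\<lambda>w. g (?\<sigma> w))"
    proof (rule smooth_on_cong)
      fix w assume w: "w \<in> E \<inter> ?\<sigma> -` V'"
      then have "?\<sigma> w \<in> S" using *(4) by blast
      then show "g' (?\<sigma> w) = g (?\<sigma> w)" using V'(4) w S by auto
    qed
    then show ?thesis using local_lifts_preimage[OF ll V'(1)] u V'(2) by blast
  qed
  moreover have "openin (mtop N) (pts N \<inter> V)"
    unfolding embD(2)[OF N] using *(3) by (simp add: openin_subtopology_Int2)
  moreover have "smooth_fun_on N (pts N \<inter> V) r"
    using emb_restrict[OF N *(3,5)] unfolding smooth_fun_on_def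
    by (auto elim!: smooth_on_subset dest!: bspec)
  moreover have "?\<sigma> ` E = S \<inter> (pts N \<inter> V)" using *(4) S by blast
  ultimately show ?thesis unfolding sub_charts_def
    using *(1,2,6) by (auto intro!: exI[of _ "pts N \<inter> V"] exI[of _ r])
qed

lemma complex_submfd_sub_smfd:
  assumes N: "emb N" and S: "S \<subseteq> pts N" and cover: "\<And>x. x \<in> S \<Longrightarrow> \<exists>E L r V. nchart d S E L r V \<and> x \<in> V"
  shows "complex_submfd (sub_smfd N d S) d"
proof
  show "pts (sub_smfd N d S) \<subseteq> pr ` hcone" using S embD(1)[OF N] by (auto simp: sub_smfd_def)
  show "lchart d (pts (sub_smfd N d S)) E \<sigma>" if "(E, \<sigma>) \<in> charts (sub_smfd N d S)" for E \<sigma>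
    using sub_chart_lchart[OF N S] that by (simp add: sub_smfd_def)
  show "\<exists>E L r V. nchart d (pts (sub_smfd N d S)) E L r V \<and> x \<in> V \<and>
      (E, \<lambda>u. pr (L u)) \<in> charts (sub_smfd N d S)" if x: "x \<in> pts (sub_smfd N d S)" for x
  proof -
    obtain E L r V where "nchart d S E L r V" "x \<in> V" using cover[of x] x by (auto simp: sub_smfd_def)
    then show ?thesis using nchart_sub_chart[OF N S, of d E L r V]
      by (intro exI[of _ E] exI[of _ L] exI[of _ r] exI[of _ V]) (simp add: sub_smfd_def)
  qed
  show "form (sub_smfd N d S) x \<xi> \<eta> = form PP x (push PP (\<lambda>y. y) x \<xi>) (push PP (\<lambda>y. y) x \<eta>)"
    if "x \<in> pts (sub_smfd N d S)" for x \<xi> \<eta>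
  proof -
    have "x \<in> pts N" using that S by (auto simp: sub_smfd_def)
    then show ?thesis using emb_form[OF N] by (simp add: sub_smfd_def)
  qed
qed

text \<open>Needed for the fibres without the base set, which are open pieces of closed
  fibres.\<close>

lemma nchart_open_subset:
  assumes c: "nchart d S E L r V" and V': "openin (mtop PP) V'" and x: "x \<in> S \<inter> V'" "x \<in> V"
  shows "nchart d (S \<inter> V') (E \<inter> (\<lambda>u. pr (L u)) -` V') L r (V \<inter> V')"
proof -
  let ?E = "E \<inter> (\<lambda>u. pr (L u)) -` V'"
  have *: "openin (top_of_set (span E)) E" "dim E = d" "mult_i ` span E \<subseteq> span E" "L ` E \<subseteq> hcone" "smooth_on E L"
     "\<forall>u\<in>E. \<exists>L'. (L has_derivative L') (at u) \<and> (\<forall>v. L' (mult_i v) = mult_i (L' v))"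
     "openin (mtop PP) V" "pr ` L ` E = S \<inter> V" "smooth_fun_on PP V r" "\<forall>u\<in>E. r (pr (L u)) = u"
    using c unfolding nchart_def by auto
  have "openin (top_of_set E) ?E" by (rule local_lifts_preimage[OF nchart_local_lifts[OF c] V'])
  then have o: "openin (top_of_set (span E)) ?E" using *(1) openin_trans by blast
  have "x \<in> pr ` L ` E" using *(8) x by blast
  then have ne: "?E \<noteq> {}" using x by auto
  \<comment> \<open>The type of a chart records the span and dimension of its domain. A nonempty
    relatively open subset still spans the subspace, since it contains short segments in all its
    directions; nonemptiness comes from x.\<close>
  have sp: "span ?E = span E"
  proof
    show "span ?E \<subseteq> span E" by (intro span_mono) auto
    show "span E \<subseteq> span ?E"
    proof
      fix v assume v: "v \<in> span E"
      obtain u where u: "u \<in> ?E" using ne by blast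
      have "eventually (\<lambda>t. u + t *\<^sub>R v \<in> ?E) (nhds (0::real))"
        by (rule line_eventually[OF o subspace_span u v])
      then have "eventually (\<lambda>t. u + t *\<^sub>R v \<in> ?E) (at (0::real))"
        by (simp add: eventually_nhds_conv_at)
      from eventually_conj[OF this eventually_neq_at_within[of 0 0 UNIV]]
      obtain t :: real where t: "u + t *\<^sub>R v \<in> ?E \<and> t \<noteq> 0"
        using eventually_happens'[OF at_neq_bot[of "0 :: real"]] by blast
      have "(u + t *\<^sub>R v) - u \<in> span ?E" using t u by (intro span_diff span_base) auto
      then have "(1 / t) *\<^sub>R ((u + t *\<^sub>R v) - u) \<in> span ?E" by (rule span_scale)
      then show "v \<in> span ?E" using t by simp
    qed
  qed
  have "dim ?E = d" using sp *(2) by (metis dim_span)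
  moreover have "smooth_fun_on PP (V \<inter> V') r"
    using *(9) unfolding smooth_fun_on_def by (auto elim!: smooth_on_subset dest!: bspec)
  moreover have "pr ` L ` ?E = (pr ` L ` E) \<inter> V'" by blast
  then have "pr ` L ` ?E = (S \<inter> V') \<inter> (V \<inter> V')" unfolding *(8) by blast
  moreover have "smooth_on ?E L" using *(5) by (rule smooth_on_subset) auto
  ultimately show ?thesis unfolding nchart_def sp
    using * o V' by (auto intro: openin_Int)
qed

lemma velocity_cong:
  assumes "eventually (\<lambda>t. \<gamma> t = \<delta> t) (nhds (0::real))"
  shows "velocity M \<gamma> = velocity M \<delta>"
proof
  fix g
  have "\<gamma> 0 = \<delta> 0" using assms eventually_nhds_x_imp_x by blast
  moreover have "deriv (\<lambda>t. g (\<gamma> t)) 0 = deriv (\<lambda>t. g (\<delta> t)) 0"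
    using assms by (intro deriv_cong_ev refl) (auto elim: eventually_mono)
  ultimately show "velocity M \<gamma> g = velocity M \<delta> g" by (simp add: velocity_def)
qed

lemma emb_push_velocity:
  assumes N: "emb N" and c: "(c has_vector_derivative w) (at 0)" "c 0 \<in> hcone"
    and ev: "eventually (\<lambda>t. pr (c t) \<in> pts N) (nhds (0::real))"
  shows "push PP (\<lambda>y. y) (pr (c 0)) (velocity N (\<lambda>t. pr (c t))) = Pvec (c 0) w"
proof
  fix g
  show "push PP (\<lambda>y. y) (pr (c 0)) (velocity N (\<lambda>t. pr (c t))) g = Pvec (c 0) w g"
  proof (cases "smooth_near PP (pr (c 0)) g")
    case True
    have "pr (c 0) \<in> pts N" using ev eventually_nhds_x_imp_x by fast
    then have "smooth_near N (pr (c 0)) g" using True emb_near[OF N] by blast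
    moreover have "((\<lambda>t. g (pr (c t))) has_real_derivative Pvec (c 0) w g) (at 0)"
      by (rule Pvec_curve[OF c True])
    ultimately show ?thesis using True by (simp add: push_def velocity_def DERIV_imp_deriv)
  qed (simp add: push_def Pvec_not_near)
qed

lemma emb_velocity_eval:
  assumes N: "emb N" and c: "(c has_vector_derivative w) (at 0)" "c 0 \<in> hcone"
    and ev: "eventually (\<lambda>t. pr (c t) \<in> pts N) (nhds (0::real))"
    and V: "openin (mtop PP) V" "pr (c 0) \<in> V" "smooth_fun_on PP V g'" "\<forall>y\<in>V \<inter> pts N. g' y = g y"
  shows "velocity N (\<lambda>t. pr (c t)) g = Pvec (c 0) w g'"
proof -
  have "pr (c 0) \<in> pts N" using ev eventually_nhds_x_imp_x by fast
  then have "smooth_near N (pr (c 0)) g" using emb_near_cong[OF N _ V] by blast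
  then show ?thesis
    using emb_curve[OF N c ev V] by (simp add: velocity_def DERIV_imp_deriv)
qed

section \<open>Lifting tangent vectors\<close>

text \<open>A relation rather than a map: w is determined only up to the directions
  \<open>scal a b z\<close> that \<open>pr\<close> contracts, and one tangent vector has lifts at
  every representative z of its base point.\<close>

definition lft :: "(ppoint, hvec) smfd \<Rightarrow> hvec \<Rightarrow> hvec \<Rightarrow> ppoint tvec \<Rightarrow> bool" where
  "lft N z w \<xi> \<longleftrightarrow> z \<in> hcone \<and> \<xi> \<in> tangent_space N (pr z) \<and> push PP (\<lambda>y. y) (pr z) \<xi> = Pvec z w"

context complex_submfd
begin

text \<open>Tangent vectors are defined as velocities of straight lines in charts. Reading the curve
  through the local inverse r of the chart and replacing it by its tangent line admits arbitrary
  curves, in any prescribed chart.\<close>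

lemma curve_tangent:
  assumes c: "(c has_vector_derivative w) (at 0)" "c 0 \<in> hcone"
    and ev: "eventually (\<lambda>t. pr (c t) \<in> pts N) (nhds (0::real))"
    and E: "(E, \<sigma>) \<in> charts N" "u \<in> E" "\<sigma> u = pr (c 0)"
  obtains v where "v \<in> span E" "velocity N (\<lambda>t. pr (c t)) = chart_vec N \<sigma> u v"
proof -
  obtain V r where V: "openin (mtop PP) V" "\<sigma> u \<in> V" "smooth_fun_on PP V (r :: ppoint \<Rightarrow> hvec)"
    "\<forall>u'\<in>E. \<sigma> u' \<in> V \<longrightarrow> r (\<sigma> u') = u'"
    using charts_lchart[OF E(1)] E(2) unfolding lchart_def by blast
  obtain V0 where V0: "openin (mtop PP) V0" "\<sigma> ` E = pts N \<inter> V0"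
    using charts_lchart[OF E(1)] unfolding lchart_def by blast
  have o: "open (hcone \<inter> pr -` V)" "open (hcone \<inter> pr -` V0)" using V V0 openin_PP by blast+
  have cV: "c 0 \<in> hcone \<inter> pr -` V" "c 0 \<in> hcone \<inter> pr -` V0"
    using V(2) E(3) c(2) V0(2) imageI[OF E(2), of \<sigma>] by auto
  have tend: "(c \<longlongrightarrow> c 0) (at 0)"
    using has_vector_derivative_continuous[OF c(1)] by (simp add: continuous_within)
  have evQ: "eventually (\<lambda>t. c t \<in> Q) (nhds 0)" if "open Q" "c 0 \<in> Q" for Q
    unfolding eventually_nhds_conv_at using topological_tendstoD[OF tend that] that by blast
  define \<gamma> where "\<gamma> t = r (pr (c t))" for t
  have ev2: "eventually (\<lambda>t. \<gamma> t \<in> E \<and> \<sigma> (\<gamma> t) = pr (c t)) (nhds 0)"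
    using ev evQ[OF o(1) cV(1)] evQ[OF o(2) cV(2)]
  proof eventually_elim
    case (elim t)
    then have "pr (c t) \<in> \<sigma> ` E" using V0(2) by blast
    then obtain u' where "u' \<in> E" "\<sigma> u' = pr (c t)" by force
    then show ?case using V(4) elim by (auto simp: \<gamma>_def)
  qed
  have "smooth_on (hcone \<inter> pr -` V) (\<lambda>y. r (pr y))" using V(3) smooth_PP[OF o(1)] by blast
  then obtain R where R: "((\<lambda>y. r (pr y)) has_derivative R) (at (c 0) within hcone \<inter> pr -` V)"
    using smooth_on_has_derivative cV(1) by blast
  then have R: "((\<lambda>y. r (pr y)) has_derivative R) (at (c 0))"
    using at_within_open[OF cV(1) o(1)] by simp
  have "(\<gamma> has_derivative (\<lambda>s. R (s *\<^sub>R w))) (at 0)"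
    using has_derivative_compose[OF c(1)[unfolded has_vector_derivative_def] R] by (simp add: \<gamma>_def[abs_def])
  then have \<gamma>: "(\<gamma> has_vector_derivative R w) (at 0)"
    unfolding has_vector_derivative_def by (simp add: linear_scale[OF has_derivative_linear[OF R]])
  have \<gamma>0: "\<gamma> 0 = u" using V(2,4) E(2) unfolding \<gamma>_def E(3)[symmetric] by blast
  \<comment> \<open>The coordinate curve \<gamma> stays in E, so the projection onto the span fixes
    it and therefore fixes its velocity.\<close>
  have "R w \<in> span E"
  proof -
    obtain P where P: "bounded_linear P" "range P \<subseteq> span E" "\<And>v. v \<in> span E \<Longrightarrow> P v = v"
      using exists_projection[OF subspace_span] by metis
    have "((\<lambda>t. P (\<gamma> t)) has_vector_derivative P (R w)) (at 0)"
      by (rule bounded_linear.has_vector_derivative[OF P(1) \<gamma>])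
    moreover have "eventually (\<lambda>t. P (\<gamma> t) = \<gamma> t) (nhds 0)"
      using ev2 by eventually_elim (use P(3)[OF span_base] in blast)
    ultimately have "(\<gamma> has_vector_derivative P (R w)) (at 0)"
      using has_vector_derivative_cong_ev[where f = "\<lambda>t. P (\<gamma> t)" and g = \<gamma> and x = 0 and S = UNIV]
        eventually_nhds_x_imp_x[of "\<lambda>t. P (\<gamma> t) = \<gamma> t" 0] by simp
    then have "P (R w) = R w" using \<gamma> vector_derivative_unique_at by blast
    then show ?thesis using P(2) by (metis rangeI subsetD)
  qed
  moreover have "velocity N (\<lambda>t. pr (c t)) = chart_vec N \<sigma> u (R w)"
  proof
    fix g
    show "velocity N (\<lambda>t. pr (c t)) g = chart_vec N \<sigma> u (R w) g"
    proof (cases "smooth_near N (\<sigma> u) g")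
      case True
      then obtain U where U: "openin (mtop N) U" "\<sigma> u \<in> U" "smooth_fun_on N U g"
        unfolding smooth_near_def by blast
      let ?E = "E \<inter> \<sigma> -` U"
      have oE: "openin (top_of_set E) ?E" using U(1) E(1) by (auto simp: openin_mtop)
      then have oE': "openin (top_of_set (span E)) ?E" using chartD(1)[OF E(1)] openin_trans by blast
      have g: "smooth_on ?E (\<lambda>u. g (\<sigma> u))" using U(3) E(1) unfolding smooth_fun_on_def by blast
      have uE: "u \<in> ?E" using E U by simp
      obtain F where F: "((\<lambda>u. g (\<sigma> u)) has_derivative F) (at u within ?E)"
        using smooth_on_has_derivative[OF g uE] .
      have 1: "((\<lambda>t. g (\<sigma> (u + t *\<^sub>R R w))) has_vector_derivative F (R w)) (at 0)"
        by (rule line_derivative[OF oE' subspace_span uE \<open>R w \<in> span E\<close> F])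
      obtain T where T: "open T" "?E = E \<inter> T" using oE by (auto simp: openin_open)
      have "(\<gamma> \<longlongrightarrow> \<gamma> 0) (at 0)"
        using has_vector_derivative_continuous[OF \<gamma>] by (simp add: continuous_within)
      then have "eventually (\<lambda>t. \<gamma> t \<in> T) (nhds 0)"
        unfolding eventually_nhds_conv_at using topological_tendstoD[of \<gamma> "\<gamma> 0" "at 0" T] T uE \<gamma>0 by auto
      then have "eventually (\<lambda>t. \<gamma> t \<in> ?E \<and> \<sigma> (\<gamma> t) = pr (c t)) (nhds 0)"
        unfolding T(2) using ev2 by eventually_elim auto
      then obtain S where S: "open S" "0 \<in> S" "\<And>t. t \<in> S \<Longrightarrow> \<gamma> t \<in> ?E \<and> \<sigma> (\<gamma> t) = pr (c t)"
        unfolding eventually_nhds by blast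
      have "((\<lambda>t. g (\<sigma> (\<gamma> t))) has_derivative (\<lambda>s. F (s *\<^sub>R R w))) (at 0 within S)"
      proof (rule has_derivative_in_compose[where f = \<gamma> and g = "\<lambda>u. g (\<sigma> u)"])
        show "(\<gamma> has_derivative (\<lambda>s. s *\<^sub>R R w)) (at 0 within S)"
          using \<gamma> by (auto simp: has_vector_derivative_def intro: has_derivative_at_withinI)
        show "((\<lambda>u. g (\<sigma> u)) has_derivative F) (at (\<gamma> 0) within \<gamma> ` S)"
          unfolding \<gamma>0 by (rule has_derivative_subset[OF F]) (use S(3) in blast)
      qed
      then have "((\<lambda>t. g (pr (c t))) has_derivative (\<lambda>s. F (s *\<^sub>R R w))) (at 0 within S)"
        by (rule has_derivative_transform[rotated 2]) (use S in auto)
      then have "((\<lambda>t. g (pr (c t))) has_vector_derivative F (R w)) (at 0)"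
        unfolding at_within_open[OF S(2,1)] has_vector_derivative_def
        by (simp add: linear_scale[OF has_derivative_linear[OF F]])
      then show ?thesis using 1 True E(3)
        by (simp add: chart_vec_def velocity_def DERIV_imp_deriv
            has_real_derivative_iff_has_vector_derivative[symmetric])
    qed (use E in \<open>simp add: chart_vec_def velocity_def\<close>)
  qed
  ultimately show ?thesis using that by blast
qed

lemma curve_lft:
  assumes c: "(c has_vector_derivative w) (at 0)" "c 0 = z" "z \<in> hcone"
    and ev: "eventually (\<lambda>t. pr (c t) \<in> pts N) (nhds (0::real))"
  shows "lft N z w (velocity N (\<lambda>t. pr (c t)))"
proof -
  have c0: "c 0 \<in> hcone" using c by simp
  have "pr z \<in> pts N" using ev eventually_nhds_x_imp_x c(2) by fast
  then obtain E L r V u where "(E, \<lambda>u. pr (L u)) \<in> charts N" "u \<in> E" "pr (L u) = pr z"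
    by (rule nice_chart)
  then obtain v where "v \<in> span E" "velocity N (\<lambda>t. pr (c t)) = chart_vec N (\<lambda>u. pr (L u)) u v"
    using curve_tangent[OF c(1) c0 ev, of E "\<lambda>u. pr (L u)" u] c(2) by metis
  then have "velocity N (\<lambda>t. pr (c t)) \<in> tangent_space N (pr z)"
    unfolding tangent_space_def
    using \<open>(E, \<lambda>u. pr (L u)) \<in> charts N\<close> \<open>u \<in> E\<close> \<open>pr (L u) = pr z\<close> by blast
  then show ?thesis
    using emb_push_velocity[OF emb c(1) c0 ev] c by (simp add: lft_def)
qed

lemma chart_curve:
  assumes E: "(E, \<sigma>) \<in> charts N" and W: "openin (top_of_set E) W" "u \<in> W" "smooth_on W L" "L ` W \<subseteq> hcone"
    "\<forall>w\<in>W. \<sigma> w = pr (L w)" and v: "v \<in> span E"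
  shows "((\<lambda>t. L (u + t *\<^sub>R v)) has_vector_derivative dd L u v) (at 0)"
    and "eventually (\<lambda>t. pr (L (u + t *\<^sub>R v)) \<in> pts N) (nhds 0)"
    and "chart_vec N \<sigma> u v = velocity N (\<lambda>t. pr (L (u + t *\<^sub>R v)))"
proof -
  have oW: "openin (top_of_set (span E)) W" using W(1) chartD(1)[OF E] openin_trans by blast
  show "((\<lambda>t. L (u + t *\<^sub>R v)) has_vector_derivative dd L u v) (at 0)"
    by (rule smooth_on_dd_derivative[OF W(3) oW subspace_span W(2) v])
  have ev: "eventually (\<lambda>t. u + t *\<^sub>R v \<in> W) (nhds 0)"
    by (rule line_eventually[OF oW subspace_span W(2) v])
  have "\<sigma> ` W \<subseteq> pts N" using chartD(5)[OF E] openin_imp_subset[OF W(1)] by blast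
  then have sub: "pr (L w) \<in> pts N" if "w \<in> W" for w using W(5) that by force
  show "eventually (\<lambda>t. pr (L (u + t *\<^sub>R v)) \<in> pts N) (nhds 0)"
    using ev by eventually_elim (rule sub)
  show "chart_vec N \<sigma> u v = velocity N (\<lambda>t. pr (L (u + t *\<^sub>R v)))"
    unfolding chart_vec_def by (rule velocity_cong) (use ev W(5) in \<open>auto elim!: eventually_mono\<close>)
qed

lemma chart_lft:
  assumes E: "(E, \<sigma>) \<in> charts N" and W: "openin (top_of_set E) W" "u \<in> W" "smooth_on W L" "L ` W \<subseteq> hcone"
    "\<forall>w\<in>W. \<sigma> w = pr (L w)" and v: "v \<in> span E"
  shows "lft N (L u) (dd L u v) (chart_vec N \<sigma> u v)"
  unfolding chart_curve(3)[OF assms]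
  by (rule curve_lft[OF chart_curve(1)[OF assms] _ _ chart_curve(2)[OF assms]]) (use W in auto)

lemma tangent_curve:
  assumes "\<xi> \<in> tangent_space N x"
  obtains c w where "(c has_vector_derivative w) (at 0)" "c 0 \<in> hcone" "pr (c 0) = x"
    "eventually (\<lambda>t. pr (c t) \<in> pts N) (nhds (0::real))" "\<xi> = velocity N (\<lambda>t. pr (c t))"
proof -
  obtain E \<sigma> u v where E: "\<xi> = chart_vec N \<sigma> u v" "(E, \<sigma>) \<in> charts N" "u \<in> E" "\<sigma> u = x" "v \<in> span E"
    using assms unfolding tangent_space_def by blast
  obtain W L where W: "openin (top_of_set E) W" "u \<in> W" "smooth_on W L" "L ` W \<subseteq> hcone"
    "\<forall>w\<in>W. \<sigma> w = pr (L w)"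
    using chartD(4)[OF E(2)] E(3) unfolding local_lifts_def by blast
  let ?c = "\<lambda>t. L (u + t *\<^sub>R v)"
  note cc = chart_curve[OF E(2) W E(5)]
  show ?thesis
    by (rule that[of ?c, OF cc(1) _ _ cc(2)]) (use W E cc(3) in auto)
qed

text \<open>The definition of the tangent space collects vectors from all charts through the point.
  Passing through a curve shows that any single chart already produces them all.\<close>

lemma tangent_in_chart:
  assumes "\<xi> \<in> tangent_space N x" "(E, \<sigma>) \<in> charts N" "u \<in> E" "\<sigma> u = x"
  obtains v where "v \<in> span E" "\<xi> = chart_vec N \<sigma> u v"
proof -
  obtain c w where c: "(c has_vector_derivative w) (at 0)" "c 0 \<in> hcone" "pr (c 0) = x"
    "eventually (\<lambda>t. pr (c t) \<in> pts N) (nhds (0::real))" "\<xi> = velocity N (\<lambda>t. pr (c t))"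
    using tangent_curve[OF assms(1)] .
  obtain v where "v \<in> span E" "velocity N (\<lambda>t. pr (c t)) = chart_vec N \<sigma> u v"
    using curve_tangent[OF c(1,2,4) assms(2,3)] assms(4) c(3) by metis
  then show ?thesis using that c(5) by blast
qed

text \<open>A lift describes a tangent vector only on functions smooth on the ambient product. Local
  extension determines its remaining values, and hence the vector itself.\<close>

lemma lft_eval:
  assumes "lft N z w \<xi>" and V: "openin (mtop PP) V" "pr z \<in> V" "smooth_fun_on PP V g'"
    "\<forall>y\<in>V \<inter> pts N. g' y = g y"
  shows "\<xi> g = Pvec z w g'"
proof -
  have l: "\<xi> \<in> tangent_space N (pr z)" "push PP (\<lambda>y. y) (pr z) \<xi> = Pvec z w"
    using assms(1) by (auto simp: lft_def)
  obtain c w' where c: "(c has_vector_derivative w') (at 0)" "c 0 \<in> hcone" "pr (c 0) = pr z"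
    "eventually (\<lambda>t. pr (c t) \<in> pts N) (nhds (0::real))" "\<xi> = velocity N (\<lambda>t. pr (c t))"
    using tangent_curve[OF l(1)] .
  have "\<xi> g = Pvec (c 0) w' g'"
    using emb_velocity_eval[OF emb c(1,2,4) V(1) _ V(3,4)] V(2) c(3,5) by simp
  also have "\<dots> = Pvec z w g'" using emb_push_velocity[OF emb c(1,2,4)] c(3,5) l(2) by simp
  finally show ?thesis .
qed

lemma tangent_not_near:
  assumes "\<xi> \<in> tangent_space N x" "\<not> smooth_near N x g" shows "\<xi> g = 0"
  using assms unfolding tangent_space_def by (auto simp: chart_vec_def velocity_def)

lemma lft_unique:
  assumes "lft N z w \<xi>" "lft N z w \<eta>" shows "\<xi> = \<eta>"
proof
  fix g
  show "\<xi> g = \<eta> g"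
  proof (cases "smooth_near N (pr z) g")
    case True
    then obtain V g' where V: "openin (mtop PP) V" "pr z \<in> V" "smooth_fun_on PP V g'"
      "\<forall>y\<in>V \<inter> pts N. g' y = g y" using emb_extend[OF emb] by blast
    show ?thesis using lft_eval[OF assms(1) V] lft_eval[OF assms(2) V] by simp
  next
    case False
    then show ?thesis using tangent_not_near assms by (metis lft_def)
  qed
qed

lemma tangent_pts: "\<xi> \<in> tangent_space N x \<Longrightarrow> x \<in> pts N"
  unfolding tangent_space_def using chartD(5) by blast

lemma lft_pts: "lft N z w \<xi> \<Longrightarrow> pr z \<in> pts N"
  unfolding lft_def using tangent_pts by blast

lemma lft_vertical: "lft N z w \<xi> \<Longrightarrow> lft N z (w + scal a b z) \<xi>"
proof -
  assume l: "lft N z w \<xi>"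
  then have "Pvec z (w + scal a b z) = Pvec z w"
    using Pvec_linear[of z 1 w 1 "scal a b z"] Pvec_vertical[of z a b] by (auto simp: lft_def fun_eq_iff)
  with l show ?thesis by (simp add: lft_def)
qed

lemma lft_scal: "a \<noteq> 0 \<Longrightarrow> b \<noteq> 0 \<Longrightarrow> lft N z w \<xi> \<Longrightarrow> lft N (scal a b z) (scal a b w) \<xi>"
  by (simp add: lft_def pr_scal Pvec_scal scal_hcone)

lemma lft_eqD: "lft N z w \<xi> \<Longrightarrow> lft N z w' \<xi> \<Longrightarrow> \<exists>a b. w' = w + scal a b z"
  unfolding lft_def using Pvec_eqD by metis

lemma tangent_lft:
  assumes "\<xi> \<in> tangent_space N (pr z)" "z \<in> hcone" obtains w where "lft N z w \<xi>"
proof -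
  obtain c w where c: "(c has_vector_derivative w) (at 0)" "c 0 \<in> hcone" "pr (c 0) = pr z"
    "eventually (\<lambda>t. pr (c t) \<in> pts N) (nhds (0::real))" "\<xi> = velocity N (\<lambda>t. pr (c t))"
    using tangent_curve[OF assms(1)] .
  have l: "lft N (c 0) w \<xi>" unfolding c(5) by (rule curve_lft[OF c(1) refl c(2,4)])
  obtain a b where "a \<noteq> 0" "b \<noteq> 0" "z = scal a b (c 0)" using pr_eqD[OF c(3) assms(2)] .
  then show ?thesis using lft_scal[OF _ _ l] that by blast
qed

lemma chart_vec_linear:
  assumes E: "(E, \<sigma>) \<in> charts N" "u \<in> E" and v: "v \<in> span E" "w \<in> span E"
  shows "chart_vec N \<sigma> u (a *\<^sub>R v + b *\<^sub>R w) = (\<lambda>g. a * chart_vec N \<sigma> u v g + b * chart_vec N \<sigma> u w g)"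
proof
  fix g
  show "chart_vec N \<sigma> u (a *\<^sub>R v + b *\<^sub>R w) g = a * chart_vec N \<sigma> u v g + b * chart_vec N \<sigma> u w g"
  proof (cases "smooth_near N (\<sigma> u) g")
    case True
    then obtain U where U: "openin (mtop N) U" "\<sigma> u \<in> U" "smooth_fun_on N U g"
      unfolding smooth_near_def by blast
    let ?E = "E \<inter> \<sigma> -` U"
    have "openin (top_of_set E) ?E" using U(1) E(1) by (auto simp: openin_mtop)
    then have oE: "openin (top_of_set (span E)) ?E" using chartD(1)[OF E(1)] openin_trans by blast
    have g: "smooth_on ?E (\<lambda>u. g (\<sigma> u))" using U(3) E(1) unfolding smooth_fun_on_def by blast
    have uE: "u \<in> ?E" using E U by simp
    obtain F where F: "((\<lambda>u. g (\<sigma> u)) has_derivative F) (at u within ?E)"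
      using smooth_on_has_derivative[OF g uE] .
    have 1: "chart_vec N \<sigma> u v g = F v" if "v \<in> span E" for v
      using line_derivative[OF oE subspace_span uE that F] True
      by (simp add: chart_vec_def velocity_def DERIV_imp_deriv
            has_real_derivative_iff_has_vector_derivative[symmetric])
    show ?thesis using v linear_add[OF has_derivative_linear[OF F]] linear_scale[OF has_derivative_linear[OF F]]
      by (simp add: 1 span_add span_scale)
  qed (simp add: chart_vec_def velocity_def)
qed

lemma tangent_linear:
  assumes "\<xi> \<in> tangent_space N x" "\<eta> \<in> tangent_space N x"
  shows "(\<lambda>g. a * \<xi> g + b * \<eta> g) \<in> tangent_space N x"
proof -
  obtain E \<sigma> u v where E: "\<xi> = chart_vec N \<sigma> u v" "(E, \<sigma>) \<in> charts N" "u \<in> E" "\<sigma> u = x" "v \<in> span E"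
    using assms(1) unfolding tangent_space_def by blast
  obtain w where w: "w \<in> span E" "\<eta> = chart_vec N \<sigma> u w" using tangent_in_chart[OF assms(2) E(2-4)] .
  have "(\<lambda>g. a * \<xi> g + b * \<eta> g) = chart_vec N \<sigma> u (a *\<^sub>R v + b *\<^sub>R w)"
    using chart_vec_linear[OF E(2,3,5) w(1)] E(1) w(2) by simp
  moreover have "a *\<^sub>R v + b *\<^sub>R w \<in> span E" using E(5) w(1) by (intro span_add span_scale)
  ultimately show ?thesis unfolding tangent_space_def using E(2-4) by blast
qed

lemma lft_linear:
  assumes "lft N z v \<xi>" "lft N z w \<eta>"
  shows "lft N z (a *\<^sub>R v + b *\<^sub>R w) (\<lambda>g. a * \<xi> g + b * \<eta> g)"
proof -
  have "push PP (\<lambda>y. y) (pr z) (\<lambda>g. a * \<xi> g + b * \<eta> g) =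
    (\<lambda>g. a * push PP (\<lambda>y. y) (pr z) \<xi> g + b * push PP (\<lambda>y. y) (pr z) \<eta> g)"
    by (auto simp: push_def)
  also have "\<dots> = Pvec z (a *\<^sub>R v + b *\<^sub>R w)"
    using assms Pvec_linear[of z a v b w] by (auto simp: lft_def)
  finally show ?thesis using assms tangent_linear by (simp add: lft_def)
qed

lemma lft_zero: "z \<in> hcone \<Longrightarrow> pr z \<in> pts N \<Longrightarrow> lft N z 0 (\<lambda>g. 0)"
proof -
  assume z: "z \<in> hcone" "pr z \<in> pts N"
  have "lft N z 0 (velocity N (\<lambda>t. pr z))"
    by (rule curve_lft[where c = "\<lambda>_. z"]) (use z in auto)
  moreover have "deriv (\<lambda>t::real. k) 0 = 0" for k :: real by (rule DERIV_imp_deriv) simp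
  then have "velocity N (\<lambda>t. pr z) = (\<lambda>g. 0)" by (simp add: velocity_def fun_eq_iff)
  ultimately show ?thesis by simp
qed

text \<open>The differential of a holomorphic lift commutes with multiplication by the imaginary
  unit, which also sends vertical vectors to vertical vectors. Hence the tangent spaces of N are
  complex, whatever representative and lift are used.\<close>

lemma lft_mult_i_chart:
  assumes E: "nchart d (pts N) E L r V" "(E, \<lambda>u. pr (L u)) \<in> charts N" "u \<in> E" and v: "v \<in> span E"
    and l: "lft N z w (chart_vec N (\<lambda>u. pr (L u)) u v)" and z: "pr (L u) = pr z"
  shows "lft N z (mult_i w) (chart_vec N (\<lambda>u. pr (L u)) u (mult_i v))"
proof -
  have Lc: "smooth_on E L" "L ` E \<subseteq> hcone" "mult_i v \<in> span E" using E(1) v by (auto simp: nchart_def)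
  obtain L' where L': "(L has_derivative L') (at u)" "\<And>v. L' (mult_i v) = mult_i (L' v)"
    using E(1,3) unfolding nchart_def by blast
  have dd: "dd L u v = L' v" if "v \<in> span E" for v
    using dd_eq[OF chartD(1)[OF E(2)] subspace_span E(3) that] has_derivative_at_withinI[OF L'(1)] by blast
  have lv: "lft N (L u) (L' v) (chart_vec N (\<lambda>u. pr (L u)) u v)" if "v \<in> span E" for v
    using chart_lft[OF E(2) openin_subtopology_self E(3) Lc(1,2) _ that] dd[OF that] by simp
  obtain a b where ab: "a \<noteq> 0" "b \<noteq> 0" "z = scal a b (L u)"
    using pr_eqD[OF z] l by (auto simp: lft_def)
  have "lft N z (scal a b (L' v)) (chart_vec N (\<lambda>u. pr (L u)) u v)"
    using lft_scal[OF ab(1,2) lv[OF v]] ab(3) by simp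
  then obtain k l where kl: "w = scal a b (L' v) + scal k l z" using lft_eqD assms(5) by blast
  have "lft N z (scal a b (L' (mult_i v))) (chart_vec N (\<lambda>u. pr (L u)) u (mult_i v))"
    using lft_scal[OF ab(1,2) lv[OF Lc(3)]] ab(3) by simp
  from lft_vertical[OF this, of "\<i> * k" "\<i> * l"]
  show ?thesis
    unfolding kl L'(2) unfolding mult_i_def by (simp add: scal_add scal_scal mult.commute)
qed

lemma lft_mult_i:
  assumes "lft N z w \<xi>" obtains \<eta> where "lft N z (mult_i w) \<eta>"
proof -
  have z: "\<xi> \<in> tangent_space N (pr z)" using assms by (simp add: lft_def)
  obtain E L r V u where E: "nchart d (pts N) E L r V" "(E, \<lambda>u. pr (L u)) \<in> charts N" "u \<in> E" "pr (L u) = pr z"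
    using nice_chart[OF lft_pts[OF assms]] by metis
  obtain v where v: "v \<in> span E" "\<xi> = chart_vec N (\<lambda>u. pr (L u)) u v"
    using tangent_in_chart[OF z E(2-4)] .
  show ?thesis by (rule that[OF lft_mult_i_chart[OF E(1-3) v(1) _ E(4)]]) (use assms v(2) in simp)
qed

lemma form_lft:
  assumes "lft N z v \<xi>" "lft N z w \<eta>" shows "form N (pr z) \<xi> \<eta> = omega z v w"
  using form_eq[OF lft_pts[OF assms(1)]] assms form_PP[of z v w] by (simp add: lft_def)

text \<open>The coordinates of the local inverse r are test functions on which a chart vector takes
  the coordinates of v as values.\<close>

lemma chart_vec_eq_0:
  assumes E: "(E, \<sigma>) \<in> charts N" "u \<in> E" "v \<in> span E" and 0: "chart_vec N \<sigma> u v = (\<lambda>g. 0)"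
  shows "v = 0"
proof -
  obtain V r where V: "openin (mtop PP) V" "\<sigma> u \<in> V" "smooth_fun_on PP V (r :: ppoint \<Rightarrow> hvec)"
    "\<forall>u'\<in>E. \<sigma> u' \<in> V \<longrightarrow> r (\<sigma> u') = u'"
    using charts_lchart[OF E(1)] E(2) unfolding lchart_def by blast
  have "openin (top_of_set E) (E \<inter> \<sigma> -` V)" by (rule local_lifts_preimage[OF chartD(4)[OF E(1)] V(1)])
  then have o: "openin (top_of_set (span E)) (E \<inter> \<sigma> -` V)" using chartD(1)[OF E(1)] openin_trans by blast
  have ev: "eventually (\<lambda>t. u + t *\<^sub>R v \<in> E \<inter> \<sigma> -` V) (nhds 0)"
    by (rule line_eventually[OF o subspace_span _ E(3)]) (use E V in auto)
  show "v = 0"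
  proof (rule euclidean_eqI)
    fix b :: hvec assume b: "b \<in> Basis"
    have "smooth_fun_on PP V (\<lambda>y. r y \<bullet> b)" by (rule smooth_fun_on_bounded_linear[OF bounded_linear_inner_left V(3)])
    then have "smooth_near PP (\<sigma> u) (\<lambda>y. r y \<bullet> b)" using V unfolding smooth_near_def by blast
    then have n: "smooth_near N (\<sigma> u) (\<lambda>y. r y \<bullet> b)" using emb_near[OF emb] chartD(5)[OF E(1)] E(2) by blast
    have "deriv (\<lambda>t. r (\<sigma> (u + t *\<^sub>R v)) \<bullet> b) 0 = deriv (\<lambda>t. (u + t *\<^sub>R v) \<bullet> b) 0"
      using ev by (intro deriv_cong_ev refl, eventually_elim) (use V(4) in auto)
    also have "\<dots> = v \<bullet> b"
      by (intro DERIV_imp_deriv) (auto intro!: derivative_eq_intros simp: inner_add_left)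
    finally have "chart_vec N \<sigma> u v (\<lambda>y. r y \<bullet> b) = v \<bullet> b" using n by (simp add: chart_vec_def velocity_def)
    then show "v \<bullet> b = 0 \<bullet> b" using 0 by simp
  qed
qed

text \<open>The tangent space is complex, so w may be tested against \<open>mult_i w\<close>, and
  positivity of the metric then makes w vertical.\<close>

lemma lft_nondegenerate:
  assumes l: "lft N z w \<xi>" and 0: "\<And>v \<eta>. lft N z v \<eta> \<Longrightarrow> omega z w v = 0"
  shows "\<xi> = (\<lambda>g. 0)" "\<exists>a b. w = scal a b z"
proof -
  have z: "z \<in> hcone" using l by (simp add: lft_def)
  obtain \<eta> where "lft N z (mult_i w) \<eta>" using lft_mult_i[OF l] .
  then have "omega z w (mult_i w) = 0" by (rule 0)
  then obtain a b where ab: "w = scal a b z" using omega_J_eq_0[OF z] by metis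
  then show "\<exists>a b. w = scal a b z" by blast
  have "lft N z (0 + scal a b z) (\<lambda>g. 0)" by (rule lft_vertical[OF lft_zero[OF z lft_pts[OF l]]])
  then show "\<xi> = (\<lambda>g. 0)" using lft_unique l ab by simp
qed

end

section \<open>Smoothness and closedness of the form\<close>

lemma bounded_bilinear_herm: "bounded_bilinear (herm :: complex ^ 'n \<Rightarrow> complex ^ 'n \<Rightarrow> complex)"
proof (unfold_locales)
  show "\<exists>K. \<forall>a b :: complex ^ 'n. norm (herm a b) \<le> norm a * norm b * K"
  proof (intro exI allI)
    fix a b :: "complex ^ 'n"
    have "norm (herm a b) \<le> (\<Sum>i\<in>UNIV. norm (a $ i * cnj (b $ i)))" unfolding herm_def by (rule norm_sum)
    also have "\<dots> \<le> (\<Sum>i\<in>(UNIV :: 'n set). norm a * norm b)"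
      by (intro sum_mono) (simp add: norm_mult mult_mono Finite_Cartesian_Product.norm_nth_le)
    finally show "norm (herm a b) \<le> norm a * norm b * real CARD('n)" by (simp add: mult_ac)
  qed
qed (simp_all add: herm_add_left herm_add_right herm_scaleR_left herm_scaleR_right scaleR_conv_of_real[where 'a = complex])

lemma fs_lifted_Re:
  "fs_lifted z v w = Im (herm v z * herm z w) / (Re (herm z z))\<^sup>2 - Im (herm v w) / Re (herm z z)"
  by (simp only: fs_lifted_eq herm_self Re_complex_of_real)

lemma smooth_on_fs_lifted:
  assumes "smooth_on D f" "smooth_on D g" "smooth_on D h" "\<And>u. u \<in> D \<Longrightarrow> f u \<noteq> 0"
  shows "smooth_on D (\<lambda>u. fs_lifted (f u) (g u) (h u))"
proof -
  have "Re (herm (f u) (f u)) \<noteq> 0" if "u \<in> D" for u using assms(4)[OF that] by (simp add: herm_self)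
  then show ?thesis unfolding fs_lifted_Re power2_eq_square
    by (intro smooth_on_diff smooth_on_divide smooth_on_mult smooth_on_bounded_linear[OF bounded_linear_Im]
        smooth_on_bounded_linear[OF bounded_linear_Re] smooth_on_bilinear[OF bounded_bilinear_herm] assms)
       auto
qed

lemma smooth_on_omega:
  assumes "smooth_on D f" "smooth_on D g" "smooth_on D h" "\<And>u. u \<in> D \<Longrightarrow> f u \<in> hcone"
  shows "smooth_on D (\<lambda>u. omega (f u) (g u) (h u))"
  unfolding omega_def using assms(4)
  by (intro smooth_on_add smooth_on_fs_lifted smooth_on_fst smooth_on_snd assms(1-3)) (auto simp: hcone_def)

text \<open>The derivative of \<open>fs_lifted\<close> in its base point z, in the direction s, with
  v and w held fixed.\<close>

definition dfs :: "complex ^ 'n \<Rightarrow> complex ^ 'n \<Rightarrow> complex ^ 'n \<Rightarrow> complex ^ 'n \<Rightarrow> real" where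
  "dfs z s v w = (Im (herm v s * herm z w) + Im (herm v z * herm s w)) / (Re (herm z z))\<^sup>2
     - 4 * Im (herm v z * herm z w) * Re (herm s z) / (Re (herm z z)) ^ 3
     + 2 * Im (herm v w) * Re (herm s z) / (Re (herm z z))\<^sup>2"

lemma quotient_difference_derivative:
  assumes p: "(p has_real_derivative p') (at t)" and q: "(q has_real_derivative q') (at t)"
    and n: "(n has_real_derivative n') (at t)" and n0: "n t \<noteq> 0"
  shows "((\<lambda>t. p t / (n t)\<^sup>2 - q t / n t) has_real_derivative
    (p' / (n t)\<^sup>2 - 2 * p t * n' / (n t) ^ 3) - (q' / n t - q t * n' / (n t)\<^sup>2)) (at t)"
proof -
  have "((\<lambda>t. p t / (n t)\<^sup>2 - q t / n t) has_real_derivative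
      (p' * (n t)\<^sup>2 - p t * (2 * n t * n')) / ((n t)\<^sup>2 * (n t)\<^sup>2) - (q' * n t - q t * n') / (n t * n t)) (at t)"
    using n0 by (auto intro!: derivative_eq_intros p q n simp: power2_eq_square)
  moreover have "(p' * N\<^sup>2 - P * (2 * N * n')) / (N\<^sup>2 * N\<^sup>2) - (q' * N - Q * n') / (N * N) =
      (p' / N\<^sup>2 - 2 * P * n' / N ^ 3) - (q' / N - Q * n' / N\<^sup>2)" if "N \<noteq> 0" for N P Q :: real
    using that by (simp add: field_simps power2_eq_square power3_eq_cube)
  ultimately show ?thesis using n0 by simp
qed

lemma fs_lifted_derivative:
  assumes z: "(z has_vector_derivative z') (at t)" and v: "(v has_vector_derivative v') (at t)"
    and w: "(w has_vector_derivative w') (at t)" and nz: "z t \<noteq> 0"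
  shows "((\<lambda>t. fs_lifted (z t) (v t) (w t)) has_real_derivative
    dfs (z t) z' (v t) (w t) + fs_lifted (z t) v' (w t) + fs_lifted (z t) (v t) w') (at t)"
proof -
  have h: "((\<lambda>t. herm (f t) (g t)) has_vector_derivative herm (f t) g' + herm f' (g t)) (at t)"
    if "(f has_vector_derivative f') (at t)" "(g has_vector_derivative g') (at t)"
    for f g :: "real \<Rightarrow> complex ^ 'a" and f' g'
    using bounded_bilinear.has_vector_derivative[OF bounded_bilinear_herm that] .
  have Im: "((\<lambda>t. Im (f t)) has_real_derivative Im f') (at t)"
    if "(f has_vector_derivative f') (at t)" for f f'
    using bounded_linear.has_vector_derivative[OF bounded_linear_Im that]
    by (simp add: has_real_derivative_iff_has_vector_derivative)
  have Re: "((\<lambda>t. Re (f t)) has_real_derivative Re f') (at t)"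
    if "(f has_vector_derivative f') (at t)" for f f'
    using bounded_linear.has_vector_derivative[OF bounded_linear_Re that]
    by (simp add: has_real_derivative_iff_has_vector_derivative)
  have sym: "Re (herm (z t) z') = Re (herm z' (z t))"
    using arg_cong[OF cnj_herm[of z' "z t"], of Re] by simp
  define n where "n t = Re (herm (z t) (z t))" for t
  have n: "(n has_real_derivative 2 * Re (herm z' (z t))) (at t)"
    using Re[OF h[OF z z]] unfolding n_def by (simp add: sym)
  have n0: "n t \<noteq> 0" using nz by (simp add: n_def herm_self)
  define p where "p t = Im (herm (v t) (z t) * herm (z t) (w t))" for t
  have p: "(p has_real_derivative Im (herm (v t) (z t) * (herm (z t) w' + herm z' (w t)) +
      (herm (v t) z' + herm v' (z t)) * herm (z t) (w t))) (at t)" (is "(p has_real_derivative ?p) _")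
    unfolding p_def[abs_def]
    by (intro Im bounded_bilinear.has_vector_derivative[OF bounded_bilinear_mult] h v w z)
  define q where "q t = Im (herm (v t) (w t))" for t
  have q: "(q has_real_derivative Im (herm (v t) w' + herm v' (w t))) (at t)"
    (is "(q has_real_derivative ?q) _") unfolding q_def[abs_def] by (intro Im h v w)
  let ?n = "2 * Re (herm z' (z t))"
  have eq: "(\<lambda>t. fs_lifted (z t) (v t) (w t)) = (\<lambda>t. p t / (n t)\<^sup>2 - q t / n t)"
    by (simp only: fs_lifted_Re n_def p_def q_def)
  have "((\<lambda>t. p t / (n t)\<^sup>2 - q t / n t) has_real_derivative
      (?p / (n t)\<^sup>2 - 2 * p t * ?n / (n t) ^ 3) - (?q / n t - q t * ?n / (n t)\<^sup>2)) (at t)"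
    by (rule quotient_difference_derivative[OF p q n n0])
  moreover have "(?p / (n t)\<^sup>2 - 2 * p t * ?n / (n t) ^ 3) - (?q / n t - q t * ?n / (n t)\<^sup>2) =
    dfs (z t) z' (v t) (w t) + fs_lifted (z t) v' (w t) + fs_lifted (z t) (v t) w'"
    unfolding dfs_def fs_lifted_Re n_def[symmetric] p_def[symmetric] q_def[symmetric]
      distrib_left distrib_right plus_complex.sel add_divide_distrib diff_divide_distrib
    by (simp add: p_def q_def mult_ac del: times_complex.sel)
  ultimately show ?thesis unfolding eq by simp
qed

text \<open>Closedness of the Fubini-Study form, reduced to an identity between the six complex
  numbers \<open>herm v1 z\<close> and so on: terms over equal powers of the squared norm
  cancel.\<close>

lemma dfs_cyclic:
  "dfs z v1 v2 v3 + dfs z v2 v3 v1 + dfs z v3 v1 v2 = 0"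
proof -
  define N where "N = Re (herm z z)"
  define b1 b2 b3 where b: "b1 = herm v1 z" "b2 = herm v2 z" "b3 = herm v3 z"
  define a12 a23 a31 where a: "a12 = herm v1 v2" "a23 = herm v2 v3" "a31 = herm v3 v1"
  have c: "herm z v1 = cnj b1" "herm z v2 = cnj b2" "herm z v3 = cnj b3"
    "herm v2 v1 = cnj a12" "herm v3 v2 = cnj a23" "herm v1 v3 = cnj a31"
    by (simp_all add: a b cnj_herm)
  \<comment> \<open>A and B collect the numerators over the second and third power of the squared
    norm. In A each product meets its counterpart with b conjugated; B is a determinant with two
    equal rows of real parts.\<close>
  define A where "A = Im (cnj a12 * cnj b3) + Im (b2 * cnj a31) + Im (cnj a23 * cnj b1) + Im (b3 * cnj a12)
    + Im (cnj a31 * cnj b2) + Im (b1 * cnj a23) + 2 * (Im a23 * Re b1 + Im a31 * Re b2 + Im a12 * Re b3)"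
  define B where "B = Im (b2 * cnj b3) * Re b1 + Im (b3 * cnj b1) * Re b2 + Im (b1 * cnj b2) * Re b3"
  have "A = 0" "B = 0" by (simp_all add: A_def B_def algebra_simps)
  moreover have "dfs z v1 v2 v3 + dfs z v2 v3 v1 + dfs z v3 v1 v2 = A / N\<^sup>2 - 4 * B / N ^ 3"
    unfolding dfs_def c a[symmetric] b[symmetric] N_def[symmetric] A_def B_def
      add_divide_distrib diff_divide_distrib distrib_left mult.assoc[symmetric]
    by (simp only: ac_simps)
  ultimately show ?thesis by simp
qed

definition d_omega :: "hvec \<Rightarrow> hvec \<Rightarrow> hvec \<Rightarrow> hvec \<Rightarrow> real" where
  "d_omega z s v w = dfs (fst z) (fst s) (fst v) (fst w) + dfs (snd z) (snd s) (snd v) (snd w)"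

lemma omega_derivative:
  assumes z: "(z has_vector_derivative z') (at t)" and v: "(v has_vector_derivative v') (at t)"
    and w: "(w has_vector_derivative w') (at t)" and nz: "z t \<in> hcone"
  shows "((\<lambda>t. omega (z t) (v t) (w t)) has_real_derivative
    d_omega (z t) z' (v t) (w t) + omega (z t) v' (w t) + omega (z t) (v t) w') (at t)"
proof -
  note f = bounded_linear.has_vector_derivative[OF bounded_linear_fst]
  note s = bounded_linear.has_vector_derivative[OF bounded_linear_snd]
  have "fst (z t) \<noteq> 0" "snd (z t) \<noteq> 0" using nz by (auto simp: hcone_def)
  then show ?thesis
    unfolding omega_def
    using DERIV_add[OF fs_lifted_derivative[OF f[OF z] f[OF v] f[OF w]] fs_lifted_derivative[OF s[OF z] s[OF v] s[OF w]]]
    by (simp add: d_omega_def algebra_simps)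
qed

lemma d_omega_cyclic: "d_omega z v1 v2 v3 + d_omega z v2 v3 v1 + d_omega z v3 v1 v2 = 0"
  using dfs_cyclic[of "fst z" "fst v1" "fst v2" "fst v3"] dfs_cyclic[of "snd z" "snd v1" "snd v2" "snd v3"]
  by (simp add: d_omega_def)

text \<open>In an orthonormal basis of V the form \<beta> becomes an endomorphism T of V.
  Nondegeneracy makes T injective, so by dimension surjective, and a preimage of the vector that
  represents \<phi> is the required v.\<close>

lemma nondegenerate_represents:
  fixes \<beta> :: "'e::euclidean_space \<Rightarrow> 'e \<Rightarrow> real"
  assumes V: "subspace V" and l1: "\<And>w. linear (\<lambda>v. \<beta> v w)" and l2: "\<And>v. linear (\<beta> v)"
    and nd: "\<And>v. v \<in> V \<Longrightarrow> \<forall>w\<in>V. \<beta> v w = 0 \<Longrightarrow> v = 0" and \<phi>: "linear \<phi>"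
  shows "\<exists>v\<in>V. \<forall>w\<in>V. \<beta> v w = \<phi> w"
proof -
  obtain B where B: "B \<subseteq> V" "pairwise orthogonal B" "\<And>x. x \<in> B \<Longrightarrow> norm x = 1"
    "independent B" "card B = dim V" "span B = V"
    using orthonormal_basis_subspace[OF V] by metis
  have fB: "finite B" using B(4) by (rule independent_imp_finite)
  have expand: "\<psi> w = (\<Sum>b\<in>B. (w \<bullet> b) * \<psi> b)" if w: "w \<in> V" and \<psi>: "linear \<psi>" for w and \<psi> :: "'e \<Rightarrow> real"
  proof -
    have "(\<Sum>b\<in>B. (w \<bullet> b) *\<^sub>R b) = w"
      by (rule orthonormal_basis_expand[OF B(2,3) _ fB]) (use w B(6) in simp_all)
    then have "\<psi> w = \<psi> (\<Sum>b\<in>B. (w \<bullet> b) *\<^sub>R b)" by simp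
    also have "\<dots> = (\<Sum>b\<in>B. (w \<bullet> b) * \<psi> b)"
      by (simp add: linear_sum[OF \<psi>] linear_scale[OF \<psi>] inner_commute)
    finally show ?thesis .
  qed
  define T where "T v = (\<Sum>b\<in>B. \<beta> v b *\<^sub>R b)" for v
  have T: "linear T" unfolding T_def[abs_def]
    by (intro linearI)
       (simp_all add: linear_add[OF l1] linear_scale[OF l1] scaleR_add_left sum.distrib scaleR_right.sum)
  have TV: "T v \<in> V" for v
    unfolding T_def using B(1) V by (intro subspace_sum subspace_scale) auto
  have Tb: "T v \<bullet> b = \<beta> v b" if "b \<in> B" for v b
  proof -
    have "T v \<bullet> b = (\<Sum>c\<in>B. \<beta> v c * (c \<bullet> b))" by (simp add: T_def inner_sum_left)
    also have "\<dots> = (\<Sum>c\<in>B. if c = b then \<beta> v c else 0)"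
      using B(2,3) that by (intro sum.cong) (auto simp: pairwise_def orthogonal_def dot_square_norm)
    finally show ?thesis using fB that by simp
  qed
  have inj: "v = 0" if "v \<in> V" "T v = 0" for v
  proof (rule nd[OF \<open>v \<in> V\<close>], intro ballI)
    fix w assume "w \<in> V"
    then have "\<beta> v w = (\<Sum>b\<in>B. (w \<bullet> b) * (T v \<bullet> b))" using expand[OF _ l2] Tb by simp
    then show "\<beta> v w = 0" using that by simp
  qed
  have "inj_on T (span V)"
    unfolding span_eq_iff[THEN iffD2, OF V] linear_inj_on_iff_eq_0[OF T V] using inj by blast
  then have "dim (T ` V) = dim V" using dim_image_eq[OF T] by blast
  then have "T ` V = V"
    using subspace_dim_equal[of "T ` V" V] linear_subspace_image[OF T V] V TV by auto
  moreover have "(\<Sum>b\<in>B. \<phi> b *\<^sub>R b) \<in> V" using B(1) V by (intro subspace_sum subspace_scale) auto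
  ultimately obtain v where v: "v \<in> V" "T v = (\<Sum>b\<in>B. \<phi> b *\<^sub>R b)" by (metis imageE)
  have "\<beta> v b = \<phi> b" if b: "b \<in> B" for b
  proof -
    have "\<beta> v b = (\<Sum>c\<in>B. \<phi> c * (c \<bullet> b))" using Tb[OF b, of v] v(2) by (simp add: inner_sum_left)
    also have "\<dots> = (\<Sum>c\<in>B. if c = b then \<phi> c else 0)"
      using B(2,3) b by (intro sum.cong) (auto simp: pairwise_def orthogonal_def dot_square_norm)
    finally show ?thesis using fB b by simp
  qed
  then have "\<forall>w\<in>V. \<beta> v w = \<phi> w" using expand[OF _ l2] expand[OF _ \<phi>] by simp
  with v(1) show ?thesis by blast
qed

context complex_submfd
begin

lemma form_in_eq:
  assumes E: "(E, \<sigma>) \<in> charts N" and W: "openin (top_of_set E) W" "smooth_on W L" "L ` W \<subseteq> hcone"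
    "\<forall>w\<in>W. \<sigma> w = pr (L w)" and u: "u \<in> W" and v: "v \<in> span E" "w \<in> span E"
  shows "form_in N \<sigma> u v w = omega (L u) (dd L u v) (dd L u w)"
  unfolding form_in_def using form_lft[OF chart_lft[OF E W(1) u W(2-4) v(1)] chart_lft[OF E W(1) u W(2-4) v(2)]] W(4) u
  by simp

lemma smooth_form_in:
  assumes E: "(E, \<sigma>) \<in> charts N" and v: "v \<in> span E" "w \<in> span E"
  shows "smooth_on E (\<lambda>u. form_in N \<sigma> u v w)"
proof (rule smooth_on_local[OF chartD(1)[OF E] subspace_span])
  fix u assume "u \<in> E"
  then obtain W L where W: "openin (top_of_set E) W" "u \<in> W" "smooth_on W L" "L ` W \<subseteq> hcone"
    "\<forall>w\<in>W. \<sigma> w = pr (L w)" using chartD(4)[OF E] unfolding local_lifts_def by blast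
  have oW: "openin (top_of_set (span E)) W" using W(1) chartD(1)[OF E] openin_trans by blast
  have "smooth_on W (\<lambda>u. omega (L u) (dd L u v) (dd L u w))"
    by (intro smooth_on_omega smooth_on_dd[OF _ oW subspace_span] W(3) v) (use W(4) in auto)
  then have "smooth_on W (\<lambda>u. form_in N \<sigma> u v w)"
    by (rule smooth_on_cong) (use form_in_eq[OF E W(1,3-5) _ v] in auto)
  then show "\<exists>W. openin (top_of_set E) W \<and> u \<in> W \<and> smooth_on W (\<lambda>u. form_in N \<sigma> u v w)"
    using W by blast
qed

text \<open>Differentiating the form along a lift L gives the derivative in the base point, which
  cancels cyclically, and second derivatives of L, which cancel in pairs by symmetry of mixed
  derivatives and antisymmetry of \<open>omega\<close>.\<close>

lemma closed_form_in:
  assumes E: "(E, \<sigma>) \<in> charts N" and u: "u \<in> E" and v: "v1 \<in> span E" "v2 \<in> span E" "v3 \<in> span E"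
  shows "deriv (\<lambda>t. form_in N \<sigma> (u + t *\<^sub>R v1) v2 v3) 0 + deriv (\<lambda>t. form_in N \<sigma> (u + t *\<^sub>R v2) v3 v1) 0 +
    deriv (\<lambda>t. form_in N \<sigma> (u + t *\<^sub>R v3) v1 v2) 0 = 0"
proof -
  obtain W L where W: "openin (top_of_set E) W" "u \<in> W" "smooth_on W L" "L ` W \<subseteq> hcone"
    "\<forall>w\<in>W. \<sigma> w = pr (L w)" using chartD(4)[OF E] u unfolding local_lifts_def by blast
  have oW: "openin (top_of_set (span E)) W" using W(1) chartD(1)[OF E] openin_trans by blast
  let ?D = "\<lambda>v. dd L u v" and ?DD = "\<lambda>v w. dd (\<lambda>u. dd L u v) u w"
  have d: "deriv (\<lambda>t. form_in N \<sigma> (u + t *\<^sub>R x) y z) 0 =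
      d_omega (L u) (?D x) (?D y) (?D z) + omega (L u) (?DD y x) (?D z) + omega (L u) (?D y) (?DD z x)"
    if x: "x \<in> span E" and y: "y \<in> span E" and z: "z \<in> span E" for x y z
  proof -
    have "eventually (\<lambda>t. u + t *\<^sub>R x \<in> W) (nhds 0)" by (rule line_eventually[OF oW subspace_span W(2) x])
    then have "deriv (\<lambda>t. form_in N \<sigma> (u + t *\<^sub>R x) y z) 0 =
        deriv (\<lambda>t. omega (L (u + t *\<^sub>R x)) (dd L (u + t *\<^sub>R x) y) (dd L (u + t *\<^sub>R x) z)) 0"
      by (intro deriv_cong_ev refl, eventually_elim) (rule form_in_eq[OF E W(1,3-5) _ y z])
    also have "\<dots> = d_omega (L u) (?D x) (?D y) (?D z) + omega (L u) (?DD y x) (?D z) + omega (L u) (?D y) (?DD z x)"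
      using omega_derivative[OF smooth_on_dd_derivative[OF W(3) oW subspace_span W(2) x]
          smooth_on_dd_derivative[OF smooth_on_dd[OF W(3) oW subspace_span y] oW subspace_span W(2) x]
          smooth_on_dd_derivative[OF smooth_on_dd[OF W(3) oW subspace_span z] oW subspace_span W(2) x]] W(2,4)
      by (intro DERIV_imp_deriv) auto
    finally show ?thesis .
  qed
  have sym: "?DD y x = ?DD x y" if "x \<in> span E" "y \<in> span E" for x y
    by (rule dd_commute[OF W(3) oW subspace_span that(2,1) W(2)])
  show ?thesis
    using d_omega_cyclic[of "L u" "?D v1" "?D v2" "?D v3"] omega_swap[of "L u" "?DD v2 v1" "?D v3"]
      omega_swap[of "L u" "?DD v3 v1" "?D v2"] omega_swap[of "L u" "?DD v3 v2" "?D v1"]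
    unfolding d[OF v] d[OF v(2,3,1)] d[OF v(3,1,2)]
    by (simp add: sym[OF v(1,2)] sym[OF v(1,3)] sym[OF v(2,3)] )
qed

lemma symplectic:
  assumes "d = 2 * n" shows "symplectic_manifold N n"
  unfolding symplectic_manifold_def
proof (intro conjI ballI allI impI)
  show "manifold N (2 * n)" using manifold assms by simp
next
  fix x \<xi> \<eta> assume x: "x \<in> pts N" and t: "\<xi> \<in> tangent_space N x" "\<eta> \<in> tangent_space N x"
  obtain z where z: "z \<in> hcone" "x = pr z" using x pts_hcone by blast
  obtain v where v: "lft N z v \<xi>" using tangent_lft[of \<xi> z] t z by blast
  obtain w where w: "lft N z w \<eta>" using tangent_lft[of \<eta> z] t z by blast
  show "form N x \<xi> \<eta> = - form N x \<eta> \<xi>"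
    unfolding z(2) form_lft[OF v w] form_lft[OF w v] by (rule omega_swap)
  fix \<zeta> and a b :: real assume "\<zeta> \<in> tangent_space N x"
  then obtain y where y: "lft N z y \<zeta>" using tangent_lft[of \<zeta> z] z by blast
  show "form N x (\<lambda>g. a * \<xi> g + b * \<eta> g) \<zeta> = a * form N x \<xi> \<zeta> + b * form N x \<eta> \<zeta>"
    unfolding z(2) form_lft[OF lft_linear[OF v w] y] form_lft[OF v y] form_lft[OF w y]
    by (simp add: omega_add_left omega_scaleR_left)
next
  fix x \<xi> assume x: "x \<in> pts N" and t: "\<xi> \<in> tangent_space N x" and 0: "\<forall>\<eta>\<in>tangent_space N x. form N x \<xi> \<eta> = 0"
  obtain z where z: "z \<in> hcone" "x = pr z" using x pts_hcone by blast
  obtain v where v: "lft N z v \<xi>" using tangent_lft[of \<xi> z] t z by blast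
  show "\<xi> = (\<lambda>g. 0)"
  proof (rule lft_nondegenerate(1)[OF v])
    fix w \<eta> assume w: "lft N z w \<eta>"
    then have "form N x \<xi> \<eta> = 0" using 0 z by (auto simp: lft_def)
    then show "omega z v w = 0" unfolding z(2) form_lft[OF v w] .
  qed
qed (use smooth_form_in closed_form_in in blast)+

text \<open>In a holomorphic chart the form is a nondegenerate bilinear form on the coordinate
  space, so it represents the differential F of g.\<close>

lemma ham_exists:
  assumes g: "smooth_near N x g"
  shows "\<exists>\<xi>\<in>tangent_space N x. \<forall>\<eta>\<in>tangent_space N x. form N x \<xi> \<eta> = \<eta> g"
proof -
  obtain U where U: "openin (mtop N) U" "x \<in> U" "smooth_fun_on N U g"
    using g unfolding smooth_near_def by blast
  then have x: "x \<in> pts N" by (auto simp: openin_mtop)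
  obtain E L r V u where E: "nchart d (pts N) E L r V" "(E, \<lambda>u. pr (L u)) \<in> charts N" "u \<in> E" "pr (L u) = x"
    using nice_chart[OF x] by metis
  let ?\<sigma> = "\<lambda>u. pr (L u)" and ?E = "E \<inter> (\<lambda>u. pr (L u)) -` U"
  have "openin (top_of_set E) ?E" using U(1) E(2) by (auto simp: openin_mtop)
  then have oE: "openin (top_of_set (span E)) ?E" using chartD(1)[OF E(2)] openin_trans by blast
  have gs: "smooth_on ?E (\<lambda>u. g (?\<sigma> u))" using U(3) E(2) unfolding smooth_fun_on_def by blast
  have uE: "u \<in> ?E" using E U by simp
  obtain F where F: "((\<lambda>u. g (?\<sigma> u)) has_derivative F) (at u within ?E)"
    using smooth_on_has_derivative[OF gs uE] .
  have cF: "chart_vec N ?\<sigma> u v g = F v" if "v \<in> span E" for v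
    using line_derivative[OF oE subspace_span uE that F] g E(4)
    by (simp add: chart_vec_def velocity_def DERIV_imp_deriv
          has_real_derivative_iff_has_vector_derivative[symmetric])
  have Lc: "smooth_on E L" "L ` E \<subseteq> hcone" using E(1) by (auto simp: nchart_def)
  obtain L' where L': "(L has_derivative L') (at u)" using E(1,3) unfolding nchart_def by blast
  interpret L': linear L' using L' by (rule has_derivative_linear)
  have dd: "dd L u v = L' v" if "v \<in> span E" for v
    using dd_eq[OF chartD(1)[OF E(2)] subspace_span E(3) that] has_derivative_at_withinI[OF L'] by blast
  have lv: "lft N (L u) (L' v) (chart_vec N ?\<sigma> u v)" if "v \<in> span E" for v
    using chart_lft[OF E(2) openin_subtopology_self E(3) Lc(1,2) _ that] dd[OF that] by simp
  have "\<exists>v\<in>span E. \<forall>w\<in>span E. omega (L u) (L' v) (L' w) = F w"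
  proof (rule nondegenerate_represents)
    show "linear (\<lambda>v. omega (L u) (L' v) (L' w))" for w
      by (intro linearI) (simp_all add: L'.add L'.scale omega_add_left omega_scaleR_left)
    show "linear (\<lambda>w. omega (L u) (L' v) (L' w))" for v
      by (intro linearI) (simp_all add: L'.add L'.scale omega_add_right omega_scaleR_right)
    show "linear F" by (rule has_derivative_linear[OF F])
    fix v assume v: "v \<in> span E" and 0: "\<forall>w\<in>span E. omega (L u) (L' v) (L' w) = 0"
    have "chart_vec N ?\<sigma> u v = (\<lambda>g. 0)"
    proof (rule lft_nondegenerate(1)[OF lv[OF v]])
      fix y \<eta> assume y: "lft N (L u) y \<eta>"
      then have "\<eta> \<in> tangent_space N (?\<sigma> u)" by (simp add: lft_def)
      then obtain w where w: "w \<in> span E" "\<eta> = chart_vec N ?\<sigma> u w"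
        using tangent_in_chart[OF _ E(2,3) refl] by blast
      then have "omega (L u) (L' v) y = omega (L u) (L' v) (L' w)"
        using form_lft[OF lv[OF v] y] form_lft[OF lv[OF v] lv[OF w(1)]] by simp
      then show "omega (L u) (L' v) y = 0" using 0 w(1) by simp
    qed
    then show "v = 0" using chart_vec_eq_0[OF E(2,3) v] by blast
  qed (rule subspace_span)
  then obtain v where v: "v \<in> span E" "\<forall>w\<in>span E. omega (L u) (L' v) (L' w) = F w" by blast
  show ?thesis
  proof (intro bexI ballI)
    show "chart_vec N ?\<sigma> u v \<in> tangent_space N x" unfolding tangent_space_def using E(2-4) v(1) by blast
    fix \<eta> assume "\<eta> \<in> tangent_space N x"
    then obtain w where w: "w \<in> span E" "\<eta> = chart_vec N ?\<sigma> u w"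
      using tangent_in_chart[OF _ E(2-4)] by blast
    show "form N x (chart_vec N ?\<sigma> u v) \<eta> = \<eta> g"
      using form_lft[OF lv[OF v(1)] lv[OF w(1)]] v(2) w cF E(4) by simp
  qed
qed

text \<open>Nondegeneracy gives uniqueness, so the definite description in \<open>ham_vec\<close>
  evaluates to any vector with the defining property.\<close>

lemma ham_vec_eqI:
  assumes x: "x \<in> pts N" and \<xi>: "\<xi> \<in> tangent_space N x" "\<And>\<eta>. \<eta> \<in> tangent_space N x \<Longrightarrow> form N x \<xi> \<eta> = \<eta> g"
  shows "ham_vec N g x = \<xi>"
  unfolding ham_vec_def
proof (rule the_equality)
  fix \<zeta> assume \<zeta>: "\<zeta> \<in> tangent_space N x \<and> (\<forall>\<eta>\<in>tangent_space N x. form N x \<zeta> \<eta> = \<eta> g)"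
  obtain z where z: "z \<in> hcone" "x = pr z" using x pts_hcone by blast
  obtain v where v: "lft N z v \<xi>" using tangent_lft[of \<xi> z] \<xi>(1) z by blast
  obtain w where w: "lft N z w \<zeta>" using tangent_lft[of \<zeta> z] \<zeta> z by blast
  have "(\<lambda>g. 1 * \<zeta> g + (- 1) * \<xi> g) = (\<lambda>g. 0)"
  proof (rule lft_nondegenerate(1)[OF lft_linear[OF w v]])
    fix y \<eta> assume y: "lft N z y \<eta>"
    then have "\<eta> \<in> tangent_space N x" using z by (simp add: lft_def)
    then have "form N x \<zeta> \<eta> = form N x \<xi> \<eta>" using \<zeta> \<xi>(2) by simp
    then show "omega z (1 *\<^sub>R w + (- 1) *\<^sub>R v) y = 0"
      unfolding z(2) form_lft[OF v y] form_lft[OF w y] omega_add_left omega_scaleR_left by simp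
  qed
  then show "\<zeta> = \<xi>" by (simp add: fun_eq_iff)
qed (use \<xi> in auto)

lemma ham_vec:
  assumes "smooth_near N x g"
  shows "ham_vec N g x \<in> tangent_space N x"
    "\<And>\<eta>. \<eta> \<in> tangent_space N x \<Longrightarrow> form N x (ham_vec N g x) \<eta> = \<eta> g"
proof -
  have x: "x \<in> pts N" using assms by (auto simp: smooth_near_def openin_mtop)
  obtain \<xi> where \<xi>: "\<xi> \<in> tangent_space N x" "\<And>\<eta>. \<eta> \<in> tangent_space N x \<Longrightarrow> form N x \<xi> \<eta> = \<eta> g"
    using ham_exists[OF assms] by blast
  have "ham_vec N g x = \<xi>" by (rule ham_vec_eqI[OF x \<xi>])
  then show "ham_vec N g x \<in> tangent_space N x"
    "\<And>\<eta>. \<eta> \<in> tangent_space N x \<Longrightarrow> form N x (ham_vec N g x) \<eta> = \<eta> g" using \<xi> by simp_all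
qed

end

section \<open>Torus actions and moment maps\<close>

definition wsc :: "(3 \<Rightarrow> complex) \<Rightarrow> complex ^ 3 \<Rightarrow> complex ^ 3" where
  "wsc a v = (\<chi> j. a j * v $ j)"

definition tor :: "(3 \<Rightarrow> real) \<Rightarrow> hvec \<Rightarrow> hvec" where
  "tor a z = (wsc (\<lambda>j. cis (a j)) (fst z), wsc (\<lambda>j. cis (- a j)) (snd z))"

text \<open>A point is a pair of lines, as sets of vectors, so the torus acts by taking images and
  no representatives are involved.\<close>

definition torp :: "(3 \<Rightarrow> real) \<Rightarrow> ppoint \<Rightarrow> ppoint" where
  "torp a p = (wsc (\<lambda>j. cis (a j)) ` fst p, wsc (\<lambda>j. cis (- a j)) ` snd p)"

definition genvec :: "(3 \<Rightarrow> real) \<Rightarrow> hvec \<Rightarrow> hvec" where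
  "genvec w z = (wsc (\<lambda>j. \<i> * w j) (fst z), wsc (\<lambda>j. - \<i> * w j) (snd z))"

lemma wsc_nth [simp]: "wsc a v $ j = a j * v $ j"
  by (simp add: wsc_def)

lemma wsc_wsc: "wsc a (wsc b v) = wsc (\<lambda>j. a j * b j) v"
  by (simp add: vec_eq_iff)

lemma wsc_scale: "wsc a (c *s v) = c *s wsc a v"
  by (simp add: vec_eq_iff)

lemma wsc_add: "wsc a (v + w) = wsc a v + wsc a w"
  by (simp add: vec_eq_iff algebra_simps)

lemma linear_wsc: "linear (wsc a)"
  by (intro linearI wsc_add) (simp add: scaleR_scale wsc_scale)

lemma smooth_on_wsc: "smooth_on D f \<Longrightarrow> smooth_on D (\<lambda>u. wsc a (f u))"
  by (rule smooth_on_bounded_linear[OF linear_conv_bounded_linear[THEN iffD1, OF linear_wsc]])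

lemma wsc_eq_0: "(\<And>j. a j \<noteq> 0) \<Longrightarrow> wsc a v = 0 \<longleftrightarrow> v = 0"
  by (auto simp: vec_eq_iff)

lemma tor_hcone: "z \<in> hcone \<Longrightarrow> tor a z \<in> hcone"
  by (simp add: hcone_def tor_def wsc_eq_0)

lemma tor_add: "tor (\<lambda>j. a j + b j) z = tor a (tor b z)"
  by (simp add: tor_def wsc_wsc cis_mult)

lemma tor_0: "tor (\<lambda>j. 0) z = z"
  by (simp add: tor_def prod_eq_iff vec_eq_iff)

lemma wsc_cline: "wsc a ` cline v = cline (wsc a v)"
proof (intro set_eqI iffI)
  fix x assume "x \<in> cline (wsc a v)"
  then obtain c where "x = wsc a (c *s v)" unfolding cline_def wsc_scale by blast
  then show "x \<in> wsc a ` cline v" unfolding cline_def by blast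
qed (auto simp: cline_def wsc_scale)

lemma norm_scale_vec: "norm (c *s v) = cmod c * norm (v :: complex ^ 'n)"
proof -
  have "of_real ((norm (c *s v))\<^sup>2) = (of_real ((cmod c * norm v)\<^sup>2) :: complex)"
    unfolding herm_self[symmetric] herm_scale_left herm_scale_right power_mult_distrib of_real_mult
      complex_norm_square by (simp add: algebra_simps)
  then have "(norm (c *s v))\<^sup>2 = (cmod c * norm v)\<^sup>2" by (simp only: of_real_eq_iff)
  then show ?thesis
    using power2_eq_imp_eq[OF _ norm_ge_zero mult_nonneg_nonneg[OF norm_ge_zero norm_ge_zero]] by simp
qed

lemma smooth_fun_on_subset: "smooth_fun_on M U g \<Longrightarrow> U' \<subseteq> U \<Longrightarrow> smooth_fun_on M U' g"
  unfolding smooth_fun_on_def by clarify (rule smooth_on_subset, auto)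

lemma torp_pr: "torp a (pr z) = pr (tor a z)"
  by (simp add: torp_def pr_def tor_def wsc_cline)

lemma smooth_on_tor: "smooth_on D (tor a)"
  unfolding tor_def
  by (intro smooth_on_Pair smooth_on_wsc smooth_on_fst smooth_on_snd smooth_on_ident)

lemma tor_curve:
  "((\<lambda>t. tor (\<lambda>j. t * w j) z) has_vector_derivative genvec w (tor (\<lambda>j. t * w j) z)) (at t)"
proof -
  have 1: "((\<lambda>t. wsc (\<lambda>j. cis (t * k j)) v) has_vector_derivative wsc (\<lambda>j. \<i> * k j) (wsc (\<lambda>j. cis (t * k j)) v)) (at t)"
    for k :: "3 \<Rightarrow> real" and v
  proof -
    have "((\<lambda>t. cis (t * k j) * v $ j) has_vector_derivative \<i> * k j * (cis (t * k j) * v $ j)) (at t)" for j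
    proof -
      have "((\<lambda>t. exp (t * (\<i> * k j)) * v $ j) has_field_derivative
          \<i> * k j * (exp (of_real t * (\<i> * k j)) * v $ j)) (at (of_real t))"
        by (auto intro!: derivative_eq_intros)
      from has_vector_derivative_real_field[OF this]
      show ?thesis by (simp add: cis_conv_exp mult_ac)
    qed
    then have "((\<lambda>t. \<Sum>j\<in>UNIV. axis j (cis (t * k j) * v $ j)) has_vector_derivative
        (\<Sum>j\<in>UNIV. axis j (\<i> * k j * (cis (t * k j) * v $ j)))) (at t)"
      by (intro has_vector_derivative_sum bounded_linear.has_vector_derivative[OF bounded_linear_axis])
    moreover have "(\<Sum>j\<in>UNIV. axis j (x j)) = (\<chi> j. x j)" for x :: "3 \<Rightarrow> complex"
      by (simp add: vec_eq_iff axis_def)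
    ultimately show ?thesis by (simp add: wsc_def)
  qed
  have 2: "wsc (\<lambda>j. \<i> * of_real (- w j)) v = wsc (\<lambda>j. - \<i> * w j) v" for v by (simp add: vec_eq_iff)
  show ?thesis
    unfolding tor_def genvec_def fst_conv snd_conv
    using has_vector_derivative_Pair[OF 1[where k = w] 1[where k = "\<lambda>j. - w j"]]
    by (simp add: 2)
qed

text \<open>The factor - 1/2 matches the normalisation of \<open>fs_lifted\<close> and the sign
  convention for Hamiltonian vectors. The second quotient enters with the opposite sign because y
  carries the inverse characters.\<close>

definition momh :: "(3 \<Rightarrow> real) \<Rightarrow> hvec \<Rightarrow> real" where
  "momh w z = - (Re (herm (wsc (\<lambda>j. w j) (fst z)) (fst z)) / Re (herm (fst z) (fst z))
    - Re (herm (wsc (\<lambda>j. w j) (snd z)) (snd z)) / Re (herm (snd z) (snd z))) / 2"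

definition mom :: "(3 \<Rightarrow> real) \<Rightarrow> ppoint \<Rightarrow> real" where
  "mom w p = momh w (rep (fst p), rep (snd p))"

lemma momh_scal: "c \<noteq> 0 \<Longrightarrow> d \<noteq> 0 \<Longrightarrow> momh w (scal c d z) = momh w z"
proof -
  have 1: "Re (herm (wsc a (c *s v)) (c *s v)) / Re (herm (c *s v) (c *s v)) =
    Re (herm (wsc a v) v) / Re (herm v v)" if "c \<noteq> 0" for a c and v :: "complex ^ 3"
  proof -
    have "herm (wsc a (c *s v)) (c *s v) = of_real ((cmod c)\<^sup>2) * herm (wsc a v) v"
      "herm (c *s v) (c *s v) = of_real ((cmod c)\<^sup>2) * herm v v"
      unfolding complex_norm_square by (simp_all add: wsc_scale herm_scale_left herm_scale_right)
    then show ?thesis using that by simp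
  qed
  show "c \<noteq> 0 \<Longrightarrow> d \<noteq> 0 \<Longrightarrow> momh w (scal c d z) = momh w z" by (simp add: momh_def 1)
qed

lemma mom_pr: "z \<in> hcone \<Longrightarrow> mom w (pr z) = momh w z"
proof -
  assume z: "z \<in> hcone"
  obtain c where c: "c \<noteq> 0" "rep (cline (fst z)) = c *s fst z"
    using rep_cline[of "fst z"] z by (auto simp: hcone_def)
  obtain d where d: "d \<noteq> 0" "rep (cline (snd z)) = d *s snd z"
    using rep_cline[of "snd z"] z by (auto simp: hcone_def)
  have "mom w (pr z) = momh w (scal c d z)" using c d by (simp add: mom_def pr_def scal_def)
  then show ?thesis using c d momh_scal by simp
qed

lemma smooth_PP_global:
  assumes "smooth_on hcone (\<lambda>z. g (pr z))" shows "smooth_fun_on PP (pr ` hcone) (g :: ppoint \<Rightarrow> 'b::real_normed_vector)"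
proof -
  have "hcone \<inter> pr -` pr ` hcone = hcone" by auto
  then show ?thesis using smooth_PP[of "pr ` hcone" g] open_hcone assms by simp
qed

lemma openin_PP_pts: "openin (mtop PP) (pr ` hcone)"
  using topspace_PP openin_topspace by metis

lemma hcone_Re: "z \<in> hcone \<Longrightarrow> Re (herm (fst z) (fst z)) \<noteq> 0" "z \<in> hcone \<Longrightarrow> Re (herm (snd z) (snd z)) \<noteq> 0"
  by (auto simp: hcone_def herm_self)

lemma smooth_mom: "smooth_fun_on PP (pr ` hcone) (mom w)"
proof (rule smooth_PP_global, rule smooth_on_cong)
  show "smooth_on hcone (momh w)" unfolding momh_def
    by (intro smooth_on_divide smooth_on_minus smooth_on_diff smooth_on_bounded_linear[OF bounded_linear_Re]
        smooth_on_bilinear[OF bounded_bilinear_herm] smooth_on_wsc smooth_on_fst smooth_on_snd smooth_on_ident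
        smooth_on_const hcone_Re) auto
qed (simp add: mom_pr)

lemma smooth_near_global:
  "smooth_fun_on PP (pr ` hcone) g \<Longrightarrow> x \<in> pr ` hcone \<Longrightarrow> smooth_near PP x g"
  unfolding smooth_near_def using openin_PP_pts by blast

lemma momh_tor: "momh w (tor a z) = momh w z"
proof -
  have 1: "herm (wsc k (wsc (\<lambda>j. cis (a j)) v)) (wsc (\<lambda>j. cis (a j)) v) = herm (wsc k v) v" for k a and v :: "complex ^ 3"
  proof -
    have "k j * (cis (a j) * v $ j) * cnj (cis (a j) * v $ j) = k j * v $ j * cnj (v $ j)" for j
    proof -
      have "cis (a j) * cnj (cis (a j)) = 1" by (simp add: cis_cnj cis_mult)
      then have "k j * v $ j * cnj (v $ j) * (cis (a j) * cnj (cis (a j))) = k j * v $ j * cnj (v $ j)" by simp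
      then show ?thesis by (simp add: mult_ac)
    qed
    then show ?thesis unfolding herm_def wsc_nth by (intro sum.cong refl)
  qed
  have 2: "herm (wsc (\<lambda>j. cis (a j)) v) (wsc (\<lambda>j. cis (a j)) v) = herm v v" for a and v :: "complex ^ 3"
    using 1[of "\<lambda>_. 1" a v] by (simp add: wsc_def vec_eq_iff[symmetric])
  show ?thesis
    using 1[of "\<lambda>j. w j" a "fst z"] 1[of "\<lambda>j. w j" "\<lambda>j. - a j" "snd z"] 2[of a "fst z"] 2[of "\<lambda>j. - a j" "snd z"]
    by (simp add: momh_def tor_def)
qed

lemma mom_torp: "x \<in> pr ` hcone \<Longrightarrow> mom w (torp a x) = mom w x"
  by (auto simp: torp_pr mom_pr tor_hcone momh_tor)

text \<open>The weights are real, so the weighted product of x with itself is real and the two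
  halves of the derivative of each product have equal real parts. The quotient rule then gives the
  two terms of \<open>fs_lifted\<close> for the generator of the rotation.\<close>

lemma herm_quotient_derivative:
  fixes x v :: "complex ^ 3" and w :: "3 \<Rightarrow> real"
  assumes x: "x \<noteq> 0"
  shows "((\<lambda>t. Re (herm (wsc (\<lambda>j. w j) (x + t *\<^sub>R v)) (x + t *\<^sub>R v)) / Re (herm (x + t *\<^sub>R v) (x + t *\<^sub>R v)))
    has_real_derivative - 2 * fs_lifted x (wsc (\<lambda>j. \<i> * w j) x) v) (at 0)"
proof -
  have l: "((\<lambda>t. x + t *\<^sub>R v) has_vector_derivative v) (at 0)"
    by (auto intro!: derivative_eq_intros)
  have wl: "((\<lambda>t. wsc (\<lambda>j. w j) (x + t *\<^sub>R v)) has_vector_derivative wsc (\<lambda>j. w j) v) (at 0)"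
    by (rule bounded_linear.has_vector_derivative[OF linear_conv_bounded_linear[THEN iffD1, OF linear_wsc] l])
  have Re: "((\<lambda>t. Re (herm (f t) (g t))) has_real_derivative Re (herm (f 0) g' + herm f' (g 0))) (at 0)"
    if "(f has_vector_derivative f') (at 0)" "(g has_vector_derivative g') (at 0)"
    for f g :: "real \<Rightarrow> complex ^ 3" and f' g'
    using bounded_linear.has_vector_derivative[OF bounded_linear_Re
        bounded_bilinear.has_vector_derivative[OF bounded_bilinear_herm that]]
    by (simp add: has_real_derivative_iff_has_vector_derivative)
  let ?W = "wsc (\<lambda>j. complex_of_real (w j)) x"
  have swap: "herm (wsc (\<lambda>j. w j) v) x = herm v ?W"
    by (simp add: herm_def mult_ac)
  have "Re (herm ?W v) = Re (herm v ?W)" "Re (herm x v) = Re (herm v x)"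
    using arg_cong[OF cnj_herm, of Re] by simp_all
  moreover have "herm (wsc (\<lambda>j. \<i> * w j) x) y = \<i> * herm ?W y" for y
    by (simp add: herm_def sum_distrib_left mult_ac)
  moreover have "Im (herm ?W x) = 0"
  proof -
    have "cnj (herm ?W x) = herm ?W x" by (simp add: herm_def mult_ac)
    from arg_cong[OF this, of Im] show ?thesis by simp
  qed
  moreover have "Re (herm x x) \<noteq> 0" using x by (simp add: herm_self)
  moreover have "2 * a / N - m * (2 * b) / N\<^sup>2 = - 2 * (m * b / N\<^sup>2 - a / N)" for a b m N :: real by simp
  ultimately have "(Re (herm (?W) v + herm (wsc (\<lambda>j. w j) v) x) * Re (herm x x) -
      Re (herm ?W x) * Re (herm x v + herm v x)) / (Re (herm x x) * Re (herm x x)) =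
    - 2 * fs_lifted x (wsc (\<lambda>j. \<i> * w j) x) v"
    unfolding fs_lifted_Re swap by (simp add: field_simps power2_eq_square)
  moreover have "((\<lambda>t. Re (herm (wsc (\<lambda>j. w j) (x + t *\<^sub>R v)) (x + t *\<^sub>R v)) / Re (herm (x + t *\<^sub>R v) (x + t *\<^sub>R v)))
    has_real_derivative (Re (herm (?W) v + herm (wsc (\<lambda>j. w j) v) x) * Re (herm x x) -
      Re (herm ?W x) * Re (herm x v + herm v x)) / (Re (herm x x) * Re (herm x x))) (at 0)"
    using DERIV_divide[OF Re[OF wl l] Re[OF l l]] \<open>Re (herm x x) \<noteq> 0\<close> by simp
  ultimately show ?thesis by simp
qed

lemma omega_genvec:
  assumes z: "z \<in> hcone" shows "omega z (genvec w z) v = Pvec z v (mom w)"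
proof -
  have nz: "fst z \<noteq> 0" "snd z \<noteq> 0" using z by (auto simp: hcone_def)
  have n: "smooth_near PP (pr z) (mom w)" using smooth_near_global[OF smooth_mom] z by blast
  have "eventually (\<lambda>t. z + t *\<^sub>R v \<in> hcone) (nhds 0)"
    by (rule line_eventually[of UNIV]) (use open_hcone z in auto)
  then have "Pvec z v (mom w) = deriv (\<lambda>t. momh w (z + t *\<^sub>R v)) 0"
    using n unfolding Pvec_def velocity_def
    by (simp, intro deriv_cong_ev refl) (auto elim!: eventually_mono simp: mom_pr)
  also have "((\<lambda>t. momh w (z + t *\<^sub>R v)) has_real_derivative
      - (- 2 * fs_lifted (fst z) (wsc (\<lambda>j. \<i> * w j) (fst z)) (fst v) -
         (- 2 * fs_lifted (snd z) (wsc (\<lambda>j. \<i> * w j) (snd z)) (snd v))) / 2) (at 0)"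
    unfolding momh_def
    using DERIV_cdivide[OF DERIV_minus[OF DERIV_diff[OF herm_quotient_derivative[OF nz(1), of w "fst v"]
        herm_quotient_derivative[OF nz(2), of w "snd v"]]], of 2] by simp
  then have "deriv (\<lambda>t. momh w (z + t *\<^sub>R v)) 0 = fs_lifted (fst z) (wsc (\<lambda>j. \<i> * w j) (fst z)) (fst v) -
     fs_lifted (snd z) (wsc (\<lambda>j. \<i> * w j) (snd z)) (snd v)"
    by (intro DERIV_imp_deriv) (simp add: diff_divide_distrib)
  also have "\<dots> = omega z (genvec w z) v"
  proof -
    have "wsc (\<lambda>j. - \<i> * w j) y = (- 1) *\<^sub>R wsc (\<lambda>j. \<i> * w j) y" for y by (simp add: vec_eq_iff)
    then show ?thesis unfolding omega_def genvec_def fst_conv snd_conv by (simp only: fs_lifted_scaleR_left)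
  qed
  finally show ?thesis by simp
qed

text \<open>A function smooth near the image point is extended from N to the ambient product,
  composed with the lift \<Psi> on the cone, where smoothness is that of ordinary maps, and
  restricted to M.\<close>

lemma smooth_map_lift:
  assumes M: "emb M" and N: "emb N" and Q: "open Q" "Q \<subseteq> hcone"
    "\<And>z c d. z \<in> Q \<Longrightarrow> c \<noteq> 0 \<Longrightarrow> d \<noteq> 0 \<Longrightarrow> scal c d z \<in> Q"
    and \<Psi>: "smooth_on Q \<Psi>" "\<Psi> ` Q \<subseteq> hcone" "\<And>z. z \<in> Q \<Longrightarrow> \<psi> (pr z) = pr (\<Psi> z)"
    and U: "U \<subseteq> pts M \<inter> pr ` Q" "\<psi> ` (pts M \<inter> pr ` Q) \<subseteq> pts N"
  shows "smooth_map_on M N U \<psi>"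
  unfolding smooth_map_on_def
proof (intro ballI conjI allI impI)
  fix x assume x: "x \<in> U"
  then show "\<psi> x \<in> pts N" using U by blast
  fix g assume g: "smooth_near N (\<psi> x) g"
  obtain V g' where V: "openin (mtop PP) V" "\<psi> x \<in> V" "smooth_fun_on PP V g'"
    "\<forall>y\<in>V \<inter> pts N. g' y = g y" using emb_extend[OF N g] .
  have o: "open (hcone \<inter> pr -` V)" using V openin_PP by blast
  \<comment> \<open>R is again stable under scalings, although \<Psi> is not assumed homogeneous:
    the points \<Psi> z and \<open>\<Psi> (scal c d z)\<close> both represent the image of the same
    point under \<psi>.\<close>
  define R where "R = Q \<inter> \<Psi> -` (hcone \<inter> pr -` V)"
  have "openin (top_of_set Q) R" unfolding R_def by (rule continuous_openin_preimage_gen[OF smooth_on_continuous[OF \<Psi>(1)] o])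
  then have oQ: "open R" using openin_open_eq[OF Q(1)] by blast
  have sat: "scal c d z \<in> R" if "z \<in> R" "c \<noteq> 0" "d \<noteq> 0" for z c d
  proof -
    have z: "z \<in> Q" "pr (\<Psi> z) \<in> V" using that by (auto simp: R_def)
    have "scal c d z \<in> Q" using Q(3) z that by blast
    moreover have "pr (\<Psi> (scal c d z)) = pr (\<Psi> z)"
      using \<Psi>(3)[OF calculation] \<Psi>(3)[OF z(1)] that pr_scal[of c d z] by simp
    ultimately show ?thesis using z \<Psi>(2) by (auto simp: R_def)
  qed
  have Rh: "R \<subseteq> hcone" using Q(2) by (auto simp: R_def)
  have oV: "openin (mtop PP) (pr ` R)" by (rule openin_PP_saturated[OF oQ Rh sat])
  have pre: "hcone \<inter> pr -` (pr ` R) = R" by (rule saturated_preimage[OF Rh sat])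
  have "smooth_on R (\<lambda>z. g' (pr (\<Psi> z)))"
    using V(3) smooth_PP[OF o, of g'] by (intro smooth_on_compose[OF smooth_on_subset[OF \<Psi>(1)]]) (auto simp: R_def)
  then have "smooth_on R (\<lambda>z. g' (\<psi> (pr z)))" by (rule smooth_on_cong) (use \<Psi>(3) in \<open>auto simp: R_def\<close>)
  then have sm: "smooth_fun_on PP (pr ` R) (\<lambda>y. g' (\<psi> y))"
    using smooth_PP[of "pr ` R" "\<lambda>y. g' (\<psi> y)"] oQ unfolding pre by simp
  show "smooth_near M x (\<lambda>y. g (\<psi> y))"
  proof (rule emb_near_cong[OF M _ oV _ sm])
    show "x \<in> pts M" using x U by blast
    obtain z where z: "z \<in> Q" "x = pr z" using x U(1) by blast
    then have "z \<in> R" using V(2) \<Psi>(2) \<Psi>(3)[OF z(1)] by (auto simp: R_def)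
    then show "x \<in> pr ` R" using z by blast
    show "\<forall>y\<in>pr ` R \<inter> pts M. g' (\<psi> y) = g (\<psi> y)"
    proof
      fix y assume y: "y \<in> pr ` R \<inter> pts M"
      then obtain z where z: "z \<in> R" "y = pr z" by blast
      then have zR: "z \<in> Q" "pr (\<Psi> z) \<in> V" by (simp_all add: R_def)
      then have "y \<in> pts M \<inter> pr ` Q" using y z(2) by blast
      then have "\<psi> y \<in> pts N" using U(2) by blast
      moreover have "\<psi> y \<in> V" using zR \<Psi>(3)[OF zR(1)] z(2) by simp
      ultimately show "g' (\<psi> y) = g (\<psi> y)" using V(4) by blast
    qed
  qed
qed

text \<open>Each point has a representative with both components of norm 1, so a closed homogeneous
  condition cuts out the image of a compact part of a product of spheres.\<close>

lemma compactin_locus: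
  assumes cl: "closed {z. F z}" and hom: "\<And>z c d. F z \<Longrightarrow> c \<noteq> 0 \<Longrightarrow> d \<noteq> 0 \<Longrightarrow> F (scal c d z)"
  shows "compactin (mtop PP) {pr z | z. z \<in> hcone \<and> F z}"
proof -
  let ?K = "(sphere 0 1 \<times> sphere 0 1) \<inter> {z. F z} :: hvec set"
  have K: "compact ?K" by (intro compact_Int_closed compact_Times compact_sphere cl)
  have Kh: "?K \<subseteq> hcone" by (auto simp: hcone_def)
  have "compactin (top_of_set hcone) ?K" using K Kh by (simp add: compactin_subtopology)
  then have "compactin (mtop PP) (pr ` ?K)" using image_compactin continuous_map_pr by blast
  moreover have "pr ` ?K = {pr z | z. z \<in> hcone \<and> F z}"
  proof (intro set_eqI iffI)
    fix x assume "x \<in> {pr z | z. z \<in> hcone \<and> F z}"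
    then obtain z where z: "z \<in> hcone" "F z" "x = pr z" by blast
    let ?z = "scal (of_real (1 / norm (fst z))) (of_real (1 / norm (snd z))) z"
    have nz: "norm (fst z) \<noteq> 0" "norm (snd z) \<noteq> 0" using z by (auto simp: hcone_def)
    then have "?z \<in> ?K" using hom z by (simp add: mem_Times_iff norm_scale_vec norm_divide)
    moreover have "x = pr ?z" using nz z by (simp add: pr_scal)
    ultimately show "x \<in> pr ` ?K" by (rule image_eqI[rotated])
  next
    fix x assume "x \<in> pr ` ?K"
    then obtain z where z: "z \<in> ?K" "x = pr z" by (rule imageE)
    have "z \<in> hcone" using subsetD[OF Kh z(1)] .
    then show "x \<in> {pr z | z. z \<in> hcone \<and> F z}" using z by auto
  qed
  ultimately show ?thesis by simp
qed

context complex_submfd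
begin

lemma velocity_torp_lft:
  assumes z: "z \<in> hcone" "pr z \<in> pts N" and inv: "\<And>t x. x \<in> pts N \<Longrightarrow> torp (\<lambda>j. t * w j) x \<in> pts N"
  shows "lft N z (genvec w z) (velocity N (\<lambda>t. torp (\<lambda>j. t * w j) (pr z)))"
  unfolding torp_pr
  using tor_curve[of w z 0] z inv[OF z(2)] by (intro curve_lft) (simp_all add: tor_0 torp_pr)

lemma mom_lft:
  assumes "lft N z v \<xi>" shows "\<xi> (mom w) = omega z (genvec w z) v"
proof -
  have z: "z \<in> hcone" using assms by (simp add: lft_def)
  have "\<xi> (mom w) = Pvec z v (mom w)"
    by (rule lft_eval[OF assms openin_PP_pts _ smooth_mom]) (use z in auto)
  then show ?thesis using omega_genvec[OF z] by simp
qed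

lemma ham_mom:
  assumes z: "z \<in> hcone" "pr z \<in> pts N" and inv: "\<And>t x. x \<in> pts N \<Longrightarrow> torp (\<lambda>j. t * w j) x \<in> pts N"
  shows "ham_vec N (mom w) (pr z) = velocity N (\<lambda>t. torp (\<lambda>j. t * w j) (pr z))"
proof (rule ham_vec_eqI[OF z(2)])
  note l = velocity_torp_lft[OF assms]
  show "velocity N (\<lambda>t. torp (\<lambda>j. t * w j) (pr z)) \<in> tangent_space N (pr z)" using l by (simp add: lft_def)
  fix \<eta> assume "\<eta> \<in> tangent_space N (pr z)"
  then obtain v where v: "lft N z v \<eta>" using tangent_lft z by blast
  show "form N (pr z) (velocity N (\<lambda>t. torp (\<lambda>j. t * w j) (pr z))) \<eta> = \<eta> (mom w)"
    using form_lft[OF l v] mom_lft[OF v] by simp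
qed

text \<open>The group law turns the derivative at time t into the derivative at time 0 of the orbit
  through the point reached at t, where the Hamiltonian vector is known.\<close>

lemma integral_curve_torp:
  assumes x: "x \<in> pts N" and inv: "\<And>t x. x \<in> pts N \<Longrightarrow> torp (\<lambda>j. t * w j) x \<in> pts N"
  shows "integral_curve N (ham_vec N (mom w)) UNIV (\<lambda>t. torp (\<lambda>j. t * w j) x)"
  unfolding integral_curve_def
proof (intro ballI conjI allI impI)
  fix t show p: "torp (\<lambda>j. t * w j) x \<in> pts N" by (rule inv[OF x])
  fix g assume g: "smooth_near N (torp (\<lambda>j. t * w j) x) g"
  obtain z0 where z0: "z0 \<in> hcone" "x = pr z0" using x pts_hcone by blast
  let ?z = "tor (\<lambda>j. t * w j) z0"
  have z: "?z \<in> hcone" "pr ?z = torp (\<lambda>j. t * w j) x" using z0 by (simp_all add: tor_hcone torp_pr)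
  let ?c = "\<lambda>s. tor (\<lambda>j. s * w j) ?z"
  have c: "(?c has_vector_derivative genvec w ?z) (at 0)" "?c 0 \<in> hcone"
    using tor_curve[of w ?z 0] z by (simp_all add: tor_0)
  have ev: "eventually (\<lambda>s. pr (?c s) \<in> pts N) (nhds 0)"
    using inv[OF p] z(2) by (simp add: torp_pr[symmetric])
  obtain V g' where V: "openin (mtop PP) V" "torp (\<lambda>j. t * w j) x \<in> V" "smooth_fun_on PP V g'"
    "\<forall>y\<in>V \<inter> pts N. g' y = g y" using emb_extend[OF emb g] .
  have V0: "pr (?c 0) \<in> V" using V(2) z(2) by (simp add: tor_0)
  have d: "((\<lambda>s. g (pr (?c s))) has_real_derivative Pvec (?c 0) (genvec w ?z) g') (at 0)"
    by (rule emb_curve[OF emb c ev V(1) V0 V(3,4)])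
  have "ham_vec N (mom w) (torp (\<lambda>j. t * w j) x) = velocity N (\<lambda>s. pr (?c s))"
    using ham_mom[OF z(1) _ inv] p unfolding z(2)[symmetric] torp_pr by simp
  then have h: "ham_vec N (mom w) (torp (\<lambda>j. t * w j) x) g = Pvec (?c 0) (genvec w ?z) g'"
    using emb_velocity_eval[OF emb c ev V(1) V0 V(3,4)] by simp
  have "pr (?c s) = torp (\<lambda>j. (s + t) * w j) x" for s
    using tor_add[of "\<lambda>j. s * w j" "\<lambda>j. t * w j" z0] by (simp add: z0(2) torp_pr distrib_right)
  then have "((\<lambda>s. g (torp (\<lambda>j. (s + t) * w j) x)) has_real_derivative
      ham_vec N (mom w) (torp (\<lambda>j. t * w j) x) g) (at 0)" using d h by simp
  then show "((\<lambda>s. g (torp (\<lambda>j. s * w j) x)) has_real_derivative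
      ham_vec N (mom w) (torp (\<lambda>j. t * w j) x) g) (at t)"
    using DERIV_shift[of "\<lambda>s. g (torp (\<lambda>j. s * w j) x)" _ 0 t] by simp
qed

lemma smooth_mom_sub: "smooth_fun_on N (pts N) (mom w)"
  by (rule smooth_fun_on_subset[OF emb_restrict[OF emb openin_PP_pts smooth_mom] pts_hcone])

text \<open>Smoothness of the action, the group law, the invariance of the moment maps and their
  flows all come from the torus acting on the ambient product. What remains for a particular locus
  is compactness, connectedness, invariance and effectiveness.\<close>

lemma toric:
  assumes dm: "d = 2 * m" and ne: "pts N \<noteq> {}"
    and cp: "compactin (mtop PP) (pts N)" and cn: "connectedin (mtop PP) (pts N)"
    and inv: "\<And>a x. x \<in> pts N \<Longrightarrow> torp a x \<in> pts N"
    and eff: "\<And>\<theta>. \<theta> \<in> Rm m \<Longrightarrow> (\<forall>x\<in>pts N. torp (\<lambda>j. \<Sum>i<m. \<theta> i * W i j) x = x) \<longleftrightarrow> \<theta> \<in> torus_lattice m"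
  shows "symplectic_toric N m (\<lambda>i. mom (W i))"
  unfolding symplectic_toric_def
proof (intro conjI)
  show "symplectic_manifold N m" by (rule symplectic[OF dm])
  show "compact_space (mtop N)" unfolding mtop_eq by (rule compact_space_subtopology[OF cp])
  show "connected_space (mtop N)" unfolding mtop_eq using cn by (simp add: connectedin_def)
  let ?a = "\<lambda>\<theta> j. \<Sum>i<m. \<theta> i * W i j"
  have "effective_hamiltonian_torus_action N m (\<lambda>\<theta>. torp (?a \<theta>)) (\<lambda>i. mom (W i))"
    unfolding effective_hamiltonian_torus_action_def
  proof (intro conjI ballI allI impI)
    fix \<theta> assume "\<theta> \<in> Rm m"
    show "smooth_map_on N N (pts N) (torp (?a \<theta>))"
    proof (rule smooth_map_lift[OF emb emb open_hcone order_refl scal_hcone smooth_on_tor _ torp_pr])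
      show "tor (?a \<theta>) ` hcone \<subseteq> hcone" using tor_hcone by blast
      show "pts N \<subseteq> pts N \<inter> pr ` hcone" using pts_hcone by blast
      show "torp (?a \<theta>) ` (pts N \<inter> pr ` hcone) \<subseteq> pts N" using inv by blast
    qed
  next
    fix x assume x: "x \<in> pts N"
    then obtain z where z: "x = pr z" using pts_hcone by blast
    show "torp (?a (\<lambda>i. 0)) x = x" by (simp add: z torp_pr tor_0)
  next
    fix \<theta> \<theta>' x assume x: "x \<in> pts N"
    then obtain z where z: "x = pr z" using pts_hcone by blast
    have "?a (\<lambda>i. \<theta> i + \<theta>' i) = (\<lambda>j. ?a \<theta> j + ?a \<theta>' j)" by (simp add: distrib_right sum.distrib)
    then show "torp (?a (\<lambda>i. \<theta> i + \<theta>' i)) x = torp (?a \<theta>) (torp (?a \<theta>') x)"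
      by (simp add: z torp_pr tor_add)
  next
    fix \<theta> assume "\<theta> \<in> Rm m"
    then show "(\<forall>x\<in>pts N. torp (?a \<theta>) x = x) = (\<theta> \<in> torus_lattice m)" by (rule eff)
  next
    fix i x and \<theta> :: "nat \<Rightarrow> real" assume "x \<in> pts N"
    then show "mom (W i) (torp (?a \<theta>) x) = mom (W i) x" using mom_torp pts_hcone by blast
  next
    fix i x assume i: "i < m" and x: "x \<in> pts N"
    \<comment> \<open>A parameter concentrated in the i-th slot acts with the i-th row of weights,
      whose flow is that of \<open>mom (W i)\<close>.\<close>
    have "?a (\<lambda>j. if j = i then t else 0) = (\<lambda>j. t * W i j)" for t
      using i by (simp add: if_distrib[of "\<lambda>s. s * _"] cong: if_cong)
    then show "integral_curve N (ham_vec N (mom (W i))) UNIV (\<lambda>t. torp (?a (\<lambda>j. if j = i then t else 0)) x)"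
      using integral_curve_torp[OF x inv] by simp
  qed (rule smooth_mom_sub)
  then show "\<exists>\<Phi>. effective_hamiltonian_torus_action N m \<Phi> (\<lambda>i. mom (W i))" by blast
qed (rule ne)

end

section \<open>Complex lines in tangent spaces\<close>

lemma mult_i_vertical: "mult_i (scal a b z) = scal (\<i> * a) (\<i> * b) z"
  by (simp add: mult_i_def scal_scal)

lemma mult_i_add: "mult_i (v + w) = mult_i v + mult_i w"
  by (simp add: mult_i_def scal_add)

lemma mult_i_scaleR: "mult_i (r *\<^sub>R v) = r *\<^sub>R mult_i v"
  by (simp add: mult_i_def scal_scaleR)

context complex_submfd
begin

text \<open>A curve that represents \<xi> may start at another representative and differ from w by a
  vertical vector. A constant scaling repairs the first, a scaling by exponentials the second, and
  neither moves the points below.\<close>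

lemma lft_curve:
  assumes l: "lft N z w \<xi>"
  obtains c where "(c has_vector_derivative w) (at 0)" "c 0 = z"
    "eventually (\<lambda>t. pr (c t) \<in> pts N) (nhds (0::real))" "\<xi> = velocity N (\<lambda>t. pr (c t))"
proof -
  have z: "z \<in> hcone" "\<xi> \<in> tangent_space N (pr z)" using l by (auto simp: lft_def)
  obtain c w0 where c: "(c has_vector_derivative w0) (at 0)" "c 0 \<in> hcone" "pr (c 0) = pr z"
    "eventually (\<lambda>t. pr (c t) \<in> pts N) (nhds (0::real))" "\<xi> = velocity N (\<lambda>t. pr (c t))"
    using tangent_curve[OF z(2)] .
  obtain a b where ab: "a \<noteq> 0" "b \<noteq> 0" "z = scal a b (c 0)" using pr_eqD[OF c(3) z(1)] .
  have "lft N (c 0) w0 \<xi>" unfolding c(5) by (rule curve_lft[OF c(1) refl c(2,4)])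
  then have "lft N z (scal a b w0) \<xi>" using lft_scal[OF ab(1,2)] ab(3) by simp
  then obtain k l where kl: "w = scal a b w0 + scal k l z" using lft_eqD l by blast
  let ?c = "\<lambda>t. scal (exp (of_real t * k)) (exp (of_real t * l)) (scal a b (c t))"
  have "((\<lambda>t. scal a b (c t)) has_vector_derivative scal a b w0) (at 0)"
    by (rule bounded_linear.has_vector_derivative[OF linear_conv_bounded_linear[THEN iffD1, OF linear_scal] c(1)])
  from scal_has_vector_derivative[OF exp_curve exp_curve this, of k l]
  have "(?c has_vector_derivative w) (at 0)" using ab(3) by (simp add: kl add.commute)
  moreover have "pr (?c t) = pr (c t)" for t using ab(1,2) by (simp add: pr_scal)
  ultimately show ?thesis using that[of ?c] c(4,5) ab(3) by simp
qed

lemma chart_vec_0: "(E, \<sigma>) \<in> charts N \<Longrightarrow> u \<in> E \<Longrightarrow> chart_vec N \<sigma> u 0 = (\<lambda>g. 0)"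
  using chart_vec_linear[of E \<sigma> u 0 0 0 0] by (simp add: span_zero)

text \<open>When the real dimension is two, a nonzero tangent vector and its multiple by the
  imaginary unit form a real basis of the tangent space.\<close>

lemma complex_line:
  assumes d2: "d = 2" and l: "lft N y b \<xi>" "\<xi> \<noteq> (\<lambda>g. 0)" and \<eta>: "\<eta> \<in> tangent_space N (pr y)"
  obtains \<alpha> \<beta> where "lft N y (\<alpha> *\<^sub>R b + \<beta> *\<^sub>R mult_i b) \<eta>"
proof -
  have y: "\<xi> \<in> tangent_space N (pr y)" using l by (simp add: lft_def)
  obtain E L r V u where E: "nchart d (pts N) E L r V" "(E, \<lambda>u. pr (L u)) \<in> charts N" "u \<in> E" "pr (L u) = pr y"
    using nice_chart[OF lft_pts[OF l(1)]] by metis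
  obtain v where v: "v \<in> span E" "\<xi> = chart_vec N (\<lambda>u. pr (L u)) u v" using tangent_in_chart[OF y E(2-4)] .
  obtain w where w: "w \<in> span E" "\<eta> = chart_vec N (\<lambda>u. pr (L u)) u w" using tangent_in_chart[OF \<eta> E(2-4)] .
  have v0: "v \<noteq> 0" using l(2) v(2) chart_vec_0[OF E(2,3)] by auto
  have J: "mult_i v \<in> span E" using E(1) v(1) by (auto simp: nchart_def)
  \<comment> \<open>A real k with i v = k v would satisfy 1 + k * k = 0.\<close>
  have "mult_i v \<notin> span {v}"
  proof
    assume "mult_i v \<in> span {v}"
    then obtain k where k: "mult_i v = k *\<^sub>R v" by (auto simp: span_singleton)
    have "- v = mult_i (mult_i v)" by (simp add: mult_i_mult_i)
    also have "\<dots> = (k * k) *\<^sub>R v" by (simp add: k mult_i_scaleR)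
    finally have "(1 + k * k) *\<^sub>R v = 0" by (simp add: scaleR_add_left add_eq_0_iff)
    moreover have "1 + k * k > 0" by (simp add: add_pos_nonneg)
    ultimately show False using v0 by simp
  qed
  then have ind: "independent {mult_i v, v}" and ne: "mult_i v \<noteq> v"
    using v0 by (auto simp: independent_insert span_base)
  have "dim (span E) = 2" using chartD(2)[OF E(2)] d2 by simp
  then have "span E \<subseteq> span {mult_i v, v}"
    using card_ge_dim_independent[of "{mult_i v, v}" "span E"] ind ne v(1) J by simp
  then obtain \<beta> where "w - \<beta> *\<^sub>R mult_i v \<in> span {v}" using w(1) span_breakdown_eq by blast
  then obtain \<alpha> where "w - \<beta> *\<^sub>R mult_i v = \<alpha> *\<^sub>R v" by (auto simp: span_singleton)
  then have "w = \<alpha> *\<^sub>R v + \<beta> *\<^sub>R mult_i v" by (simp add: diff_eq_eq)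
  then have "\<eta> = (\<lambda>g. \<alpha> * \<xi> g + \<beta> * chart_vec N (\<lambda>u. pr (L u)) u (mult_i v) g)"
    using chart_vec_linear[OF E(2,3) v(1) J] w(2) v(2) by simp
  moreover have "lft N y (mult_i b) (chart_vec N (\<lambda>u. pr (L u)) u (mult_i v))"
    using lft_mult_i_chart[OF E(1-3) v(1) _ E(4)] l(1) v(2) by simp
  ultimately have "lft N y (\<alpha> *\<^sub>R b + \<beta> *\<^sub>R mult_i b) \<eta>" using lft_linear[OF l(1)] by simp
  then show ?thesis by (rule that)
qed

text \<open>If every Hamiltonian vector at x were zero, each tangent vector would annihilate all
  functions and so vanish, against positive dimension.\<close>

lemma exists_ham_nonzero:
  assumes "d \<noteq> 0" "x \<in> pts N"
  obtains h where "smooth_near N x h" "ham_vec N h x \<noteq> (\<lambda>g. 0)"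
proof (rule ccontr)
  assume "\<not> thesis"
  then have 0: "ham_vec N h x = (\<lambda>g. 0)" if "smooth_near N x h" for h using that \<open>\<And>h. \<lbrakk>smooth_near N x h; ham_vec N h x \<noteq> (\<lambda>g. 0)\<rbrakk> \<Longrightarrow> thesis\<close> by blast
  obtain E L r V u where E: "nchart d (pts N) E L r V" "(E, \<lambda>u. pr (L u)) \<in> charts N" "u \<in> E" "pr (L u) = x"
    using nice_chart[OF assms(2)] by metis
  have "dim (span E) \<noteq> 0" using chartD(2)[OF E(2)] assms(1) by simp
  then obtain v where v: "v \<in> span E" "v \<noteq> 0" by (metis dim_eq_0 subsetI singletonI)
  let ?\<eta> = "chart_vec N (\<lambda>u. pr (L u)) u v"
  have \<eta>: "?\<eta> \<in> tangent_space N x" unfolding tangent_space_def using E v by blast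
  obtain z where z: "z \<in> hcone" "x = pr z" using assms(2) pts_hcone by blast
  obtain w where w: "lft N z w ?\<eta>" using tangent_lft \<eta> z by blast
  have "?\<eta> h = 0" for h
  proof (cases "smooth_near N x h")
    case True
    have "form N x (\<lambda>g. 0) ?\<eta> = ?\<eta> h" using ham_vec(2)[OF True \<eta>] 0[OF True] by simp
    moreover have "form N x (\<lambda>g. 0) ?\<eta> = omega z 0 w"
      using form_lft[OF lft_zero w] z assms(2) by simp
    moreover have "omega z 0 w = 0" using omega_scaleR_left[of z 0 0 w] by simp
    ultimately show ?thesis by simp
  qed (rule tangent_not_near[OF \<eta>])
  then show False using chart_vec_eq_0[OF E(2,3) v(1)] v(2) by blast
qed

end

section \<open>Holomorphic maps onto curves\<close>

locale holomorphic_map = M: complex_submfd M dM + Y: complex_submfd Y 2 for M dM Y +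
  fixes Q :: "hvec set" and \<Psi> :: "hvec \<Rightarrow> hvec" and \<psi> :: "ppoint \<Rightarrow> ppoint"
  assumes Q: "open Q" "Q \<subseteq> hcone" "\<And>z c d. z \<in> Q \<Longrightarrow> c \<noteq> 0 \<Longrightarrow> d \<noteq> 0 \<Longrightarrow> scal c d z \<in> Q"
    and \<Psi>: "smooth_on Q \<Psi>" "\<Psi> ` Q \<subseteq> hcone" "\<And>z. z \<in> Q \<Longrightarrow> \<psi> (pr z) = pr (\<Psi> z)"
    and holo: "\<And>z. z \<in> Q \<Longrightarrow> \<exists>L'. (\<Psi> has_derivative L') (at z) \<and> (\<forall>v. L' (mult_i v) = mult_i (L' v))"
    and \<psi>_pts: "\<psi> ` (pts M \<inter> pr ` Q) \<subseteq> pts Y"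
begin

lemma smooth: "smooth_map_on M Y (pts M \<inter> pr ` Q) \<psi>"
  by (rule smooth_map_lift[OF M.emb Y.emb Q \<Psi> order_refl \<psi>_pts])

lemma smooth_near_pullback: "x \<in> pts M \<inter> pr ` Q \<Longrightarrow> smooth_near Y (\<psi> x) g \<Longrightarrow> smooth_near M x (\<lambda>y. g (\<psi> y))"
  using smooth unfolding smooth_map_on_def by blast

text \<open>The lift \<Psi> carries a lifted curve of M to a lifted curve of Y with velocity
  \<open>L' w\<close>. So the differential of \<psi> is computed by that of \<Psi>.\<close>

lemma push_lft:
  assumes z: "z \<in> Q" and L': "(\<Psi> has_derivative L') (at z)" and l: "lft M z w \<xi>"
  shows "lft Y (\<Psi> z) (L' w) (push Y \<psi> (pr z) \<xi>)"
proof -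
  obtain c where c: "(c has_vector_derivative w) (at 0)" "c 0 = z"
    "eventually (\<lambda>t. pr (c t) \<in> pts M) (nhds (0::real))" "\<xi> = velocity M (\<lambda>t. pr (c t))"
    using M.lft_curve[OF l] .
  have "(c \<longlongrightarrow> c 0) (at 0)" using has_vector_derivative_continuous[OF c(1)] by (simp add: continuous_within)
  then have evQ: "eventually (\<lambda>t. c t \<in> Q) (nhds 0)"
    unfolding eventually_nhds_conv_at using topological_tendstoD[of c "c 0" "at 0" Q] Q(1) z c(2) by auto
  have ev: "eventually (\<lambda>t. pr (c t) \<in> pts M \<and> \<psi> (pr (c t)) = pr (\<Psi> (c t)) \<and> pr (\<Psi> (c t)) \<in> pts Y) (nhds 0)"
    using evQ c(3)
  proof eventually_elim
    case (elim t)
    then have "\<psi> (pr (c t)) \<in> pts Y" using \<psi>_pts by blast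
    then show ?case using elim \<Psi>(3) by simp
  qed
  have L0: "(\<Psi> has_derivative L') (at (c 0))" using L' c(2) by simp
  have "((\<lambda>t. \<Psi> (c t)) has_derivative (\<lambda>s. L' (s *\<^sub>R w))) (at 0)"
    using has_derivative_compose[OF c(1)[unfolded has_vector_derivative_def] L0] .
  then have d: "((\<lambda>t. \<Psi> (c t)) has_vector_derivative L' w) (at 0)"
    unfolding has_vector_derivative_def by (simp add: linear_scale[OF has_derivative_linear[OF L']])
  have "lft Y (\<Psi> z) (L' w) (velocity Y (\<lambda>t. pr (\<Psi> (c t))))"
    by (rule Y.curve_lft[OF d]) (use c(2) z \<Psi>(2) ev in \<open>auto elim: eventually_mono\<close>)
  moreover have "push Y \<psi> (pr z) \<xi> = velocity Y (\<lambda>t. pr (\<Psi> (c t)))"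
  proof
    fix g
    have x: "pr z \<in> pts M \<inter> pr ` Q" using M.lft_pts[OF l] z by blast
    have "deriv (\<lambda>t. g (\<psi> (pr (c t)))) 0 = deriv (\<lambda>t. g (pr (\<Psi> (c t)))) 0"
      by (intro deriv_cong_ev refl) (use ev in \<open>auto elim: eventually_mono\<close>)
    then show "push Y \<psi> (pr z) \<xi> g = velocity Y (\<lambda>t. pr (\<Psi> (c t))) g"
      using smooth_near_pullback[OF x, of g] \<Psi>(3)[OF z] c(2,4) by (simp add: push_def velocity_def)
  qed
  ultimately show ?thesis by simp
qed

text \<open>Fix one nonzero Hamiltonian vector of Y with lift b, and let p lift the Hamiltonian
  vector of the pulled-back function; p is then the adjoint of b. The image of p is a positive
  multiple \<alpha> of b modulo vertical vectors, because L' is complex linear and Y is a curve.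
  Hence p and \<open>mult_i p\<close>, divided by \<alpha>, lift b and \<open>mult_i b\<close>
  horizontally, and 1 / \<alpha> serves for every h.\<close>

lemma compatibility:
  assumes z: "z \<in> Q" "pr z \<in> pts M"
    and surj: "push Y \<psi> (pr z) ` tangent_space M (pr z) = tangent_space Y (\<psi> (pr z))"
  shows "\<exists>t>0. (\<forall>\<zeta>\<in>tangent_space Y (\<psi> (pr z)). \<exists>!\<xi>. \<xi> \<in> horizontal M \<psi> Y (pr z) \<and> push Y \<psi> (pr z) \<xi> = \<zeta>) \<and>
    (\<forall>h. smooth_fun_on Y (pts Y) h \<longrightarrow> horizontal_lift M \<psi> Y (pr z) (ham_vec Y h (\<psi> (pr z))) =
       (\<lambda>g. t * ham_vec M (\<lambda>y. h (\<psi> y)) (pr z) g))"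
proof -
  define y where "y = \<Psi> z"
  have zh: "z \<in> hcone" using z(1) Q(2) by blast
  have \<psi>x: "\<psi> (pr z) = pr y" using \<Psi>(3)[OF z(1)] by (simp add: y_def)
  have "pr z \<in> pts M \<inter> pr ` Q" using z by blast
  then have "\<psi> (pr z) \<in> pts Y" using \<psi>_pts by blast
  moreover have "y \<in> hcone" using \<Psi>(2) z(1) unfolding y_def by blast
  ultimately have yY: "y \<in> hcone" "pr y \<in> pts Y" using \<psi>x by simp_all
  obtain L' where L': "(\<Psi> has_derivative L') (at z)" "\<And>v. L' (mult_i v) = mult_i (L' v)" using holo[OF z(1)] by blast
  interpret L': linear L' by (rule has_derivative_linear[OF L'(1)])
  let ?p = "push Y \<psi> (pr z)"
  have pl: "lft Y y (L' w) (?p \<xi>)" if "lft M z w \<xi>" for w \<xi>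
    using push_lft[OF z(1) L'(1) that] by (simp add: y_def)
  have ptan: "?p \<xi> \<in> tangent_space Y (pr y)" if "\<xi> \<in> tangent_space M (pr z)" for \<xi>
    using imageI[OF that, of ?p] surj \<psi>x by simp
  have plin: "?p (\<lambda>g. a * \<xi> g + b * \<eta> g) = (\<lambda>g. a * ?p \<xi> g + b * ?p \<eta> g)" for a b \<xi> \<eta>
    by (auto simp: push_def)
  have pham: "(?p \<eta>) h = \<eta> (\<lambda>y. h (\<psi> y))" if "smooth_near Y (pr y) h" for h \<eta>
    using that by (simp add: push_def \<psi>x)
  obtain h0 where h0: "smooth_near Y (pr y) h0" "ham_vec Y h0 (pr y) \<noteq> (\<lambda>g. 0)"
    using Y.exists_ham_nonzero[OF _ yY(2)] by auto
  let ?X = "ham_vec Y h0 (pr y)" and ?\<xi> = "ham_vec M (\<lambda>y. h0 (\<psi> y)) (pr z)"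
  have near: "smooth_near M (pr z) (\<lambda>y. h (\<psi> y))" if "smooth_near Y (pr y) h" for h
    using smooth_near_pullback[of "pr z" h] z that \<psi>x by auto
  obtain b where b: "lft Y y b ?X" using Y.tangent_lft[OF Y.ham_vec(1)[OF h0(1)] yY(1)] .
  obtain p where p: "lft M z p ?\<xi>" using M.tangent_lft[OF M.ham_vec(1)[OF near[OF h0(1)]] zh] .
  obtain X1 where X1: "lft Y y (mult_i b) X1" using Y.lft_mult_i[OF b] .
  obtain \<xi>1 where \<xi>1: "lft M z (mult_i p) \<xi>1" using M.lft_mult_i[OF p] .
  \<comment> \<open>Both sides are the derivative of the pulled-back function: once through its
    Hamiltonian vector upstairs, once through the Hamiltonian vector downstairs.\<close>
  have adj: "omega z p v = omega y b (L' v)" if v: "lft M z v \<eta>" for v \<eta>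
  proof -
    have t: "\<eta> \<in> tangent_space M (pr z)" using v by (simp add: lft_def)
    have "omega z p v = \<eta> (\<lambda>y. h0 (\<psi> y))" using M.form_lft[OF p v] M.ham_vec(2)[OF near[OF h0(1)] t] by simp
    also have "\<dots> = (?p \<eta>) h0" using pham[OF h0(1)] by simp
    also have "\<dots> = form Y (pr y) ?X (?p \<eta>)" using Y.ham_vec(2)[OF h0(1) ptan[OF t]] by simp
    also have "\<dots> = omega y b (L' v)" by (rule Y.form_lft[OF b pl[OF v]])
    finally show ?thesis .
  qed
  define k where "k = omega y b (mult_i b)"
  have "k \<noteq> 0"
  proof
    assume "k = 0"
    then obtain m n where "b = scal m n y" using omega_J_eq_0[OF yY(1)] unfolding k_def by metis
    then have "lft Y y b (\<lambda>g. 0)" using Y.lft_vertical[OF Y.lft_zero[OF yY]] by simp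
    then show False using Y.lft_unique[OF b] h0(2) by blast
  qed
  then have k: "k > 0" using omega_J_nonneg[of y b] by (simp add: k_def)
  have pt: "?p ?\<xi> \<in> tangent_space Y (pr y)" using pl[OF p] by (simp add: lft_def)
  obtain \<alpha> \<beta> where ab: "lft Y y (\<alpha> *\<^sub>R b + \<beta> *\<^sub>R mult_i b) (?p ?\<xi>)" using Y.complex_line[OF refl b h0(2) pt] .
  obtain m n where mn: "L' p = (\<alpha> *\<^sub>R b + \<beta> *\<^sub>R mult_i b) + scal m n y" using Y.lft_eqD[OF ab pl[OF p]] by blast
  \<comment> \<open>Testing p against itself removes the component of L' p along
    \<open>mult_i b\<close>, because k is not zero.\<close>
  have "0 = omega y b (L' p)" using adj[OF p] by (simp add: omega_self)
  also have "\<dots> = \<beta> * k" unfolding mn by (simp add: omega_add_right omega_scaleR_right omega_vertical_right omega_self k_def)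
  finally have \<beta>: "\<beta> = 0" using k by simp
  have LJ: "L' (mult_i p) = \<alpha> *\<^sub>R mult_i b + scal (\<i> * m) (\<i> * n) y"
    unfolding L'(2) mn by (simp add: \<beta> mult_i_add mult_i_scaleR mult_i_vertical)
  have "omega z p (mult_i p) = \<alpha> * k"
    using adj[OF \<xi>1] unfolding LJ by (simp add: omega_add_right omega_scaleR_right omega_vertical_right k_def)
  \<comment> \<open>Here submersivity enters. If p were vertical, its pairing with every lift would
    vanish, while a lift v of a tangent vector that is mapped to i b pairs with p to k, which is
    positive.\<close>
  moreover have "omega z p (mult_i p) \<noteq> 0"
  proof
    assume "omega z p (mult_i p) = 0"
    then obtain i j where ij: "p = scal i j z" using omega_J_eq_0[OF zh] by metis
    have "X1 \<in> ?p ` tangent_space M (pr z)" using X1 surj \<psi>x by (simp add: lft_def)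
    then obtain \<eta> where \<eta>: "\<eta> \<in> tangent_space M (pr z)" "X1 = ?p \<eta>" by blast
    obtain v where v: "lft M z v \<eta>" using M.tangent_lft[OF \<eta>(1) zh] .
    have "lft Y y (L' v) X1" using pl[OF v] \<eta>(2) by simp
    then obtain i' j' where "L' v = mult_i b + scal i' j' y" using Y.lft_eqD[OF X1] by blast
    then have "omega y b (L' v) = k" by (simp add: omega_add_right omega_vertical_right k_def)
    moreover have "omega z p v = 0" by (simp add: ij omega_vertical_left)
    ultimately show False using adj[OF v] k by simp
  qed
  ultimately have \<alpha>: "\<alpha> > 0" using omega_J_nonneg[of z p] k by (metis less_eq_real_def mult_neg_pos not_le zero_less_mult_pos2)
  \<comment> \<open>The candidate for the horizontal lift of the vector with coordinates a and c in
    the basis b, i b.\<close>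
  define lift where "lift a c = (\<lambda>g. (a / \<alpha>) * ?\<xi> g + (c / \<alpha>) * \<xi>1 g)" for a c
  have ll: "lft M z ((a / \<alpha>) *\<^sub>R p + (c / \<alpha>) *\<^sub>R mult_i p) (lift a c)" for a c
    unfolding lift_def by (rule M.lft_linear[OF p \<xi>1])
  have plift: "?p (lift a c) = \<zeta>" if \<zeta>: "lft Y y (a *\<^sub>R b + c *\<^sub>R mult_i b) \<zeta>" for a c \<zeta>
  proof -
    have "L' ((a / \<alpha>) *\<^sub>R p + (c / \<alpha>) *\<^sub>R mult_i p) = (a *\<^sub>R b + c *\<^sub>R mult_i b) +
        ((a / \<alpha>) *\<^sub>R scal m n y + (c / \<alpha>) *\<^sub>R scal (\<i> * m) (\<i> * n) y)"
      unfolding L'.add L'.scale LJ unfolding mn using \<alpha> by (simp add: \<beta> scaleR_add_right)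
    also have "\<dots> = (a *\<^sub>R b + c *\<^sub>R mult_i b) + scal ((a / \<alpha>) * m + (c / \<alpha>) * (\<i> * m)) ((a / \<alpha>) * n + (c / \<alpha>) * (\<i> * n)) y"
      by (simp add: scaleR_scal[of "_ / _"] scal_scal scal_scalar_add)
    finally have "lft Y y (L' ((a / \<alpha>) *\<^sub>R p + (c / \<alpha>) *\<^sub>R mult_i p)) \<zeta>" using Y.lft_vertical[OF \<zeta>] by simp
    then show ?thesis using Y.lft_unique pl[OF ll] by blast
  qed
  \<comment> \<open>The adjoint relation for p extends to \<open>mult_i p\<close> by moving the
    complex structure to the other argument of \<open>omega\<close>. It shows at once that the lifts
    are horizontal and that \<alpha> times a lift is Hamiltonian.\<close>
  have flift: "\<alpha> * form M (pr z) (lift a c) \<eta> = form Y (pr y) \<zeta> (?p \<eta>)"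
    if \<zeta>: "lft Y y (a *\<^sub>R b + c *\<^sub>R mult_i b) \<zeta>" and \<eta>: "\<eta> \<in> tangent_space M (pr z)" for a c \<zeta> \<eta>
  proof -
    obtain v where v: "lft M z v \<eta>" using M.tangent_lft[OF \<eta> zh] .
    obtain \<eta>' where "lft M z (mult_i v) \<eta>'" using M.lft_mult_i[OF v] .
    then have J: "omega z p (mult_i v) = omega y b (mult_i (L' v))" using adj L'(2) by metis
    have "\<alpha> * omega z ((a / \<alpha>) *\<^sub>R p + (c / \<alpha>) *\<^sub>R mult_i p) v = omega y (a *\<^sub>R b + c *\<^sub>R mult_i b) (L' v)"
      using \<alpha> adj[OF v] by (simp add: omega_add_left omega_scaleR_left omega_J_left J right_diff_distrib distrib_left)
    then show ?thesis using M.form_lft[OF ll v] Y.form_lft[OF \<zeta> pl[OF v]] by simp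
  qed
  have form0: "form Y (pr y) \<zeta> (\<lambda>g. 0) = 0" if "lft Y y w \<zeta>" for w \<zeta>
    using Y.form_lft[OF that Y.lft_zero[OF yY]] omega_scaleR_right[of y w 0 0] by simp
  have hor: "lift a c \<in> horizontal M \<psi> Y (pr z)" if \<zeta>: "lft Y y (a *\<^sub>R b + c *\<^sub>R mult_i b) \<zeta>" for a c \<zeta>
  proof -
    have "form M (pr z) (lift a c) \<eta> = 0" if "\<eta> \<in> tangent_space M (pr z)" "?p \<eta> = (\<lambda>g. 0)" for \<eta>
      using flift[OF \<zeta> that(1)] form0[OF \<zeta>] that(2) \<alpha> by simp
    then show ?thesis using ll[of a c] by (simp add: horizontal_def lft_def)
  qed
  \<comment> \<open>The difference of two horizontal lifts of the same vector lies in the kernel of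
    the differential, and so does its multiple by the imaginary unit. Horizontality makes the two
    orthogonal, so positivity makes the difference zero.\<close>
  have uniq: "\<xi> = \<xi>'" if \<xi>: "\<xi> \<in> horizontal M \<psi> Y (pr z)" "\<xi>' \<in> horizontal M \<psi> Y (pr z)" "?p \<xi> = ?p \<xi>'" for \<xi> \<xi>'
  proof -
    have t: "\<xi> \<in> tangent_space M (pr z)" "\<xi>' \<in> tangent_space M (pr z)" using \<xi> by (auto simp: horizontal_def)
    obtain v v' where v: "lft M z v \<xi>" "lft M z v' \<xi>'" using M.tangent_lft t zh by metis
    let ?\<delta> = "\<lambda>g. 1 * \<xi> g + (- 1) * \<xi>' g" and ?v = "1 *\<^sub>R v + (- 1) *\<^sub>R v'"
    have \<delta>: "lft M z ?v ?\<delta>" by (rule M.lft_linear[OF v])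
    have "?p ?\<delta> = (\<lambda>g. 0)" unfolding plin \<xi>(3) by simp
    then have "lft Y y (L' ?v) (\<lambda>g. 0)" using pl[OF \<delta>] by simp
    then obtain i j where "L' ?v = 0 + scal i j y" using Y.lft_eqD[OF Y.lft_zero[OF yY]] by blast
    then have LJv: "L' (mult_i ?v) = 0 + scal (\<i> * i) (\<i> * j) y" using L'(2)[of ?v] mult_i_vertical[of i j y] by simp
    obtain \<delta>' where \<delta>': "lft M z (mult_i ?v) \<delta>'" using M.lft_mult_i[OF \<delta>] .
    have "lft Y y (L' (mult_i ?v)) (\<lambda>g. 0)" unfolding LJv by (rule Y.lft_vertical[OF Y.lft_zero[OF yY]])
    then have "?p \<delta>' = (\<lambda>g. 0)" using Y.lft_unique pl[OF \<delta>'] by blast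
    then have "form M (pr z) \<xi> \<delta>' = 0" "form M (pr z) \<xi>' \<delta>' = 0"
      using \<xi> \<delta>' by (auto simp: horizontal_def lft_def)
    then have "omega z v (mult_i ?v) = 0" "omega z v' (mult_i ?v) = 0"
      using M.form_lft[OF v(1) \<delta>'] M.form_lft[OF v(2) \<delta>'] by simp_all
    then have "omega z ?v (mult_i ?v) = 0"
      using omega_add_left[of z "1 *\<^sub>R v" "(- 1) *\<^sub>R v'" "mult_i ?v"] unfolding omega_scaleR_left by simp
    then obtain i j where "?v = scal i j z" using omega_J_eq_0[OF zh] by metis
    then have "lft M z ?v (\<lambda>g. 0)" using M.lft_vertical[OF M.lft_zero[OF zh z(2)], of i j] by simp
    then have "?\<delta> = (\<lambda>g. 0)" using M.lft_unique[OF \<delta>] by blast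
    then show ?thesis by (simp add: fun_eq_iff)
  qed
  have coord: "\<exists>a c. lft Y y (a *\<^sub>R b + c *\<^sub>R mult_i b) \<zeta>" if "\<zeta> \<in> tangent_space Y (pr y)" for \<zeta>
    using Y.complex_line[OF refl b h0(2) that] by blast
  show ?thesis
  proof (intro exI[of _ "1 / \<alpha>"] conjI ballI allI impI)
    show "1 / \<alpha> > 0" using \<alpha> by simp
    fix \<zeta> assume "\<zeta> \<in> tangent_space Y (\<psi> (pr z))"
    then obtain a c where ac: "lft Y y (a *\<^sub>R b + c *\<^sub>R mult_i b) \<zeta>" using coord \<psi>x by metis
    show "\<exists>!\<xi>. \<xi> \<in> horizontal M \<psi> Y (pr z) \<and> ?p \<xi> = \<zeta>"
      by (rule ex1I[of _ "lift a c"]) (use hor[OF ac] plift[OF ac] uniq in auto)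
  next
    fix h :: "ppoint \<Rightarrow> real" assume h: "smooth_fun_on Y (pts Y) h"
    have "openin (mtop Y) (pts Y)" by (metis Y.mtop_eq Y.pts_hcone topspace_PP topspace_subtopology_subset openin_topspace)
    then have hn: "smooth_near Y (pr y) h" using h yY(2) unfolding smooth_near_def by blast
    let ?\<zeta> = "ham_vec Y h (pr y)"
    obtain a c where ac: "lft Y y (a *\<^sub>R b + c *\<^sub>R mult_i b) ?\<zeta>" using coord[OF Y.ham_vec(1)[OF hn]] by blast
    \<comment> \<open>The zero term only gives the multiple the form of a linear combination, as
      \<open>M.lft_linear\<close> expects.\<close>
    have "ham_vec M (\<lambda>y. h (\<psi> y)) (pr z) = (\<lambda>g. \<alpha> * lift a c g + 0 * lift a c g)"
    proof (rule M.ham_vec_eqI[OF z(2)])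
      have s: "lft M z (\<alpha> *\<^sub>R ((a / \<alpha>) *\<^sub>R p + (c / \<alpha>) *\<^sub>R mult_i p) + 0 *\<^sub>R ((a / \<alpha>) *\<^sub>R p + (c / \<alpha>) *\<^sub>R mult_i p))
          (\<lambda>g. \<alpha> * lift a c g + 0 * lift a c g)" by (rule M.lft_linear[OF ll ll])
      then show "(\<lambda>g. \<alpha> * lift a c g + 0 * lift a c g) \<in> tangent_space M (pr z)" by (simp add: lft_def)
      fix \<eta> assume \<eta>: "\<eta> \<in> tangent_space M (pr z)"
      obtain v where v: "lft M z v \<eta>" using M.tangent_lft[OF \<eta> zh] .
      have "form M (pr z) (\<lambda>g. \<alpha> * lift a c g + 0 * lift a c g) \<eta> = \<alpha> * form M (pr z) (lift a c) \<eta>"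
        unfolding M.form_lft[OF s v] M.form_lft[OF ll v] omega_add_left[of z "\<alpha> *\<^sub>R _"] omega_scaleR_left by simp
      also have "\<dots> = form Y (pr y) ?\<zeta> (?p \<eta>)" by (rule flift[OF ac \<eta>])
      also have "\<dots> = \<eta> (\<lambda>y. h (\<psi> y))" using Y.ham_vec(2)[OF hn ptan[OF \<eta>]] pham[OF hn] by simp
      finally show "form M (pr z) (\<lambda>g. \<alpha> * lift a c g + 0 * lift a c g) \<eta> = \<eta> (\<lambda>y. h (\<psi> y))" .
    qed
    then have "(\<lambda>g. 1 / \<alpha> * ham_vec M (\<lambda>y. h (\<psi> y)) (pr z) g) = lift a c" using \<alpha> by (simp add: fun_eq_iff)
    moreover have "horizontal_lift M \<psi> Y (pr z) ?\<zeta> = lift a c"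
      unfolding horizontal_lift_def
      by (rule the_equality) (use hor[OF ac] plift[OF ac] uniq in auto)
    ultimately show "horizontal_lift M \<psi> Y (pr z) (ham_vec Y h (\<psi> (pr z))) =
       (\<lambda>g. 1 / \<alpha> * ham_vec M (\<lambda>y. h (\<psi> y)) (pr z) g)" by (simp add: \<psi>x)
  qed
qed

end

lemma univ3:
  assumes "a \<noteq> b" "a \<noteq> c" "b \<noteq> (c :: 3)" shows "UNIV = {a, b, c}"
proof -
  have "card {a, b, c} = 3" using assms by simp
  then show ?thesis using card_subset_eq[of UNIV "{a, b, c}"] by auto
qed

lemma sum3:
  assumes "a \<noteq> b" "a \<noteq> c" "b \<noteq> (c :: 3)" shows "sum f UNIV = f a + f b + (f c :: complex)"
  unfolding univ3[OF assms] using assms by (simp add: add.assoc)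

lemma third_index:
  obtains c :: 3 where "c \<noteq> a" "c \<noteq> b"
proof -
  have "\<not> UNIV \<subseteq> {a, b}"
  proof
    assume "UNIV \<subseteq> {a, b}"
    then have "card (UNIV :: 3 set) \<le> card {a, b}" by (intro card_mono) auto
    also have "\<dots> \<le> 2" by (simp add: card_insert_if)
    finally show False by simp
  qed
  then show ?thesis using that by auto
qed

section \<open>The flag variety, the target line and the fibres\<close>

definition locus :: "(hvec \<Rightarrow> bool) \<Rightarrow> ppoint set" where
  "locus F = {pr z | z. z \<in> hcone \<and> F z}"

definition homogeneous :: "(hvec \<Rightarrow> bool) \<Rightarrow> bool" where
  "homogeneous F \<longleftrightarrow> (\<forall>z c d. c \<noteq> 0 \<longrightarrow> d \<noteq> 0 \<longrightarrow> F z \<longrightarrow> F (scal c d z))"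

lemma locus_iff:
  assumes "homogeneous F" "z \<in> hcone" shows "pr z \<in> locus F \<longleftrightarrow> F z"
proof
  assume "pr z \<in> locus F"
  then obtain y where y: "y \<in> hcone" "F y" "pr y = pr z" unfolding locus_def by force
  obtain c d where "c \<noteq> 0" "d \<noteq> 0" "z = scal c d y" using pr_eqD[OF y(3) assms(2)] .
  then show "F z" using assms(1) y(2) unfolding homogeneous_def by blast
next
  assume "F z"
  then show "pr z \<in> locus F" unfolding locus_def using assms(2) by blast
qed

lemma locusE:
  assumes "x \<in> locus F" obtains z where "z \<in> hcone" "F z" "x = pr z"
  using assms unfolding locus_def by blast

lemma locus_hcone: "locus F \<subseteq> pr ` hcone"
  unfolding locus_def by blast

lemma has_derivative_vecI:
  fixes f :: "'e::euclidean_space \<Rightarrow> complex ^ 'n"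
  assumes "\<And>k. ((\<lambda>u. f u $ k) has_derivative (\<lambda>h. f' h $ k)) (at u)"
  shows "(f has_derivative f') (at u)"
proof -
  have "((\<lambda>u. \<Sum>k\<in>UNIV. axis k (f u $ k)) has_derivative (\<lambda>h. \<Sum>k\<in>UNIV. axis k (f' h $ k))) (at u)"
    by (intro has_derivative_sum bounded_linear.has_derivative[OF bounded_linear_axis] assms)
  moreover have "(\<Sum>k\<in>UNIV. axis k (x $ k)) = x" for x :: "complex ^ 'n"
    by (simp add: vec_eq_iff axis_def)
  ultimately show ?thesis by simp
qed

text \<open>Holomorphy on the whole vector space is enough: all lifts of charts, and the lift of the
  pencil, are polynomial maps.\<close>

definition hol :: "(hvec \<Rightarrow> complex) \<Rightarrow> bool" where
  "hol f \<longleftrightarrow> smooth_on UNIV f \<and> (\<forall>u. \<exists>f'. (f has_derivative f') (at u) \<and> (\<forall>v. f' (mult_i v) = \<i> * f' v))"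

lemma hol_const: "hol (\<lambda>u. c)"
  unfolding hol_def by (intro conjI allI smooth_on_const exI[of _ "\<lambda>_. 0"]) auto

lemma hol_fst: "hol (\<lambda>u. fst u $ k)"
  unfolding hol_def
proof (intro conjI allI)
  fix u :: hvec
  have "bounded_linear (\<lambda>u :: hvec. fst u $ k)"
    using bounded_linear_compose[OF bounded_linear_vec_nth bounded_linear_fst] .
  then show "\<exists>f'. ((\<lambda>u. fst u $ k) has_derivative f') (at u) \<and> (\<forall>v. f' (mult_i v) = \<i> * f' v)"
    using bounded_linear_imp_has_derivative by (intro exI[of _ "\<lambda>u. fst u $ k"]) (simp add: mult_i_def)
qed (intro smooth_on_nth smooth_on_fst smooth_on_ident)

lemma hol_snd: "hol (\<lambda>u. snd u $ k)"
  unfolding hol_def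
proof (intro conjI allI)
  fix u :: hvec
  have "bounded_linear (\<lambda>u :: hvec. snd u $ k)"
    using bounded_linear_compose[OF bounded_linear_vec_nth bounded_linear_snd] .
  then show "\<exists>f'. ((\<lambda>u. snd u $ k) has_derivative f') (at u) \<and> (\<forall>v. f' (mult_i v) = \<i> * f' v)"
    using bounded_linear_imp_has_derivative by (intro exI[of _ "\<lambda>u. snd u $ k"]) (simp add: mult_i_def)
qed (intro smooth_on_nth smooth_on_snd smooth_on_ident)

lemma hol_add: "hol f \<Longrightarrow> hol g \<Longrightarrow> hol (\<lambda>u. f u + g u)"
  unfolding hol_def
proof (elim conjE, intro conjI allI)
  fix u assume "\<forall>u. \<exists>f'. (f has_derivative f') (at u) \<and> (\<forall>v. f' (mult_i v) = \<i> * f' v)"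
    "\<forall>u. \<exists>f'. (g has_derivative f') (at u) \<and> (\<forall>v. f' (mult_i v) = \<i> * f' v)"
  then obtain f' g' where "(f has_derivative f') (at u)" "\<forall>v. f' (mult_i v) = \<i> * f' v"
    "(g has_derivative g') (at u)" "\<forall>v. g' (mult_i v) = \<i> * g' v" by metis
  then show "\<exists>f'. ((\<lambda>u. f u + g u) has_derivative f') (at u) \<and> (\<forall>v. f' (mult_i v) = \<i> * f' v)"
    by (intro exI[of _ "\<lambda>v. f' v + g' v"]) (auto intro: has_derivative_add simp: algebra_simps)
qed (rule smooth_on_add)

lemma hol_mult: "hol f \<Longrightarrow> hol g \<Longrightarrow> hol (\<lambda>u. f u * g u)"
  unfolding hol_def
proof (elim conjE, intro conjI allI)
  fix u assume "\<forall>u. \<exists>f'. (f has_derivative f') (at u) \<and> (\<forall>v. f' (mult_i v) = \<i> * f' v)"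
    "\<forall>u. \<exists>f'. (g has_derivative f') (at u) \<and> (\<forall>v. f' (mult_i v) = \<i> * f' v)"
  then obtain f' g' where "(f has_derivative f') (at u)" "\<forall>v. f' (mult_i v) = \<i> * f' v"
    "(g has_derivative g') (at u)" "\<forall>v. g' (mult_i v) = \<i> * g' v" by metis
  then show "\<exists>f'. ((\<lambda>u. f u * g u) has_derivative f') (at u) \<and> (\<forall>v. f' (mult_i v) = \<i> * f' v)"
    by (intro exI[of _ "\<lambda>v. f u * g' v + f' v * g u"]) (auto intro: has_derivative_mult simp: algebra_simps)
qed (rule smooth_on_mult)

lemma hol_minus: "hol f \<Longrightarrow> hol (\<lambda>u. - f u)"
  using hol_mult[OF hol_const[of "- 1"], of f] by simp

lemmas hol_intros = hol_const hol_fst hol_snd hol_add hol_mult hol_minus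

lemma hol_vec:
  assumes "\<And>k. hol (\<lambda>u. fst (L u) $ k)" "\<And>k. hol (\<lambda>u. snd (L u) $ k)"
  shows "smooth_on UNIV L" "\<exists>L'. (L has_derivative L') (at u) \<and> (\<forall>v. L' (mult_i v) = mult_i (L' v))"
proof -
  have "smooth_on UNIV (\<lambda>u. fst (L u))" "smooth_on UNIV (\<lambda>u. snd (L u))"
    by (rule smooth_on_vec; use assms in \<open>simp add: hol_def\<close>)+
  from smooth_on_Pair[OF this] show "smooth_on UNIV L" by simp
  have "\<forall>k. \<exists>f'. ((\<lambda>u. fst (L u) $ k) has_derivative f') (at u) \<and> (\<forall>v. f' (mult_i v) = \<i> * f' v)"
    using assms(1) unfolding hol_def by blast
  from choice[OF this] obtain f' where
    f': "\<And>k. ((\<lambda>u. fst (L u) $ k) has_derivative f' k) (at u)" "\<And>k v. f' k (mult_i v) = \<i> * f' k v"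
    by blast
  have "\<forall>k. \<exists>f'. ((\<lambda>u. snd (L u) $ k) has_derivative f') (at u) \<and> (\<forall>v. f' (mult_i v) = \<i> * f' v)"
    using assms(2) unfolding hol_def by blast
  from choice[OF this] obtain g' where
    g': "\<And>k. ((\<lambda>u. snd (L u) $ k) has_derivative g' k) (at u)" "\<And>k v. g' k (mult_i v) = \<i> * g' k v"
    by blast
  have "((\<lambda>u. fst (L u)) has_derivative (\<lambda>v. \<chi> k. f' k v)) (at u)"
    by (rule has_derivative_vecI) (simp add: f'(1))
  moreover have "((\<lambda>u. snd (L u)) has_derivative (\<lambda>v. \<chi> k. g' k v)) (at u)"
    by (rule has_derivative_vecI) (simp add: g'(1))
  ultimately have "((\<lambda>u. (fst (L u), snd (L u))) has_derivative (\<lambda>v. (\<chi> k. f' k v, \<chi> k. g' k v))) (at u)"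
    by (rule has_derivative_Pair)
  moreover have "(\<chi> k. f' k (mult_i v), \<chi> k. g' k (mult_i v)) = mult_i (\<chi> k. f' k v, \<chi> k. g' k v)" for v
    unfolding f'(2) g'(2) by (simp add: mult_i_def scal_def vec_eq_iff)
  ultimately show "\<exists>L'. (L has_derivative L') (at u) \<and> (\<forall>v. L' (mult_i v) = mult_i (L' v))"
    by (intro exI[of _ "\<lambda>v. (\<chi> k. f' k v, \<chi> k. g' k v)"]) simp
qed

text \<open>In the slice x_a = y_b = 1 the locus is a graph. The map j places the free coordinates
  in a linear subspace of \<open>hvec\<close>, L fills in the coordinates solved for, and \<rho>
  reads the free ones back.\<close>

lemma nchart_graph:
  fixes j :: "'x::euclidean_space \<Rightarrow> hvec" and \<rho> :: "hvec \<Rightarrow> 'x"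
  assumes F: "homogeneous F" and j: "linear j" and \<rho>: "linear \<rho>" and d: "DIM('x) = d"
    and J: "\<And>x. mult_i (j x) \<in> range j"
    and L: "\<And>k. hol (\<lambda>u. fst (L u) $ k)" "\<And>k. hol (\<lambda>u. snd (L u) $ k)"
    and n: "\<And>x. fst (L (j x)) $ a = 1" "\<And>x. snd (L (j x)) $ b = 1"
    and inv: "\<And>x. \<rho> (L (j x)) = x" and FL: "\<And>x. F (L (j x))"
    and im: "\<And>z. fst z $ a = 1 \<Longrightarrow> snd z $ b = 1 \<Longrightarrow> F z \<Longrightarrow> L (j (\<rho> z)) = z"
  shows "nchart d (locus F) (range j) L (\<lambda>p. j (\<rho> (affrep a b p))) (pr ` affcone a b)"
proof -
  have sp: "subspace (range j)" using linear_subspace_image[OF j subspace_UNIV] .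
  have span: "span (range j) = range j" using sp by simp
  have "inj j" by (rule inj_on_inverseI[of _ "\<lambda>u. \<rho> (L u)"]) (rule inv)
  then have "inj_on j (span UNIV)" by simp
  then have dim: "dim (range j) = d" using dim_image_eq[OF j, of UNIV] d by simp
  have Laff: "L (j x) \<in> affcone a b" for x by (simp add: affcone_def n)
  then have Lh: "L (j x) \<in> hcone" for x using affcone_hcone by blast
  have jb: "bounded_linear (\<lambda>z. j (\<rho> z))"
    using j \<rho> by (auto simp: linear_conv_bounded_linear intro: bounded_linear_compose)
  have r: "affrep a b (pr (L (j x))) = L (j x)" for x
    using affrep_pr[OF Lh] by (simp add: n)
  show ?thesis
    unfolding nchart_def span
  proof (intro conjI)
    show "mult_i ` range j \<subseteq> range j" using J by blast
    show "L ` range j \<subseteq> hcone" using Lh by blast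
    show "smooth_on (range j) L" by (rule smooth_on_subset[OF hol_vec(1)[OF L]]) simp
    show "\<forall>u\<in>range j. \<exists>L'. (L has_derivative L') (at u) \<and> (\<forall>v. L' (mult_i v) = mult_i (L' v))"
      using hol_vec(2)[OF L] by blast
    show "smooth_fun_on PP (pr ` affcone a b) (\<lambda>p. j (\<rho> (affrep a b p)))"
      by (rule smooth_fun_on_bounded_linear[OF jb smooth_affrep])
    show "\<forall>u\<in>range j. j (\<rho> (affrep a b (pr (L u)))) = u" using r inv by auto
    show "pr ` L ` range j = locus F \<inter> pr ` affcone a b"
    proof (intro set_eqI iffI)
      fix x assume "x \<in> pr ` L ` range j"
      then obtain y where "x = pr (L (j y))" by blast
      then show "x \<in> locus F \<inter> pr ` affcone a b"
        using locus_iff[OF F Lh] FL Laff by simp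
    next
      fix x assume x: "x \<in> locus F \<inter> pr ` affcone a b"
      let ?z = "affrep a b x"
      have z: "?z \<in> hcone" "pr ?z = x" using pr_affrep x by blast+
      obtain y where y: "y \<in> affcone a b" "x = pr y" using x by blast
      then have "?z = scal (1 / fst y $ a) (1 / snd y $ b) y" using affrep_pr[of y a b] affcone_hcone by auto
      then have n1: "fst ?z $ a = 1" "snd ?z $ b = 1" using y(1) by (simp_all add: affcone_def)
      have "F ?z" using locus_iff[OF F z(1)] z(2) x by simp
      then have "L (j (\<rho> ?z)) = ?z" by (rule im[OF n1])
      then show "x \<in> pr ` L ` range j" using z(2) by (metis imageI rangeI)
    qed
  qed (use openin_affcone dim in auto)
qed

lemma range_linear_connected:
  fixes j :: "'x::euclidean_space \<Rightarrow> hvec"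
  assumes "linear j" shows "connected (range j)"
  using linear_subspace_image[OF assms subspace_UNIV] subspace_imp_convex convex_connected by blast

lemma nchart_connected:
  assumes c: "nchart d S E L r V" and E: "connected E" shows "connectedin (mtop PP) (S \<inter> V)"
proof -
  have *: "L ` E \<subseteq> hcone" "smooth_on E L" "pr ` L ` E = S \<inter> V" using c by (auto simp: nchart_def)
  have "continuous_map (top_of_set E) (top_of_set hcone) L"
    using *(1) smooth_on_continuous[OF *(2)] by (simp add: continuous_map_in_subtopology image_subset_iff_funcset)
  then have "continuous_map (top_of_set E) (mtop PP) (pr \<circ> L)"
    using continuous_map_pr by (rule continuous_map_compose)
  moreover have "connectedin (top_of_set E) E" using E by (simp add: connectedin_subtopology)
  ultimately have "connectedin (mtop PP) ((pr \<circ> L) ` E)" by (rule connectedin_continuous_map_image)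
  then show ?thesis using *(3) by (simp add: image_comp)
qed

text \<open>Each affine piece of the loci below is the image of a linear space, hence connected; the
  pieces are glued at a common point x0.\<close>

lemma connectedin_cover:
  assumes "\<And>x. x \<in> S \<Longrightarrow> \<exists>V. x \<in> V \<and> x0 \<in> V \<and> connectedin (mtop PP) (S \<inter> V)" and "x0 \<in> S"
  shows "connectedin (mtop PP) S"
proof -
  let ?C = "{C. x0 \<in> C \<and> C \<subseteq> S \<and> connectedin (mtop PP) C}"
  have "connectedin (mtop PP) (\<Union>?C)" by (rule connectedin_Union) auto
  moreover have "\<Union>?C = S"
  proof
    show "S \<subseteq> \<Union>?C"
    proof
      fix x assume "x \<in> S"
      then obtain V where "x \<in> V" "x0 \<in> V" "connectedin (mtop PP) (S \<inter> V)" using assms(1) by blast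
      then show "x \<in> \<Union>?C" using \<open>x \<in> S\<close> assms(2) by (intro UnionI[of "S \<inter> V"]) auto
    qed
  qed blast
  ultimately show ?thesis by simp
qed

section \<open>Equations of the flag variety, the fibres and the target line\<close>

definition bil :: "hvec \<Rightarrow> complex" where
  "bil z = (\<Sum>i\<in>UNIV. fst z $ i * snd z $ i)"

abbreviation flag_eq :: "hvec \<Rightarrow> bool" where
  "flag_eq z \<equiv> bil z = 0"

text \<open>The 2 x 2 minors of the matrix with columns (x_i y_i) and p. They express
  proportionality to p including the zero vector, so that base points satisfy them for every p, and
  they do not depend on the scaling of p.\<close>

definition fibre_eqs :: "complex ^ 3 \<Rightarrow> hvec \<Rightarrow> bool" where
  "fibre_eqs p z \<longleftrightarrow> (\<forall>i k. fst z $ i * snd z $ i * p $ k = fst z $ k * snd z $ k * p $ i)"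

definition line_eqs :: "hvec \<Rightarrow> bool" where
  "line_eqs z \<longleftrightarrow> fst z $ 3 = 0 \<and> snd z $ 1 = 0 \<and> snd z $ 2 = 0"

lemma flag_points_locus: "flag_points = locus flag_eq"
  unfolding flag_points_def locus_def bil_def pr_def hcone_def by (auto simp: prod_eq_iff)

lemma bil_scal: "bil (scal c d z) = c * d * bil z"
  by (simp add: bil_def sum_distrib_left mult_ac)

lemma homogeneous_flag: "homogeneous flag_eq"
  by (simp add: homogeneous_def bil_scal)

lemma homogeneous_fibre_eqs: "homogeneous (fibre_eqs p)"
  unfolding homogeneous_def
proof (intro allI impI)
  fix z c d assume F: "fibre_eqs p z"
  have "(c * fst z $ i) * (d * snd z $ i) * p $ k = (c * fst z $ k) * (d * snd z $ k) * p $ i" for i k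
  proof -
    have "c * d * (fst z $ i * snd z $ i * p $ k) = c * d * (fst z $ k * snd z $ k * p $ i)"
      using F by (simp only: fibre_eqs_def)
    then show ?thesis by (simp add: mult_ac)
  qed
  then show "fibre_eqs p (scal c d z)" by (simp add: fibre_eqs_def)
qed

lemma homogeneous_line_eqs: "homogeneous line_eqs"
  by (simp add: homogeneous_def line_eqs_def)

text \<open>Summing the minors for a fixed k with p_k nonzero transfers the relation between the p_i
  to the products x_i y_i.\<close>

lemma fibre_eqs_bil: "fibre_eqs p z \<Longrightarrow> p \<noteq> 0 \<Longrightarrow> (\<Sum>i\<in>UNIV. p $ i) = 0 \<Longrightarrow> bil z = 0"
proof -
  assume F: "fibre_eqs p z" and p: "p \<noteq> 0" "(\<Sum>i\<in>UNIV. p $ i) = 0"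
  obtain k where k: "p $ k \<noteq> 0" using p(1) by (auto simp: vec_eq_iff)
  have "bil z * p $ k = (\<Sum>i\<in>UNIV. fst z $ k * snd z $ k * p $ i)"
    unfolding bil_def sum_distrib_right using F by (simp only: fibre_eqs_def)
  also have "\<dots> = 0" using p(2) by (simp add: sum_distrib_left[symmetric])
  finally show ?thesis using k by simp
qed

text \<open>If x_a is the chosen nonzero coordinate and y vanished off a, the incidence relation
  would reduce to x_a y_a = 0 and y would be zero. So charts with two different normalised indices
  cover the flag variety.\<close>

lemma flag_indices:
  assumes "z \<in> hcone" "bil z = 0"
  obtains a b c where "a \<noteq> b" "a \<noteq> c" "b \<noteq> c" "z \<in> affcone a b"
proof -
  obtain a where a: "fst z $ a \<noteq> 0" using assms(1) by (auto simp: hcone_def vec_eq_iff)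
  have "\<exists>b. b \<noteq> a \<and> snd z $ b \<noteq> 0"
  proof (rule ccontr)
    assume "\<not> ?thesis"
    then have 0: "snd z $ b = 0" if "b \<noteq> a" for b using that by blast
    have "bil z = (\<Sum>i\<in>UNIV. if i = a then fst z $ a * snd z $ a else 0)"
      unfolding bil_def by (intro sum.cong) (auto simp: 0)
    then have "snd z $ a = 0" using assms(2) a by simp
    then have "snd z = 0" using 0 by (metis vec_eq_iff zero_index)
    then show False using assms(1) by (simp add: hcone_def)
  qed
  then obtain b where b: "b \<noteq> a" "snd z $ b \<noteq> 0" by blast
  obtain c where "c \<noteq> a" "c \<noteq> b" by (rule third_index)
  then show ?thesis using that[of a b c] a b by (auto simp: affcone_def)
qed

lemma axis_add: "axis k (x + y) = axis k x + axis k (y :: complex)"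
  by (simp add: vec_eq_iff axis_def)

lemma axis_scaleR: "axis k (r *\<^sub>R x) = r *\<^sub>R axis k (x :: complex)"
  by (simp add: vec_eq_iff axis_def)

lemma scale_axis: "c *s axis k x = axis k (c * x :: complex)"
  by (simp add: vec_eq_iff axis_def)

lemma hol_if: "(P \<Longrightarrow> hol f) \<Longrightarrow> (\<not> P \<Longrightarrow> hol g) \<Longrightarrow> hol (\<lambda>u. if P then f u else g u)"
  by (cases P) auto

text \<open>With x_a = y_b = 1 the incidence relation reads y_a + x_b + x_c y_c = 0. It is solved
  for y_a, and x_b, x_c, y_c remain free.\<close>

lemma nchart_flag:
  assumes "a \<noteq> b" "a \<noteq> c" "b \<noteq> (c :: 3)"
  obtains E L r where "nchart 6 (locus flag_eq) E L r (pr ` affcone a b)"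
proof -
  let ?j = "\<lambda>(s, t, w). (axis b s + axis c t, axis c w) :: hvec"
  let ?\<rho> = "\<lambda>z :: hvec. (fst z $ b, fst z $ c, snd z $ c)"
  let ?L = "\<lambda>u :: hvec. (\<chi> k. if k = a then 1 else if k = b then fst u $ b else fst u $ c,
     \<chi> k. if k = b then 1 else if k = c then snd u $ c else - (fst u $ b + fst u $ c * snd u $ c)) :: hvec"
  have "nchart 6 (locus flag_eq) (range ?j) ?L (\<lambda>p. ?j (?\<rho> (affrep a b p))) (pr ` affcone a b)"
  proof (rule nchart_graph[OF homogeneous_flag])
    show "linear ?j" by (intro linearI) (auto simp: axis_add axis_scaleR algebra_simps)
    show "linear ?\<rho>" by (intro linearI) auto
    show "DIM(complex \<times> complex \<times> complex) = 6" by simp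
    show "mult_i (?j x) \<in> range ?j" for x
      by (intro image_eqI[of _ _ "(\<i> * fst x, \<i> * fst (snd x), \<i> * snd (snd x))"])
         (auto simp: mult_i_def scal_def vector_add_ldistrib scale_axis split: prod.splits)
    show "hol (\<lambda>u. fst (?L u) $ k)" "hol (\<lambda>u. snd (?L u) $ k)" for k
      by (auto intro!: hol_if hol_intros)
    show "bil (?L (?j x)) = 0" for x
      using assms by (cases x) (simp add: bil_def sum3[OF assms] axis_def)
    show "?L (?j (?\<rho> z)) = z" if "fst z $ a = 1" "snd z $ b = 1" "bil z = 0" for z
    proof -
      have "snd z $ a + fst z $ b + fst z $ c * snd z $ c = 0"
        using that by (simp add: bil_def sum3[OF assms])
      then have 1: "snd z $ a = - (fst z $ b + fst z $ c * snd z $ c)" by (simp only: eq_neg_iff_add_eq_0 add.assoc)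
      have ex: "k = a \<or> k = b \<or> k = c" for k using univ3[OF assms] by blast
      have "fst (?L (?j (?\<rho> z))) $ k = fst z $ k \<and> snd (?L (?j (?\<rho> z))) $ k = snd z $ k" for k
        using ex[of k] assms that 1 by (auto simp: axis_def)
      then show ?thesis unfolding prod_eq_iff vec_eq_iff by blast
    qed
  qed (use assms in \<open>auto simp: axis_def\<close>)
  then show ?thesis by (rule that)
qed

text \<open>With x_a = y_b = 1 the minors give x_b = (p_b / p_c) x_c y_c and y_a = (p_a / p_c) x_c
  y_c, with x_c and y_c free. The chart passes through the base points, where x_c y_c = 0, so the
  closed fibre is smooth there too.\<close>

lemma nchart_fibre_eqs:
  assumes abc: "a \<noteq> b" "a \<noteq> c" "b \<noteq> (c :: 3)" and p: "\<And>k. p $ k \<noteq> 0"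
  obtains E L r where "nchart 4 (locus (fibre_eqs p)) E L r (pr ` affcone a b)" "connected E"
proof -
  let ?j = "\<lambda>(s, t). (axis c s, axis c t) :: hvec"
  let ?\<rho> = "\<lambda>z :: hvec. (fst z $ c, snd z $ c)"
  let ?L = "\<lambda>u :: hvec. (\<chi> k. if k = a then 1 else if k = b then p $ b / p $ c * (fst u $ c * snd u $ c) else fst u $ c,
     \<chi> k. if k = b then 1 else if k = c then snd u $ c else p $ a / p $ c * (fst u $ c * snd u $ c)) :: hvec"
  have ex: "k = a \<or> k = b \<or> k = c" for k using univ3[OF abc] by blast
  have lin: "linear ?j" by (intro linearI) (auto simp: axis_add axis_scaleR)
  have "nchart 4 (locus (fibre_eqs p)) (range ?j) ?L (\<lambda>q. ?j (?\<rho> (affrep a b q))) (pr ` affcone a b)"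
  proof (rule nchart_graph[OF homogeneous_fibre_eqs lin])
    show "linear ?\<rho>" by (intro linearI) auto
    show "DIM(complex \<times> complex) = 4" by simp
    show "mult_i (?j x) \<in> range ?j" for x
      by (intro image_eqI[of _ _ "(\<i> * fst x, \<i> * snd x)"])
         (auto simp: mult_i_def scal_def scale_axis split: prod.splits)
    show "hol (\<lambda>u. fst (?L u) $ k)" "hol (\<lambda>u. snd (?L u) $ k)" for k
      by (auto intro!: hol_if hol_intros)
    show "fibre_eqs p (?L (?j x))" for x
    proof -
      obtain s t where x: "x = (s, t)" by (cases x)
      have "fst (?L (?j x)) $ i * snd (?L (?j x)) $ i = s * t / p $ c * p $ i" for i
        using ex[of i] abc p[of c] by (auto simp: x axis_def)
      then show ?thesis unfolding fibre_eqs_def by simp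
    qed
    show "?L (?j (?\<rho> z)) = z" if z: "fst z $ a = 1" "snd z $ b = 1" "fibre_eqs p z" for z
    proof -
      have "fst z $ b * p $ c = fst z $ c * snd z $ c * p $ b"
        using z(3)[unfolded fibre_eqs_def, rule_format, of b c] z(2) by simp
      then have 1: "p $ b / p $ c * (fst z $ c * snd z $ c) = fst z $ b" using p[of c] by (simp add: field_simps)
      have "snd z $ a * p $ c = fst z $ c * snd z $ c * p $ a"
        using z(3)[unfolded fibre_eqs_def, rule_format, of a c] z(1) by simp
      then have 2: "p $ a / p $ c * (fst z $ c * snd z $ c) = snd z $ a" using p[of c] by (simp add: field_simps)
      have "fst (?L (?j (?\<rho> z))) $ k = fst z $ k \<and> snd (?L (?j (?\<rho> z))) $ k = snd z $ k" for k
        using ex[of k] abc z 1 2 by (auto simp: axis_def)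
      then show ?thesis unfolding prod_eq_iff vec_eq_iff by blast
    qed
  qed (use abc in \<open>auto simp: axis_def\<close>)
  then show ?thesis using that range_linear_connected[OF lin] by blast
qed

lemma nchart_line_eqs:
  assumes abc: "a \<noteq> b" "a \<noteq> 3" "b \<noteq> (3 :: 3)"
  obtains E L r where "nchart 2 (locus line_eqs) E L r (pr ` affcone a 3)" "connected E"
proof -
  let ?j = "\<lambda>s. (axis b s, 0) :: hvec"
  let ?\<rho> = "\<lambda>z :: hvec. fst z $ b"
  let ?L = "\<lambda>u :: hvec. (\<chi> k. if k = a then 1 else if k = b then fst u $ b else 0, \<chi> k. if k = 3 then 1 else 0) :: hvec"
  have ex: "k = a \<or> k = b \<or> k = 3" for k using univ3[OF abc] by blast
  \<comment> \<open>The indices a and b are 1 and 2 in some order, which allows the equations to be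
    restated for both charts at once.\<close>
  have ab: "{a, b} = {1, 2}"
  proof -
    have "(1::3) \<noteq> 2" "(1::3) \<noteq> 3" "(2::3) \<noteq> 3" by simp_all
    then show ?thesis using ex[of 1] ex[of 2] by auto
  qed
  have line_eqs: "line_eqs z \<longleftrightarrow> fst z $ 3 = 0 \<and> snd z $ a = 0 \<and> snd z $ b = 0" for z
    using ab unfolding line_eqs_def doubleton_eq_iff by auto
  have lin: "linear ?j" by (intro linearI) (auto simp: axis_add axis_scaleR)
  have "nchart 2 (locus line_eqs) (range ?j) ?L (\<lambda>q. ?j (?\<rho> (affrep a 3 q))) (pr ` affcone a 3)"
  proof (rule nchart_graph[OF homogeneous_line_eqs lin])
    show "linear ?\<rho>" by (intro linearI) auto
    show "mult_i (?j x) \<in> range ?j" for x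
      by (intro image_eqI[of _ _ "\<i> * x"]) (auto simp: mult_i_def scal_def scale_axis vec_eq_iff)
    show "hol (\<lambda>u. fst (?L u) $ k)" "hol (\<lambda>u. snd (?L u) $ k)" for k
      by (auto intro!: hol_if hol_intros)
    show "?L (?j (?\<rho> z)) = z" if z: "fst z $ a = 1" "snd z $ 3 = 1" "line_eqs z" for z
    proof -
      have "fst (?L (?j (?\<rho> z))) $ k = fst z $ k \<and> snd (?L (?j (?\<rho> z))) $ k = snd z $ k" for k
        using ex[of k] abc z by (auto simp: axis_def line_eqs)
      then show ?thesis unfolding prod_eq_iff vec_eq_iff by blast
    qed
  qed (use abc in \<open>auto simp: axis_def line_eqs\<close>)
  then show ?thesis using that range_linear_connected[OF lin] by blast
qed

text \<open>The target of \<open>\<psi>\<close> is the line \<open>x\<^sub>3 = 0\<close> times the point \<open>y = e\<^sub>3\<close>, so that it is a submanifold of the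
  same ambient product as the flag variety.\<close>

definition CP1 :: "(ppoint, hvec) smfd" where "CP1 = sub_smfd PP 2 (locus line_eqs)"

lemma pts_CP1: "pts CP1 = locus line_eqs"
  by (simp add: CP1_def sub_smfd_def)

lemma pts_flag: "pts flag_variety = locus flag_eq"
  by (simp add: flag_variety_def sub_smfd_def flag_points_locus)

lemma complex_submfd_flag: "complex_submfd flag_variety 6"
  unfolding flag_variety_def flag_points_locus
proof (rule complex_submfd_sub_smfd[OF emb_PP])
  show "locus flag_eq \<subseteq> pts PP" using locus_hcone pts_PP by simp
  fix x assume "x \<in> locus flag_eq"
  then obtain z where z: "z \<in> hcone" "bil z = 0" "x = pr z" by (rule locusE)
  obtain a b c where abc: "a \<noteq> b" "a \<noteq> c" "b \<noteq> c" "z \<in> affcone a b" using flag_indices[OF z(1,2)] .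
  obtain E L r where "nchart 6 (locus flag_eq) E L r (pr ` affcone a b)" using nchart_flag[OF abc(1-3)] .
  then show "\<exists>E L r V. nchart 6 (locus flag_eq) E L r V \<and> x \<in> V" using abc(4) z(3) by blast
qed

lemma line_eqs_indices:
  assumes "z \<in> hcone" "line_eqs z"
  obtains a b where "a \<noteq> b" "a \<noteq> 3" "b \<noteq> (3 :: 3)" "z \<in> affcone a 3"
proof -
  have ex: "k = 1 \<or> k = 2 \<or> k = 3" for k :: 3 by (rule exhaust_3)
  have "snd z $ 3 \<noteq> 0"
  proof
    assume "snd z $ 3 = 0"
    then have "snd z $ k = 0" for k using ex[of k] assms(2) by (auto simp: line_eqs_def)
    then show False using assms(1) by (simp add: hcone_def vec_eq_iff)
  qed
  moreover have "fst z $ 1 \<noteq> 0 \<or> fst z $ 2 \<noteq> 0"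
  proof (rule ccontr)
    assume "\<not> ?thesis"
    then have "fst z $ k = 0" for k using ex[of k] assms(2) by (auto simp: line_eqs_def)
    then show False using assms(1) by (simp add: hcone_def vec_eq_iff)
  qed
  ultimately show ?thesis using that[of 1 2] that[of 2 1] by (auto simp: affcone_def)
qed

lemma complex_submfd_CP1: "complex_submfd CP1 2"
  unfolding CP1_def
proof (rule complex_submfd_sub_smfd[OF emb_PP])
  show "locus line_eqs \<subseteq> pts PP" using locus_hcone pts_PP by simp
  fix x assume "x \<in> locus line_eqs"
  then obtain z where z: "z \<in> hcone" "line_eqs z" "x = pr z" by (rule locusE)
  obtain a b where ab: "a \<noteq> b" "a \<noteq> 3" "b \<noteq> 3" "z \<in> affcone a 3" using line_eqs_indices[OF z(1,2)] .
  obtain E L r where "nchart 2 (locus line_eqs) E L r (pr ` affcone a 3)" using nchart_line_eqs[OF ab(1-3)] .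
  then show "\<exists>E L r V. nchart 2 (locus line_eqs) E L r V \<and> x \<in> V" using ab(4) z(3) by blast
qed

lemma locus_fibre_eqs_flag: "p \<noteq> 0 \<Longrightarrow> (\<Sum>i\<in>UNIV. p $ i) = 0 \<Longrightarrow> locus (fibre_eqs p) \<subseteq> pts flag_variety"
  unfolding pts_flag locus_def using fibre_eqs_bil by blast

lemma nchart_fibre_eqs_cover:
  assumes p: "\<And>k. p $ k \<noteq> 0" "(\<Sum>i\<in>UNIV. p $ i) = 0" and x: "x \<in> locus (fibre_eqs p)"
  shows "\<exists>a b E L r. nchart 4 (locus (fibre_eqs p)) E L r (pr ` affcone a b) \<and> connected E \<and> x \<in> pr ` affcone a b"
proof -
  obtain z where z: "z \<in> hcone" "fibre_eqs p z" "x = pr z" using x by (rule locusE)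
  have "p \<noteq> 0" using p(1)[of 1] by auto
  then have "bil z = 0" using fibre_eqs_bil z(2) p(2) by blast
  then obtain a b c where abc: "a \<noteq> b" "a \<noteq> c" "b \<noteq> c" "z \<in> affcone a b" using flag_indices[OF z(1)] by metis
  obtain E L r where "nchart 4 (locus (fibre_eqs p)) E L r (pr ` affcone a b)" "connected E"
    using nchart_fibre_eqs[OF abc(1-3) p(1)] .
  then show ?thesis using abc(4) z(3) by blast
qed

text \<open>Serves both requirements on generic fibres: the whole product as V' gives the closed
  fibre, the image of \<open>psi_cone\<close> the fibre without the base set.\<close>

lemma complex_submfd_fibre_eqs_open:
  assumes p: "\<And>k. p $ k \<noteq> 0" "(\<Sum>i\<in>UNIV. p $ i) = 0" and V': "openin (mtop PP) V'"
  shows "complex_submfd (sub_smfd flag_variety 4 (locus (fibre_eqs p) \<inter> V')) 4"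
proof (rule complex_submfd_sub_smfd[OF complex_submfd.emb[OF complex_submfd_flag]])
  have "p \<noteq> 0" using p(1)[of 1] by auto
  then show "locus (fibre_eqs p) \<inter> V' \<subseteq> pts flag_variety" using locus_fibre_eqs_flag p(2) by blast
  fix x assume x: "x \<in> locus (fibre_eqs p) \<inter> V'"
  then obtain a b E L r where E: "nchart 4 (locus (fibre_eqs p)) E L r (pr ` affcone a b)" "x \<in> pr ` affcone a b"
    using nchart_fibre_eqs_cover[OF p, of x] by blast
  have "nchart 4 (locus (fibre_eqs p) \<inter> V') (E \<inter> (\<lambda>u. pr (L u)) -` V') L r (pr ` affcone a b \<inter> V')"
    by (rule nchart_open_subset[OF E(1) V' x E(2)])
  moreover have "x \<in> pr ` affcone a b \<inter> V'" using E(2) x by blast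
  ultimately show "\<exists>E L r V. nchart 4 (locus (fibre_eqs p) \<inter> V') E L r V \<and> x \<in> V" by blast
qed

lemma complex_submfd_fibre_eqs:
  assumes p: "\<And>k. p $ k \<noteq> 0" "(\<Sum>i\<in>UNIV. p $ i) = 0"
  shows "complex_submfd (sub_smfd flag_variety 4 (locus (fibre_eqs p))) 4"
  using complex_submfd_fibre_eqs_open[OF p openin_PP_pts] by (simp add: inf.absorb1[OF locus_hcone])

section \<open>Torus invariance, compactness, connectedness and effectiveness\<close>

lemma torp_locus:
  assumes "\<And>z. F z \<Longrightarrow> F (tor a z)" "x \<in> locus F" shows "torp a x \<in> locus F"
proof -
  obtain z where z: "z \<in> hcone" "F z" "x = pr z" using assms(2) by (rule locusE)
  have "torp a x = pr (tor a z)" "tor a z \<in> hcone" "F (tor a z)"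
    using z tor_hcone assms(1) by (simp_all add: torp_pr)
  then show ?thesis unfolding locus_def by blast
qed

lemma tor_products: "fst (tor a z) $ i * snd (tor a z) $ i = fst z $ i * snd z $ i"
proof -
  have "cis (a i) * cis (- a i) = 1" by (simp add: cis_mult)
  then have "(cis (a i) * cis (- a i)) * (fst z $ i * snd z $ i) = fst z $ i * snd z $ i" by simp
  then show ?thesis by (simp add: tor_def mult_ac)
qed

lemma bil_tor: "bil (tor a z) = bil z"
  unfolding bil_def tor_products ..

lemma torp_flag: "x \<in> pts flag_variety \<Longrightarrow> torp a x \<in> pts flag_variety"
  unfolding pts_flag by (rule torp_locus) (simp_all add: bil_tor)

lemma torp_fibre_eqs: "x \<in> locus (fibre_eqs p) \<Longrightarrow> torp a x \<in> locus (fibre_eqs p)"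
  by (rule torp_locus) (simp_all add: fibre_eqs_def tor_products)

lemma torp_line_eqs: "x \<in> locus line_eqs \<Longrightarrow> torp a x \<in> locus line_eqs"
  by (rule torp_locus) (simp_all add: line_eqs_def tor_def)

lemma closed_fibre_eqs: "closed {z. fibre_eqs p z}"
  unfolding fibre_eqs_def by (intro closed_Collect_all closed_Collect_eq continuous_intros)

lemma closed_line_eqs: "closed {z. line_eqs z}"
  unfolding line_eqs_def by (intro closed_Collect_conj closed_Collect_eq continuous_intros)

lemma compactin_locus_fibre_eqs: "compactin (mtop PP) (locus (fibre_eqs p))"
  unfolding locus_def by (rule compactin_locus[OF closed_fibre_eqs]) (use homogeneous_fibre_eqs in \<open>auto simp: homogeneous_def\<close>)

lemma compactin_locus_line_eqs: "compactin (mtop PP) (locus line_eqs)"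
  unfolding locus_def by (rule compactin_locus[OF closed_line_eqs]) (use homogeneous_line_eqs in \<open>auto simp: homogeneous_def\<close>)

text \<open>A point of the fibre with no vanishing coordinate. It lies in every affine piece, which
  gives connectedness, and only the lattice fixes it, which gives effectiveness.\<close>

definition fibre_point :: "complex ^ 3 \<Rightarrow> hvec" where "fibre_point p = (\<chi> i. 1, p)"

lemma fibre_point:
  assumes "\<And>k. p $ k \<noteq> 0"
  shows "fibre_point p \<in> hcone" "fibre_eqs p (fibre_point p)" "fibre_point p \<in> affcone a b" "pr (fibre_point p) \<in> locus (fibre_eqs p)"
proof -
  show 1: "fibre_point p \<in> affcone a b" using assms by (simp add: fibre_point_def affcone_def)
  show 2: "fibre_eqs p (fibre_point p)" by (simp add: fibre_point_def fibre_eqs_def)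
  show 3: "fibre_point p \<in> hcone" using 1 affcone_hcone by blast
  show "pr (fibre_point p) \<in> locus (fibre_eqs p)" using 2 3 unfolding locus_def by blast
qed

lemma connectedin_locus_fibre_eqs:
  assumes p: "\<And>k. p $ k \<noteq> 0" "(\<Sum>i\<in>UNIV. p $ i) = 0"
  shows "connectedin (mtop PP) (locus (fibre_eqs p))"
proof (rule connectedin_cover[of _ "pr (fibre_point p)"])
  fix x assume "x \<in> locus (fibre_eqs p)"
  then obtain a b E L r where E: "nchart 4 (locus (fibre_eqs p)) E L r (pr ` affcone a b)" "connected E"
    and x: "x \<in> pr ` affcone a b" using nchart_fibre_eqs_cover[OF p, of x] by blast
  have "pr (fibre_point p) \<in> pr ` affcone a b" by (rule imageI[OF fibre_point(3)[OF p(1)]])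
  with x nchart_connected[OF E]
  show "\<exists>V. x \<in> V \<and> pr (fibre_point p) \<in> V \<and> connectedin (mtop PP) (locus (fibre_eqs p) \<inter> V)"
    by (intro exI[of _ "pr ` affcone a b"] conjI)
qed (rule fibre_point(4)[OF p(1)])

text \<open>Plays the part of \<open>fibre_point\<close> for the target line: it lies in both affine
  pieces and away from the fixed points of the torus.\<close>

definition line_point :: hvec where "line_point = (\<chi> i. if i = 3 then 0 else 1, axis 3 1)"

lemma line_point: "a \<noteq> 3 \<Longrightarrow> line_point \<in> affcone a 3" "line_point \<in> hcone" "line_eqs line_point" "pr line_point \<in> locus line_eqs"
proof -
  show 1: "a \<noteq> 3 \<Longrightarrow> line_point \<in> affcone a 3" for a by (simp add: line_point_def affcone_def axis_def)
  then have "line_point \<in> affcone 1 3" by simp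
  then show 2: "line_point \<in> hcone" using affcone_hcone by blast
  show 3: "line_eqs line_point" by (simp add: line_point_def line_eqs_def axis_def)
  show "pr line_point \<in> locus line_eqs" using 2 3 unfolding locus_def by blast
qed

lemma connectedin_locus_line_eqs: "connectedin (mtop PP) (locus line_eqs)"
proof (rule connectedin_cover[of _ "pr line_point"])
  fix x assume "x \<in> locus line_eqs"
  then obtain z where z: "z \<in> hcone" "line_eqs z" "x = pr z" by (rule locusE)
  obtain a b where ab: "a \<noteq> b" "a \<noteq> 3" "b \<noteq> 3" "z \<in> affcone a 3" using line_eqs_indices[OF z(1,2)] .
  obtain E L r where E: "nchart 2 (locus line_eqs) E L r (pr ` affcone a 3)" "connected E" using nchart_line_eqs[OF ab(1-3)] .
  have "pr line_point \<in> pr ` affcone a 3" by (rule imageI[OF line_point(1)[OF ab(2)]])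
  moreover have "x \<in> pr ` affcone a 3" unfolding z(3) by (rule imageI[OF ab(4)])
  ultimately show "\<exists>V. x \<in> V \<and> pr line_point \<in> V \<and> connectedin (mtop PP) (locus line_eqs \<inter> V)"
    using nchart_connected[OF E] by (intro exI[of _ "pr ` affcone a 3"] conjI)
qed (rule line_point(4))

text \<open>Only differences of weights act on the lines. Relative to the coordinate of weight 0,
  the two rows form the unimodular matrix with entries 1, 2 and 1, 3, so the parameter torus acts
  without a finite kernel.\<close>

definition fweight :: "nat \<Rightarrow> 3 \<Rightarrow> real" where
  "fweight i j = (if j = 1 then 0 else if j = 2 then 1 else if i = 0 then 2 else 3)"

lemma inj_fweight: "inj (fweight i)"
proof (rule injI)
  fix j k assume "fweight i j = fweight i k"
  then show "j = k" using exhaust_3[of j] exhaust_3[of k] by (auto simp: fweight_def split: if_splits)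
qed

definition yweight :: "nat \<Rightarrow> 3 \<Rightarrow> real" where
  "yweight i j = (if j = 2 then 1 else 0)"

lemma cis_eq_1: "cis x = 1 \<longleftrightarrow> (\<exists>n::int. x = 2 * pi * n)"
proof
  assume "cis x = 1"
  then have "cos x = 1" by (simp add: complex_eq_iff)
  then obtain n :: int where "x = of_int n * 2 * pi" using cos_one_2pi_int by blast
  then show "\<exists>n::int. x = 2 * pi * n" by (intro exI[of _ n]) simp
next
  assume "\<exists>n::int. x = 2 * pi * n"
  then obtain n :: int where "x = 2 * pi * n" by blast
  then show "cis x = 1" using cos_int_2pin[of n] sin_int_2pin[of n] by (simp add: complex_eq_iff)
qed

lemma tor_trivial:
  assumes "\<And>j. \<exists>n::int. a j = 2 * pi * n" shows "tor a z = z"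
proof -
  have "cis (a j) = 1" for j using assms cis_eq_1 by blast
  moreover have "cis (- a j) = 1" for j using calculation[of j] by (metis cis_cnj complex_cnj_one)
  ultimately show ?thesis by (simp add: tor_def prod_eq_iff vec_eq_iff)
qed

lemma effective_fibre_eqs:
  assumes p: "\<And>k. p $ k \<noteq> 0" and \<theta>: "\<theta> \<in> Rm 2"
  shows "(\<forall>x\<in>locus (fibre_eqs p). torp (\<lambda>j. \<Sum>i<2. \<theta> i * fweight i j) x = x) \<longleftrightarrow> \<theta> \<in> torus_lattice 2"
proof -
  let ?a = "\<lambda>j. \<Sum>i<2. \<theta> i * fweight i j"
  have a: "?a 1 = 0" "?a 2 = \<theta> 0 + \<theta> 1" "?a 3 = 2 * \<theta> 0 + 3 * \<theta> 1"
    by (simp_all add: fweight_def numeral_2_eq_2)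
  show ?thesis
  proof
    assume fixed: "\<forall>x\<in>locus (fibre_eqs p). torp ?a x = x"
    have "pr (fibre_point p) = pr (tor ?a (fibre_point p))" using bspec[OF fixed fibre_point(4)[OF p]] unfolding torp_pr by (rule sym)
    then obtain c d where c: "tor ?a (fibre_point p) = scal c d (fibre_point p)"
      using pr_eqD tor_hcone[OF fibre_point(1)[OF p]] by metis
    \<comment> \<open>All x-coordinates of \<open>fibre_point p\<close> are 1, so a torus element
      that fixes its class multiplies them by one scalar c, and c = 1 because the coordinate j = 1
      has weight 0.\<close>
    have "cis (?a j) = c" for j
      using arg_cong[OF c, of "\<lambda>z. fst z $ j"] by (simp add: tor_def fibre_point_def)
    then have "cis (?a j) = cis (?a 1)" for j by simp
    then have "\<exists>n::int. ?a j = 2 * pi * n" for j using cis_eq_1[of "?a j"] unfolding a(1) by simp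
    from this[of 2] this[of 3] obtain m n :: int where mn: "\<theta> 0 + \<theta> 1 = 2 * pi * m" "2 * \<theta> 0 + 3 * \<theta> 1 = 2 * pi * n"
      unfolding a by blast
    \<comment> \<open>The inverse of the weight matrix has integer entries because its determinant
      is 1.\<close>
    have "\<theta> 1 = 2 * pi * of_int (n - 2 * m)" "\<theta> 0 = 2 * pi * of_int (3 * m - n)"
      using mn by (simp_all add: algebra_simps)
    then have "\<exists>z::int. \<theta> i = 2 * pi * of_int z" for i
    proof (cases "i < 2")
      case True
      then have "i = 0 \<or> i = 1" by auto
      then show ?thesis using \<open>\<theta> 1 = _\<close> \<open>\<theta> 0 = _\<close> by blast
    next
      case False
      then show ?thesis using \<theta> by (intro exI[of _ 0]) (simp add: Rm_def)
    qed
    then show "\<theta> \<in> torus_lattice 2" using \<theta> by (simp add: torus_lattice_def)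
  next
    assume "\<theta> \<in> torus_lattice 2"
    then have "\<exists>z::int. \<theta> i = 2 * pi * of_int z" for i by (simp add: torus_lattice_def)
    from this[of 0] this[of 1] obtain m n :: int where mn: "\<theta> 0 = 2 * pi * m" "\<theta> 1 = 2 * pi * n" by blast
    have "\<exists>n::int. ?a j = 2 * pi * n" for j
    proof -
      have "?a 1 = 2 * pi * of_int 0" "?a 2 = 2 * pi * of_int (m + n)" "?a 3 = 2 * pi * of_int (2 * m + 3 * n)"
        unfolding a mn by (simp_all add: algebra_simps)
      then show ?thesis using exhaust_3[of j] by blast
    qed
    then have "tor ?a z = z" for z by (rule tor_trivial)
    then show "\<forall>x\<in>locus (fibre_eqs p). torp ?a x = x" by (auto simp: locus_def torp_pr)
  qed
qed

lemma effective_line_eqs: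
  assumes \<theta>: "\<theta> \<in> Rm 1"
  shows "(\<forall>x\<in>locus line_eqs. torp (\<lambda>j. \<Sum>i<1. \<theta> i * yweight i j) x = x) \<longleftrightarrow> \<theta> \<in> torus_lattice 1"
proof -
  let ?a = "\<lambda>j. \<Sum>i<1. \<theta> i * yweight i j"
  have a: "?a j = (if j = 2 then \<theta> 0 else 0)" for j by (simp add: yweight_def)
  show ?thesis
  proof
    assume fixed: "\<forall>x\<in>locus line_eqs. torp ?a x = x"
    have "pr line_point = pr (tor ?a line_point)" using bspec[OF fixed line_point(4)] unfolding torp_pr by (rule sym)
    then obtain c d where c: "tor ?a line_point = scal c d line_point"
      using pr_eqD tor_hcone[OF line_point(2)] by metis
    have cc: "cis (?a j) = c" if "j \<noteq> 3" for j
      using arg_cong[OF c, of "\<lambda>z. fst z $ j"] that by (simp add: tor_def line_point_def)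
    have "cis (\<theta> 0) = 1" using cc[of 2] cc[of 1] unfolding a by simp
    then obtain n :: int where "\<theta> 0 = 2 * pi * n" using cis_eq_1 by blast
    then have "\<exists>z::int. \<theta> i = 2 * pi * of_int z" for i
      using \<theta> by (cases "i = 0") (auto simp: Rm_def intro: exI[of _ 0])
    then show "\<theta> \<in> torus_lattice 1" using \<theta> by (simp add: torus_lattice_def)
  next
    assume "\<theta> \<in> torus_lattice 1"
    then obtain m :: int where m: "\<theta> 0 = 2 * pi * m" unfolding torus_lattice_def by blast
    have "\<exists>n::int. ?a j = 2 * pi * n" for j
      unfolding a using m by (cases "j = 2") (auto intro: exI[of _ 0])
    then have "tor ?a z = z" for z by (rule tor_trivial)
    then show "\<forall>x\<in>locus line_eqs. torp ?a x = x" by (auto simp: locus_def torp_pr)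
  qed
qed

lemma toric_CP1: "symplectic_toric CP1 1 (\<lambda>i. mom (yweight i))"
proof (rule complex_submfd.toric[OF complex_submfd_CP1])
  show "pts CP1 \<noteq> {}" using line_point(4) unfolding pts_CP1 by blast
qed (use compactin_locus_line_eqs connectedin_locus_line_eqs torp_line_eqs effective_line_eqs in \<open>simp_all add: pts_CP1\<close>)

lemma toric_fibre_eqs:
  assumes p: "\<And>k. p $ k \<noteq> 0" "(\<Sum>i\<in>UNIV. p $ i) = 0"
  shows "symplectic_toric (sub_smfd flag_variety 4 (locus (fibre_eqs p))) 2 (\<lambda>i. mom (fweight i))"
proof (rule complex_submfd.toric[OF complex_submfd_fibre_eqs[OF p]])
  have pts: "pts (sub_smfd flag_variety 4 (locus (fibre_eqs p))) = locus (fibre_eqs p)" by (simp add: sub_smfd_def)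
  show "pts (sub_smfd flag_variety 4 (locus (fibre_eqs p))) \<noteq> {}" using fibre_point(4)[OF p(1)] unfolding pts by blast
  show "compactin (mtop PP) (pts (sub_smfd flag_variety 4 (locus (fibre_eqs p))))"
    unfolding pts by (rule compactin_locus_fibre_eqs)
  show "connectedin (mtop PP) (pts (sub_smfd flag_variety 4 (locus (fibre_eqs p))))"
    unfolding pts by (rule connectedin_locus_fibre_eqs[OF p])
  show "torp a x \<in> pts (sub_smfd flag_variety 4 (locus (fibre_eqs p)))"
    if "x \<in> pts (sub_smfd flag_variety 4 (locus (fibre_eqs p)))" for a x
    using that unfolding pts by (rule torp_fibre_eqs)
  show "(\<forall>x\<in>pts (sub_smfd flag_variety 4 (locus (fibre_eqs p))). torp (\<lambda>j. \<Sum>i<2. \<theta> i * fweight i j) x = x) =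
      (\<theta> \<in> torus_lattice 2)" if "\<theta> \<in> Rm 2" for \<theta>
    unfolding pts by (rule effective_fibre_eqs[OF p(1) that])
qed simp

interpretation flag: complex_submfd flag_variety 6 by (rule complex_submfd_flag)
interpretation Y: complex_submfd CP1 2 by (rule complex_submfd_CP1)

section \<open>Morse property and involution\<close>

text \<open>Converse of differentiating the incidence relation: a solution of the linearised
  equation is the velocity of a curve on the flag variety, obtained by bending a straight line to
  second order.\<close>

lemma flag_lft:
  assumes z: "z \<in> hcone" "bil z = 0"
    and v: "(\<Sum>i\<in>UNIV. fst v $ i * snd z $ i + fst z $ i * snd v $ i) = 0"
  obtains \<xi> where "lft flag_variety z v \<xi>"
proof -
  obtain a where a: "fst z $ a \<noteq> 0" using z(1) by (auto simp: hcone_def vec_eq_iff)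
  define k where "k = (\<Sum>i\<in>UNIV. fst v $ i * snd v $ i)"
  \<comment> \<open>Along the line z + t v the incidence relation fails exactly by t^2 k. Changing
    y_a by q t restores it, with the value of x_a at time t as denominator, and since q vanishes to
    second order the velocity remains v.\<close>
  define q where "q t = - (of_real t * of_real t * k / (fst z $ a + of_real t * fst v $ a))" for t :: real
  define c where "c t = z + t *\<^sub>R v + (0, axis a (q t))" for t
  have q0: "q 0 = 0" by (simp add: q_def)
  have q': "(q has_vector_derivative 0) (at 0)"
  proof -
    have "((\<lambda>t. - (t * t * k / (fst z $ a + t * fst v $ a))) has_field_derivative 0) (at (of_real 0))"
      using a by (auto intro!: derivative_eq_intros)
    from has_vector_derivative_real_field[OF this] show ?thesis by (simp add: q_def[abs_def])
  qed
  have "((\<lambda>t. axis a (q t)) has_vector_derivative axis a 0) (at 0)"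
    by (rule bounded_linear.has_vector_derivative[OF bounded_linear_axis q'])
  then have "((\<lambda>t. (0, axis a (q t))) has_vector_derivative (0, axis a 0)) (at 0)"
    by (intro has_vector_derivative_Pair has_vector_derivative_const)
  moreover have "((\<lambda>t. z + t *\<^sub>R v) has_vector_derivative v) (at 0)" by (auto intro!: derivative_eq_intros)
  ultimately have "(c has_vector_derivative v + (0, axis a 0)) (at 0)"
    unfolding c_def[abs_def] by (intro has_vector_derivative_add)
  moreover have "axis a 0 = (0 :: complex ^ 3)" by (simp add: vec_eq_iff axis_def)
  ultimately have c': "(c has_vector_derivative v) (at 0)" by (simp add: zero_prod_def[symmetric])
  have c0: "c 0 = z" by (simp add: c_def q0 \<open>axis a 0 = 0\<close> zero_prod_def[symmetric])
  have tend: "(c \<longlongrightarrow> c 0) (at 0)"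
    using has_vector_derivative_continuous[OF c'] by (simp add: continuous_within)
  have o: "open (hcone \<inter> {z. fst z $ a \<noteq> 0})"
    by (intro open_Int open_hcone open_Collect_neq continuous_intros)
  have ev: "eventually (\<lambda>t. c t \<in> hcone \<inter> {z. fst z $ a \<noteq> 0}) (nhds 0)"
    unfolding eventually_nhds_conv_at using topological_tendstoD[OF tend o] z(1) a c0 by auto
  have sum_lin: "(\<Sum>i\<in>UNIV. A i + s * B i + s' * C i + D i) =
      sum A UNIV + s * sum B UNIV + s' * sum C UNIV + (sum D UNIV :: complex)"
    for A B C D :: "3 \<Rightarrow> complex" and s s'
    by (simp add: sum.distrib sum_distrib_left)
  from ev have "eventually (\<lambda>t. pr (c t) \<in> pts flag_variety) (nhds 0)"
  proof eventually_elim
    case (elim t)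
    then have nz: "fst z $ a + of_real t * fst v $ a \<noteq> 0"
      by (simp add: c_def scaleR_conv_of_real[where 'a = complex])
    have f: "fst (c t) $ i = fst z $ i + of_real t * fst v $ i" for i
      by (simp add: c_def scaleR_conv_of_real[where 'a = complex])
    have s: "snd (c t) $ i = snd z $ i + of_real t * snd v $ i + (if i = a then q t else 0)" for i
      by (simp add: c_def scaleR_conv_of_real[where 'a = complex] axis_def)
    have "bil (c t) = (\<Sum>i\<in>UNIV. fst z $ i * snd z $ i + of_real t * (fst v $ i * snd z $ i + fst z $ i * snd v $ i)
        + of_real t * of_real t * (fst v $ i * snd v $ i)
        + (if i = a then (fst z $ a + of_real t * fst v $ a) * q t else 0))"
      unfolding bil_def f s by (intro sum.cong refl) (simp add: algebra_simps)
    also have "\<dots> = bil z + of_real t * (\<Sum>i\<in>UNIV. fst v $ i * snd z $ i + fst z $ i * snd v $ i)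
        + of_real t * of_real t * k + (fst z $ a + of_real t * fst v $ a) * q t"
      unfolding bil_def k_def
      using sum_lin[of "\<lambda>i. fst z $ i * snd z $ i" "of_real t" "\<lambda>i. fst v $ i * snd z $ i + fst z $ i * snd v $ i"
          "of_real t * of_real t" "\<lambda>i. fst v $ i * snd v $ i"
          "\<lambda>i. if i = a then (fst z $ a + of_real t * fst v $ a) * q t else 0"] by simp
    also have "\<dots> = 0" unfolding v z(2) q_def using nz by simp
    finally have "bil (c t) = 0" .
    then show ?case using elim unfolding pts_flag locus_def by blast
  qed
  from flag.curve_lft[OF c' c0 z(1) this] show ?thesis by (rule that)
qed

text \<open>A curve that represents the tangent vector stays in the zero set of \<open>bil\<close>,
  so the derivative of \<open>bil\<close> along it vanishes.\<close>

lemma flag_lftD: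
  assumes "lft flag_variety z v \<xi>"
  shows "bil z = 0" "(\<Sum>i\<in>UNIV. fst v $ i * snd z $ i + fst z $ i * snd v $ i) = 0"
proof -
  have z: "z \<in> hcone" using assms by (simp add: lft_def)
  obtain c where c: "(c has_vector_derivative v) (at 0)" "c 0 = z"
    "eventually (\<lambda>t. pr (c t) \<in> pts flag_variety) (nhds (0::real))"
    "\<xi> = velocity flag_variety (\<lambda>t. pr (c t))" using flag.lft_curve[OF assms] .
  have "(c \<longlongrightarrow> c 0) (at 0)" using has_vector_derivative_continuous[OF c(1)] by (simp add: continuous_within)
  from topological_tendstoD[OF this open_hcone]
  have "eventually (\<lambda>t. c t \<in> hcone) (nhds 0)"
    unfolding eventually_nhds_conv_at using z c(2) by simp
  with c(3) have ev: "eventually (\<lambda>t. bil (c t) = 0) (nhds 0)"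
    by eventually_elim (use locus_iff[OF homogeneous_flag] in \<open>auto simp: pts_flag\<close>)
  show "bil z = 0" using eventually_nhds_x_imp_x[OF ev] c(2) by simp
  have f: "((\<lambda>t. fst (c t) $ i) has_vector_derivative fst v $ i) (at 0)"
    "((\<lambda>t. snd (c t) $ i) has_vector_derivative snd v $ i) (at 0)" for i
    by (intro bounded_linear.has_vector_derivative[OF bounded_linear_vec_nth]
        bounded_linear.has_vector_derivative[OF bounded_linear_fst]
        bounded_linear.has_vector_derivative[OF bounded_linear_snd] c(1))+
  have "((\<lambda>t. bil (c t)) has_vector_derivative
      (\<Sum>i\<in>UNIV. fst (c 0) $ i * snd v $ i + fst v $ i * snd (c 0) $ i)) (at 0)"
    unfolding bil_def by (intro has_vector_derivative_sum has_vector_derivative_mult f)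
  then have "((\<lambda>t::real. 0 :: complex) has_vector_derivative
      (\<Sum>i\<in>UNIV. fst (c 0) $ i * snd v $ i + fst v $ i * snd (c 0) $ i)) (at 0)"
    using has_vector_derivative_cong_ev[where f = "\<lambda>t. bil (c t)" and g = "\<lambda>t. 0" and x = 0 and S = UNIV]
      ev eventually_nhds_x_imp_x[OF ev] by simp
  then have "(\<Sum>i\<in>UNIV. fst z $ i * snd v $ i + fst v $ i * snd z $ i) = 0"
    using vector_derivative_unique_at[OF _ has_vector_derivative_const] unfolding c(2) by blast
  then show "(\<Sum>i\<in>UNIV. fst v $ i * snd z $ i + fst z $ i * snd v $ i) = 0" by (simp add: add.commute)
qed

lemma herm_zero: "herm 0 w = 0" "herm w 0 = 0"
  by (simp_all add: herm_def)

lemma omega_zero_left: "omega z 0 w = 0"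
  using omega_scaleR_left[of z 0 0 w] by simp

text \<open>At a critical point the generator of the circle action is vertical. After this vertical
  part is subtracted, the generator has a linear lift \<open>Wl\<close> that vanishes at the point,
  and the Hessian becomes the pairing with \<open>Wl\<close>. Distinct weights make the kernel of
  \<open>Wl\<close> vertical modulo vertical vectors, so the Hessian has no kernel.\<close>

lemma morse_mom:
  assumes w: "inj w" shows "morse_function flag_variety (mom w)"
  unfolding morse_function_def
proof (intro conjI)
  show "smooth_fun_on flag_variety (pts flag_variety) (mom w)" by (rule flag.smooth_mom_sub)
  show "\<forall>(D, \<sigma>)\<in>charts flag_variety. \<forall>u\<in>D.
        (\<forall>\<xi>\<in>tangent_space flag_variety (\<sigma> u). \<xi> (mom w) = 0) \<longrightarrow>
        (\<forall>v\<in>span D.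
           (\<forall>w'\<in>span D. deriv (\<lambda>s. deriv (\<lambda>t. mom w (\<sigma> (u + s *\<^sub>R v + t *\<^sub>R w'))) 0) 0 = 0)
           \<longrightarrow> v = 0)"
  proof (clarify)
    fix D \<sigma> u v
    assume D: "(D, \<sigma>) \<in> charts flag_variety" and u: "u \<in> D"
      and crit: "\<forall>\<xi>\<in>tangent_space flag_variety (\<sigma> u). \<xi> (mom w) = 0" and v: "v \<in> span D"
      and hess: "\<forall>w'\<in>span D. deriv (\<lambda>s. deriv (\<lambda>t. mom w (\<sigma> (u + s *\<^sub>R v + t *\<^sub>R w'))) 0) 0 = 0"
    obtain W L where W: "openin (top_of_set D) W" "u \<in> W" "smooth_on W L" "L ` W \<subseteq> hcone"
      "\<forall>w\<in>W. \<sigma> w = pr (L w)" using flag.chartD(4)[OF D] u unfolding local_lifts_def by blast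
    have oW: "openin (top_of_set (span D)) W" using W(1) flag.chartD(1)[OF D] openin_trans by blast
    define z where "z = L u"
    have z: "z \<in> hcone" "pr z = \<sigma> u" using W by (auto simp: z_def)
    have zp: "pr z \<in> pts flag_variety" using flag.chartD(5)[OF D] u z(2) by auto
    note gl = flag.velocity_torp_lft[where w = w, OF z(1) zp torp_flag]
    have "omega z (genvec w z) y = 0" if y: "lft flag_variety z y \<eta>" for y \<eta>
    proof -
      have "\<eta> \<in> tangent_space flag_variety (\<sigma> u)" using y z(2) by (simp add: lft_def)
      then have "\<eta> (mom w) = 0" using crit by blast
      then show ?thesis using flag.mom_lft[OF y, of w] by simp
    qed
    \<comment> \<open>A critical point of the moment map is a fixed point of the flow: the generator
      is orthogonal to the tangent space, hence vertical. Comparing coordinates below shows that x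
      and y are multiples of coordinate vectors e_p and e_q.\<close>
    then obtain a b where ab: "genvec w z = scal a b z" using flag.lft_nondegenerate(2)[OF gl] by blast
    have X: "\<i> * w j * fst z $ j = a * fst z $ j" and Y: "- \<i> * w j * snd z $ j = b * snd z $ j" for j
      using arg_cong[OF ab, of "\<lambda>y. fst y $ j"] arg_cong[OF ab, of "\<lambda>y. snd y $ j"]
      by (simp_all add: genvec_def)
    obtain p where p: "fst z $ p \<noteq> 0" using z(1) by (auto simp: hcone_def vec_eq_iff)
    obtain q where q: "snd z $ q \<noteq> 0" using z(1) by (auto simp: hcone_def vec_eq_iff)
    have a: "a = \<i> * w p" using X[of p] p by simp
    have "(- \<i> * w q) * snd z $ q = b * snd z $ q" using Y[of q] .
    then have b: "b = - \<i> * w q" using q mult_right_cancel by metis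
    have X0: "fst z $ j = 0" if "j \<noteq> p" for j
      using X[of j] that inj_eq[OF w, of j p] by (simp add: a)
    have Y0: "snd z $ j = 0" if "j \<noteq> q" for j
      using Y[of j] that inj_eq[OF w, of j q] by (simp add: b)
    \<comment> \<open>Equal indices would violate the incidence relation, since x_p y_p is then the
      only product and is nonzero.\<close>
    have pq: "p \<noteq> q"
    proof
      assume "p = q"
      have "bil z = (\<Sum>i\<in>UNIV. if i = p then fst z $ p * snd z $ p else 0)"
        unfolding bil_def by (intro sum.cong) (auto simp: X0)
      then show False using flag_lftD(1)[OF gl] p q \<open>p = q\<close> by simp
    qed
    \<comment> \<open>The subtracted term \<open>scal a b y\<close> is vertical at every y, so the
      pairing with \<open>omega\<close> is unchanged, while \<open>Wl\<close> now vanishes at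
      z.\<close>
    define Wl where "Wl y = (wsc (\<lambda>j. \<i> * w j - a) (fst y), wsc (\<lambda>j. - \<i> * w j - b) (snd y))" for y :: hvec
    have Wl: "genvec w y = Wl y + scal a b y" for y
      by (simp add: Wl_def genvec_def prod_eq_iff vec_eq_iff algebra_simps)
    have "linear Wl" unfolding Wl_def[abs_def]
      by (intro linearI) (simp_all add: linear_add[OF linear_wsc] linear_scale[OF linear_wsc])
    then have blW: "bounded_linear Wl" by (simp add: linear_conv_bounded_linear)
    have Wlz: "Wl z = 0" using Wl[of z] ab by simp
    have lf: "lft flag_variety (L x) (dd L x y) (chart_vec flag_variety \<sigma> x y)" if "x \<in> W" "y \<in> span D" for x y
      by (rule flag.chart_lft[OF D W(1) that(1) W(3-5) that(2)])
    have inner: "deriv (\<lambda>t. mom w (\<sigma> (x + t *\<^sub>R y))) 0 = omega (L x) (Wl (L x)) (dd L x y)"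
      if x: "x \<in> W" and y: "y \<in> span D" for x y
    proof -
      have "\<sigma> x \<in> pts flag_variety" using flag.lft_pts[OF lf[OF x y]] W(5) x by simp
      then have "smooth_near flag_variety (\<sigma> x) (mom w)"
        using emb_near[OF flag.emb _ smooth_near_global[OF smooth_mom]] flag.pts_hcone by blast
      then have "deriv (\<lambda>t. mom w (\<sigma> (x + t *\<^sub>R y))) 0 = chart_vec flag_variety \<sigma> x y (mom w)"
        by (simp add: chart_vec_def velocity_def)
      also have "\<dots> = omega (L x) (genvec w (L x)) (dd L x y)" by (rule flag.mom_lft[OF lf[OF x y]])
      finally show ?thesis unfolding Wl by (simp add: omega_add_left omega_vertical_left)
    qed
    let ?V = "dd L u v"
    have ev: "eventually (\<lambda>s. u + s *\<^sub>R v \<in> W) (nhds 0)" by (rule line_eventually[OF oW subspace_span W(2) v])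
    note dL = smooth_on_dd_derivative[OF W(3) oW subspace_span W(2) v]
    \<comment> \<open>Because \<open>Wl\<close> vanishes at z, only the derivative of
      \<open>Wl\<close> along V survives in the Hessian; neither the derivative of the form nor the
      second derivative of the lift contributes.\<close>
    have H: "omega z (Wl ?V) (dd L u y) = 0" if y: "y \<in> span D" for y
    proof -
      have "deriv (\<lambda>s. deriv (\<lambda>t. mom w (\<sigma> (u + s *\<^sub>R v + t *\<^sub>R y))) 0) 0 =
          deriv (\<lambda>s. omega (L (u + s *\<^sub>R v)) (Wl (L (u + s *\<^sub>R v))) (dd L (u + s *\<^sub>R v) y)) 0"
        using ev by (intro deriv_cong_ev refl, eventually_elim) (rule inner[OF _ y])
      also have "\<dots> = d_omega z ?V (Wl z) (dd L u y) + omega z (Wl ?V) (dd L u y) +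
          omega z (Wl z) (dd (\<lambda>x. dd L x y) u v)"
        using omega_derivative[OF dL bounded_linear.has_vector_derivative[OF blW dL]
            smooth_on_dd_derivative[OF smooth_on_dd[OF W(3) oW subspace_span y] oW subspace_span W(2) v]] z(1)
        by (intro DERIV_imp_deriv) (simp add: z_def)
      also have "\<dots> = omega z (Wl ?V) (dd L u y)"
        by (simp add: Wlz omega_zero_left d_omega_def dfs_def herm_zero)
      finally show ?thesis using hess y by simp
    qed
    have lV: "lft flag_variety z ?V (chart_vec flag_variety \<sigma> u v)" using lf[OF W(2) v] by (simp add: z_def)
    \<comment> \<open>With x along e_p and y along e_q, only j = p and j = q contribute to the
      linearised incidence relation, and \<open>Wl\<close> multiplies both contributions by i (w_q -
      w_p). Hence \<open>Wl ?V\<close> is tangent again.\<close>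
    have "fst (Wl ?V) $ j * snd z $ j + fst z $ j * snd (Wl ?V) $ j =
        \<i> * (w q - w p) * (fst ?V $ j * snd z $ j + fst z $ j * snd ?V $ j)" for j
      using X0[of j] Y0[of j] pq by (cases "j = p"; cases "j = q") (simp_all add: Wl_def a b algebra_simps)
    then have "(\<Sum>j\<in>UNIV. fst (Wl ?V) $ j * snd z $ j + fst z $ j * snd (Wl ?V) $ j) =
        \<i> * (w q - w p) * (\<Sum>j\<in>UNIV. fst ?V $ j * snd z $ j + fst z $ j * snd ?V $ j)"
      by (simp only: sum_distrib_left)
    then have "(\<Sum>j\<in>UNIV. fst (Wl ?V) $ j * snd z $ j + fst z $ j * snd (Wl ?V) $ j) = 0"
      using flag_lftD(2)[OF lV] by simp
    then obtain \<xi> where \<xi>: "lft flag_variety z (Wl ?V) \<xi>" using flag_lft[OF z(1) flag_lftD(1)[OF lV]] by blast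
    have "omega z (Wl ?V) y = 0" if y: "lft flag_variety z y \<eta>" for y \<eta>
    proof -
      have "\<eta> \<in> tangent_space flag_variety (\<sigma> u)" using y z(2) by (simp add: lft_def)
      then obtain y' where y': "y' \<in> span D" "\<eta> = chart_vec flag_variety \<sigma> u y'"
        using flag.tangent_in_chart[OF _ D u refl] by blast
      have "lft flag_variety z (dd L u y') \<eta>" using lf[OF W(2) y'(1)] y'(2) by (simp add: z_def)
      then obtain k l where "y = dd L u y' + scal k l z" using flag.lft_eqD y by blast
      then show ?thesis using H[OF y'(1)] by (simp add: omega_add_right omega_vertical_right)
    qed
    then obtain k l where kl: "Wl ?V = scal k l z" using flag.lft_nondegenerate(2)[OF \<xi>] by blast
    \<comment> \<open>Off p the entry of \<open>Wl ?V\<close> is a nonzero multiple, by i (w_j -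
      w_p), of the entry of V, whereas the vertical vector has entry 0 there.\<close>
    have V1: "fst ?V $ j = 0" if "j \<noteq> p" for j
      using arg_cong[OF kl, of "\<lambda>y. fst y $ j"] X0[OF that] inj_eq[OF w, of j p] that
      by (simp add: Wl_def a right_diff_distrib[symmetric])
    have V2: "snd ?V $ j = 0" if "j \<noteq> q" for j
      using arg_cong[OF kl, of "\<lambda>y. snd y $ j"] Y0[OF that] inj_eq[OF w, of j q] that
      by (simp add: Wl_def b right_diff_distrib[symmetric])
    have VV: "fst ?V $ j = fst ?V $ p / fst z $ p * fst z $ j" "snd ?V $ j = snd ?V $ q / snd z $ q * snd z $ j" for j
      using V1[of j] V2[of j] X0[of j] Y0[of j] p q by (cases "j = p"; cases "j = q"; simp)+
    have "?V = scal (fst ?V $ p / fst z $ p) (snd ?V $ q / snd z $ q) z"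
      unfolding prod_eq_iff vec_eq_iff scal_simps vector_smult_component by (intro conjI allI VV)
    then have "lft flag_variety z ?V (\<lambda>g. 0)"
      using flag.lft_vertical[OF flag.lft_zero[OF z(1) zp]] by (metis add_0)
    then have "chart_vec flag_variety \<sigma> u v = (\<lambda>g. 0)" using flag.lft_unique[OF lV] by blast
    then show "v = 0" using flag.chart_vec_eq_0[OF D u v] by blast
  qed
qed

text \<open>One moment map is constant along the torus orbits, so the Hamiltonian vector of the
  other annihilates it.\<close>

lemma poisson_mom:
  assumes x: "x \<in> pts flag_variety" shows "poisson flag_variety (mom w) (mom w') x = 0"
proof -
  obtain z where z: "z \<in> hcone" "x = pr z" using x flag.pts_hcone by blast
  have zp: "pr z \<in> pts flag_variety" using x z by simp
  let ?v = "\<lambda>w. velocity flag_variety (\<lambda>t. torp (\<lambda>j. t * w j) (pr z))"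
  have h: "ham_vec flag_variety (mom w) x = ?v w" for w
    unfolding z(2) by (rule flag.ham_mom[OF z(1) zp torp_flag])
  note l = flag.velocity_torp_lft[OF z(1) zp torp_flag]
  have "(\<lambda>t. mom w' (torp (\<lambda>j. t * w j) (pr z))) = (\<lambda>t. mom w' (pr z))"
    using mom_torp z(1) by blast
  moreover have "deriv (\<lambda>t::real. k) 0 = 0" for k :: real by (rule DERIV_imp_deriv) simp
  ultimately have "?v w (mom w') = 0" by (simp add: velocity_def)
  then have "omega z (genvec w' z) (genvec w z) = 0" using flag.mom_lft[OF l] by simp
  moreover have "poisson flag_variety (mom w) (mom w') x = form flag_variety x (?v w) (?v w')"
    by (simp only: poisson_def h)
  moreover have "form flag_variety (pr z) (?v w) (?v w') = omega z (genvec w z) (genvec w' z)"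
    by (rule flag.form_lft[OF l l])
  ultimately show ?thesis using omega_swap[of z "genvec w z" "genvec w' z"] z(2) by simp
qed

section \<open>The pencil\<close>

definition Psi :: "hvec \<Rightarrow> hvec" where
  "Psi z = (\<chi> k. if k = 3 then 0 else fst z $ k * snd z $ k, axis 3 1)"

definition psi :: "ppoint \<Rightarrow> ppoint" where
  "psi p = pr (Psi (rep (fst p), rep (snd p)))"

definition dPsi :: "hvec \<Rightarrow> hvec \<Rightarrow> hvec" where
  "dPsi z v = (\<chi> k. if k = 3 then 0 else fst v $ k * snd z $ k + fst z $ k * snd v $ k, 0)"

definition base_eqs :: "hvec \<Rightarrow> bool" where
  "base_eqs z \<longleftrightarrow> (\<forall>i. fst z $ i * snd z $ i = 0)"

text \<open>Two products suffice: on the flag variety the third is minus the sum of the other two,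
  so this is the cone over the complement of the base set. As a subset of the whole cone it is open
  and stable under scalings.\<close>

definition psi_cone :: "hvec set" where
  "psi_cone = {z \<in> hcone. fst z $ 1 * snd z $ 1 \<noteq> 0 \<or> fst z $ 2 * snd z $ 2 \<noteq> 0}"

text \<open>The coordinates of a target point, completed by the third one, which is forced by the
  requirement that the sum be 0.\<close>

definition pvec :: "hvec \<Rightarrow> complex ^ 3" where
  "pvec y = (\<chi> k. if k = 3 then - (fst y $ 1 + fst y $ 2) else fst y $ k)"

lemma Psi_scal: "Psi (scal c d z) = scal (c * d) 1 (Psi z)"
  by (simp add: Psi_def scal_def vec_eq_iff)

lemma dPsi: "(Psi has_derivative dPsi z) (at z)"
proof -
  have fs: "((\<lambda>u :: hvec. fst u $ k) has_derivative (\<lambda>v. fst v $ k)) (at z)"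
    "((\<lambda>u :: hvec. snd u $ k) has_derivative (\<lambda>v. snd v $ k)) (at z)" for k
    by (intro bounded_linear_imp_has_derivative
        bounded_linear_compose[OF bounded_linear_vec_nth bounded_linear_fst]
        bounded_linear_compose[OF bounded_linear_vec_nth bounded_linear_snd])+
  have m: "((\<lambda>u. fst u $ k * snd u $ k) has_derivative (\<lambda>v. fst z $ k * snd v $ k + fst v $ k * snd z $ k)) (at z)"
    for k by (rule has_derivative_mult[OF fs])
  have "((\<lambda>u. fst (Psi u)) has_derivative (\<lambda>v. fst (dPsi z v))) (at z)"
  proof (rule has_derivative_vecI)
    fix k :: 3
    show "((\<lambda>u. fst (Psi u) $ k) has_derivative (\<lambda>v. fst (dPsi z v) $ k)) (at z)"
      using m[of k] by (cases "k = 3") (simp_all add: Psi_def dPsi_def add.commute)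
  qed
  moreover have "((\<lambda>u. snd (Psi u)) has_derivative (\<lambda>v. snd (dPsi z v))) (at z)"
    by (simp add: Psi_def dPsi_def)
  ultimately have "((\<lambda>u. (fst (Psi u), snd (Psi u))) has_derivative (\<lambda>v. (fst (dPsi z v), snd (dPsi z v)))) (at z)"
    by (rule has_derivative_Pair)
  then show ?thesis by simp
qed

lemma psi_cone_hcone: "psi_cone \<subseteq> hcone"
  by (auto simp: psi_cone_def)

lemma Psi_hcone: "z \<in> psi_cone \<Longrightarrow> Psi z \<in> hcone"
proof -
  assume "z \<in> psi_cone"
  then have "fst (Psi z) $ 1 \<noteq> 0 \<or> fst (Psi z) $ 2 \<noteq> 0" by (simp add: psi_cone_def Psi_def)
  moreover have "snd (Psi z) $ 3 \<noteq> 0" by (simp add: Psi_def axis_def)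
  ultimately show "Psi z \<in> hcone" by (auto simp: hcone_def)
qed

lemma psi_pr: "z \<in> psi_cone \<Longrightarrow> psi (pr z) = pr (Psi z)"
proof -
  assume "z \<in> psi_cone"
  then have z: "z \<in> hcone" using psi_cone_hcone by blast
  obtain c where c: "c \<noteq> 0" "rep (cline (fst z)) = c *s fst z"
    using rep_cline[of "fst z"] z by (auto simp: hcone_def)
  obtain d where d: "d \<noteq> 0" "rep (cline (snd z)) = d *s snd z"
    using rep_cline[of "snd z"] z by (auto simp: hcone_def)
  have "psi (pr z) = pr (Psi (scal c d z))" using c d by (simp add: psi_def pr_def scal_def)
  then show ?thesis using c d by (simp add: Psi_scal pr_scal)
qed

lemma line_eqs_Psi: "line_eqs (Psi z)"
  by (simp add: line_eqs_def Psi_def axis_def)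

lemma open_psi_cone: "open psi_cone"
proof -
  have eq: "psi_cone = hcone \<inter> ({z. fst z $ 1 * snd z $ 1 \<noteq> 0} \<union> {z. fst z $ 2 * snd z $ 2 \<noteq> 0})"
    by (auto simp: psi_cone_def)
  show ?thesis
    unfolding eq by (intro open_Int open_Un open_hcone open_Collect_neq continuous_intros)
qed

lemma scal_psi_cone: "z \<in> psi_cone \<Longrightarrow> c \<noteq> 0 \<Longrightarrow> d \<noteq> 0 \<Longrightarrow> scal c d z \<in> psi_cone"
  by (auto simp: psi_cone_def scal_hcone)

lemma openin_psi_cone: "openin (mtop PP) (pr ` psi_cone)"
  by (rule openin_PP_saturated[OF open_psi_cone psi_cone_hcone scal_psi_cone])

lemma in_psi_cone: "z \<in> hcone \<Longrightarrow> pr z \<in> pr ` psi_cone \<longleftrightarrow> z \<in> psi_cone"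
  using saturated_preimage[OF psi_cone_hcone scal_psi_cone] by blast

lemma holomorphic_map_psi: "holomorphic_map flag_variety 6 CP1 psi_cone Psi psi"
proof
  show "open psi_cone" "psi_cone \<subseteq> hcone" by (rule open_psi_cone, rule psi_cone_hcone)
  show "scal c d z \<in> psi_cone" if "z \<in> psi_cone" "c \<noteq> 0" "d \<noteq> 0" for z c d using that by (rule scal_psi_cone)
  have h: "hol (\<lambda>u. fst (Psi u) $ k)" "hol (\<lambda>u. snd (Psi u) $ k)" for k
    unfolding Psi_def by (auto intro!: hol_if hol_intros)
  show "smooth_on psi_cone Psi" by (rule smooth_on_subset[OF hol_vec(1)[OF h]]) simp
  show "Psi ` psi_cone \<subseteq> hcone" using Psi_hcone by blast
  show "psi (pr z) = pr (Psi z)" if "z \<in> psi_cone" for z using that by (rule psi_pr)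
  show "\<exists>L'. (Psi has_derivative L') (at z) \<and> (\<forall>v. L' (mult_i v) = mult_i (L' v))" if "z \<in> psi_cone" for z
    by (rule hol_vec(2)[OF h])
  show "psi ` (pts flag_variety \<inter> pr ` psi_cone) \<subseteq> pts CP1"
  proof
    fix x assume "x \<in> psi ` (pts flag_variety \<inter> pr ` psi_cone)"
    then obtain z where "z \<in> psi_cone" "x = pr (Psi z)" using psi_pr by auto
    then show "x \<in> pts CP1" unfolding pts_CP1 locus_def using Psi_hcone line_eqs_Psi by blast
  qed
qed

lemma base_eqs_psi_cone: "z \<in> hcone \<Longrightarrow> bil z = 0 \<Longrightarrow> z \<in> psi_cone \<longleftrightarrow> \<not> base_eqs z"
proof -
  assume z: "z \<in> hcone" "bil z = 0"
  have "fst z $ 1 * snd z $ 1 + fst z $ 2 * snd z $ 2 + fst z $ 3 * snd z $ 3 = 0"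
    using z(2) unfolding bil_def by (subst (asm) sum3[of 1 2 3]) simp_all
  then have "base_eqs z \<longleftrightarrow> fst z $ 1 * snd z $ 1 = 0 \<and> fst z $ 2 * snd z $ 2 = 0"
    unfolding base_eqs_def forall_3 by auto
  then show ?thesis using z(1) by (auto simp: psi_cone_def)
qed

lemma base_eqs_bil: "base_eqs z \<Longrightarrow> bil z = 0"
  unfolding base_eqs_def bil_def by (intro sum.neutral) blast

lemma homogeneous_base_eqs: "homogeneous base_eqs"
  unfolding homogeneous_def base_eqs_def by auto

lemma flag_minus_base: "pts flag_variety - locus base_eqs = pts flag_variety \<inter> pr ` psi_cone"
proof -
  have *: "pr z \<notin> locus base_eqs \<longleftrightarrow> pr z \<in> pr ` psi_cone" if "z \<in> hcone" "bil z = 0" for z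
    unfolding locus_iff[OF homogeneous_base_eqs that(1)] in_psi_cone[OF that(1)] using base_eqs_psi_cone[OF that] by blast
  have "x \<notin> locus base_eqs \<longleftrightarrow> x \<in> pr ` psi_cone" if x: "x \<in> locus flag_eq" for x
  proof -
    obtain z where z: "z \<in> hcone" "bil z = 0" "x = pr z" using x by (rule locusE)
    show ?thesis unfolding z(3) by (rule *[OF z(1,2)])
  qed
  then show ?thesis unfolding pts_flag by (intro set_eqI) (simp only: Diff_iff Int_iff, metis)
qed

lemma closedin_base: "closedin (mtop flag_variety) (locus base_eqs)"
proof -
  have "locus base_eqs \<subseteq> pts flag_variety" unfolding pts_flag locus_def using base_eqs_bil by blast
  moreover have top: "topspace (mtop flag_variety) = pts flag_variety"
    unfolding flag.mtop_eq using flag.pts_hcone by (auto simp: topspace_PP)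
  moreover have "openin (mtop flag_variety) (pts flag_variety \<inter> pr ` psi_cone)"
    unfolding flag.mtop_eq by (rule openin_subtopology_Int2[OF openin_psi_cone])
  ultimately show ?thesis unfolding closedin_def top flag_minus_base by simp
qed

lemma pvec_props:
  assumes "y \<in> hcone" "line_eqs y" shows "pvec y \<noteq> 0" "(\<Sum>i\<in>UNIV. pvec y $ i) = 0"
proof -
  show "(\<Sum>i\<in>UNIV. pvec y $ i) = 0" by (subst sum3[of 1 2 3]) (simp_all add: pvec_def)
  show "pvec y \<noteq> 0"
  proof
    assume "pvec y = 0"
    then have 0: "pvec y $ k = 0" for k by simp
    have "fst y $ k = 0" if "k \<noteq> 3" for k
      using 0[of k] that by (simp add: pvec_def)
    moreover have "fst y $ 3 = 0" using assms(2) by (simp add: line_eqs_def)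
    ultimately have "fst y = 0" by (metis vec_eq_iff zero_index)
    then show False using assms(1) by (simp add: hcone_def)
  qed
qed

lemma flag_sum: "bil z = 0 \<Longrightarrow> fst z $ 3 * snd z $ 3 = - (fst z $ 1 * snd z $ 1 + fst z $ 2 * snd z $ 2)"
proof -
  assume "bil z = 0"
  then have "fst z $ 1 * snd z $ 1 + fst z $ 2 * snd z $ 2 + fst z $ 3 * snd z $ 3 = 0"
    unfolding bil_def by (subst (asm) sum3[of 1 2 3]) simp_all
  then show ?thesis by (metis add.commute eq_neg_iff_add_eq_0)
qed

text \<open>The third product and the third entry of \<open>pvec y\<close> are both minus the sum of
  the other two, so all minors reduce to the one with indices 1 and 2.\<close>

lemma fibre_eqs_pvec:
  assumes "bil z = 0"
  shows "fibre_eqs (pvec y) z \<longleftrightarrow> fst z $ 1 * snd z $ 1 * fst y $ 2 = fst z $ 2 * snd z $ 2 * fst y $ 1"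
proof -
  define A B p q where "A = fst z $ 1 * snd z $ 1" and "B = fst z $ 2 * snd z $ 2"
    and "p = fst y $ 1" and "q = fst y $ 2"
  have e: "fst z $ 3 * snd z $ 3 = - (A + B)" using flag_sum[OF assms] by (simp add: A_def B_def)
  have "fibre_eqs (pvec y) z \<longleftrightarrow> A * q = B * p \<and> - (A * (p + q)) = - ((A + B) * p) \<and> - (B * (p + q)) = - ((A + B) * q)"
    unfolding fibre_eqs_def forall_3 e A_def[symmetric] B_def[symmetric]
    by (auto simp: pvec_def p_def q_def algebra_simps)
  then show ?thesis unfolding A_def[symmetric] B_def[symmetric] p_def[symmetric] q_def[symmetric]
    by (auto simp: algebra_simps)
qed

text \<open>Off the base set the vector of products is nonzero, so that proportionality to p means
  equality of points of the target line.\<close>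

lemma psi_eq_iff:
  assumes z: "z \<in> psi_cone" "bil z = 0" and y: "y \<in> hcone" "line_eqs y"
  shows "psi (pr z) = pr y \<longleftrightarrow> fibre_eqs (pvec y) z"
proof
  assume "psi (pr z) = pr y"
  then have "pr y = pr (Psi z)" using psi_pr[OF z(1)] by simp
  then obtain c d where c: "Psi z = scal c d y" using pr_eqD[OF _ Psi_hcone[OF z(1)]] by metis
  have "fst z $ k * snd z $ k = c * fst y $ k" if "k \<noteq> 3" for k
    using arg_cong[OF c, of "\<lambda>y. fst y $ k"] that by (simp add: Psi_def)
  then show "fibre_eqs (pvec y) z" unfolding fibre_eqs_pvec[OF z(2)] by simp
next
  assume F: "fibre_eqs (pvec y) z"
  have e: "fst z $ 1 * snd z $ 1 * fst y $ 2 = fst z $ 2 * snd z $ 2 * fst y $ 1"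
    using F unfolding fibre_eqs_pvec[OF z(2)] .
  have ex: "\<exists>c. fst z $ 1 * snd z $ 1 = c * fst y $ 1 \<and> fst z $ 2 * snd z $ 2 = c * fst y $ 2"
  proof (cases "fst y $ 1 = 0")
    case True
    have "fst y $ 2 \<noteq> 0"
    proof
      assume "fst y $ 2 = 0"
      then have "fst y $ k = 0" for k using True y(2) exhaust_3[of k] by (auto simp: line_eqs_def)
      then show False using y(1) by (simp add: hcone_def vec_eq_iff)
    qed
    then show ?thesis using e True by (intro exI[of _ "fst z $ 2 * snd z $ 2 / fst y $ 2"]) auto
  next
    case False
    then show ?thesis using e
      by (intro exI[of _ "fst z $ 1 * snd z $ 1 / fst y $ 1"]) (simp add: field_simps)
  qed
  then obtain c where c: "fst z $ 1 * snd z $ 1 = c * fst y $ 1" "fst z $ 2 * snd z $ 2 = c * fst y $ 2" by blast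
  \<comment> \<open>With c = 0 the first two products would vanish, which \<open>psi_cone\<close>
    excludes.\<close>
  have c0: "c \<noteq> 0" using z(1) c by (auto simp: psi_cone_def)
  have y3: "snd y $ 3 \<noteq> 0"
  proof
    assume "snd y $ 3 = 0"
    then have "snd y $ k = 0" for k using y(2) exhaust_3[of k] by (auto simp: line_eqs_def)
    then show False using y(1) by (simp add: hcone_def vec_eq_iff)
  qed
  have "fst (Psi z) $ k = c * fst y $ k \<and> snd (Psi z) $ k = 1 / snd y $ 3 * snd y $ k" for k
    using exhaust_3[of k] c y(2) y3 by (auto simp: Psi_def line_eqs_def axis_def)
  then have "Psi z = scal c (1 / snd y $ 3) y" by (simp add: prod_eq_iff vec_eq_iff)
  then show "psi (pr z) = pr y" using psi_pr[OF z(1)] c0 y3 by (simp add: pr_scal)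
qed

lemma fiber_eq:
  assumes y: "y \<in> hcone" "line_eqs y"
  shows "fiber flag_variety (locus base_eqs) psi (pr y) = locus (fibre_eqs (pvec y)) \<inter> pr ` psi_cone"
proof (intro set_eqI iffI)
  fix x assume "x \<in> fiber flag_variety (locus base_eqs) psi (pr y)"
  then have x: "x \<in> pts flag_variety \<inter> pr ` psi_cone" "psi x = pr y"
    unfolding fiber_def flag_minus_base by auto
  then obtain z where z: "z \<in> psi_cone" "x = pr z" by blast
  have zh: "z \<in> hcone" using z(1) psi_cone_hcone by blast
  have "bil z = 0" using x(1) z(2) locus_iff[OF homogeneous_flag zh] by (simp add: pts_flag)
  then have "fibre_eqs (pvec y) z" using psi_eq_iff[OF z(1) _ y] x(2) z(2) by simp
  then show "x \<in> locus (fibre_eqs (pvec y)) \<inter> pr ` psi_cone" using z zh unfolding locus_def by blast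
next
  fix x assume x: "x \<in> locus (fibre_eqs (pvec y)) \<inter> pr ` psi_cone"
  then obtain z where z: "z \<in> psi_cone" "x = pr z" by blast
  have zh: "z \<in> hcone" using z(1) psi_cone_hcone by blast
  have F: "fibre_eqs (pvec y) z" using x z(2) locus_iff[OF homogeneous_fibre_eqs zh] by simp
  have b: "bil z = 0" by (rule fibre_eqs_bil[OF F pvec_props[OF y]])
  have "x \<in> pts flag_variety \<inter> pr ` psi_cone" using z zh b unfolding pts_flag locus_def by blast
  moreover have "psi x = pr y" using psi_eq_iff[OF z(1) b y] F z(2) by simp
  ultimately show "x \<in> fiber flag_variety (locus base_eqs) psi (pr y)"
    unfolding fiber_def flag_minus_base by simp
qed

text \<open>The minors hold trivially where all products vanish, and a point of the closed fibre
  that is not a base point lies in the domain of \<open>psi\<close>.\<close>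

lemma fiber_closure_eq:
  assumes y: "y \<in> hcone" "line_eqs y"
  shows "fiber flag_variety (locus base_eqs) psi (pr y) \<union> locus base_eqs = locus (fibre_eqs (pvec y))"
proof -
  have "pr z \<in> locus base_eqs \<or> pr z \<in> pr ` psi_cone" if "z \<in> hcone" "fibre_eqs (pvec y) z" for z
    unfolding locus_iff[OF homogeneous_base_eqs that(1)] in_psi_cone[OF that(1)]
    using base_eqs_psi_cone[OF that(1) fibre_eqs_bil[OF that(2) pvec_props[OF y]]] by blast
  then have "locus (fibre_eqs (pvec y)) \<subseteq> locus base_eqs \<union> pr ` psi_cone"
    using locusE[of _ "fibre_eqs (pvec y)"] by blast
  moreover have "fibre_eqs (pvec y) z" if "base_eqs z" for z
    unfolding fibre_eqs_def using that[unfolded base_eqs_def] by (simp only: mult_zero_left simp_thms)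
  then have "locus base_eqs \<subseteq> locus (fibre_eqs (pvec y))" unfolding locus_def by blast
  ultimately show ?thesis unfolding fiber_eq[OF y] by blast
qed

interpretation hm: holomorphic_map flag_variety 6 CP1 psi_cone Psi psi by (rule holomorphic_map_psi)

text \<open>The target is a complex curve and the differential is complex linear, so a single
  tangent vector with nonzero image already gives surjectivity.\<close>

lemma submersion_psi:
  assumes z: "z \<in> hcone" "bil z = 0" and nz: "\<And>k. fst z $ k * snd z $ k \<noteq> 0"
  shows "push CP1 psi (pr z) ` tangent_space flag_variety (pr z) = tangent_space CP1 (psi (pr z))"
proof
  have zQ: "z \<in> psi_cone" using z(1) nz by (simp add: psi_cone_def)
  have pz: "psi (pr z) = pr (Psi z)" by (rule psi_pr[OF zQ])
  note pl = hm.push_lft[OF zQ dPsi]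
  show "push CP1 psi (pr z) ` tangent_space flag_variety (pr z) \<subseteq> tangent_space CP1 (psi (pr z))"
  proof (rule image_subsetI)
    fix \<xi> assume "\<xi> \<in> tangent_space flag_variety (pr z)"
    then obtain v where "lft flag_variety z v \<xi>" using flag.tangent_lft z(1) by blast
    from pl[OF this] show "push CP1 psi (pr z) \<xi> \<in> tangent_space CP1 (psi (pr z))" by (simp add: lft_def pz)
  qed
  \<comment> \<open>Moving x_1 y_1 and compensating with x_3 y_3 solves the linearised incidence
    relation and leaves x_2 y_2 unchanged. The image (x_1 y_1, 0, 0) is then not a multiple of the
    vector of \<open>Psi z\<close>, whose second entry is nonzero.\<close>
  define s :: "3 \<Rightarrow> complex" where "s k = (if k = 1 then 1 else if k = 2 then 0
    else - (fst z $ 1 * snd z $ 1 / (fst z $ 3 * snd z $ 3)))" for k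
  define V :: hvec where "V = (wsc s (fst z), 0)"
  have "(\<Sum>i\<in>UNIV. fst V $ i * snd z $ i + fst z $ i * snd V $ i) = 0"
  proof -
    have "s 3 * fst z $ 3 * snd z $ 3 = - (fst z $ 1 * snd z $ 1)"
      using nz[of 3] by (simp add: s_def field_simps)
    then show ?thesis by (subst sum3[of 1 2 3]) (simp_all add: V_def s_def)
  qed
  then obtain \<xi> where \<xi>: "lft flag_variety z V \<xi>" using flag_lft[OF z] by blast
  obtain \<xi>' where \<xi>': "lft flag_variety z (mult_i V) \<xi>'" using flag.lft_mult_i[OF \<xi>] .
  have JV: "dPsi z (mult_i V) = mult_i (dPsi z V)"
    by (simp add: dPsi_def mult_i_def scal_def vec_eq_iff algebra_simps)
  let ?X = "push CP1 psi (pr z) \<xi>"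
  have X: "lft CP1 (Psi z) (dPsi z V) ?X" by (rule pl[OF \<xi>])
  have X': "lft CP1 (Psi z) (mult_i (dPsi z V)) (push CP1 psi (pr z) \<xi>')" using pl[OF \<xi>'] unfolding JV .
  have "?X \<noteq> (\<lambda>g. 0)"
  proof
    assume "?X = (\<lambda>g. 0)"
    then have X0: "lft CP1 (Psi z) (dPsi z V) (\<lambda>g. 0)" using X by (simp only:)
    have "Psi z \<in> hcone" using X by (simp add: lft_def)
    then have "lft CP1 (Psi z) 0 (\<lambda>g. 0)" by (rule Y.lft_zero[OF _ Y.lft_pts[OF X]])
    from Y.lft_eqD[OF this X0] obtain m n where mn: "dPsi z V = 0 + scal m n (Psi z)" by blast
    have "fst (dPsi z V) $ k = m * fst (Psi z) $ k" for k using mn by simp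
    from this[of 1] this[of 2] show False using nz[of 1] nz[of 2]
      by (simp add: dPsi_def Psi_def V_def s_def)
  qed
  show "tangent_space CP1 (psi (pr z)) \<subseteq> push CP1 psi (pr z) ` tangent_space flag_variety (pr z)"
  proof
    fix \<zeta> assume "\<zeta> \<in> tangent_space CP1 (psi (pr z))"
    then have \<zeta>: "\<zeta> \<in> tangent_space CP1 (pr (Psi z))" by (simp add: pz)
    obtain \<alpha> \<beta> where l: "lft CP1 (Psi z) (\<alpha> *\<^sub>R dPsi z V + \<beta> *\<^sub>R mult_i (dPsi z V)) \<zeta>"
      using Y.complex_line[OF refl X \<open>?X \<noteq> (\<lambda>g. 0)\<close> \<zeta>] .
    let ?\<eta> = "\<lambda>g. \<alpha> * \<xi> g + \<beta> * \<xi>' g"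
    have "push CP1 psi (pr z) ?\<eta> = (\<lambda>g. \<alpha> * ?X g + \<beta> * push CP1 psi (pr z) \<xi>' g)" by (auto simp: push_def)
    then have "lft CP1 (Psi z) (\<alpha> *\<^sub>R dPsi z V + \<beta> *\<^sub>R mult_i (dPsi z V)) (push CP1 psi (pr z) ?\<eta>)"
      using Y.lft_linear[OF X X'] by simp
    then have "\<zeta> = push CP1 psi (pr z) ?\<eta>" using Y.lft_unique[OF l] by blast
    moreover have "?\<eta> \<in> tangent_space flag_variety (pr z)"
      using flag.lft_linear[OF \<xi> \<xi>'] by (simp add: lft_def)
    ultimately show "\<zeta> \<in> push CP1 psi (pr z) ` tangent_space flag_variety (pr z)" by blast
  qed
qed

section \<open>Generic points: the target line without the three points with a vanishing
  coordinate\<close>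

definition generic_points :: "ppoint set" where
  "generic_points = locus (\<lambda>y. line_eqs y \<and> (\<forall>k. pvec y $ k \<noteq> 0))"

lemma pvec_scal: "pvec (scal c d y) = c *s pvec y"
  by (simp add: pvec_def vec_eq_iff algebra_simps)

lemma openin_generic_points: "openin (mtop CP1) generic_points"
proof -
  let ?Q = "{y \<in> hcone. \<forall>k. pvec y $ k \<noteq> 0}"
  have "?Q = hcone \<inter> ({y. fst y $ 1 \<noteq> 0} \<inter> ({y. fst y $ 2 \<noteq> 0} \<inter> {y. - (fst y $ 1 + fst y $ 2) \<noteq> 0}))"
    unfolding forall_3 pvec_def by auto
  then have "open ?Q"
    by (simp only:) (intro open_Int open_hcone open_Collect_neq continuous_intros)
  moreover have "scal c d z \<in> ?Q" if "z \<in> ?Q" "c \<noteq> 0" "d \<noteq> 0" for z c d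
    using that by (simp add: scal_hcone pvec_scal)
  ultimately have V: "openin (mtop PP) (pr ` ?Q)" and pre: "hcone \<inter> pr -` (pr ` ?Q) = ?Q"
    using openin_PP_saturated[of ?Q] saturated_preimage[of ?Q] by auto
  have "generic_points = pts CP1 \<inter> pr ` ?Q"
  proof (intro set_eqI iffI)
    fix x assume "x \<in> pts CP1 \<inter> pr ` ?Q"
    then obtain z where z: "z \<in> ?Q" "x = pr z" "pr z \<in> locus line_eqs" unfolding pts_CP1 by blast
    then have "z \<in> hcone" "\<forall>k. pvec z $ k \<noteq> 0" by simp_all
    moreover have "line_eqs z" using z(3) locus_iff[OF homogeneous_line_eqs \<open>z \<in> hcone\<close>] by simp
    ultimately show "x \<in> generic_points" unfolding generic_points_def locus_def z(2) by blast
  next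
    fix x assume "x \<in> generic_points"
    then show "x \<in> pts CP1 \<inter> pr ` ?Q" unfolding generic_points_def pts_CP1 locus_def by blast
  qed
  then show ?thesis unfolding Y.mtop_eq using openin_subtopology_Int2[OF V, of "pts CP1"] by (simp only:)
qed

lemma topspace_CP1: "topspace (mtop CP1) = pts CP1"
  unfolding Y.mtop_eq using Y.pts_hcone by (auto simp: topspace_PP)

lemma eventually_affine_nonzero:
  fixes a b :: complex
  assumes "b \<noteq> 0" shows "eventually (\<lambda>t::real. a + of_real t * b \<noteq> 0) (at 0)"
proof (cases "a = 0")
  case True
  then show ?thesis using assms eventually_neq_at_within[of 0 0 UNIV] by (auto elim: eventually_mono)
next
  case False
  have "((\<lambda>t::real. a + of_real t * b) \<longlongrightarrow> a + of_real 0 * b) (at 0)" by (intro tendsto_intros)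
  then show ?thesis using False tendsto_imp_eventually_ne by fastforce
qed

lemma dense_generic_points: "mtop CP1 closure_of generic_points = pts CP1"
proof
  show "mtop CP1 closure_of generic_points \<subseteq> pts CP1" using closure_of_subset_topspace topspace_CP1 by metis
  show "pts CP1 \<subseteq> mtop CP1 closure_of generic_points"
  proof
    fix x assume x: "x \<in> pts CP1"
    then obtain y where y: "y \<in> hcone" "line_eqs y" "x = pr y" unfolding pts_CP1 by (rule locusE)
    have "\<exists>g. g \<in> generic_points \<and> g \<in> T" if T: "x \<in> T" "openin (mtop CP1) T" for T
    proof -
      obtain V where V: "openin (mtop PP) V" "T = V \<inter> pts CP1"
        using T(2) unfolding Y.mtop_eq by (auto simp: openin_subtopology)
      have o: "open (hcone \<inter> pr -` V)" using V(1) openin_PP by blast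
      have yV: "y \<in> hcone \<inter> pr -` V" using y T(1) V(2) by auto
      \<comment> \<open>Moving both coordinates at unit speed changes p_1, p_2 and their sum at
        rates 1, 1 and 2. Each of the three is then nonzero for all small nonzero t.\<close>
      define v :: hvec where "v = (\<chi> k. if k = 3 then 0 else 1, 0)"
      have "eventually (\<lambda>t. y + t *\<^sub>R v \<in> hcone \<inter> pr -` V) (nhds (0::real))"
        by (rule line_eventually[of UNIV]) (use o yV in auto)
      then have e0: "eventually (\<lambda>t. y + t *\<^sub>R v \<in> hcone \<inter> pr -` V) (at (0::real))"
        by (simp add: eventually_nhds_conv_at)
      have e1: "eventually (\<lambda>t::real. fst y $ 1 + of_real t * 1 \<noteq> 0) (at 0)"
        "eventually (\<lambda>t::real. fst y $ 2 + of_real t * 1 \<noteq> 0) (at 0)"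
        "eventually (\<lambda>t::real. (fst y $ 1 + fst y $ 2) + of_real t * 2 \<noteq> 0) (at 0)"
        by (rule eventually_affine_nonzero; simp)+
      from eventually_conj[OF e0 eventually_conj[OF e1(1) eventually_conj[OF e1(2,3)]]]
      obtain t :: real where t: "y + t *\<^sub>R v \<in> hcone \<inter> pr -` V" "fst y $ 1 + of_real t * 1 \<noteq> 0"
        "fst y $ 2 + of_real t * 1 \<noteq> 0" "(fst y $ 1 + fst y $ 2) + of_real t * 2 \<noteq> 0"
        using eventually_happens'[OF at_neq_bot[of "0 :: real"]] by blast
      let ?w = "y + t *\<^sub>R v"
      have F: "line_eqs ?w" using y(2) by (simp add: line_eqs_def v_def)
      have f: "fst ?w $ 1 = fst y $ 1 + of_real t * 1" "fst ?w $ 2 = fst y $ 2 + of_real t * 1"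
        by (simp_all add: v_def scaleR_conv_of_real[where 'a = complex])
      have "fst ?w $ 1 + fst ?w $ 2 = (fst y $ 1 + fst y $ 2) + of_real t * 2" unfolding f by simp
      then have "- (fst ?w $ 1 + fst ?w $ 2) \<noteq> 0" using t(4) by (simp only: neg_equal_0_iff_equal not_False_eq_True)
      then have "\<forall>k. pvec ?w $ k \<noteq> 0"
        using t(2,3) f unfolding forall_3 pvec_def by simp
      then have "pr ?w \<in> generic_points" using F t(1) unfolding generic_points_def locus_def by blast
      moreover have "pr ?w \<in> T" using F t(1) unfolding V(2) pts_CP1 locus_def by blast
      ultimately show ?thesis by blast
    qed
    then show "x \<in> mtop CP1 closure_of generic_points"
      unfolding in_closure_of topspace_CP1 using x by blast
  qed
qed

text \<open>A function on the flag variety, constant along the torus orbits, whose zero set is the closed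
  fibre over \<open>y\<close>.\<close>

definition fibre_fun_lift :: "hvec \<Rightarrow> hvec \<Rightarrow> real" where
  "fibre_fun_lift y z = (let D = fst z $ 1 * snd z $ 1 * fst y $ 2 - fst z $ 2 * snd z $ 2 * fst y $ 1
     in Re (D * cnj D) / (Re (herm (fst z) (fst z)) * Re (herm (snd z) (snd z))))"

definition fibre_fun :: "hvec \<Rightarrow> ppoint \<Rightarrow> real" where
  "fibre_fun y p = fibre_fun_lift y (rep (fst p), rep (snd p))"

lemma fibre_fun_lift_scal: "c \<noteq> 0 \<Longrightarrow> d \<noteq> 0 \<Longrightarrow> fibre_fun_lift y (scal c d z) = fibre_fun_lift y z"
proof -
  assume cd: "c \<noteq> 0" "d \<noteq> 0"
  define D where "D = fst z $ 1 * snd z $ 1 * fst y $ 2 - fst z $ 2 * snd z $ 2 * fst y $ 1"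
  have eq: "fst (scal c d z) $ 1 * snd (scal c d z) $ 1 * fst y $ 2 - fst (scal c d z) $ 2 * snd (scal c d z) $ 2 * fst y $ 1
    = c * d * D" by (simp add: D_def algebra_simps)
  have "fst (scal c d z) = c *s fst z" "snd (scal c d z) = d *s snd z" by (simp_all add: scal_def)
  then have "fibre_fun_lift y (scal c d z) = Re ((c * d * D) * cnj (c * d * D)) /
      (Re (herm (c *s fst z) (c *s fst z)) * Re (herm (d *s snd z) (d *s snd z)))"
    unfolding fibre_fun_lift_def Let_def eq by (simp only:)
  also have "(c * d * D) * cnj (c * d * D) = of_real ((cmod c)\<^sup>2 * (cmod d)\<^sup>2) * (D * cnj D)"
    unfolding of_real_mult complex_norm_square by (simp add: mult_ac)
  also have "herm (c *s fst z) (c *s fst z) = of_real ((cmod c)\<^sup>2) * herm (fst z) (fst z)"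
    unfolding complex_norm_square by (simp add: herm_scale_left herm_scale_right)
  also have "herm (d *s snd z) (d *s snd z) = of_real ((cmod d)\<^sup>2) * herm (snd z) (snd z)"
    unfolding complex_norm_square by (simp add: herm_scale_left herm_scale_right)
  also have "Re (of_real ((cmod c)\<^sup>2 * (cmod d)\<^sup>2) * (D * cnj D)) /
      (Re (of_real ((cmod c)\<^sup>2) * herm (fst z) (fst z)) * Re (of_real ((cmod d)\<^sup>2) * herm (snd z) (snd z))) =
      Re (D * cnj D) / (Re (herm (fst z) (fst z)) * Re (herm (snd z) (snd z)))"
  proof -
    have r: "Re (of_real r * k) = r * Re k" for r k by simp
    show ?thesis unfolding r using cd by simp
  qed
  also have "\<dots> = fibre_fun_lift y z" unfolding fibre_fun_lift_def Let_def D_def ..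
  finally show ?thesis .
qed

lemma fibre_fun_pr: "z \<in> hcone \<Longrightarrow> fibre_fun y (pr z) = fibre_fun_lift y z"
proof -
  assume z: "z \<in> hcone"
  obtain c where c: "c \<noteq> 0" "rep (cline (fst z)) = c *s fst z"
    using rep_cline[of "fst z"] z by (auto simp: hcone_def)
  obtain d where d: "d \<noteq> 0" "rep (cline (snd z)) = d *s snd z"
    using rep_cline[of "snd z"] z by (auto simp: hcone_def)
  have "fibre_fun y (pr z) = fibre_fun_lift y (scal c d z)" using c d by (simp add: fibre_fun_def pr_def scal_def)
  then show ?thesis using c d fibre_fun_lift_scal by simp
qed

lemma smooth_fibre_fun: "smooth_fun_on PP (pr ` hcone) (fibre_fun y)"
proof (rule smooth_PP_global, rule smooth_on_cong)
  have "smooth_on hcone (\<lambda>z. fst z $ 1 * snd z $ 1 * fst y $ 2 - fst z $ 2 * snd z $ 2 * fst y $ 1)"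
    by (intro smooth_on_diff smooth_on_mult smooth_on_nth smooth_on_fst smooth_on_snd smooth_on_ident smooth_on_const)
  then show "smooth_on hcone (fibre_fun_lift y)" unfolding fibre_fun_lift_def[abs_def] Let_def
    by (intro smooth_on_divide smooth_on_mult smooth_on_bounded_linear[OF bounded_linear_Re]
        smooth_on_bounded_linear[OF bounded_linear_cnj]
        smooth_on_bilinear[OF bounded_bilinear_herm] smooth_on_fst smooth_on_snd smooth_on_ident)
       (simp_all add: hcone_Re)
qed (simp add: fibre_fun_pr)

lemma fibre_fun_lift_tor: "fibre_fun_lift y (tor a z) = fibre_fun_lift y z"
proof -
  have u: "herm (wsc (\<lambda>j. cis (a j)) v) (wsc (\<lambda>j. cis (a j)) v) = herm v v" for a and v :: "complex ^ 3"
  proof -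
    have "(cis (a j) * v $ j) * cnj (cis (a j) * v $ j) = v $ j * cnj (v $ j)" for j
    proof -
      have "cis (a j) * cnj (cis (a j)) = 1" by (simp add: cis_cnj cis_mult)
      then have "v $ j * cnj (v $ j) * (cis (a j) * cnj (cis (a j))) = v $ j * cnj (v $ j)" by simp
      then show ?thesis by (simp add: mult_ac)
    qed
    then show ?thesis unfolding herm_def wsc_nth by (intro sum.cong refl)
  qed
  have f: "fst (tor a z) = wsc (\<lambda>j. cis (a j)) (fst z)" "snd (tor a z) = wsc (\<lambda>j. cis (- a j)) (snd z)"
    by (simp_all add: tor_def)
  show ?thesis unfolding fibre_fun_lift_def tor_products
    unfolding f u u[of "\<lambda>j. - a j"] ..
qed

lemma fibre_fun_eq_0:
  assumes z: "z \<in> hcone" "bil z = 0" shows "fibre_fun y (pr z) = 0 \<longleftrightarrow> fibre_eqs (pvec y) z"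
proof -
  define D where "D = fst z $ 1 * snd z $ 1 * fst y $ 2 - fst z $ 2 * snd z $ 2 * fst y $ 1"
  have "D * cnj D = of_real ((cmod D)\<^sup>2)" by (rule complex_norm_square[symmetric])
  then have "fibre_fun y (pr z) = (cmod D)\<^sup>2 / (Re (herm (fst z) (fst z)) * Re (herm (snd z) (snd z)))"
    unfolding fibre_fun_pr[OF z(1)] fibre_fun_lift_def Let_def D_def[symmetric] by simp
  then have "fibre_fun y (pr z) = 0 \<longleftrightarrow> D = 0" using hcone_Re[OF z(1)] by simp
  then show ?thesis unfolding fibre_eqs_pvec[OF z(2)] D_def by simp
qed

text \<open>The Hamiltonian vector is the velocity of a torus orbit, so it annihilates the invariant
  function \<open>fibre_fun y\<close>. This function is therefore constant along every integral
  curve, over singular fibres as well, and its zero set on the flag variety is the closed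
  fibre.\<close>

lemma ham_preserved_fibre_eqs:
  assumes y: "y \<in> hcone" "line_eqs y"
  shows "ham_preserved flag_variety (mom w) (locus (fibre_eqs (pvec y)))"
  unfolding ham_preserved_def
proof (intro allI impI, elim conjE)
  fix I :: "real set" and \<gamma> :: "real \<Rightarrow> ppoint"
  assume I: "open I" "is_interval I" "0 \<in> I" and \<gamma>: "integral_curve flag_variety (ham_vec flag_variety (mom w)) I \<gamma>"
    and \<gamma>0: "\<gamma> 0 \<in> locus (fibre_eqs (pvec y))"
  have pts: "\<gamma> t \<in> pts flag_variety" if "t \<in> I" for t using \<gamma> that unfolding integral_curve_def by blast
  have flagE: "\<exists>z. z \<in> hcone \<and> bil z = 0 \<and> \<gamma> t = pr z" if "t \<in> I" for t
    using pts[OF that] unfolding pts_flag locus_def by blast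
  have "((\<lambda>s. fibre_fun y (\<gamma> s)) has_real_derivative 0) (at t)" if t: "t \<in> I" for t
  proof -
    obtain z where z: "z \<in> hcone" "bil z = 0" "\<gamma> t = pr z" using flagE[OF t] by blast
    have n: "smooth_near flag_variety (\<gamma> t) (fibre_fun y)"
      using emb_near[OF flag.emb pts[OF t] smooth_near_global[OF smooth_fibre_fun]] flag.pts_hcone pts[OF t] by blast
    have zp: "pr z \<in> pts flag_variety" using pts[OF t] z(3) by simp
    have "ham_vec flag_variety (mom w) (\<gamma> t) = velocity flag_variety (\<lambda>t. torp (\<lambda>j. t * w j) (pr z))"
      unfolding z(3) by (rule flag.ham_mom[OF z(1) zp torp_flag])
    moreover have "(\<lambda>t. fibre_fun y (torp (\<lambda>j. t * w j) (pr z))) = (\<lambda>t. fibre_fun y (pr z))"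
      by (simp add: torp_pr fibre_fun_pr tor_hcone z(1) fibre_fun_lift_tor)
    moreover have "deriv (\<lambda>t::real. k) 0 = 0" for k :: real by (rule DERIV_imp_deriv) simp
    ultimately have "ham_vec flag_variety (mom w) (\<gamma> t) (fibre_fun y) = 0" by (simp add: velocity_def)
    moreover have "((\<lambda>s. fibre_fun y (\<gamma> s)) has_real_derivative ham_vec flag_variety (mom w) (\<gamma> t) (fibre_fun y)) (at t)"
      using \<gamma> t n unfolding integral_curve_def by blast
    ultimately show ?thesis by simp
  qed
  then have "\<exists>c. \<forall>t\<in>I. fibre_fun y (\<gamma> t) = c"
    using I(2) by (intro has_field_derivative_zero_constant) (auto simp: is_interval_convex_1 intro: has_field_derivative_at_within)
  then obtain c where c: "\<And>t. t \<in> I \<Longrightarrow> fibre_fun y (\<gamma> t) = c" by blast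
  obtain z0 where z0: "z0 \<in> hcone" "bil z0 = 0" "\<gamma> 0 = pr z0" using flagE[OF I(3)] by blast
  have "fibre_eqs (pvec y) z0" using \<gamma>0 locus_iff[OF homogeneous_fibre_eqs z0(1)] z0(3) by simp
  then have c0: "c = 0" using c[OF I(3)] fibre_fun_eq_0[OF z0(1,2), of y] z0(3) by simp
  show "\<gamma> ` I \<subseteq> locus (fibre_eqs (pvec y))"
  proof (rule image_subsetI)
    fix t assume t: "t \<in> I"
    obtain z where z: "z \<in> hcone" "bil z = 0" "\<gamma> t = pr z" using flagE[OF t] by blast
    have "fibre_eqs (pvec y) z" using c[OF t] c0 fibre_fun_eq_0[OF z(1,2), of y] z(3) by simp
    then show "\<gamma> t \<in> locus (fibre_eqs (pvec y))" using z unfolding locus_def by blast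
  qed
qed

lemma generic_fiber:
  assumes y: "y \<in> hcone" "line_eqs y" and p: "\<And>k. pvec y $ k \<noteq> 0"
  shows "fiber flag_variety (locus base_eqs) psi (pr y) \<noteq> {}"
    "fiber flag_variety (locus base_eqs) psi (pr y) \<inter> Sing flag_variety (locus base_eqs) psi CP1 = {}"
    "symplectic_manifold (sub_smfd flag_variety 4 (fiber flag_variety (locus base_eqs) psi (pr y))) 2"
    "symplectic_toric (sub_smfd flag_variety 4 (fiber flag_variety (locus base_eqs) psi (pr y) \<union> locus base_eqs)) 2
      (\<lambda>i. mom (fweight i))"
proof -
  note s = pvec_props(2)[OF y]
  note Sp = fibre_point[OF p]
  have "fibre_point (pvec y) \<in> psi_cone" using Sp(1) p by (simp add: psi_cone_def fibre_point_def)
  then show "fiber flag_variety (locus base_eqs) psi (pr y) \<noteq> {}" unfolding fiber_eq[OF y] using Sp(4) by blast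
  show "symplectic_manifold (sub_smfd flag_variety 4 (fiber flag_variety (locus base_eqs) psi (pr y))) 2"
    unfolding fiber_eq[OF y] by (rule complex_submfd.symplectic[OF complex_submfd_fibre_eqs_open[OF p s openin_psi_cone]]) simp
  show "symplectic_toric (sub_smfd flag_variety 4 (fiber flag_variety (locus base_eqs) psi (pr y) \<union> locus base_eqs)) 2
      (\<lambda>i. mom (fweight i))"
    unfolding fiber_closure_eq[OF y] by (rule toric_fibre_eqs[OF p s])
  have "x \<notin> Sing flag_variety (locus base_eqs) psi CP1" if x: "x \<in> locus (fibre_eqs (pvec y)) \<inter> pr ` psi_cone" for x
  proof -
    obtain z where z: "z \<in> psi_cone" "x = pr z" using x by blast
    have zh: "z \<in> hcone" using z(1) psi_cone_hcone by blast
    have F: "fibre_eqs (pvec y) z" using x z(2) locus_iff[OF homogeneous_fibre_eqs zh] by simp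
    have b: "bil z = 0" by (rule fibre_eqs_bil[OF F pvec_props[OF y]])
    obtain i where i: "fst z $ i * snd z $ i \<noteq> 0" using z(1) by (auto simp: psi_cone_def)
    \<comment> \<open>Some product is nonzero off the base set, and proportionality to a vector
      without zero entries makes all of them nonzero, which is the condition for
      submersivity.\<close>
    have "fst z $ k * snd z $ k \<noteq> 0" for k
    proof
      assume "fst z $ k * snd z $ k = 0"
      then have "fst z $ i * snd z $ i * pvec y $ k = 0" using F unfolding fibre_eqs_def by (metis mult_zero_left)
      then show False using i p[of k] by simp
    qed
    then show ?thesis using submersion_psi[OF zh b] unfolding Sing_def z(2) by blast
  qed
  then show "fiber flag_variety (locus base_eqs) psi (pr y) \<inter> Sing flag_variety (locus base_eqs) psi CP1 = {}"
    unfolding fiber_eq[OF y] by blast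
qed

lemma compatibility_psi:
  assumes x: "x \<in> pts flag_variety - (locus base_eqs \<union> Sing flag_variety (locus base_eqs) psi CP1)"
  shows "\<exists>t>0. (\<forall>\<zeta>\<in>tangent_space CP1 (psi x). \<exists>!\<xi>. \<xi> \<in> horizontal flag_variety psi CP1 x \<and> push CP1 psi x \<xi> = \<zeta>) \<and>
    (\<forall>h. smooth_fun_on CP1 (pts CP1) h \<longrightarrow> horizontal_lift flag_variety psi CP1 x (ham_vec CP1 h (psi x)) =
       (\<lambda>g. t * ham_vec flag_variety (\<lambda>y. h (psi y)) x g))"
proof -
  have "x \<in> pts flag_variety - locus base_eqs" using x by blast
  then have xQ: "x \<in> pts flag_variety \<inter> pr ` psi_cone" unfolding flag_minus_base .
  then obtain z where z: "z \<in> psi_cone" "x = pr z" by blast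
  have "push CP1 psi x ` tangent_space flag_variety x = tangent_space CP1 (psi x)"
    using x unfolding Sing_def by blast
  then show ?thesis using hm.compatibility[OF z(1)] xQ unfolding z(2) by blast
qed

theorem proposition1p1:
  shows "pseudotoric flag_variety"
proof -
  have "pseudotoric_structure flag_variety 3 2 (\<lambda>i. mom (fweight i)) (locus base_eqs) psi CP1"
    unfolding pseudotoric_structure_def
  proof (intro conjI)
    show "symplectic_manifold flag_variety 3" by (rule flag.symplectic) simp
    show "\<forall>i<2. morse_function flag_variety (mom (fweight i))" using morse_mom[OF inj_fweight] by blast
    show "\<forall>i<2. \<forall>j<2. \<forall>x\<in>pts flag_variety. poisson flag_variety (mom (fweight i)) (mom (fweight j)) x = 0"
      using poisson_mom by blast
    show "\<exists>\<mu>. symplectic_toric CP1 (3 - 2) \<mu>" using toric_CP1 by auto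
    show "closedin (mtop flag_variety) (locus base_eqs)" by (rule closedin_base)
    show "smooth_map_on flag_variety CP1 (pts flag_variety - locus base_eqs) psi"
      unfolding flag_minus_base by (rule hm.smooth)
    show "\<exists>G. openin (mtop CP1) G \<and> mtop CP1 closure_of G = pts CP1 \<and>
        (\<forall>p\<in>G. fiber flag_variety (locus base_eqs) psi p \<noteq> {} \<and>
           fiber flag_variety (locus base_eqs) psi p \<inter> Sing flag_variety (locus base_eqs) psi CP1 = {} \<and>
           symplectic_manifold (sub_smfd flag_variety (2 * 2) (fiber flag_variety (locus base_eqs) psi p)) 2 \<and>
           symplectic_toric (sub_smfd flag_variety (2 * 2) (fiber flag_variety (locus base_eqs) psi p \<union> locus base_eqs)) 2
             (\<lambda>i. mom (fweight i)))"
    proof (intro exI[of _ generic_points] conjI ballI openin_generic_points dense_generic_points)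
      fix p assume "p \<in> generic_points"
      then obtain y where y: "y \<in> hcone" "line_eqs y \<and> (\<forall>k. pvec y $ k \<noteq> 0)" "p = pr y"
        unfolding generic_points_def by (rule locusE)
      then have y': "line_eqs y" "\<And>k. pvec y $ k \<noteq> 0" by auto
      note g = generic_fiber[OF y(1) y'(1) y'(2), folded y(3)]
      show "fiber flag_variety (locus base_eqs) psi p \<noteq> {}"
        "fiber flag_variety (locus base_eqs) psi p \<inter> Sing flag_variety (locus base_eqs) psi CP1 = {}"
        "symplectic_manifold (sub_smfd flag_variety (2 * 2) (fiber flag_variety (locus base_eqs) psi p)) 2"
        "symplectic_toric (sub_smfd flag_variety (2 * 2) (fiber flag_variety (locus base_eqs) psi p \<union> locus base_eqs)) 2
             (\<lambda>i. mom (fweight i))"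
        using g by simp_all
    qed
    show "\<forall>p\<in>pts CP1. \<forall>i<2. ham_preserved flag_variety (mom (fweight i))
        (fiber flag_variety (locus base_eqs) psi p \<union> locus base_eqs)"
    proof (intro ballI allI impI)
      fix p i assume "p \<in> pts CP1"
      then obtain y where y: "y \<in> hcone" "line_eqs y" "p = pr y" unfolding pts_CP1 by (rule locusE)
      show "ham_preserved flag_variety (mom (fweight i)) (fiber flag_variety (locus base_eqs) psi p \<union> locus base_eqs)"
        unfolding y(3) fiber_closure_eq[OF y(1,2)] by (rule ham_preserved_fibre_eqs[OF y(1,2)])
    qed
    show "\<exists>\<tau>. \<forall>x\<in>pts flag_variety - (locus base_eqs \<union> Sing flag_variety (locus base_eqs) psi CP1).
        \<tau> x > 0 \<and>
        (\<forall>\<zeta>\<in>tangent_space CP1 (psi x). \<exists>!\<xi>. \<xi> \<in> horizontal flag_variety psi CP1 x \<and> push CP1 psi x \<xi> = \<zeta>) \<and>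
        (\<forall>h. smooth_fun_on CP1 (pts CP1) h \<longrightarrow>
           horizontal_lift flag_variety psi CP1 x (ham_vec CP1 h (psi x)) =
             (\<lambda>g. \<tau> x * ham_vec flag_variety (\<lambda>y. h (psi y)) x g))"
      \<comment> \<open>The conformal factor is found point by point; the axiom of choice assembles
        it into the function \<tau>.\<close>
      by (rule bchoice) (rule ballI, rule compatibility_psi)
  qed simp_all
  then show ?thesis unfolding pseudotoric_def by blast
qed

end
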